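(* Let $G$ be a connected algebraic group over an algebraically closed field $k$ and let $Q$ be a connected unipotent algebraic $G$-group. Then $Q$ has a sectioned central filtration by $G$-modules.
   Context: Algebraic groups are affine algebraic groups over $k$ and subgroups are closed. An algebraic $G$-group is an algebraic group $Q$ over $k$ with a right action of $G$ on $Q$ by group automorphisms such that the action map $G\times Q\to Q$, $(g,q)\mapsto q^g$, is a morphism of varieties. A finite filtration $Q=Q_1\ge Q_2\ge\dots\ge Q_{n+1}=1$ with all $Q_i\triangleleft Q$ is: central if $Q_i/Q_{i+1}\le Z(Q/Q_{i+1})$ for all $i$; a filtration by $G$-groups if each $Q_i$ is $G$-stable; a filtration by $G$-modules if it is a filtration by $G$-groups and each $Q_i/Q_{i+1}$, with its induced $G$-action, has the structure of a rational (linear) $G$-module; sectioned if for each $i$ there is a regular map $Q/Q_i\to Q$ which is a section of the quotient morphism $Q\to Q/Q_i$. *)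

theory Defs
  imports
    "HOL-Algebra.Coset"
    "HOL-Analysis.Abstract_Topology"
    "HOL-Computational_Algebra.Polynomial"
    "Jordan_Normal_Form.Matrix"
begin

section \<open>Affine varieties\<close>

text \<open>
  A variety is a set of points \<open>X\<close> together with its ring \<open>k[X]\<close> of regular functions, over the
  ground field \<open>k\<close> given by the type \<open>'k\<close>. HOL functions are total, so an element of \<open>k[X]\<close> is
  represented by every function \<open>'a \<Rightarrow> 'k\<close> that agrees with it on \<open>X\<close>; the values outside \<open>X\<close>
  carry no information. Varieties need not be irreducible.
\<close>

record ('a, 'k) variety =
  points :: "'a set"
  reg :: "('a \<Rightarrow> 'k) set"

definition regular_map :: "('a, 'k) variety \<Rightarrow> ('b, 'k) variety \<Rightarrow> ('a \<Rightarrow> 'b) \<Rightarrow> bool" where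
  "regular_map V W \<phi> \<longleftrightarrow> \<phi> \<in> points V \<rightarrow> points W \<and> (\<forall>f\<in>reg W. f \<circ> \<phi> \<in> reg V)"

definition variety_iso :: "('a, 'k) variety \<Rightarrow> ('b, 'k) variety \<Rightarrow> ('a \<Rightarrow> 'b) \<Rightarrow> bool" where
  "variety_iso V W \<phi> \<longleftrightarrow> bij_betw \<phi> (points V) (points W) \<and> regular_map V W \<phi> \<and>
     regular_map W V (inv_into (points V) \<phi>)"

inductive_set poly_fun :: "nat \<Rightarrow> ('k::field vec \<Rightarrow> 'k) set" for d :: nat where
  const: "(\<lambda>_. c) \<in> poly_fun d"
| coord: "i < d \<Longrightarrow> (\<lambda>v. v $ i) \<in> poly_fun d"
| add: "p \<in> poly_fun d \<Longrightarrow> q \<in> poly_fun d \<Longrightarrow> (\<lambda>v. p v + q v) \<in> poly_fun d"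
| mult: "p \<in> poly_fun d \<Longrightarrow> q \<in> poly_fun d \<Longrightarrow> (\<lambda>v. p v * q v) \<in> poly_fun d"

definition subvariety :: "('a, 'k) variety \<Rightarrow> 'a set \<Rightarrow> ('a, 'k) variety" where
  "subvariety V Z = \<lparr>points = Z, reg = {f. \<exists>g\<in>reg V. \<forall>x\<in>Z. f x = g x}\<rparr>"

definition affine_space :: "nat \<Rightarrow> ('k::field vec, 'k) variety" where
  "affine_space d = \<lparr>points = carrier_vec d,
     reg = {f. \<exists>p\<in>poly_fun d. \<forall>v\<in>carrier_vec d. f v = p v}\<rparr>"

definition zero_set :: "('a, 'k::field) variety \<Rightarrow> ('a \<Rightarrow> 'k) set \<Rightarrow> 'a set" where
  "zero_set V S = {x \<in> points V. \<forall>f\<in>S. f x = 0}"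

definition zariski :: "('a, 'k::field) variety \<Rightarrow> 'a topology" where
  "zariski V = topology (\<lambda>U. U \<subseteq> points V \<and> (\<exists>S\<subseteq>reg V. points V - U = zero_set V S))"

text \<open>
  The first conjunct only says that \<open>reg V\<close> contains all representatives of each of its
  functions. For infinite \<open>k\<close>, in particular for algebraically closed \<open>k\<close>, polynomial functions on
  \<open>k\<^sup>d\<close> are the same as polynomials in \<open>d\<close> variables.
\<close>

definition affine_variety :: "('a, 'k::field) variety \<Rightarrow> bool" where
  "affine_variety V \<longleftrightarrow>
     (\<forall>f\<in>reg V. \<forall>g. (\<forall>x\<in>points V. g x = f x) \<longrightarrow> g \<in> reg V) \<and>
     (\<exists>d Z \<iota>. closedin (zariski (affine_space d)) Z \<and>
        variety_iso V (subvariety (affine_space d) Z) \<iota>)"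

text \<open>The ring \<open>k[X \<times> Y]\<close> is \<open>k[X] \<otimes> k[Y]\<close>, realised as functions on \<open>X \<times> Y\<close>.\<close>

definition product_variety ::
    "('a, 'k::field) variety \<Rightarrow> ('b, 'k) variety \<Rightarrow> ('a \<times> 'b, 'k) variety" where
  "product_variety V W = \<lparr>points = points V \<times> points W,
     reg = {h. \<exists>(n::nat) f g. (\<forall>i<n. f i \<in> reg V \<and> g i \<in> reg W) \<and>
       (\<forall>x\<in>points V. \<forall>y\<in>points W. h (x, y) = (\<Sum>i<n. f i x * g i y))}\<rparr>"


section \<open>Affine algebraic groups\<close>

record ('a, 'k) alg_group = "'a monoid" +
  coord_ring :: "('a \<Rightarrow> 'k) set"

definition variety_of :: "('a, 'k) alg_group \<Rightarrow> ('a, 'k) variety" where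
  "variety_of G = \<lparr>points = carrier G, reg = coord_ring G\<rparr>"

definition algebraic_group :: "('a, 'k::field) alg_group \<Rightarrow> bool" where
  "algebraic_group G \<longleftrightarrow> group G \<and> affine_variety (variety_of G) \<and>
     regular_map (product_variety (variety_of G) (variety_of G)) (variety_of G)
       (\<lambda>(x, y). x \<otimes>\<^bsub>G\<^esub> y) \<and>
     regular_map (variety_of G) (variety_of G) (m_inv G)"

definition alg_group_iso :: "('a, 'k) alg_group \<Rightarrow> ('b, 'k) alg_group \<Rightarrow> ('a \<Rightarrow> 'b) \<Rightarrow> bool" where
  "alg_group_iso G H \<phi> \<longleftrightarrow> \<phi> \<in> iso G H \<and> variety_iso (variety_of G) (variety_of H) \<phi>"

definition connected_alg_group :: "('a, 'k::field) alg_group \<Rightarrow> bool" where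
  "connected_alg_group G \<longleftrightarrow> connected_space (zariski (variety_of G))"

definition closed_subgroup :: "'a set \<Rightarrow> ('a, 'k::field) alg_group \<Rightarrow> bool" where
  "closed_subgroup H G \<longleftrightarrow> subgroup H G \<and> closedin (zariski (variety_of G)) H"

definition sub_alg_group :: "('a, 'k) alg_group \<Rightarrow> 'a set \<Rightarrow> ('a, 'k) alg_group" where
  "sub_alg_group G H = \<lparr>carrier = H, monoid.mult = monoid.mult G, one = \<one>\<^bsub>G\<^esub>,
     coord_ring = reg (subvariety (variety_of G) H)\<rparr>"

text \<open>
  The quotient by a closed normal subgroup \<open>N\<close>: a function on \<open>G/N\<close> is regular iff its composition
  with the quotient morphism is regular on \<open>G\<close>, that is, \<open>k[G/N] = k[G]\<^sup>N\<close>.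
\<close>

definition quotient_alg_group :: "('a, 'k) alg_group \<Rightarrow> 'a set \<Rightarrow> ('a set, 'k) alg_group" where
  "quotient_alg_group G N = \<lparr>carrier = carrier (G Mod N), monoid.mult = monoid.mult (G Mod N),
     one = \<one>\<^bsub>G Mod N\<^esub>, coord_ring = {f. (\<lambda>x. f (N #>\<^bsub>G\<^esub> x)) \<in> coord_ring G}\<rparr>"

definition vector_alg_group :: "nat \<Rightarrow> ('k::field vec, 'k) alg_group" where
  "vector_alg_group d = \<lparr>carrier = carrier_vec d, monoid.mult = (+), one = 0\<^sub>v d,
     coord_ring = reg (affine_space d)\<rparr>"

text \<open>
  An element \<open>x\<close> is unipotent iff right translation \<open>\<rho>\<^sub>x\<close> on \<open>k[G]\<close>, \<open>(\<rho>\<^sub>x f)(y) = f (y x)\<close>, is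
  locally unipotent, i.e. \<open>\<rho>\<^sub>x - 1\<close> is locally nilpotent.
\<close>

definition unipotent_element :: "('a, 'k::field) alg_group \<Rightarrow> 'a \<Rightarrow> bool" where
  "unipotent_element G x \<longleftrightarrow> (\<forall>f\<in>coord_ring G. \<exists>m. \<forall>y\<in>carrier G.
     ((\<lambda>h y. h (y \<otimes>\<^bsub>G\<^esub> x) - h y) ^^ m) f y = 0)"

definition unipotent_alg_group :: "('a, 'k::field) alg_group \<Rightarrow> bool" where
  "unipotent_alg_group G \<longleftrightarrow> (\<forall>x\<in>carrier G. unipotent_element G x)"

definition center_of :: "('a, 'b) monoid_scheme \<Rightarrow> 'a set" where
  "center_of G = {z \<in> carrier G. \<forall>x\<in>carrier G. z \<otimes>\<^bsub>G\<^esub> x = x \<otimes>\<^bsub>G\<^esub> z}"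


section \<open>Algebraic \<open>G\<close>-groups and \<open>G\<close>-modules\<close>

text \<open>Right actions: \<open>act q g\<close> stands for \<open>q\<^sup>g\<close>.\<close>

definition right_action :: "('g, 'b) monoid_scheme \<Rightarrow> 'q set \<Rightarrow> ('q \<Rightarrow> 'g \<Rightarrow> 'q) \<Rightarrow> bool" where
  "right_action G X act \<longleftrightarrow>
     (\<forall>x\<in>X. \<forall>g\<in>carrier G. act x g \<in> X) \<and>
     (\<forall>x\<in>X. act x \<one>\<^bsub>G\<^esub> = x) \<and>
     (\<forall>x\<in>X. \<forall>g\<in>carrier G. \<forall>h\<in>carrier G. act x (g \<otimes>\<^bsub>G\<^esub> h) = act (act x g) h)"

definition algebraic_G_group ::
    "('g, 'k::field) alg_group \<Rightarrow> ('q, 'k) alg_group \<Rightarrow> ('q \<Rightarrow> 'g \<Rightarrow> 'q) \<Rightarrow> bool" where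
  "algebraic_G_group G Q act \<longleftrightarrow> algebraic_group G \<and> algebraic_group Q \<and>
     right_action G (carrier Q) act \<and>
     (\<forall>g\<in>carrier G. (\<lambda>q. act q g) \<in> iso Q Q) \<and>
     regular_map (product_variety (variety_of G) (variety_of Q)) (variety_of Q)
       (\<lambda>(g, q). act q g)"

text \<open>A rational right \<open>G\<close>-module structure on the vector space \<open>k\<^sup>d\<close>.\<close>

definition rational_module ::
    "('g, 'k::field) alg_group \<Rightarrow> nat \<Rightarrow> ('k vec \<Rightarrow> 'g \<Rightarrow> 'k vec) \<Rightarrow> bool" where
  "rational_module G d \<rho> \<longleftrightarrow> right_action G (carrier_vec d) \<rho> \<and>
     (\<forall>g\<in>carrier G. \<forall>a. \<forall>v\<in>carrier_vec d. \<forall>w\<in>carrier_vec d.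
        \<rho> (a \<cdot>\<^sub>v v + w) g = a \<cdot>\<^sub>v \<rho> v g + \<rho> w g) \<and>
     regular_map (product_variety (variety_of G) (affine_space d)) (affine_space d)
       (\<lambda>(g, v). \<rho> v g)"

text \<open>
  The algebraic group \<open>M\<close>, with the given action of \<open>G\<close>, has the structure of a rational
  \<open>G\<close>-module: as an algebraic group it can be identified with a vector group \<open>k\<^sup>d\<close> in such a way
  that \<open>G\<close> acts linearly and rationally.
\<close>

definition has_rational_module_structure ::
    "('g, 'k::field) alg_group \<Rightarrow> ('m, 'k) alg_group \<Rightarrow> ('m \<Rightarrow> 'g \<Rightarrow> 'm) \<Rightarrow> bool" where
  "has_rational_module_structure G M act \<longleftrightarrow>
     (\<exists>d \<rho> \<phi>. rational_module G d \<rho> \<and> alg_group_iso M (vector_alg_group d) \<phi> \<and>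
        (\<forall>x\<in>carrier M. \<forall>g\<in>carrier G. \<phi> (act x g) = \<rho> (\<phi> x) g))"

definition coset_action :: "('q \<Rightarrow> 'g \<Rightarrow> 'q) \<Rightarrow> 'q set \<Rightarrow> 'g \<Rightarrow> 'q set" where
  "coset_action act C g = (\<lambda>q. act q g) ` C"


section \<open>Filtrations\<close>

text \<open>A filtration \<open>Q = F 1 \<ge> F 2 \<ge> \<dots> \<ge> F (n + 1) = 1\<close>; only the values of \<open>F\<close> on \<open>{1..n+1}\<close> matter.\<close>

definition filtration :: "('q, 'k::field) alg_group \<Rightarrow> nat \<Rightarrow> (nat \<Rightarrow> 'q set) \<Rightarrow> bool" where
  "filtration Q n F \<longleftrightarrow>
     (\<forall>i\<in>{1..n+1}. closed_subgroup (F i) Q \<and> F i \<lhd> Q) \<and>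
     F 1 = carrier Q \<and> F (n + 1) = {\<one>\<^bsub>Q\<^esub>} \<and>
     (\<forall>i\<in>{1..n}. F (i + 1) \<subseteq> F i)"

definition filtration_factor ::
    "('q, 'k) alg_group \<Rightarrow> (nat \<Rightarrow> 'q set) \<Rightarrow> nat \<Rightarrow> ('q set, 'k) alg_group" where
  "filtration_factor Q F i = quotient_alg_group (sub_alg_group Q (F i)) (F (i + 1))"

definition central_filtration :: "('q, 'k::field) alg_group \<Rightarrow> nat \<Rightarrow> (nat \<Rightarrow> 'q set) \<Rightarrow> bool" where
  "central_filtration Q n F \<longleftrightarrow> filtration Q n F \<and>
     (\<forall>i\<in>{1..n}. carrier (filtration_factor Q F i) \<subseteq> center_of (Q Mod F (i + 1)))"

definition filtration_by_G_groups ::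
    "('g, 'k::field) alg_group \<Rightarrow> ('q, 'k) alg_group \<Rightarrow> ('q \<Rightarrow> 'g \<Rightarrow> 'q) \<Rightarrow> nat \<Rightarrow> (nat \<Rightarrow> 'q set) \<Rightarrow> bool"
  where
  "filtration_by_G_groups G Q act n F \<longleftrightarrow> filtration Q n F \<and>
     (\<forall>i\<in>{1..n+1}. \<forall>q\<in>F i. \<forall>g\<in>carrier G. act q g \<in> F i)"

definition filtration_by_G_modules ::
    "('g, 'k::field) alg_group \<Rightarrow> ('q, 'k) alg_group \<Rightarrow> ('q \<Rightarrow> 'g \<Rightarrow> 'q) \<Rightarrow> nat \<Rightarrow> (nat \<Rightarrow> 'q set) \<Rightarrow> bool"
  where
  "filtration_by_G_modules G Q act n F \<longleftrightarrow> filtration_by_G_groups G Q act n F \<and>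
     (\<forall>i\<in>{1..n}. has_rational_module_structure G (filtration_factor Q F i) (coset_action act))"

definition sectioned_filtration :: "('q, 'k::field) alg_group \<Rightarrow> nat \<Rightarrow> (nat \<Rightarrow> 'q set) \<Rightarrow> bool" where
  "sectioned_filtration Q n F \<longleftrightarrow> filtration Q n F \<and>
     (\<forall>i\<in>{1..n+1}. \<exists>\<sigma>.
        regular_map (variety_of (quotient_alg_group Q (F i))) (variety_of Q) \<sigma> \<and>
        (\<forall>C\<in>carrier (Q Mod F i). F i #>\<^bsub>Q\<^esub> \<sigma> C = C))"


section \<open>Basic properties\<close>

text \<open>
  The predicate in the definition of \<^const>\<open>zariski\<close> is a topology whenever the functions in
  \<open>reg V\<close> contain \<open>1\<close> and are closed under multiplication; this covers affine varieties.
\<close>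

lemma openin_zariski_gen:
  fixes V :: "('a, 'k::field) variety"
  assumes one: "(\<lambda>_. 1) \<in> reg V"
    and mult: "\<And>f g. f \<in> reg V \<Longrightarrow> g \<in> reg V \<Longrightarrow> (\<lambda>x. f x * g x) \<in> reg V"
  shows "openin (zariski V) U \<longleftrightarrow>
    U \<subseteq> points V \<and> (\<exists>S\<subseteq>reg V. points V - U = zero_set V S)"
proof -
  let ?P = "\<lambda>U. U \<subseteq> points V \<and> (\<exists>S\<subseteq>reg V. points V - U = zero_set V S)"
  have "istopology ?P"
    unfolding istopology_def
  proof (rule conjI; intro allI impI)
    fix A B assume PA: "?P A" and PB: "?P B"
    obtain S where S: "S \<subseteq> reg V" "points V - A = zero_set V S" using PA by (elim conjE exE)
    obtain T where T: "T \<subseteq> reg V" "points V - B = zero_set V T" using PB by (elim conjE exE)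
    define R where "R = (\<lambda>(f, g) x. f x * g x) ` (S \<times> T)"
    have "h \<in> reg V" if "h \<in> R" for h
    proof -
      from that obtain f g where "f \<in> S" "g \<in> T" "h = (\<lambda>x. f x * g x)"
        unfolding R_def by (elim imageE SigmaE) simp
      then show ?thesis using mult[of f g] S(1) T(1) by (simp add: subset_iff)
    qed
    then have "R \<subseteq> reg V" by (rule subsetI)
    moreover have "points V - A \<inter> B = zero_set V R"
    proof -
      have "(\<forall>h\<in>R. h x = 0) \<longleftrightarrow> (\<forall>f\<in>S. \<forall>g\<in>T. f x * g x = 0)" for x
        unfolding R_def by (simp add: split_beta)
      also have "(\<forall>f\<in>S. \<forall>g\<in>T. f x * g x = 0) \<longleftrightarrow> (\<forall>f\<in>S. f x = 0) \<or> (\<forall>g\<in>T. g x = 0)" for x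
        unfolding mult_eq_0_iff by blast
      finally have "zero_set V R = zero_set V S \<union> zero_set V T"
        unfolding zero_set_def by blast
      then show ?thesis unfolding S(2)[symmetric] T(2)[symmetric] by blast
    qed
    ultimately have "\<exists>S\<subseteq>reg V. points V - A \<inter> B = zero_set V S"
      by (intro exI[of _ R] conjI)
    moreover have "A \<inter> B \<subseteq> points V" using conjunct1[OF PA] by (rule le_infI1)
    ultimately show "?P (A \<inter> B)" by (rule conjI[rotated])
  next
    fix \<K> assume *: "\<forall>K\<in>\<K>. ?P K"
    define R where "R = {f \<in> reg V. \<exists>K\<in>\<K>. \<forall>x\<in>points V - K. f x = 0}"
    have "points V - \<Union>\<K> = zero_set V R"
    proof (intro equalityI subsetI)
      fix x assume "x \<in> points V - \<Union>\<K>"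
      then show "x \<in> zero_set V R" by (auto simp: zero_set_def R_def)
    next
      fix x assume x: "x \<in> zero_set V R"
      have "x \<notin> K" if K: "K \<in> \<K>" for K
      proof -
        from bspec[OF * K] obtain S where S: "S \<subseteq> reg V" "points V - K = zero_set V S"
          by (elim conjE exE)
        have "f \<in> R" if f: "f \<in> S" for f
        proof -
          have "\<forall>y\<in>points V - K. f y = 0" unfolding S(2) using f by (simp add: zero_set_def)
          then show ?thesis unfolding R_def using f S(1) K by blast
        qed
        then have "x \<in> zero_set V S" using x unfolding zero_set_def by blast
        then show ?thesis unfolding S(2)[symmetric] by simp
      qed
      then show "x \<in> points V - \<Union>\<K>" using x by (simp add: zero_set_def)
    qed
    moreover have "R \<subseteq> reg V" by (simp add: R_def)
    ultimately have "\<exists>S\<subseteq>reg V. points V - \<Union>\<K> = zero_set V S"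
      by (intro exI[of _ R] conjI)
    moreover have "\<Union>\<K> \<subseteq> points V" using * by (intro Union_least) simp
    ultimately show "?P (\<Union>\<K>)" by (rule conjI[rotated])
  qed
  then show ?thesis by (simp add: zariski_def)
qed

lemma affine_space_const: "(\<lambda>_. c) \<in> reg (affine_space d)"
  unfolding affine_space_def using poly_fun.const[of c d] by auto

lemma subvariety_affine_space_mult:
  fixes u v :: "'k::field vec \<Rightarrow> 'k"
  assumes "u \<in> reg (subvariety (affine_space d) Z)" "v \<in> reg (subvariety (affine_space d) Z)"
    and "Z \<subseteq> carrier_vec d"
  shows "(\<lambda>x. u x * v x) \<in> reg (subvariety (affine_space d) Z)"
proof -
  have ex: "\<exists>p\<in>poly_fun d. \<forall>x\<in>Z. w x = p x"
    if "w \<in> reg (subvariety (affine_space d) Z)" for w :: "'k vec \<Rightarrow> 'k"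
  proof -
    have "\<exists>g\<in>reg (affine_space d). \<forall>x\<in>Z. w x = g x" using that by (simp add: subvariety_def)
    then obtain g where g: "g \<in> reg (affine_space d)" "\<forall>x\<in>Z. w x = g x" by (elim bexE)
    from g(1) have "\<exists>p\<in>poly_fun d. \<forall>x\<in>carrier_vec d. g x = p x" by (simp add: affine_space_def)
    then obtain p where p: "p \<in> poly_fun d" "\<forall>x\<in>carrier_vec d. g x = p x" by (elim bexE)
    show ?thesis using p g(2) assms(3) by (intro bexI[of _ p]) auto
  qed
  obtain p where p: "p \<in> poly_fun d" "\<forall>x\<in>Z. u x = p x" using ex[OF assms(1)] by (elim bexE)
  obtain q where q: "q \<in> poly_fun d" "\<forall>x\<in>Z. v x = q x" using ex[OF assms(2)] by (elim bexE)
  have "(\<lambda>x. p x * q x) \<in> reg (affine_space d)"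
    using poly_fun.mult[OF p(1) q(1)] by (auto simp: affine_space_def)
  moreover have "\<forall>x\<in>Z. u x * v x = p x * q x" using p q by simp
  ultimately have "\<exists>g\<in>reg (affine_space d). \<forall>x\<in>Z. u x * v x = g x"
    by (intro bexI[of _ "\<lambda>x. p x * q x"])
  then show ?thesis by (simp add: subvariety_def)
qed

lemma subvariety_affine_space_self: "subvariety (affine_space d) (carrier_vec d) = affine_space d"
  by (auto simp: subvariety_def affine_space_def)

lemma topspace_zariski_gen:
  fixes V :: "('a, 'k::field) variety"
  assumes one: "(\<lambda>_. 1) \<in> reg V"
    and mult: "\<And>f g. f \<in> reg V \<Longrightarrow> g \<in> reg V \<Longrightarrow> (\<lambda>x. f x * g x) \<in> reg V"
  shows "topspace (zariski V) = points V"
proof -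
  have o: "openin (zariski V) U \<longleftrightarrow>
      U \<subseteq> points V \<and> (\<exists>S\<subseteq>reg V. points V - U = zero_set V S)" for U
  proof (rule openin_zariski_gen)
    show "(\<lambda>_. 1) \<in> reg V" by (rule one)
    fix f g assume "f \<in> reg V" "g \<in> reg V"
    then show "(\<lambda>x. f x * g x) \<in> reg V" by (rule mult)
  qed
  have "points V - points V = zero_set V {\<lambda>_. 1}" by (simp add: zero_set_def)
  then have "\<exists>S\<subseteq>reg V. points V - points V = zero_set V S"
    using one by (intro exI[of _ "{\<lambda>_. 1}"]) simp
  then have "openin (zariski V) (points V)" unfolding o by (rule conjI[OF order_refl])
  then have "points V \<subseteq> topspace (zariski V)" by (rule openin_subset)
  moreover have "topspace (zariski V) \<subseteq> points V"
    using openin_topspace[of "zariski V"] unfolding o by (rule conjunct1)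
  ultimately show ?thesis by (intro equalityI)
qed

lemma affine_space_mult:
  assumes "u \<in> reg (affine_space d)" "v \<in> reg (affine_space d)"
  shows "(\<lambda>x. u x * v x) \<in> reg (affine_space d)"
  using subvariety_affine_space_mult[of u d "carrier_vec d" v] assms
  by (simp add: subvariety_affine_space_self)

lemma topspace_zariski_affine_space:
  "topspace (zariski (affine_space d)) = (carrier_vec d :: 'k::field vec set)"
proof -
  have "topspace (zariski (affine_space d)) = points (affine_space d :: ('k vec, 'k) variety)"
  proof (rule topspace_zariski_gen)
    show "(\<lambda>_. 1) \<in> reg (affine_space d)" by (rule affine_space_const)
    fix f g :: "'k vec \<Rightarrow> 'k" assume "f \<in> reg (affine_space d)" "g \<in> reg (affine_space d)"
    then show "(\<lambda>x. f x * g x) \<in> reg (affine_space d)" by (rule affine_space_mult)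
  qed
  then show ?thesis by (simp add: affine_space_def)
qed

lemma affine_variety_cong:
  assumes "affine_variety V" and "f \<in> reg V" and "\<forall>x\<in>points V. g x = f x"
  shows "g \<in> reg V"
  using assms(1)[unfolded affine_variety_def, THEN conjunct1] assms(2,3) by blast

lemma affine_varietyE:
  assumes "affine_variety V"
  obtains d Z \<iota> where "Z \<subseteq> carrier_vec d" "bij_betw \<iota> (points V) Z"
    "\<And>f. f \<in> reg (subvariety (affine_space d) Z) \<Longrightarrow> f \<circ> \<iota> \<in> reg V"
    "\<And>f. f \<in> reg V \<Longrightarrow> f \<circ> inv_into (points V) \<iota> \<in> reg (subvariety (affine_space d) Z)"
proof -
  obtain d Z \<iota> where Z: "closedin (zariski (affine_space d)) Z"
    and i: "variety_iso V (subvariety (affine_space d) Z) \<iota>"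
    using assms[unfolded affine_variety_def, THEN conjunct2] by blast
  have p: "points (subvariety (affine_space d) Z) = Z" by (simp add: subvariety_def)
  show thesis
  proof (rule that)
    show "Z \<subseteq> carrier_vec d"
      using closedin_subset[OF Z] by (simp add: topspace_zariski_affine_space)
    show "bij_betw \<iota> (points V) Z" using i unfolding variety_iso_def p by simp
    show "\<And>f. f \<in> reg (subvariety (affine_space d) Z) \<Longrightarrow> f \<circ> \<iota> \<in> reg V"
      "\<And>f. f \<in> reg V \<Longrightarrow> f \<circ> inv_into (points V) \<iota> \<in> reg (subvariety (affine_space d) Z)"
      using i unfolding variety_iso_def regular_map_def by simp_all
  qed
qed

lemma affine_variety_const:
  assumes "affine_variety V" shows "(\<lambda>_. c) \<in> reg V"
proof (rule affine_varietyE[OF assms])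
  fix d Z \<iota>
  assume "\<And>f. f \<in> reg (subvariety (affine_space d) Z) \<Longrightarrow> f \<circ> \<iota> \<in> reg V"
  moreover have "(\<lambda>_. c) \<in> reg (subvariety (affine_space d) Z)"
    using affine_space_const[of c d] by (auto simp: subvariety_def)
  ultimately have "(\<lambda>_. c) \<circ> \<iota> \<in> reg V" by simp
  then show ?thesis by (simp add: o_def)
qed

lemma affine_variety_mult:
  fixes V :: "('a, 'k::field) variety"
  assumes V: "affine_variety V" and f: "f \<in> reg V" and g: "g \<in> reg V"
  shows "(\<lambda>x. f x * g x) \<in> reg V"
proof (rule affine_varietyE[OF V])
  fix d and Z :: "'k vec set" and \<iota> :: "'a \<Rightarrow> 'k vec"
  let ?W = "subvariety (affine_space d) Z" and ?j = "inv_into (points V) \<iota>"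
  assume Z: "Z \<subseteq> carrier_vec d" and b: "bij_betw \<iota> (points V) Z"
    and pull: "\<And>f. f \<in> reg ?W \<Longrightarrow> f \<circ> \<iota> \<in> reg V"
    and push: "\<And>f. f \<in> reg V \<Longrightarrow> f \<circ> ?j \<in> reg ?W"
  have "(\<lambda>x. (f \<circ> ?j) x * (g \<circ> ?j) x) \<circ> \<iota> \<in> reg V"
    by (rule pull, rule subvariety_affine_space_mult[OF push[OF f] push[OF g] Z])
  moreover have "\<forall>x\<in>points V. f x * g x = ((\<lambda>x. (f \<circ> ?j) x * (g \<circ> ?j) x) \<circ> \<iota>) x"
    using b by (simp add: bij_betw_inv_into_left)
  ultimately show ?thesis by (rule affine_variety_cong[OF V])
qed

lemma openin_zariski:
  assumes "affine_variety V"
  shows "openin (zariski V) U \<longleftrightarrow>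
    U \<subseteq> points V \<and> (\<exists>S\<subseteq>reg V. points V - U = zero_set V S)"
proof (rule openin_zariski_gen)
  show "(\<lambda>_. 1) \<in> reg V" by (rule affine_variety_const[OF assms])
  fix f g assume "f \<in> reg V" "g \<in> reg V"
  then show "(\<lambda>x. f x * g x) \<in> reg V" by (rule affine_variety_mult[OF assms])
qed

lemma topspace_zariski:
  assumes "affine_variety V" shows "topspace (zariski V) = points V"
proof (rule topspace_zariski_gen)
  show "(\<lambda>_. 1) \<in> reg V" by (rule affine_variety_const[OF assms])
  fix f g assume "f \<in> reg V" "g \<in> reg V"
  then show "(\<lambda>x. f x * g x) \<in> reg V" by (rule affine_variety_mult[OF assms])
qed

lemma closedin_zariski:
  assumes "affine_variety V"
  shows "closedin (zariski V) Z \<longleftrightarrow> (\<exists>S\<subseteq>reg V. Z = zero_set V S)"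
proof -
  have sub: "zero_set V S \<subseteq> points V" for S by (auto simp: zero_set_def)
  have "closedin (zariski V) Z \<longleftrightarrow>
      Z \<subseteq> points V \<and> (\<exists>S\<subseteq>reg V. points V - (points V - Z) = zero_set V S)"
    unfolding closedin_def openin_zariski[OF assms] topspace_zariski[OF assms] by simp
  also have "\<dots> \<longleftrightarrow> Z \<subseteq> points V \<and> (\<exists>S\<subseteq>reg V. Z = zero_set V S)"
    by (rule conj_cong) (simp_all add: double_diff)
  also have "\<dots> \<longleftrightarrow> (\<exists>S\<subseteq>reg V. Z = zero_set V S)" using sub by auto
  finally show ?thesis .
qed

lemma affine_variety_affine_space: "affine_variety (affine_space d :: ('k::field vec, 'k) variety)"
proof -
  let ?A = "affine_space d :: ('k vec, 'k) variety" and ?X = "carrier_vec d :: 'k vec set"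
  have p: "points ?A = ?X" by (simp add: affine_space_def)
  have sat: "\<forall>f\<in>reg ?A. \<forall>g. (\<forall>x\<in>points ?A. g x = f x) \<longrightarrow> g \<in> reg ?A"
    unfolding affine_space_def by auto
  have j: "inv_into ?X id x = x" if "x \<in> ?X" for x
    using inv_into_f_f[of id ?X x] that by simp
  have "regular_map ?A ?A (inv_into ?X id)"
    unfolding regular_map_def p
  proof (intro conjI ballI)
    show "inv_into ?X id \<in> ?X \<rightarrow> ?X" using j by (intro funcsetI) simp
    fix f assume f: "f \<in> reg ?A"
    have "\<forall>x\<in>points ?A. (f \<circ> inv_into ?X id) x = f x" by (simp add: j p)
    then show "f \<circ> inv_into ?X id \<in> reg ?A" using sat f by blast
  qed
  moreover have "regular_map ?A ?A id" by (simp add: regular_map_def)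
  ultimately have "variety_iso ?A (subvariety ?A ?X) id"
    unfolding subvariety_affine_space_self variety_iso_def p by (simp add: bij_betw_id)
  moreover have "closedin (zariski ?A) ?X"
    using closedin_topspace[of "zariski ?A"] unfolding topspace_zariski_affine_space .
  ultimately show ?thesis
    unfolding affine_variety_def using sat by (intro conjI exI)
qed

end

theory Submission
  imports Defs "HOL-Library.Function_Algebras"
begin

text \<open>
  For a translation stable subalgebra \<open>S\<close> of \<open>k[Q]\<close> call \<open>f\<close> invariant modulo \<open>S\<close> if every left and right
  translate of \<open>f\<close> differs from \<open>f\<close> by an element of \<open>S\<close>. Such an \<open>f\<close> restricts to a homomorphism from
  the normal subgroup cut out by \<open>S\<close> to the additive group, and that subgroup is central modulo the one
  cut out by \<open>S[f]\<close>. Kolchin's theorem gives an invariant outside \<open>S\<close> unless \<open>S = k[Q]\<close>, and an invariant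
  which is algebraic over \<open>S\<close> satisfies a relation \<open>P(f) \<in> S\<close> with an additive polynomial \<open>P\<close>.

  Starting from \<open>S = k\<close>, one adjoins \<open>G\<close>-stable spaces \<open>M\<close> of invariants that are irreducible modulo
  \<open>S\<close>, keeping the condition that all invariants outside \<open>S\<close> are transcendental over \<open>S\<close>. For \<open>S = k\<close>
  it holds because \<open>Q\<close> is connected. In characteristic \<open>p\<close> the algebraic invariants over \<open>S[M]\<close> come from
  invariants \<open>a\<close> modulo \<open>S\<close> with \<open>a\<^sup>p \<in> M\<close> or \<open>a\<^sup>p - a \<in> M\<close>; choosing \<open>S[M]\<close> maximal excludes them, in
  the second case because the connected group \<open>G\<close> can only act trivially on the discrete set of roots.

  Hence \<open>k[Q]\<close> is a polynomial ring in bases of the spaces \<open>M\<close>. The subgroups of the filtration are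
  given by the vanishing of the first blocks of coordinates, \<open>G\<close> acts linearly on each block, and
  setting the remaining coordinates to \<open>0\<close> is a section of the quotient morphism.
\<close>

section \<open>Linear algebra\<close>

text \<open>Translation stable subalgebras of k[Q] stand for homomorphic images of \<open>Q\<close>,
  inseparable ones included, so no quotient group has to be formed during the construction.
  Transcendence keeps each layer a vector group: an algebraic invariant would produce a layer cut
  out by an additive polynomial, for instance a finite group. Irreducibility of \<open>M\<close>
  modulo \<open>S\<close> is needed because a stable space of transcendental invariants may still
  satisfy an additive relation, as x and x^p do. The obstacle in characteristic p is that an
  algebraic invariant over S[M] is invariant only modulo S[M]. It has to be corrected by an element
  of S[M] before it can be compared with \<open>S\<close>. The correction comes from evaluating its
  coboundary at formal points, where the adjoined function takes a value independent of the base
  point; transcendence makes such evaluations well defined although no such points of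
  \<open>Q\<close> are known yet. A maximal S[M] exists because every translation stable subalgebra
  of k[Q] is finitely generated.\<close>

locale ac_vector_space = vector_space scale
  for scale :: "'a::alg_closed_field \<Rightarrow> 'b::ab_group_add \<Rightarrow> 'b" (infixr \<open>*s\<close> 75)
begin

definition lin :: "('b \<Rightarrow> 'b) \<Rightarrow> bool" where
  "lin T \<longleftrightarrow> (\<forall>x y. T (x + y) = T x + T y) \<and> (\<forall>c x. T (c *s x) = c *s T x)"

lemma lin_add: "lin T \<Longrightarrow> T (x + y) = T x + T y"
  and lin_scale: "lin T \<Longrightarrow> T (c *s x) = c *s T x"
  by (auto simp: lin_def)

lemma lin_0: "lin T \<Longrightarrow> T 0 = 0"
  using lin_scale[of T 0 0] by simp

lemma lin_neg: "lin T \<Longrightarrow> T (- x) = - T x"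
  using lin_scale[of T "-1" x] by simp

lemma lin_diff: "lin T \<Longrightarrow> T (x - y) = T x - T y"
  using lin_add[of T x "-y"] lin_neg[of T y] by simp

lemma lin_sum: "lin T \<Longrightarrow> T (sum f A) = (\<Sum>a\<in>A. T (f a))"
  by (induction A rule: infinite_finite_induct) (auto simp: lin_0 lin_add)

lemma lin_comp: "lin S \<Longrightarrow> lin T \<Longrightarrow> lin (S \<circ> T)"
  by (auto simp: lin_def)

lemma lin_funpow: "lin T \<Longrightarrow> lin (T ^^ n)"
  by (induction n) (auto simp: lin_def)

lemma subspace_lin_vimage:
  assumes "lin T" "subspace S" shows "subspace {v. T v \<in> S}"
  using assms by (auto intro!: subspaceI simp: lin_0 lin_add lin_scale subspace_0 subspace_add subspace_scale)

lemma subspace_lin_image: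
  assumes "lin T" "subspace S" shows "subspace (T ` S)"
proof (rule subspaceI)
  show "0 \<in> T ` S" using lin_0[OF assms(1)] subspace_0[OF assms(2)] by force
  fix x y assume "x \<in> T ` S" "y \<in> T ` S"
  then show "x + y \<in> T ` S" using subspace_add[OF assms(2)] by (auto simp flip: lin_add[OF assms(1)])
next
  fix c x assume "x \<in> T ` S"
  then show "c *s x \<in> T ` S" using subspace_scale[OF assms(2)] by (auto simp flip: lin_scale[OF assms(1)])
qed

section \<open>Bases and dimensions inside a finitely spanned space\<close>

lemma obtain_basis:
  assumes "subspace V" "V \<subseteq> span E" "finite E"
  obtains B where "independent B" "finite B" "span B = V" "card B = dim V"
proof -
  obtain B where B: "B \<subseteq> V" "independent B" "V \<subseteq> span B" "card B = dim V"
    by (rule basis_exists)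
  have "finite B" using independent_span_bound[OF assms(3) B(2)] B(1) assms(2) by auto
  moreover have "span B = V" using span_minimal[OF B(1) assms(1)] B(3) by auto
  ultimately show thesis using that B by auto
qed

lemma obtain_basis_extend:
  assumes "independent B0" "B0 \<subseteq> V" "subspace V" "V \<subseteq> span E" "finite E"
  obtains B where "B0 \<subseteq> B" "independent B" "finite B" "span B = V"
proof -
  obtain B where B: "B0 \<subseteq> B" "B \<subseteq> V" "independent B" "V \<subseteq> span B"
    using maximal_independent_subset_extend[OF assms(2,1)] by blast
  have "finite B" using independent_span_bound[OF assms(5) B(3)] B(2) assms(4) by auto
  moreover have "span B = V" using span_minimal[OF B(2) assms(3)] B(4) by auto
  ultimately show thesis using that B by auto
qed

lemma fd_dim_psubset:
  assumes "subspace U" "subspace V" "U \<subset> V" "V \<subseteq> span E" "finite E"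
  shows "dim U < dim V"
proof -
  have UE: "U \<subseteq> span E" using assms(3,4) by blast
  obtain B where B: "independent B" "finite B" "span B = U" "card B = dim U"
    by (rule obtain_basis[OF assms(1) UE assms(5)])
  have BV: "B \<subseteq> V" using span_superset[of B] B(3) assms(3) by blast
  obtain C where C: "B \<subseteq> C" "independent C" "finite C" "span C = V"
    by (rule obtain_basis_extend[OF B(1) BV assms(2,4,5)])
  have "B \<noteq> C" using B(3) C(4) assms(3) by auto
  then have "card B < card C" using C(1,3) by (simp add: psubset_card_mono psubsetI)
  moreover have "dim V = card C" using dim_eq_card[OF _ C(2)] C(4) by (metis span_span)
  ultimately show ?thesis using B(4) by simp
qed

lemma fd_dim_mono:
  assumes "subspace U" "subspace V" "U \<subseteq> V" "V \<subseteq> span E" "finite E"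
  shows "dim U \<le> dim V"
  using fd_dim_psubset[OF assms(1,2) _ assms(4,5)] assms(3) by (cases "U = V") (auto simp: psubset_eq)

text \<open>The family is indexed by numbers because iterates of an operator or powers of a function
  may coincide; two equal members already give the relation with coefficients 1 and -1.\<close>

lemma family_dependent:
  assumes "finite E" "\<And>i. i \<le> card E \<Longrightarrow> u i \<in> span E"
  obtains c where "\<exists>i\<le>card E. c i \<noteq> 0" "(\<Sum>i\<le>card E. c i *s u i) = 0"
proof (cases "inj_on u {..card E}")
  case False
  then obtain i j where ij: "i \<le> card E" "j \<le> card E" "i \<noteq> j" "u i = u j"
    by (auto simp: inj_on_def)
  define c where "c l = (if l = i then 1 else if l = j then -1 else 0 :: 'a)" for l
  have "(\<Sum>l\<le>card E. c l *s u l) = (\<Sum>l\<in>{i,j}. c l *s u l)"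
    using ij by (intro sum.mono_neutral_right) (auto simp: c_def)
  also have "\<dots> = 0" using ij by (simp add: c_def)
  finally have "(\<Sum>l\<le>card E. c l *s u l) = 0" .
  moreover have "c i \<noteq> 0" by (simp add: c_def)
  ultimately show thesis using that[of c] ij(1) by blast
next
  case True
  have "\<not> independent (u ` {..card E})"
  proof
    assume "independent (u ` {..card E})"
    then have "card (u ` {..card E}) \<le> card E"
      using independent_span_bound[OF assms(1)] assms(2) by blast
    then show False using card_image[OF True] by simp
  qed
  then obtain d where d: "(\<Sum>v\<in>u ` {..card E}. d v *s v) = 0" "\<exists>v\<in>u ` {..card E}. d v \<noteq> 0"
    using dependent_finite[of "u ` {..card E}"] by auto
  have "(\<Sum>i\<le>card E. d (u i) *s u i) = 0" using d(1) sum.reindex[OF True, of "\<lambda>v. d v *s v"] by (simp add: o_def)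
  then show thesis using that[of "\<lambda>i. d (u i)"] d(2) by auto
qed

section \<open>Polynomials in an operator and eigenvectors\<close>

definition poly_act :: "'a poly \<Rightarrow> ('b \<Rightarrow> 'b) \<Rightarrow> 'b \<Rightarrow> 'b" where
  "poly_act p T v = (\<Sum>i\<le>degree p. coeff p i *s ((T ^^ i) v))"

lemma poly_act_altdef: "degree p \<le> n \<Longrightarrow> poly_act p T v = (\<Sum>i\<le>n. coeff p i *s ((T ^^ i) v))"
  unfolding poly_act_def by (rule sum.mono_neutral_left) (auto simp: coeff_eq_0)

lemma poly_act_linear_factor:
  assumes "lin T"
  shows "poly_act ([:-l, 1:] * q) T v = T (poly_act q T v) - l *s poly_act q T v"
proof -
  define n where "n = degree q"
  have "degree ([:-l, 1:] * q) \<le> Suc n"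
    unfolding n_def using degree_mult_le[of "[:-l, 1:]" q] by simp
  then have "poly_act ([:-l, 1:] * q) T v
     = (\<Sum>i\<le>Suc n. coeff ([:-l, 1:] * q) i *s ((T ^^ i) v))"
    by (rule poly_act_altdef)
  also have "\<dots> = (\<Sum>i\<le>Suc n. coeff (pCons 0 q) i *s ((T ^^ i) v) - (l * coeff q i) *s ((T ^^ i) v))"
    by (intro sum.cong) (auto simp: algebra_simps)
  also have "\<dots> = (\<Sum>i\<le>Suc n. coeff (pCons 0 q) i *s ((T ^^ i) v))
      - (\<Sum>i\<le>Suc n. (l * coeff q i) *s ((T ^^ i) v))"
    by (rule sum_subtractf)
  also have "(\<Sum>i\<le>Suc n. (l * coeff q i) *s ((T ^^ i) v)) = l *s poly_act q T v"
    by (subst poly_act_altdef[of q "Suc n"]) (auto simp: n_def scale_sum_right scale_right_distrib)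
  also have "(\<Sum>i\<le>Suc n. coeff (pCons 0 q) i *s ((T ^^ i) v)) = T (poly_act q T v)"
    by (subst sum.atMost_Suc_shift) (simp add: poly_act_def n_def lin_sum[OF assms] lin_scale[OF assms])
  finally show ?thesis .
qed

lemma poly_act_in:
  assumes "subspace V" "\<And>v. v \<in> V \<Longrightarrow> T v \<in> V" "v \<in> V"
  shows "poly_act q T v \<in> V"
proof -
  have "(T ^^ i) v \<in> V" for i using assms by (induction i) auto
  then show ?thesis unfolding poly_act_def
    by (intro subspace_sum[OF assms(1)] subspace_scale[OF assms(1)]) auto
qed

text \<open>A polynomial of least degree whose value at \<open>T\<close> kills \<open>v\<close> has
  a root \<open>l\<close>. The cofactor of the linear factor does not kill \<open>v\<close> any
  more, and it sends \<open>v\<close> to an eigenvector.\<close>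

lemma eigenvector_exists:
  assumes "lin T" "subspace V" "\<And>v. v \<in> V \<Longrightarrow> T v \<in> V" "V \<subseteq> span E" "finite E"
    and "v \<in> V" "v \<noteq> 0"
  obtains u l where "u \<in> V" "u \<noteq> 0" "T u = l *s u"
proof -
  have Tv: "(T ^^ i) v \<in> V" for i using assms by (induction i) auto
  obtain c where c: "\<exists>i\<le>card E. c i \<noteq> 0" "(\<Sum>i\<le>card E. c i *s ((T ^^ i) v)) = 0"
    using family_dependent[OF assms(5), of "\<lambda>i. (T ^^ i) v"] Tv assms(4) by blast
  define P where "P p \<longleftrightarrow> p \<noteq> 0 \<and> poly_act p T v = 0" for p
  define p0 where "p0 = (\<Sum>i\<le>card E. monom (c i) i)"
  have cf: "coeff p0 i = (if i \<le> card E then c i else 0)" for i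
    by (simp add: p0_def coeff_sum)
  then have "degree p0 \<le> card E" by (intro degree_le) auto
  then have "poly_act p0 T v = (\<Sum>i\<le>card E. c i *s ((T ^^ i) v))"
    by (subst poly_act_altdef[of _ "card E"]) (auto simp: cf intro!: sum.cong)
  moreover have "p0 \<noteq> 0" using c(1) cf by (metis coeff_0)
  ultimately have "P p0" using c(2) by (simp add: P_def)
  then obtain p where p: "P p" "\<And>q. P q \<Longrightarrow> degree p \<le> degree q"
    using ex_has_least_nat[of P p0 degree] by blast
  have "degree p > 0"
  proof (rule ccontr)
    assume "\<not> degree p > 0"
    then obtain a where "p = [:a:]" by (metis degree_eq_zeroE gr0I)
    then have "a \<noteq> 0" "a *s v = 0" using p(1) by (auto simp: P_def poly_act_def)
    then show False using assms(7) by simp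
  qed
  then obtain l where l: "poly p l = 0" using alg_closed_imp_poly_has_root by blast
  then obtain q where q: "p = [:-l, 1:] * q" using poly_eq_0_iff_dvd dvdE by blast
  have "q \<noteq> 0" using p(1) q by (auto simp: P_def)
  moreover have "degree q < degree p" unfolding q using \<open>q \<noteq> 0\<close>
    by (subst degree_mult_eq) auto
  ultimately have "poly_act q T v \<noteq> 0" using p(2)[of q] by (auto simp: P_def)
  moreover have "poly_act q T v \<in> V" using poly_act_in assms by blast
  moreover have "T (poly_act q T v) = l *s poly_act q T v"
    using p(1) poly_act_linear_factor[OF assms(1), of l q v] by (simp add: P_def q)
  ultimately show thesis using that by blast
qed

text \<open>The trace of \<open>T\<close> on \<open>span B\<close>, meaningful when \<open>T\<close>
  maps that span into itself.\<close>

definition tr :: "'b set \<Rightarrow> ('b \<Rightarrow> 'b) \<Rightarrow> 'a" where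
  "tr B T = (\<Sum>b\<in>B. representation B (T b) b)"

lemma representation_sum_eq:
  assumes "independent B" "finite B" "v \<in> span B"
  shows "(\<Sum>b\<in>B. representation B v b *s b) = v"
proof -
  have "(\<Sum>b\<in>B. representation B v b *s b) = (\<Sum>b | representation B v b \<noteq> 0. representation B v b *s b)"
    using assms(2) by (intro sum.mono_neutral_right) (auto dest: representation_ne_zero)
  then show ?thesis using sum_nonzero_representation_eq[OF assms(1,3)] by simp
qed

lemma tr_basis_change:
  assumes B: "independent B" "finite B" and C: "independent C" "finite C" and eq: "span B = span C"
    and T: "lin T" "\<And>v. v \<in> span B \<Longrightarrow> T v \<in> span B"
  shows "tr B T = tr C T"
proof -
  let ?r = "representation B" and ?s = "representation C"
  have Tc: "T c \<in> span B" if "c \<in> C" for c using T(2) that span_base eq by blast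
  have "?r (T b) b = (\<Sum>c\<in>C. ?s b c * ?r (T c) b)" if b: "b \<in> B" for b
  proof -
    have bC: "b \<in> span C" using b span_base eq by blast
    have "T b = T (\<Sum>c\<in>C. ?s b c *s c)" using representation_sum_eq[OF C bC] by simp
    also have "\<dots> = (\<Sum>c\<in>C. ?s b c *s T c)" by (simp add: lin_sum[OF T(1)] lin_scale[OF T(1)])
    finally have "?r (T b) = ?r (\<Sum>c\<in>C. ?s b c *s T c)" by simp
    also have "\<dots> = (\<lambda>x. \<Sum>c\<in>C. ?r (?s b c *s T c) x)"
      using Tc by (intro representation_sum[OF B(1)] span_scale)
    finally have "?r (T b) b = (\<Sum>c\<in>C. ?r (?s b c *s T c) b)" by simp
    then show ?thesis using Tc B(1) by (simp add: representation_scale)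
  qed
  then have "tr B T = (\<Sum>b\<in>B. \<Sum>c\<in>C. ?s b c * ?r (T c) b)" unfolding tr_def by simp
  also have "\<dots> = (\<Sum>c\<in>C. \<Sum>b\<in>B. ?r (T c) b * ?s b c)" by (subst sum.swap) (simp add: mult.commute)
  also have "(\<Sum>b\<in>B. ?r (T c) b * ?s b c) = ?s (T c) c" if c: "c \<in> C" for c
  proof -
    have "?s (T c) = ?s (\<Sum>b\<in>B. ?r (T c) b *s b)" using representation_sum_eq[OF B Tc[OF c]] by simp
    also have "\<dots> = (\<lambda>c'. \<Sum>b\<in>B. ?s (?r (T c) b *s b) c')"
      using span_base[of _ B] unfolding eq by (intro representation_sum[OF C(1)] span_scale)
    finally have "?s (T c) c = (\<Sum>b\<in>B. ?s (?r (T c) b *s b) c)" by simp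
    also have "\<dots> = (\<Sum>b\<in>B. ?r (T c) b * ?s b c)"
    proof (rule sum.cong[OF refl])
      fix b assume "b \<in> B"
      then have "b \<in> span C" using span_base eq by blast
      then show "?s (?r (T c) b *s b) c = ?r (T c) b * ?s b c" using C(1) by (simp add: representation_scale)
    qed
    finally show ?thesis by simp
  qed
  then have "(\<Sum>c\<in>C. \<Sum>b\<in>B. ?r (T c) b * ?s b c) = tr C T" unfolding tr_def by simp
  finally show ?thesis .
qed

text \<open>The kernel of each power of \<open>T\<close> is mapped by \<open>T\<close> into the
  kernel of the preceding power. Extending bases along this chain makes the matrix strictly
  triangular; the last clause keeps of this only what the trace requires, a zero diagonal.\<close>

lemma nilpotent_adapted_basis:
  assumes T: "lin T" and V: "subspace V" "\<And>v. v \<in> V \<Longrightarrow> T v \<in> V" "V \<subseteq> span E" "finite E"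
  shows "\<exists>B. independent B \<and> finite B \<and> span B = {v \<in> V. (T ^^ j) v = 0} \<and>
    (\<forall>b\<in>B. \<exists>B'\<subseteq>B. b \<notin> B' \<and> T b \<in> span B')"
proof (induction j)
  case 0
  have "{v \<in> V. (T ^^ 0) v = 0} = {0}" using subspace_0[OF V(1)] by auto
  then show ?case by (intro exI[of _ "{}"]) (simp add: independent_empty)
next
  case (Suc j)
  then obtain B where B: "independent B" "finite B" "span B = {v \<in> V. (T ^^ j) v = 0}"
    "\<forall>b\<in>B. \<exists>B'\<subseteq>B. b \<notin> B' \<and> T b \<in> span B'" by blast
  let ?W = "{v \<in> V. (T ^^ Suc j) v = 0}"
  have W: "subspace ?W"
  proof -
    have "?W = V \<inter> {v. (T ^^ Suc j) v \<in> {0}}" by auto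
    then show ?thesis
      using subspace_inter[OF V(1) subspace_lin_vimage[OF lin_funpow[OF T] subspace_single_0]] by metis
  qed
  have BW: "B \<subseteq> ?W"
  proof
    fix b assume "b \<in> B"
    then have "b \<in> span B" by (rule span_base)
    then show "b \<in> ?W" unfolding B(3) using lin_0[OF T] by simp
  qed
  have "?W \<subseteq> span E" using V(3) by blast
  then obtain C where C: "B \<subseteq> C" "independent C" "finite C" "span C = ?W"
    using obtain_basis_extend[OF B(1) BW W _ V(4)] by blast
  have "\<exists>B'\<subseteq>C. b \<notin> B' \<and> T b \<in> span B'" if b: "b \<in> C" for b
  proof (cases "b \<in> B")
    case True
    then obtain B' where "B' \<subseteq> B" "b \<notin> B'" "T b \<in> span B'" using B(4) by auto
    then show ?thesis using C(1) by (intro exI[of _ B']) simp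
  next
    case False
    have "b \<in> ?W" using b C(4) span_base by blast
    then have "T b \<in> span B" unfolding B(3) using V(2) by (simp add: funpow_Suc_right del: funpow.simps)
    then show ?thesis using False C(1) by blast
  qed
  then show ?case using C by blast
qed

lemma tr_nilpotent:
  assumes T: "lin T" and B: "independent B" "finite B" "\<And>v. v \<in> span B \<Longrightarrow> T v \<in> span B"
    and nil: "\<And>v. v \<in> span B \<Longrightarrow> (T ^^ n) v = 0"
  shows "tr B T = 0"
proof -
  obtain C where C: "independent C" "finite C" "span C = {v \<in> span B. (T ^^ n) v = 0}"
    "\<forall>b\<in>C. \<exists>B'\<subseteq>C. b \<notin> B' \<and> T b \<in> span B'"
    using nilpotent_adapted_basis[OF T subspace_span B(3) order_refl B(2), of n] by blast
  have eq: "span B = span C" using nil C(3) by auto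
  have "representation C (T b) b = 0" if b: "b \<in> C" for b
  proof -
    obtain B' where B': "B' \<subseteq> C" "b \<notin> B'" "T b \<in> span B'" using C(4) b by blast
    have "representation C (T b) = representation B' (T b)"
      using representation_extend[OF C(1) B'(3,1)] .
    then show ?thesis using B'(2) representation_ne_zero by metis
  qed
  then have "tr C T = 0" by (simp add: tr_def)
  then show ?thesis using tr_basis_change[OF B(1,2) C(1,2) eq T B(3)] by simp
qed


section \<open>Kolchin's theorem\<close>

text \<open>There is no clause for composition: the linear span of a family closed under composition
  is already an algebra, and trace identities are then proved by induction over linear combinations
  alone.\<close>

inductive_set alg_hull :: "('b \<Rightarrow> 'b) set \<Rightarrow> ('b \<Rightarrow> 'b) set" for \<Gamma> where
  base: "\<gamma> \<in> \<Gamma> \<Longrightarrow> \<gamma> \<in> alg_hull \<Gamma>"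
| add: "S \<in> alg_hull \<Gamma> \<Longrightarrow> T \<in> alg_hull \<Gamma> \<Longrightarrow> (\<lambda>v. S v + T v) \<in> alg_hull \<Gamma>"
| scale: "T \<in> alg_hull \<Gamma> \<Longrightarrow> (\<lambda>v. c *s T v) \<in> alg_hull \<Gamma>"

lemma alg_hull_lin:
  assumes "T \<in> alg_hull \<Gamma>" "\<And>\<gamma>. \<gamma> \<in> \<Gamma> \<Longrightarrow> lin \<gamma>"
  shows "lin T"
  using assms by induction (auto simp: lin_def algebra_simps)

lemma alg_hull_stable:
  assumes "T \<in> alg_hull \<Gamma>" "subspace V" "\<And>\<gamma> v. \<gamma> \<in> \<Gamma> \<Longrightarrow> v \<in> V \<Longrightarrow> \<gamma> v \<in> V" "v \<in> V"
  shows "T v \<in> V"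
  using assms by induction (auto intro: subspace_add subspace_scale)

lemma alg_hull_comp:
  assumes "S \<in> alg_hull \<Gamma>" "T \<in> alg_hull \<Gamma>"
    and lin: "\<And>\<gamma>. \<gamma> \<in> \<Gamma> \<Longrightarrow> lin \<gamma>"
    and comp: "\<And>\<gamma> \<delta>. \<gamma> \<in> \<Gamma> \<Longrightarrow> \<delta> \<in> \<Gamma> \<Longrightarrow> \<gamma> \<circ> \<delta> \<in> \<Gamma>"
  shows "S \<circ> T \<in> alg_hull \<Gamma>"
  using assms(1)
proof induction
  case (base \<gamma>)
  show ?case using assms(2)
  proof induction
    case (base \<delta>)
    then show ?case using comp \<open>\<gamma> \<in> \<Gamma>\<close> alg_hull.base by blast
  next
    case (add S T)
    then show ?case using alg_hull.add[OF add.IH] lin_add[OF lin[OF base]] by (simp add: o_def)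
  next
    case (scale T c)
    then show ?case using alg_hull.scale[OF scale.IH, of c] lin_scale[OF lin[OF base]] by (simp add: o_def)
  qed
next
  case (add S S')
  then show ?case using alg_hull.add[OF add.IH] by (simp add: o_def)
next
  case (scale S c)
  then show ?case using alg_hull.scale[OF scale.IH, of c] by (simp add: o_def)
qed

text \<open>All members of \<open>\<Gamma>\<close> have the trace of the identity, so composing with
  \<open>\<gamma>\<close> does not change the trace of any \<open>S\<close> in the span. Instead of
  Burnside's theorem, one operator of rank one in the span suffices: writing it as T x = \<phi>(x)
  x0, the trace identity says that \<phi> vanishes on every S (\<gamma> v - v), and irreducibility
  turns this into \<gamma> v = v.\<close>

lemma kolchin_aux:
  assumes lin: "\<And>\<gamma>. \<gamma> \<in> \<Gamma> \<Longrightarrow> lin \<gamma>"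
    and comp: "\<And>\<gamma> \<delta>. \<gamma> \<in> \<Gamma> \<Longrightarrow> \<delta> \<in> \<Gamma> \<Longrightarrow> \<gamma> \<circ> \<delta> \<in> \<Gamma>"
    and id: "id \<in> \<Gamma>"
    and M: "subspace M" "\<And>\<gamma> v. \<gamma> \<in> \<Gamma> \<Longrightarrow> v \<in> M \<Longrightarrow> \<gamma> v \<in> M" "M \<subseteq> span E" "finite E" "M \<noteq> {0}"
    and irr: "\<And>N. subspace N \<Longrightarrow> (\<And>\<gamma> v. \<gamma> \<in> \<Gamma> \<Longrightarrow> v \<in> N \<Longrightarrow> \<gamma> v \<in> N) \<Longrightarrow> N \<subseteq> M \<Longrightarrow> N = {0} \<or> N = M"
    and unip: "\<And>\<gamma> v. \<gamma> \<in> \<Gamma> \<Longrightarrow> v \<in> M \<Longrightarrow> \<exists>n. ((\<lambda>v. \<gamma> v - v) ^^ n) v = 0"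
    and g: "\<gamma> \<in> \<Gamma>" "v \<in> M"
  shows "\<gamma> v = v"
proof -
  let ?A = "alg_hull \<Gamma>"
  have idA: "id \<in> ?A" using id by (rule alg_hull.base)
  have linA: "lin T" if "T \<in> ?A" for T using alg_hull_lin[OF that lin] .
  have stA: "T v \<in> M" if "T \<in> ?A" "v \<in> M" for T v using alg_hull_stable[OF that(1) M(1)] M(2) that(2) by blast
  have compA: "S \<circ> T \<in> ?A" if "S \<in> ?A" "T \<in> ?A" for S T using alg_hull_comp[OF that lin comp] .
  \<comment> \<open>The images of a nonzero vector under the span form a stable space, which
    irreducibility makes all of \<open>M\<close>.\<close>
  have orbit: "\<exists>T\<in>?A. T x = y" if x: "x \<in> M" "x \<noteq> 0" and y: "y \<in> M" for x y
  proof -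
    let ?N = "(\<lambda>T. T x) ` ?A"
    have "subspace ?N"
    proof (rule subspaceI)
      have "(\<lambda>v. 0 *s id v) \<in> ?A" by (rule alg_hull.scale[OF idA])
      from imageI[OF this, of "\<lambda>T. T x"] show "0 \<in> ?N" by simp
      fix a b assume "a \<in> ?N" "b \<in> ?N"
      then obtain S T where ST: "S \<in> ?A" "T \<in> ?A" "a = S x" "b = T x" by auto
      from imageI[OF alg_hull.add[OF ST(1,2)], of "\<lambda>T. T x"] show "a + b \<in> ?N" using ST by simp
    next
      fix c a assume "a \<in> ?N"
      then obtain T where T: "T \<in> ?A" "a = T x" by auto
      from imageI[OF alg_hull.scale[OF T(1)], of "\<lambda>T. T x"] show "c *s a \<in> ?N" using T by simp
    qed
    moreover have "\<gamma> v \<in> ?N" if "\<gamma> \<in> \<Gamma>" and v: "v \<in> ?N" for \<gamma> v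
    proof -
      obtain T where T: "T \<in> ?A" "v = T x" using v by blast
      from imageI[OF compA[OF alg_hull.base[OF that(1)] T(1)], of "\<lambda>T. T x"] show ?thesis using T by simp
    qed
    moreover have "?N \<subseteq> M" using stA x by auto
    moreover have "x \<in> ?N" using imageI[OF idA, of "\<lambda>T. T x"] by simp
    ultimately have "?N = {0} \<or> ?N = M" "x \<in> ?N" using irr[of ?N] by auto
    then have "?N = M" using x(2) by blast
    then show ?thesis using y by blast
  qed
  define K where "K T = {v \<in> M. T v = 0}" for T :: "'b \<Rightarrow> 'b"
  have K: "subspace (K T)" if "T \<in> ?A" for T
  proof -
    have "K T = M \<inter> {v. T v \<in> {0}}" by (auto simp: K_def)
    then show ?thesis
      using subspace_inter[OF M(1) subspace_lin_vimage[OF linA[OF that] subspace_single_0]] by metis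
  qed
  have KM: "K T \<subseteq> M" for T by (auto simp: K_def)
  define P where "P T \<longleftrightarrow> T \<in> ?A \<and> K T \<noteq> M" for T
  have "K id = {0}" using subspace_0[OF M(1)] by (auto simp: K_def)
  then have "P id" using idA M(5) by (simp add: P_def)
  then obtain T where T: "P T" "\<And>S. P S \<Longrightarrow> dim M - dim (K T) \<le> dim M - dim (K S)"
    using ex_has_least_nat[of P id "\<lambda>T. dim M - dim (K T)"] by blast
  have TA: "T \<in> ?A" and TK: "K T \<noteq> M" using T(1) by (auto simp: P_def)
  have max: "\<not> K T \<subset> K S" if "S \<in> ?A" "K S \<noteq> M" for S
  proof
    assume *: "K T \<subset> K S"
    have KS: "K S \<subseteq> span E" using KM M(3) by blast
    have "dim (K T) < dim (K S)" by (rule fd_dim_psubset[OF K[OF TA] K[OF that(1)] * KS M(4)])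
    moreover have "dim (K S) \<le> dim M" by (rule fd_dim_mono[OF K[OF that(1)] M(1) KM M(3,4)])
    ultimately show False using T(2)[of S] that by (auto simp: P_def)
  qed
  obtain x1 where x1: "x1 \<in> M" "T x1 \<noteq> 0" using TK by (auto simp: K_def)
  \<comment> \<open>An element with maximal proper kernel has rank one: otherwise \<open>TAT - lT\<close> has a larger one.\<close>
  have rank1: "\<exists>c. T x = c *s T x1" if x: "x \<in> M" for x
  proof (rule ccontr)
    assume nx: "\<nexists>c. T x = c *s T x1"
    obtain A where A: "A \<in> ?A" "A (T x1) = x" using orbit[OF stA[OF TA x1(1)] x1(2) x] by blast
    define V where "V = T ` M"
    have V: "subspace V" unfolding V_def by (rule subspace_lin_image[OF linA[OF TA] M(1)])
    have VM: "V \<subseteq> M" using stA[OF TA] by (auto simp: V_def)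
    have TAl: "lin (T \<circ> A)" using linA[OF compA[OF TA A(1)]] .
    have TAV: "(T \<circ> A) v \<in> V" if "v \<in> V" for v using stA[OF A(1)] that VM by (auto simp: V_def)
    have VE: "V \<subseteq> span E" using VM M(3) by blast
    have "T x1 \<in> V" using x1 by (auto simp: V_def)
    \<comment> \<open>The eigenvector lies in the image of \<open>T\<close>, so it is
      \<open>T w\<close> for some \<open>w\<close> which is outside the kernel of \<open>T\<close>
      but inside the kernel of TAT - lT.\<close>
    then obtain u l where u: "u \<in> V" "u \<noteq> 0" "(T \<circ> A) u = l *s u"
      using eigenvector_exists[OF TAl V TAV VE M(4) _ x1(2)] by blast
    obtain w where w: "w \<in> M" "u = T w" using u(1) by (auto simp: V_def)
    define S where "S = (\<lambda>v. (T \<circ> A \<circ> T) v + (-l) *s T v)"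
    have SA: "S \<in> ?A" unfolding S_def
      by (intro alg_hull.add alg_hull.scale compA TA A(1))
    have "S x1 = T x - l *s T x1" using A(2) by (simp add: S_def)
    then have "S x1 \<noteq> 0" using nx by auto
    then have "K S \<noteq> M" using x1 by (auto simp: K_def)
    moreover have "K T \<subseteq> K S" using lin_0[OF linA[OF TA]] lin_0[OF linA[OF A(1)]] by (auto simp: K_def S_def)
    moreover have "w \<in> K S" "w \<notin> K T" using u w by (auto simp: K_def S_def)
    ultimately show False using max[OF SA] by blast
  qed
  define x0 where "x0 = T x1"
  define \<phi> where "\<phi> x = (SOME c. T x = c *s x0)" for x
  have x0: "x0 \<in> M" "x0 \<noteq> 0" using x1 stA[OF TA] by (auto simp: x0_def)
  have uniq: "c = d" if "c *s x0 = d *s x0" for c d using that x0 by simp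
  have \<phi>: "T x = \<phi> x *s x0" if x: "x \<in> M" for x
    unfolding \<phi>_def using someI_ex[OF rank1[OF x]] by (simp add: x0_def)
  have \<phi>_add: "\<phi> (x + y) = \<phi> x + \<phi> y" if "x \<in> M" "y \<in> M" for x y
    using \<phi>[OF that(1)] \<phi>[OF that(2)] \<phi>[OF subspace_add[OF M(1) that]] lin_add[OF linA[OF TA], of x y]
    by (intro uniq) (simp add: scale_left_distrib)
  have \<phi>_scale: "\<phi> (c *s x) = c * \<phi> x" if "x \<in> M" for x c
    using \<phi>[OF that] \<phi>[OF subspace_scale[OF M(1) that]] lin_scale[OF linA[OF TA], of c x]
    by (intro uniq) simp
  have \<phi>_0: "\<phi> 0 = 0" using \<phi>_scale[OF x0(1), of 0] by simp
  have \<phi>_sum: "\<phi> (sum f B) = (\<Sum>b\<in>B. \<phi> (f b))" if "\<And>b. b \<in> B \<Longrightarrow> f b \<in> M" for f and B :: "'b set"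
    using that by (induction B rule: infinite_finite_induct)
      (auto simp: \<phi>_0 \<phi>_add subspace_sum[OF M(1)])
  obtain B where B: "independent B" "finite B" "span B = M" by (rule obtain_basis[OF M(1,3,4)])
  let ?r = "representation B"
  have BM: "b \<in> M" if "b \<in> B" for b using that B(3) span_base by blast
  have tr_add: "tr B (\<lambda>v. S v + S' v) = tr B S + tr B S'" if "S \<in> ?A" "S' \<in> ?A" for S S'
    unfolding tr_def using stA[OF that(1) BM] stA[OF that(2) BM] B
    by (simp add: representation_add sum.distrib)
  have tr_scale: "tr B (\<lambda>v. c *s S v) = c * tr B S" if "S \<in> ?A" for S c
    unfolding tr_def using stA[OF that BM] B
    by (simp add: representation_scale sum_distrib_left)
  have tr_unip: "tr B \<gamma> = tr B id" if \<gamma>: "\<gamma> \<in> \<Gamma>" for \<gamma>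
  proof -
    let ?N = "\<lambda>v. \<gamma> v - v"
    have N: "?N = (\<lambda>v. \<gamma> v + (-1) *s id v)" by auto
    have NA: "?N \<in> ?A" unfolding N using alg_hull.add[OF alg_hull.base[OF \<gamma>] alg_hull.scale[OF idA]] .
    have lN: "lin ?N" by (rule linA[OF NA])
    have "\<exists>n. \<forall>b\<in>B. (?N ^^ n) b = 0"
    proof -
      obtain n where n: "\<And>b. b \<in> B \<Longrightarrow> (?N ^^ n b) b = 0" using unip[OF \<gamma> BM] by metis
      \<comment> \<open>The nilpotency exponent depends on the basis vector; the sum of the
        exponents serves all of them.\<close>
      have "(?N ^^ sum n B) b = 0" if b: "b \<in> B" for b
      proof -
        have "sum n B = (sum n B - n b) + n b" using B(2) b member_le_sum[of b B n] by simp
        then have "(?N ^^ sum n B) b = (?N ^^ (sum n B - n b)) ((?N ^^ n b) b)"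
          using funpow_add[of "sum n B - n b" "n b" ?N] by simp
        then show ?thesis using n[OF b] lin_0[OF lin_funpow[OF lN]] by simp
      qed
      then show ?thesis by blast
    qed
    then obtain n where n: "\<forall>b\<in>B. (?N ^^ n) b = 0" by blast
    have "(?N ^^ n) v = 0" if "v \<in> span B" for v
      using span_minimal[OF _ subspace_lin_vimage[OF lin_funpow[OF lN, of n] subspace_single_0], of B] n that by auto
    then have "tr B ?N = 0" using tr_nilpotent[OF lN B(1,2)] stA[OF NA] B(3) by blast
    moreover have "tr B ?N = tr B \<gamma> + tr B (\<lambda>v. (-1) *s id v)"
      unfolding N by (rule tr_add[OF alg_hull.base[OF \<gamma>] alg_hull.scale[OF idA]])
    moreover have "tr B (\<lambda>v. (-1) *s id v) = (-1) * tr B id" by (rule tr_scale[OF idA])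
    ultimately show ?thesis by simp
  qed
  have tr_gT: "tr B (\<gamma> \<circ> S) = tr B S" if "\<gamma> \<in> \<Gamma>" "S \<in> ?A" for \<gamma> S
    using that(2)
  proof induction
    case (base \<delta>)
    then show ?case using tr_unip comp[OF that(1)] by metis
  next
    case (add S S')
    have "\<gamma> \<circ> (\<lambda>v. S v + S' v) = (\<lambda>v. (\<gamma> \<circ> S) v + (\<gamma> \<circ> S') v)"
      using lin_add[OF lin[OF that(1)]] by auto
    then show ?case using add compA[OF alg_hull.base[OF that(1)]] by (simp add: tr_add del: o_apply)
  next
    case (scale S c)
    have "\<gamma> \<circ> (\<lambda>v. c *s S v) = (\<lambda>v. c *s (\<gamma> \<circ> S) v)"
      using lin_scale[OF lin[OF that(1)]] by auto
    then show ?case using scale compA[OF alg_hull.base[OF that(1)]] by (simp add: tr_scale del: o_apply)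
  qed
  have tr_rank1: "tr B (S \<circ> T \<circ> S') = \<phi> (S' (S x0))" if S: "S \<in> ?A" "S' \<in> ?A" for S S'
  proof -
    let ?y = "S x0"
    have y: "?y \<in> span B" using stA[OF S(1) x0(1)] B(3) by blast
    have "?r ((S \<circ> T \<circ> S') b) b = \<phi> (?r ?y b *s S' b)" if b: "b \<in> B" for b
    proof -
      have "(S \<circ> T \<circ> S') b = \<phi> (S' b) *s ?y"
        using \<phi>[OF stA[OF S(2) BM[OF b]]] lin_scale[OF linA[OF S(1)]] by simp
      then show ?thesis using y B(1) \<phi>_scale[OF stA[OF S(2) BM[OF b]]]
        by (simp add: representation_scale mult.commute)
    qed
    then have "tr B (S \<circ> T \<circ> S') = (\<Sum>b\<in>B. \<phi> (?r ?y b *s S' b))" by (simp add: tr_def)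
    also have "\<dots> = \<phi> (\<Sum>b\<in>B. ?r ?y b *s S' b)"
      using stA[OF S(2) BM] subspace_scale[OF M(1)] by (subst \<phi>_sum) auto
    also have "(\<Sum>b\<in>B. ?r ?y b *s S' b) = S' (\<Sum>b\<in>B. ?r ?y b *s b)"
      by (simp add: lin_sum[OF linA[OF S(2)]] lin_scale[OF linA[OF S(2)]])
    also have "(\<Sum>b\<in>B. ?r ?y b *s b) = ?y" by (rule representation_sum_eq[OF B(1,2) y])
    finally show ?thesis .
  qed
  \<comment> \<open>The vectors that no operator of the span moves out of the kernel of
    \<open>\<phi>\<close>. This stable space is proper, hence zero, so it remains to put \<gamma> v
    - v into it.\<close>
  define N where "N = {w \<in> M. \<forall>S\<in>?A. \<phi> (S w) = 0}"
  have "subspace N"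
    unfolding N_def using \<phi>_0 linA stA subspace_0[OF M(1)] subspace_add[OF M(1)] subspace_scale[OF M(1)]
    by (intro subspaceI) (auto simp: lin_0 lin_add lin_scale \<phi>_add \<phi>_scale)
  moreover have "\<gamma> w \<in> N" if "\<gamma> \<in> \<Gamma>" "w \<in> N" for \<gamma> w
  proof -
    have "\<phi> (S (\<gamma> w)) = 0" if "S \<in> ?A" for S
      using compA[OF that alg_hull.base[OF \<open>\<gamma> \<in> \<Gamma>\<close>]] \<open>w \<in> N\<close> by (auto simp: N_def)
    then show ?thesis using M(2) that by (auto simp: N_def)
  qed
  moreover have "N \<subseteq> M" by (auto simp: N_def)
  ultimately have "N = {0} \<or> N = M" by (rule irr)
  moreover have "x1 \<notin> N"
  proof
    assume "x1 \<in> N"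
    then have "\<phi> x1 = 0" using idA by (auto simp: N_def)
    then show False using \<phi>[OF x1(1)] x1(2) by simp
  qed
  ultimately have N0: "N = {0}" using x1 by blast
  have "\<gamma> v - v \<in> N"
  proof -
    have "\<phi> (S (\<gamma> v - v)) = 0" if S: "S \<in> ?A" for S
    proof -
      \<comment> \<open>With v = A x0 the rank one formula turns \<phi>(S v) and \<phi>(S (\<gamma>
        v)) into traces that differ only by the factor \<open>\<gamma>\<close>.\<close>
      obtain A where A: "A \<in> ?A" "A x0 = v" using orbit[OF x0 g(2)] by blast
      have "(\<gamma> \<circ> A) x0 = \<gamma> v" using A(2) by simp
      then have "\<phi> (S (\<gamma> v)) = tr B (\<gamma> \<circ> A \<circ> T \<circ> S)"
        using tr_rank1[OF compA[OF alg_hull.base[OF g(1)] A(1)] S] by (simp only:)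
      also have "\<dots> = tr B (A \<circ> T \<circ> S)"
        using tr_gT[OF g(1) compA[OF compA[OF A(1) TA] S]] by (simp add: o_assoc)
      also have "\<dots> = \<phi> (S v)" using tr_rank1[OF A(1) S] A(2) by simp
      finally have eq: "\<phi> (S (\<gamma> v)) = \<phi> (S v)" .
      have m: "S (\<gamma> v) \<in> M" "S v \<in> M" using stA[OF S] M(2)[OF g] g(2) by auto
      have "S (\<gamma> v - v) = S (\<gamma> v) + (-1) *s S v" using lin_diff[OF linA[OF S]] by simp
      then show ?thesis using eq m subspace_scale[OF M(1) m(2), of "-1"]
        by (simp add: \<phi>_add \<phi>_scale del: scale_minus_left)
    qed
    then show ?thesis using g M(2) subspace_diff[OF M(1)] by (auto simp: N_def)
  qed
  then show ?thesis using N0 by simp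
qed

text \<open>The spaces between \<open>W\<close> and \<open>U\<close> may be infinite dimensional, so
  minimality is measured by the dimension of the intersection with \<open>V\<close>. As
  \<open>V\<close> meets every class of \<open>U\<close> modulo \<open>W\<close>, proper inclusions
  above \<open>W\<close> stay proper after intersecting.\<close>

lemma minimal_stable_subspace:
  assumes "subspace W" "subspace U" "W \<subset> U" "subspace V" "V \<subseteq> span E" "finite E"
    and UV: "\<And>u. u \<in> U \<Longrightarrow> \<exists>v\<in>V. u - v \<in> W"
    and U: "\<And>\<gamma> v. \<gamma> \<in> \<Gamma> \<Longrightarrow> v \<in> U \<Longrightarrow> \<gamma> v \<in> U"
  obtains M where "subspace M" "W \<subset> M" "M \<subseteq> U" "\<And>\<gamma> v. \<gamma> \<in> \<Gamma> \<Longrightarrow> v \<in> M \<Longrightarrow> \<gamma> v \<in> M"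
    "\<And>N. subspace N \<Longrightarrow> (\<And>\<gamma> v. \<gamma> \<in> \<Gamma> \<Longrightarrow> v \<in> N \<Longrightarrow> \<gamma> v \<in> N) \<Longrightarrow> W \<subset> N \<Longrightarrow> N \<subseteq> M \<Longrightarrow> N = M"
proof -
  define P where "P M \<longleftrightarrow> subspace M \<and> W \<subset> M \<and> M \<subseteq> U \<and> (\<forall>\<gamma>\<in>\<Gamma>. \<forall>v\<in>M. \<gamma> v \<in> M)" for M
  have "P U" using assms(2,3) U by (auto simp: P_def)
  then obtain M where M: "P M" "\<And>N. P N \<Longrightarrow> dim (M \<inter> V) \<le> dim (N \<inter> V)"
    using ex_has_least_nat[of P U "\<lambda>M. dim (M \<inter> V)"] by blast
  have "N = M" if N: "subspace N" "\<And>\<gamma> v. \<gamma> \<in> \<Gamma> \<Longrightarrow> v \<in> N \<Longrightarrow> \<gamma> v \<in> N" "W \<subset> N" "N \<subseteq> M" for N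
  proof (rule ccontr)
    assume "N \<noteq> M"
    then obtain x where x: "x \<in> M" "x \<notin> N" using N(4) by blast
    have sM: "subspace M" and MU: "M \<subseteq> U" and WM: "W \<subseteq> M" using M(1) by (auto simp: P_def)
    obtain v where v: "v \<in> V" "x - v \<in> W" using UV x(1) MU by blast
    have "v \<in> M"
    proof -
      have "x - (x - v) \<in> M" using subspace_diff[OF sM x(1)] v(2) WM by blast
      then show ?thesis by simp
    qed
    moreover have "v \<notin> N"
    proof
      assume "v \<in> N"
      then have "(x - v) + v \<in> N" using subspace_add[OF N(1)] v(2) N(3) by blast
      then show False using x(2) by simp
    qed
    ultimately have "N \<inter> V \<subset> M \<inter> V" using N(4) v(1) by blast
    moreover have "M \<inter> V \<subseteq> span E" using assms(5) by blast
    ultimately have "dim (N \<inter> V) < dim (M \<inter> V)"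
      using fd_dim_psubset[OF subspace_inter[OF N(1) assms(4)] subspace_inter[OF sM assms(4)] _ _ assms(6)] by blast
    moreover have "P N" using N MU by (auto simp: P_def)
    ultimately show False using M(2)[of N] by simp
  qed
  then show thesis using that[of M] M(1) by (auto simp: P_def)
qed

text \<open>\<open>\<Gamma>\<close> is a mere semigroup here because the application supplies the
  compressions \<open>q \<circ> \<gamma> \<circ> q\<close>, among which the identity does not occur.
  Adjoining \<open>id\<close> gives the monoid on which \<open>kolchin_aux\<close> works.\<close>

lemma kolchin_zero:
  assumes lin: "\<And>\<gamma>. \<gamma> \<in> \<Gamma> \<Longrightarrow> lin \<gamma>"
    and comp: "\<And>\<gamma> \<delta>. \<gamma> \<in> \<Gamma> \<Longrightarrow> \<delta> \<in> \<Gamma> \<Longrightarrow> \<gamma> \<circ> \<delta> \<in> \<Gamma>"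
    and U: "subspace U" "\<And>\<gamma> v. \<gamma> \<in> \<Gamma> \<Longrightarrow> v \<in> U \<Longrightarrow> \<gamma> v \<in> U" "U \<subseteq> span E" "finite E" "U \<noteq> {0}"
    and unip: "\<And>\<gamma> v. \<gamma> \<in> \<Gamma> \<Longrightarrow> v \<in> U \<Longrightarrow> \<exists>n. ((\<lambda>v. \<gamma> v - v) ^^ n) v = 0"
  shows "\<exists>u\<in>U. u \<noteq> 0 \<and> (\<forall>\<gamma>\<in>\<Gamma>. \<gamma> u = u)"
proof -
  have "{0} \<subset> U" using U(5) subspace_0[OF U(1)] by blast
  then obtain M where M: "subspace M" "{0} \<subset> M" "M \<subseteq> U" "\<And>\<gamma> v. \<gamma> \<in> \<Gamma> \<Longrightarrow> v \<in> M \<Longrightarrow> \<gamma> v \<in> M"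
    and irr: "\<And>N. subspace N \<Longrightarrow> (\<And>\<gamma> v. \<gamma> \<in> \<Gamma> \<Longrightarrow> v \<in> N \<Longrightarrow> \<gamma> v \<in> N) \<Longrightarrow> {0} \<subset> N \<Longrightarrow> N \<subseteq> M \<Longrightarrow> N = M"
    using minimal_stable_subspace[OF subspace_single_0 U(1) _ U(1,3,4), of \<Gamma>] U(2) by auto
  let ?G = "insert id \<Gamma>"
  have "\<gamma> v = v" if g: "\<gamma> \<in> ?G" "v \<in> M" for \<gamma> v
  proof (rule kolchin_aux[of ?G M E, OF _ _ _ M(1) _ _ U(4)])
    show "lin \<delta>" if "\<delta> \<in> ?G" for \<delta> using that lin by (auto simp: lin_def)
    show "\<delta> \<circ> \<epsilon> \<in> ?G" if "\<delta> \<in> ?G" "\<epsilon> \<in> ?G" for \<delta> \<epsilon> using that comp by auto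
    show "\<delta> v \<in> M" if "\<delta> \<in> ?G" "v \<in> M" for \<delta> v using that M(4) by auto
    show "M \<subseteq> span E" "M \<noteq> {0}" using M(2,3) U(3) by auto
    show "\<exists>n. ((\<lambda>v. \<delta> v - v) ^^ n) v = 0" if "\<delta> \<in> ?G" "v \<in> M" for \<delta> v
    proof (cases "\<delta> = id")
      case True
      then show ?thesis by (intro exI[of _ 1]) simp
    next
      case False
      then show ?thesis using unip that M(3) by auto
    qed
    show "N = {0} \<or> N = M" if "subspace N" "\<And>\<gamma> v. \<gamma> \<in> ?G \<Longrightarrow> v \<in> N \<Longrightarrow> \<gamma> v \<in> N" "N \<subseteq> M" for N
    proof (cases "N = {0}")
      case False
      then have "{0} \<subset> N" using subspace_0[OF that(1)] by blast
      then show ?thesis using irr[OF that(1) _ _ that(3)] that(2) by blast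
    qed simp
  qed (use g in auto)
  moreover obtain u where "u \<in> M" "u \<noteq> 0" using M(2) by auto
  ultimately show ?thesis using M(3) by (intro bexI[of _ u]) auto
qed

lemma projection_exists:
  assumes "subspace W"
  obtains \<pi> where "lin \<pi>" "\<And>v. \<pi> v \<in> W" "\<And>w. w \<in> W \<Longrightarrow> \<pi> w = w"
proof -
  interpret p: vector_space_pair scale scale by unfold_locales
  obtain g where g: "g ` UNIV \<subseteq> W" "Vector_Spaces.linear scale scale g" "\<forall>v\<in>W. g (id v) = v"
    using p.linear_exists_left_inverse_on[OF linear_id assms inj_on_id] by auto
  interpret g: Vector_Spaces.linear scale scale g by (rule g(2))
  have "lin g" by (simp add: lin_def g.add g.scale)
  then show thesis using that g(1,3) by auto
qed

theorem kolchin: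
  assumes lin: "\<And>\<gamma>. \<gamma> \<in> \<Gamma> \<Longrightarrow> lin \<gamma>"
    and comp: "\<And>\<gamma> \<delta>. \<gamma> \<in> \<Gamma> \<Longrightarrow> \<delta> \<in> \<Gamma> \<Longrightarrow> \<gamma> \<circ> \<delta> \<in> \<Gamma>"
    and W: "subspace W" "\<And>\<gamma> v. \<gamma> \<in> \<Gamma> \<Longrightarrow> v \<in> W \<Longrightarrow> \<gamma> v \<in> W"
    and U: "subspace U" "\<And>\<gamma> v. \<gamma> \<in> \<Gamma> \<Longrightarrow> v \<in> U \<Longrightarrow> \<gamma> v \<in> U" "U \<subseteq> span E" "finite E" "\<not> U \<subseteq> W"
    and unip: "\<And>\<gamma> v. \<gamma> \<in> \<Gamma> \<Longrightarrow> v \<in> U \<Longrightarrow> \<exists>n. ((\<lambda>v. \<gamma> v - v) ^^ n) v = 0"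
  shows "\<exists>u\<in>U. u \<notin> W \<and> (\<forall>\<gamma>\<in>\<Gamma>. \<gamma> u - u \<in> W)"
proof -
  \<comment> \<open>A linear map with kernel \<open>W\<close> plays the role of the quotient by \<open>W\<close>.\<close>
  obtain p where p: "lin p" "\<And>v. p v \<in> W" "\<And>w. w \<in> W \<Longrightarrow> p w = w" by (rule projection_exists[OF W(1)]) (rule that)
  define q where "q v = v - p v" for v
  have q: "lin q" using p(1) by (auto simp: lin_def q_def algebra_simps)
  have qW: "q v = 0 \<longleftrightarrow> v \<in> W" for v using p(2)[of v] p(3)[of v] by (auto simp: q_def)
  have vq: "v - q v \<in> W" for v using p(2) by (simp add: q_def)
  \<comment> \<open>Since \<open>W\<close> is stable, the change made by \<open>q\<close> before
    \<open>\<gamma>\<close> is invisible after a second \<open>q\<close>. Hence the compressions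
    compose like the original operators and inherit their unipotence.\<close>
  have q\<gamma>: "q (\<gamma> (q v)) = q (\<gamma> v)" if "\<gamma> \<in> \<Gamma>" for \<gamma> v
  proof -
    have "q (\<gamma> (v - q v)) = 0" using W(2)[OF that vq] qW by blast
    then show ?thesis by (simp add: lin_diff[OF lin[OF that]] lin_diff[OF q])
  qed
  define G where "G = (\<lambda>\<gamma>. q \<circ> \<gamma> \<circ> q) ` \<Gamma>"
  have "\<exists>u\<in>q ` U. u \<noteq> 0 \<and> (\<forall>\<gamma>\<in>G. \<gamma> u = u)"
  proof (rule kolchin_zero)
    show "lin \<delta>" if "\<delta> \<in> G" for \<delta> using that lin_comp[OF lin_comp[OF q lin] q] by (auto simp: G_def)
    show "\<delta> \<circ> \<epsilon> \<in> G" if de: "\<delta> \<in> G" "\<epsilon> \<in> G" for \<delta> \<epsilon>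
    proof -
      obtain d e where *: "d \<in> \<Gamma>" "e \<in> \<Gamma>" "\<delta> = q \<circ> d \<circ> q" "\<epsilon> = q \<circ> e \<circ> q" using de by (auto simp: G_def)
      have "\<delta> \<circ> \<epsilon> = q \<circ> (d \<circ> e) \<circ> q" using q\<gamma>[OF *(1)] by (auto simp: *(3,4) fun_eq_iff q\<gamma>[OF *(1)])
      then show ?thesis using comp[OF *(1,2)] by (simp add: G_def)
    qed
    show "subspace (q ` U)" by (rule subspace_lin_image[OF q U(1)])
    show "\<delta> v \<in> q ` U" if "\<delta> \<in> G" "v \<in> q ` U" for \<delta> v
      using that q\<gamma> U(2) by (auto simp: G_def)
    have "subspace {v. q v \<in> span (q ` E)}" by (rule subspace_lin_vimage[OF q subspace_span])
    then have "span E \<subseteq> {v. q v \<in> span (q ` E)}" by (intro span_minimal) (auto intro: span_base)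
    then show "q ` U \<subseteq> span (q ` E)" using U(3) by auto
    show "finite (q ` E)" using U(4) by simp
    show "q ` U \<noteq> {0}" using U(5) qW by force
    show "\<exists>n. ((\<lambda>v. \<delta> v - v) ^^ n) v = 0" if dv: "\<delta> \<in> G" "v \<in> q ` U" for \<delta> v
    proof -
      obtain d u where *: "d \<in> \<Gamma>" "\<delta> = q \<circ> d \<circ> q" "u \<in> U" "v = q u" using dv by (auto simp: G_def)
      have "((\<lambda>v. \<delta> v - v) ^^ n) (q u) = q (((\<lambda>v. d v - v) ^^ n) u)" for n
      proof (induction n)
        case (Suc n)
        have qq: "q (q x) = q x" for x
        proof -
          have "q (x - q x) = 0" using vq qW by blast
          then show ?thesis by (simp add: lin_diff[OF q])
        qed
        then show ?case using Suc q\<gamma>[OF *(1)] by (simp add: *(2) lin_diff[OF q])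
      qed simp
      moreover obtain n where "((\<lambda>v. d v - v) ^^ n) u = 0" using unip[OF *(1,3)] by blast
      ultimately show ?thesis using lin_0[OF q] *(4) by metis
    qed
  qed
  then obtain u where u: "u \<in> U" "q u \<noteq> 0" "\<forall>\<gamma>\<in>G. \<gamma> (q u) = q u" by blast
  have "\<gamma> u - u \<in> W" if g: "\<gamma> \<in> \<Gamma>" for \<gamma>
  proof -
    have "q \<circ> \<gamma> \<circ> q \<in> G" using g by (auto simp: G_def)
    then have "(q \<circ> \<gamma> \<circ> q) (q u) = q u" using u(3) by blast
    then have "q (\<gamma> u) = q u" using q\<gamma>[OF g] by simp
    then have "q (\<gamma> u - u) = 0" by (simp add: lin_diff[OF q])
    then show ?thesis using qW by blast
  qed
  then show ?thesis using u qW by blast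
qed

end

section \<open>Algebras of functions\<close>

definition cst :: "'k \<Rightarrow> 'q \<Rightarrow> 'k" where "cst c = (\<lambda>_. c)"

definition fscale :: "'k::times \<Rightarrow> ('q \<Rightarrow> 'k) \<Rightarrow> 'q \<Rightarrow> 'k" where "fscale c f = (\<lambda>x. c * f x)"

lemma cst_apply [simp]: "cst c x = c"
  by (simp add: cst_def)

lemma fscale_apply [simp]: "fscale c f x = c * f x"
  by (simp add: fscale_def)

lemma sum_fun_apply [simp]: "(sum f A) x = (\<Sum>a\<in>A. f a x)"
  by (induction A rule: infinite_finite_induct) auto

lemma minus_fun_apply [simp]: "((f :: 'q \<Rightarrow> 'k::ab_group_add) - g) x = f x - g x"
  by (simp add: fun_diff_def)

lemma uminus_fun_apply [simp]: "(- (f :: 'q \<Rightarrow> 'k::ab_group_add)) x = - f x"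
  by (simp add: fun_Compl_def)

lemma power_fun_apply [simp]: "((f :: 'q \<Rightarrow> 'k::comm_semiring_1) ^ n) x = f x ^ n"
  by (induction n) auto

lemma poly_fun_apply: "poly p y x = poly (map_poly (\<lambda>a. a x) p) (y x)"
  for y :: "'q \<Rightarrow> 'k::comm_ring_1"
  by (induction p) (auto simp: map_poly_pCons)

lemma fun_plus_comp: "(f + g) \<circ> \<sigma> = (f \<circ> \<sigma>) + (g \<circ> \<sigma>)" and fun_times_comp: "(f * g) \<circ> \<sigma> = (f \<circ> \<sigma>) * (g \<circ> \<sigma>)"
  by auto

lemma fun_power_comp: "(f ^ n) \<circ> \<sigma> = (f \<circ> \<sigma>) ^ n" for f :: "_ \<Rightarrow> _::comm_semiring_1"
  by auto

lemma fscale_comp: "fscale c f \<circ> \<sigma> = fscale c (f \<circ> \<sigma>)"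
  by auto

lemma cst_comp [simp]: "cst c \<circ> \<sigma> = cst c"
  by auto

lemma fscale_altdef: "fscale c f = cst c * f"
  by auto

lemma cst_eq_0_iff [simp]: "cst c = 0 \<longleftrightarrow> c = 0"
  by (auto simp: cst_def fun_eq_iff)

lemma cst_0: "cst 0 = 0" and cst_1: "cst 1 = 1"
  by (simp_all add: fun_eq_iff)

lemma poly_comp: "poly p y \<circ> \<sigma> = poly (map_poly (\<lambda>a. a \<circ> \<sigma>) p) (y \<circ> \<sigma>)"
  for y :: "'q \<Rightarrow> 'k::comm_ring_1"
proof (induction p)
  case 0
  then show ?case by auto
next
  case (pCons a p)
  have "map_poly (\<lambda>a. a \<circ> \<sigma>) (pCons a p) = pCons (a \<circ> \<sigma>) (map_poly (\<lambda>a. a \<circ> \<sigma>) p)"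
    by (rule map_poly_pCons) auto
  then show ?case using pCons by (simp only: poly_pCons fun_plus_comp fun_times_comp)
qed

lemma coeff_map_poly_comp [simp]: "coeff (map_poly (\<lambda>a. a \<circ> \<sigma>) p) i = coeff p i \<circ> \<sigma>"
  for p :: "('q \<Rightarrow> 'k::comm_ring_1) poly"
  by (rule coeff_map_poly) auto

text \<open>Taylor expansion of \<open>p\<close> at \<open>c\<close>. A bound on the degree takes
  the place of the degree, so that polynomials with a vanishing top coefficient can be compared as
  well.\<close>

lemma coeff_pcompose_shift:
  fixes p :: "'a::comm_ring_1 poly"
  assumes "degree p \<le> n"
  shows "coeff (pcompose p [:c, 1:]) j = (\<Sum>l\<le>n. of_nat (l choose j) * coeff p l * c ^ (l - j))"
proof -
  have cf: "coeff ([:c, 1:] ^ l) j = of_nat (l choose j) * c ^ (l - j)" for l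
  proof (cases "j \<le> l")
    case True
    then show ?thesis by (simp add: coeff_linear_poly_power)
  next
    case False
    have "degree ([:c, 1:] ^ l) \<le> l" using degree_power_le[of "[:c, 1:]" l] by simp
    then show ?thesis using False by (simp add: coeff_eq_0 binomial_eq_0)
  qed
  have "p = (\<Sum>l\<le>n. monom (coeff p l) l)" by (rule poly_as_sum_of_monoms'[OF assms, symmetric])
  then have "pcompose p [:c, 1:] = (\<Sum>l\<le>n. pcompose (monom (coeff p l) l) [:c, 1:])"
    by (metis pcompose_sum)
  also have "\<dots> = (\<Sum>l\<le>n. Polynomial.smult (coeff p l) ([:c, 1:] ^ l))"
    by (simp add: pcompose_altdef map_poly_monom poly_monom)
  finally have "coeff (pcompose p [:c, 1:]) j = (\<Sum>l\<le>n. coeff p l * coeff ([:c, 1:] ^ l) j)"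
    by (simp add: coeff_sum)
  then show ?thesis by (simp add: cf mult_ac)
qed

global_interpretation fs: ac_vector_space "fscale :: 'k::alg_closed_field \<Rightarrow> ('q \<Rightarrow> 'k) \<Rightarrow> 'q \<Rightarrow> 'k"
  by unfold_locales (auto simp: fun_eq_iff algebra_simps)

definition subalg :: "('q \<Rightarrow> 'k::comm_ring_1) set \<Rightarrow> bool" where
  "subalg S \<longleftrightarrow> (\<forall>c. cst c \<in> S) \<and> (\<forall>f\<in>S. \<forall>g\<in>S. f + g \<in> S \<and> f * g \<in> S)"

lemma subalgD:
  assumes "subalg S"
  shows subalg_cst: "cst c \<in> S" and subalg_add: "f \<in> S \<Longrightarrow> g \<in> S \<Longrightarrow> f + g \<in> S"
    and subalg_mult: "f \<in> S \<Longrightarrow> g \<in> S \<Longrightarrow> f * g \<in> S"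
  using assms by (auto simp: subalg_def)

lemma subalg_0: "subalg S \<Longrightarrow> 0 \<in> S" and subalg_1: "subalg S \<Longrightarrow> 1 \<in> S"
  using subalg_cst[of S 0] subalg_cst[of S 1] by (auto simp: cst_0 cst_1)

lemma subalg_scale: "subalg S \<Longrightarrow> f \<in> S \<Longrightarrow> fscale c f \<in> S"
  by (simp add: fscale_altdef subalgD)

lemma subalg_uminus: "subalg S \<Longrightarrow> f \<in> S \<Longrightarrow> - f \<in> S"
proof -
  assume "subalg S" "f \<in> S"
  then have "fscale (-1) f \<in> S" by (rule subalg_scale)
  moreover have "fscale (-1) f = - f" by auto
  ultimately show ?thesis by simp
qed

lemma subalg_diff: "subalg S \<Longrightarrow> f \<in> S \<Longrightarrow> g \<in> S \<Longrightarrow> f - g \<in> S"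
  using subalg_add[of S f "- g"] subalg_uminus[of S g] by simp

lemma subalg_power: "subalg S \<Longrightarrow> f \<in> S \<Longrightarrow> f ^ n \<in> S"
  by (induction n) (auto simp: subalg_1 subalgD)

lemma subalg_sum: "subalg S \<Longrightarrow> (\<And>i. i \<in> I \<Longrightarrow> f i \<in> S) \<Longrightarrow> sum f I \<in> S"
  by (induction I rule: infinite_finite_induct) (auto simp: subalg_0 subalgD)

lemma subalg_of_nat: "subalg S \<Longrightarrow> of_nat n \<in> S"
  using subalg_cst[of S "of_nat n"] by (simp add: cst_def of_nat_fun)

lemma subalg_subspace: "subalg S \<Longrightarrow> fs.subspace S"
  by (intro fs.subspaceI) (auto simp: subalg_0 subalgD subalg_scale)

section \<open>Polynomials with coefficients in a subalgebra\<close>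

definition coeffs_in :: "'a::zero set \<Rightarrow> 'a poly \<Rightarrow> bool" where
  "coeffs_in S p \<longleftrightarrow> (\<forall>i. coeff p i \<in> S)"

lemma coeffs_in_mono: "coeffs_in S p \<Longrightarrow> S \<subseteq> T \<Longrightarrow> coeffs_in T p"
  by (auto simp: coeffs_in_def)

context
  fixes S :: "('q \<Rightarrow> 'k::comm_ring_1) set" assumes S: "subalg S"
begin

lemma coeffs_in_0: "coeffs_in S 0" and coeffs_in_1: "coeffs_in S 1"
  and coeffs_in_const: "a \<in> S \<Longrightarrow> coeffs_in S [:a:]"
  and coeffs_in_pCons: "a \<in> S \<Longrightarrow> coeffs_in S p \<Longrightarrow> coeffs_in S (pCons a p)"
  and coeffs_in_add: "coeffs_in S p \<Longrightarrow> coeffs_in S q \<Longrightarrow> coeffs_in S (p + q)"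
  and coeffs_in_diff: "coeffs_in S p \<Longrightarrow> coeffs_in S q \<Longrightarrow> coeffs_in S (p - q)"
  and coeffs_in_smult: "a \<in> S \<Longrightarrow> coeffs_in S p \<Longrightarrow> coeffs_in S (Polynomial.smult a p)"
  and coeffs_in_monom: "a \<in> S \<Longrightarrow> coeffs_in S (monom a n)"
  using subalg_0[OF S] subalg_1[OF S]
  by (auto simp: coeffs_in_def coeff_pCons subalgD[OF S] subalg_diff[OF S] split: nat.splits)

lemma coeffs_in_mult: "coeffs_in S p \<Longrightarrow> coeffs_in S q \<Longrightarrow> coeffs_in S (p * q)"
  by (auto simp: coeffs_in_def coeff_mult intro!: subalg_sum[OF S] subalg_mult[OF S])

lemma coeffs_in_pcompose_shift: "coeffs_in S p \<Longrightarrow> c \<in> S \<Longrightarrow> coeffs_in S (pcompose p [:c, 1:])"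
  unfolding coeffs_in_def coeff_pcompose_shift[OF order_refl]
  by (auto intro!: subalg_sum[OF S] subalg_mult[OF S] subalg_power[OF S] subalg_of_nat[OF S])

lemma poly_in: "coeffs_in S p \<Longrightarrow> y \<in> S \<Longrightarrow> poly p y \<in> S"
  unfolding poly_altdef coeffs_in_def by (intro subalg_sum[OF S] subalg_mult[OF S] subalg_power[OF S]) auto

end

section \<open>Adjoining one function, and transcendence over a subalgebra\<close>

definition adj :: "('q \<Rightarrow> 'k::comm_ring_1) set \<Rightarrow> ('q \<Rightarrow> 'k) \<Rightarrow> ('q \<Rightarrow> 'k) set" where
  "adj S y = {poly p y | p. coeffs_in S p}"

lemma adjI: "coeffs_in S p \<Longrightarrow> poly p y \<in> adj S y"
  by (auto simp: adj_def)

lemma subalg_adj: assumes "subalg S" shows "subalg (adj S y)"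
  unfolding subalg_def
proof (intro conjI ballI allI)
  fix c
  have "poly [:cst c:] y \<in> adj S y" by (intro adjI coeffs_in_const assms subalgD)
  then show "cst c \<in> adj S y" by simp
next
  fix f g assume "f \<in> adj S y" "g \<in> adj S y"
  then obtain p q where pq: "coeffs_in S p" "coeffs_in S q" "f = poly p y" "g = poly q y"
    by (auto simp: adj_def)
  show "f + g \<in> adj S y" using adjI[OF coeffs_in_add[OF assms pq(1,2)], of y] pq by simp
  show "f * g \<in> adj S y" using adjI[OF coeffs_in_mult[OF assms pq(1,2)], of y] pq by simp
qed

lemma adj_base: "subalg S \<Longrightarrow> f \<in> S \<Longrightarrow> f \<in> adj S y"
  using adjI[OF coeffs_in_const, of S f y] by simp

lemma adj_superset: "subalg S \<Longrightarrow> S \<subseteq> adj S y"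
  by (auto intro: adj_base)

lemma adj_self:
  assumes "subalg S" shows "y \<in> adj S y"
proof -
  have "poly (monom 1 1) y \<in> adj S y" by (intro adjI coeffs_in_monom subalg_1 assms)
  then show ?thesis by (simp add: poly_monom)
qed

lemma adj_minimal: "subalg T \<Longrightarrow> S \<subseteq> T \<Longrightarrow> y \<in> T \<Longrightarrow> adj S y \<subseteq> T"
  unfolding adj_def using poly_in coeffs_in_mono by blast

definition transc :: "('q \<Rightarrow> 'k::comm_ring_1) set \<Rightarrow> ('q \<Rightarrow> 'k) \<Rightarrow> bool" where
  "transc S y \<longleftrightarrow> (\<forall>p. coeffs_in S p \<longrightarrow> poly p y = 0 \<longrightarrow> p = 0)"

text \<open>Transcendence truncated at degree \<open>n\<close>. This is what is left for an
  algebraic \<open>y\<close> when \<open>n\<close> is the least degree of a relation; it lets the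
  algebraic and the transcendental case share one comparison of coefficients.\<close>

definition free_below :: "('q \<Rightarrow> 'k::comm_ring_1) set \<Rightarrow> ('q \<Rightarrow> 'k) \<Rightarrow> nat \<Rightarrow> bool" where
  "free_below S y n \<longleftrightarrow> (\<forall>p. coeffs_in S p \<longrightarrow> degree p < n \<longrightarrow> poly p y = 0 \<longrightarrow> p = 0)"

lemma transc_free_below: "transc S y \<Longrightarrow> free_below S y n"
  by (auto simp: transc_def free_below_def)

lemma transc_inj:
  assumes "subalg S" "transc S y" "coeffs_in S p" "coeffs_in S q" "poly p y = poly q y"
  shows "p = q"
proof -
  have "coeffs_in S (p - q)" by (rule coeffs_in_diff[OF assms(1,3,4)])
  moreover have "poly (p - q) y = 0" using assms(5) by simp
  ultimately have "p - q = 0" using assms(2) unfolding transc_def by blast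
  then show ?thesis by simp
qed

definition algebra_gen :: "('q \<Rightarrow> 'k::comm_ring_1) set \<Rightarrow> ('q \<Rightarrow> 'k) set" where
  "algebra_gen B = \<Inter>{S. subalg S \<and> B \<subseteq> S}"

lemma subalg_algebra_gen: "subalg (algebra_gen B)"
  unfolding algebra_gen_def subalg_def by auto

lemma algebra_gen_superset: "B \<subseteq> algebra_gen B"
  by (auto simp: algebra_gen_def)

lemma algebra_gen_minimal: "subalg S \<Longrightarrow> B \<subseteq> S \<Longrightarrow> algebra_gen B \<subseteq> S"
  by (auto simp: algebra_gen_def)

definition pev :: "'k::comm_ring_1 poly \<Rightarrow> ('q \<Rightarrow> 'k) \<Rightarrow> 'q \<Rightarrow> 'k" where
  "pev p y = (\<lambda>x. poly p (y x))"

lemma pev_apply [simp]: "pev p y x = poly p (y x)" by (simp add: pev_def)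

lemma coeff_map_poly_cst [simp]: "coeff (map_poly cst p) i = cst (coeff p i)"
  by (rule coeff_map_poly) (auto simp: cst_0)

lemma degree_map_poly_cst [simp]: "degree (map_poly cst p) = degree p"
  by (rule degree_map_poly) (auto simp: cst_0)

lemma pev_conv_poly: "pev p y = poly (map_poly cst p) y"
  by (intro ext) (simp add: poly_fun_apply map_poly_map_poly o_def cst_0)

lemma coeffs_in_map_poly_cst: "subalg S \<Longrightarrow> coeffs_in S (map_poly cst p)"
  by (simp add: coeffs_in_def subalgD)

lemma pev_in: "subalg S \<Longrightarrow> y \<in> S \<Longrightarrow> pev p y \<in> S"
  unfolding pev_conv_poly by (intro poly_in coeffs_in_map_poly_cst)

lemma pev_0 [simp]: "pev 0 y = 0"
  by (auto simp: fun_eq_iff)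

section \<open>Additive polynomials\<close>

text \<open>In characteristic 0 this means l = 1, in characteristic p that \<open>l\<close> is a
  power of p. The form with binomial coefficients is what a comparison of Taylor coefficients
  delivers, and it covers all characteristics at once.\<close>

definition addexp :: "'k::comm_ring_1 itself \<Rightarrow> nat \<Rightarrow> bool" where
  "addexp k l \<longleftrightarrow> l > 0 \<and> (\<forall>j. 0 < j \<longrightarrow> j < l \<longrightarrow> (of_nat (l choose j) :: 'k) = 0)"

definition additive_poly :: "'k::comm_ring_1 poly \<Rightarrow> bool" where
  "additive_poly p \<longleftrightarrow> (\<forall>l. coeff p l \<noteq> 0 \<longrightarrow> addexp TYPE('k) l)"

lemma addexp_power_add:
  assumes "addexp TYPE('k::comm_ring_1) l"
  shows "(x + y) ^ l = x ^ l + (y :: 'k) ^ l"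
proof -
  have l: "l > 0" using assms by (simp add: addexp_def)
  have "(x + y) ^ l = (\<Sum>k\<le>l. of_nat (l choose k) * x ^ k * y ^ (l - k))" by (rule binomial_ring)
  also have "\<dots> = (\<Sum>k\<in>{0,l}. of_nat (l choose k) * x ^ k * y ^ (l - k))"
    using assms by (intro sum.mono_neutral_right) (auto simp: addexp_def)
  also have "\<dots> = x ^ l + y ^ l" using l by simp
  finally show ?thesis .
qed

lemma additive_poly_add:
  assumes "additive_poly p" shows "poly p (x + y) = poly p x + poly p (y :: 'k::comm_ring_1)"
  unfolding poly_altdef sum.distrib[symmetric]
proof (rule sum.cong[OF refl])
  fix i
  show "coeff p i * (x + y) ^ i = coeff p i * x ^ i + coeff p i * y ^ i"
    using assms addexp_power_add[of i x y]
    by (cases "coeff p i = 0") (auto simp: additive_poly_def algebra_simps)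
qed

lemma additive_poly_0 [simp]: "additive_poly 0"
  by (simp add: additive_poly_def)

lemma additive_poly_smult: "additive_poly p \<Longrightarrow> additive_poly (Polynomial.smult c p)"
  unfolding additive_poly_def by (metis coeff_smult mult_zero_right)

lemma additive_poly_sum_monom:
  "additive_poly p \<Longrightarrow> coeff p 0 = 0"
  by (auto simp: additive_poly_def addexp_def)

lemma additive_poly_at_0: "additive_poly p \<Longrightarrow> poly p 0 = 0"
  by (simp add: poly_0_coeff_0 additive_poly_sum_monom)

lemma additive_poly_diff: "additive_poly p \<Longrightarrow> poly p (x - y) = poly p x - poly p (y :: 'k::comm_ring_1)"
  using additive_poly_add[of p "x - y" y] by simp

lemma pev_additive: "additive_poly p \<Longrightarrow> pev p (f + g) = pev p f + pev p g"
  by (auto simp: additive_poly_add)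

lemma addexp_1: "addexp TYPE('k::comm_ring_1) 1"
  by (auto simp: addexp_def)

lemma addexp_char_0:
  assumes "addexp TYPE('k::field) l" "CHAR('k) = 0"
  shows "l = 1"
proof (rule ccontr)
  assume "l \<noteq> 1"
  then have "1 < l" using assms(1) by (simp add: addexp_def)
  then have "(of_nat (l choose 1) :: 'k) = 0" using assms(1) by (simp only: addexp_def)
  then show False using assms by (auto simp: CHAR_eq0_iff addexp_def)
qed

lemma addexp_prime_char:
  assumes "addexp TYPE('k::field) l" "CHAR('k) = p" "p > 0"
  shows "\<exists>i. l = p ^ i"
proof -
  have prime: "prime p" using assms(2,3) prime_CHAR_semidom[where 'a='k] by simp
  have l: "l > 0" using assms(1) by (simp add: addexp_def)
  obtain i b where ib: "l = p ^ i * b" "\<not> p dvd b"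
    using multiplicity_decompose'[of l p] l prime by (metis not_prime_unit not_gr_zero)
  have "b = 1"
  proof (rule ccontr)
    assume "b \<noteq> 1"
    then have b: "b > 1" using ib l by (cases b) auto
    have pc: "prime CHAR('k poly)" using prime assms(2) by simp
    let ?X = "[:0, 1:] :: 'k poly"
    have X: "?X ^ n = monom 1 n" for n by (simp add: monom_altdef)
    have Xk: "(?X ^ n) ^ k = monom 1 (n * k)" for n k unfolding power_mult[symmetric] by (rule X)
    have "(1 + ?X) ^ l = (1 ^ (p ^ i) + ?X ^ (p ^ i)) ^ b"
      using freshmans_dream'[OF pc, of "p ^ i" i 1 ?X] assms(2) ib by (simp add: power_mult)
    also have "\<dots> = (\<Sum>k\<le>b. of_nat (b choose k) * (?X ^ (p ^ i)) ^ k)"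
      unfolding add.commute[of "1 ^ (p ^ i)"] binomial_ring by simp
    also have "\<dots> = (\<Sum>k\<le>b. monom (of_nat (b choose k)) (p ^ i * k))"
      by (simp only: Xk of_nat_monom mult_monom mult_1_right add_0)
    finally have "coeff ((1 + ?X) ^ l) (p ^ i) = (\<Sum>k\<le>b. if p ^ i * k = p ^ i then of_nat (b choose k) else 0)"
      by (simp add: coeff_sum)
    also have "\<dots> = (\<Sum>k\<in>{1}. if p ^ i * k = p ^ i then of_nat (b choose k) else 0)"
      using b prime by (intro sum.mono_neutral_right) auto
    also have "\<dots> = of_nat b" by simp
    finally have 1: "coeff ((1 + ?X) ^ l) (p ^ i) = (of_nat b :: 'k)" .
    have lt: "p ^ i < l" using b ib prime by (simp add: prime_gt_0_nat)
    have "1 + ?X = [:1, 1:]" by (simp add: one_pCons)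
    then have "coeff ((1 + ?X) ^ l) (p ^ i) = of_nat (l choose (p ^ i))"
      using coeff_linear_poly_power[of "p ^ i" l "1::'k" 1] lt by simp
    also have "\<dots> = (0::'k)" using assms(1) lt prime by (simp add: addexp_def prime_gt_0_nat)
    finally have "(of_nat b :: 'k) = 0" using 1 by simp
    then show False using ib(2) assms(2) by (simp add: of_nat_eq_0_iff_char_dvd)
  qed
  then show ?thesis using ib by auto
qed

lemma addexp_prime_power:
  assumes "CHAR('k::field) = p" "p > 0"
  shows "addexp TYPE('k) (p ^ i)"
proof -
  have prime: "prime p" using assms prime_CHAR_semidom[where 'a='k] by simp
  have pc: "prime CHAR('k poly)" using prime assms by simp
  have "of_nat (p ^ i choose j) = (0::'k)" if j: "0 < j" "j < p ^ i" for j
  proof -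
    let ?X = "[:0, 1:] :: 'k poly"
    have X: "?X ^ n = monom 1 n" for n by (simp add: monom_altdef)
    have "1 + ?X = [:1, 1:]" by (simp add: one_pCons)
    then have "of_nat (p ^ i choose j) = coeff ((1 + ?X) ^ (p ^ i)) j"
      using coeff_linear_poly_power[of j "p ^ i" "1::'k" 1] j by simp
    also have "(1 + ?X) ^ (p ^ i) = 1 + monom 1 (p ^ i)"
      using freshmans_dream'[OF pc, of "p ^ i" i 1 ?X] assms by (simp add: X)
    finally show ?thesis using j by simp
  qed
  then show ?thesis using prime by (simp add: addexp_def prime_gt_0_nat)
qed

lemma funpow_agree:
  assumes "v \<in> X" "\<And>x. x \<in> X \<Longrightarrow> f x = g x" "\<And>x. x \<in> X \<Longrightarrow> g x \<in> X"
  shows "(f ^^ n) v = (g ^^ n) v \<and> (g ^^ n) v \<in> X"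
  by (induction n) (use assms in auto)

section \<open>Unipotent translation algebras\<close>

text \<open>
  \<open>A\<close> models \<open>k[Q]\<close> for a unipotent group \<open>Q\<close>. The multiplication \<open>m\<close> is a total function on the
  type; only its composition with functions from \<open>A\<close> matters.
\<close>

locale unipotent_algebra =
  fixes m :: "'q \<Rightarrow> 'q \<Rightarrow> 'q" and e :: 'q and A :: "('q \<Rightarrow> 'k::alg_closed_field) set"
  assumes A: "subalg A"
    and assoc: "f \<in> A \<Longrightarrow> f (m (m x y) z) = f (m x (m y z))"
    and right_unit: "f \<in> A \<Longrightarrow> f (m x e) = f x"
    and left_unit: "f \<in> A \<Longrightarrow> f (m e x) = f x"
    and comult: "f \<in> A \<Longrightarrow> \<exists>(n::nat) a b. (\<forall>j<n. a j \<in> A \<and> b j \<in> A) \<and> (\<forall>x y. f (m x y) = (\<Sum>j<n. a j x * b j y))"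
    and unipotent_right: "f \<in> A \<Longrightarrow> \<exists>n. ((\<lambda>h. (h \<circ> (\<lambda>x. m x a)) - h) ^^ n) f = 0"
    and unipotent_left: "f \<in> A \<Longrightarrow> \<exists>n. ((\<lambda>h. (h \<circ> m a) - h) ^^ n) f = 0"
    and fin_gen: "\<exists>B. finite B \<and> A = algebra_gen B"
    and conn: "f \<in> A \<Longrightarrow> finite (range f) \<Longrightarrow> \<exists>c. f = cst c"
begin

definition Tr :: "('q \<Rightarrow> 'q) set" where "Tr = range (\<lambda>a x. m x a) \<union> range m"

lemma Tr_right: "(\<lambda>x. m x a) \<in> Tr" and Tr_left: "m a \<in> Tr"
  by (auto simp: Tr_def)

definition tstable :: "('q \<Rightarrow> 'k) set \<Rightarrow> bool" where
  "tstable S \<longleftrightarrow> (\<forall>\<sigma>\<in>Tr. \<forall>f\<in>S. f \<circ> \<sigma> \<in> S)"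

lemma tstableD: "tstable S \<Longrightarrow> \<sigma> \<in> Tr \<Longrightarrow> f \<in> S \<Longrightarrow> f \<circ> \<sigma> \<in> S"
  by (auto simp: tstable_def)

lemma tstable_A: "tstable A"
  unfolding tstable_def
proof (intro ballI)
  fix \<sigma> f assume s: "\<sigma> \<in> Tr" and f: "f \<in> A"
  obtain n a b where ab: "\<forall>j<(n::nat). a j \<in> A \<and> b j \<in> A" "\<forall>x y. f (m x y) = (\<Sum>j<n. a j x * b j y)"
    using comult[OF f] by blast
  consider c where "\<sigma> = (\<lambda>x. m x c)" | c where "\<sigma> = m c" using s by (auto simp: Tr_def)
  then show "f \<circ> \<sigma> \<in> A"
  proof cases
    case 1
    then have "f \<circ> \<sigma> = (\<Sum>j<n. fscale (b j c) (a j))" using ab(2) by (auto simp: mult.commute)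
    then show ?thesis using ab(1) by (auto intro!: subalg_sum[OF A] subalg_scale[OF A])
  next
    case 2
    then have "f \<circ> \<sigma> = (\<Sum>j<n. fscale (a j c) (b j))" using ab(2) by (auto simp: fun_eq_iff)
    then show ?thesis using ab(1) by (auto intro!: subalg_sum[OF A] subalg_scale[OF A])
  qed
qed

lemma one_sided_invariant:
  fixes R :: "'c \<Rightarrow> 'q \<Rightarrow> 'q"
  assumes RT: "\<And>a. R a \<in> Tr"
    and Rcomp: "\<And>a b. \<exists>c. \<forall>f\<in>A. f \<circ> R a \<circ> R b = f \<circ> R c"
    and unip: "\<And>f a. f \<in> A \<Longrightarrow> \<exists>n. ((\<lambda>h. (h \<circ> R a) - h) ^^ n) f = 0"
    and W: "fs.subspace W" "\<And>a f. f \<in> W \<Longrightarrow> f \<circ> R a \<in> W" "W \<subseteq> A"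
    and U: "fs.subspace U" "\<And>a f. f \<in> U \<Longrightarrow> f \<circ> R a \<in> U" "U \<subseteq> fs.span E" "finite E" "\<not> U \<subseteq> W" "U \<subseteq> A"
  shows "\<exists>u\<in>U. u \<notin> W \<and> (\<forall>a. (u \<circ> R a) - u \<in> W)"
proof -
  \<comment> \<open>Translations compose to translations only on \<open>A\<close>, because the laws
    of \<open>m\<close> hold only after applying functions from \<open>A\<close>. Taking all linear
    operators that agree on \<open>A\<close> with some translation gives a set closed under
    composition.\<close>
  define G where "G = {\<gamma>. fs.lin \<gamma> \<and> (\<exists>a. \<forall>f\<in>A. \<gamma> f = f \<circ> R a)}"
  have RA: "f \<circ> R a \<in> A" if "f \<in> A" for f a using tstableD[OF tstable_A RT that] .
  have "\<exists>u\<in>U. u \<notin> W \<and> (\<forall>\<gamma>\<in>G. \<gamma> u - u \<in> W)"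
  proof (rule fs.kolchin[OF _ _ W(1) _ U(1) _ U(3,4,5)])
    show "fs.lin \<gamma>" if "\<gamma> \<in> G" for \<gamma> using that by (simp add: G_def)
    show "\<gamma> \<circ> \<delta> \<in> G" if gd: "\<gamma> \<in> G" "\<delta> \<in> G" for \<gamma> \<delta>
    proof -
      obtain a b where ab: "\<forall>f\<in>A. \<gamma> f = f \<circ> R a" "\<forall>f\<in>A. \<delta> f = f \<circ> R b" using gd by (auto simp: G_def)
      obtain c where c: "\<forall>f\<in>A. f \<circ> R b \<circ> R a = f \<circ> R c" using Rcomp by blast
      have "(\<gamma> \<circ> \<delta>) f = f \<circ> R c" if "f \<in> A" for f using ab c that RA by simp
      then show ?thesis using gd fs.lin_comp by (auto simp: G_def)
    qed
    show "\<gamma> v \<in> W" if g: "\<gamma> \<in> G" and v: "v \<in> W" for \<gamma> v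
    proof -
      obtain a where "\<forall>f\<in>A. \<gamma> f = f \<circ> R a" using g by (auto simp: G_def)
      then show ?thesis using W(2)[of v a] W(3) v by auto
    qed
    show "\<gamma> v \<in> U" if g: "\<gamma> \<in> G" and v: "v \<in> U" for \<gamma> v
    proof -
      obtain a where "\<forall>f\<in>A. \<gamma> f = f \<circ> R a" using g by (auto simp: G_def)
      then show ?thesis using U(2)[of v a] U(6) v by auto
    qed
    show "\<exists>n. ((\<lambda>v. \<gamma> v - v) ^^ n) v = 0" if gv: "\<gamma> \<in> G" "v \<in> U" for \<gamma> v
    proof -
      obtain a where a: "\<forall>f\<in>A. \<gamma> f = f \<circ> R a" using gv by (auto simp: G_def)
      have v: "v \<in> A" using U(6) gv(2) by auto
      have "((\<lambda>v. \<gamma> v - v) ^^ n) v = ((\<lambda>h. (h \<circ> R a) - h) ^^ n) v \<and> ((\<lambda>h. (h \<circ> R a) - h) ^^ n) v \<in> A" for n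
      proof (rule funpow_agree[OF v])
        fix x assume x: "x \<in> A"
        show "\<gamma> x - x = (x \<circ> R a) - x" using a x by simp
        show "(x \<circ> R a) - x \<in> A" by (rule subalg_diff[OF A RA[OF x] x])
      qed
      then show ?thesis using unip[OF v, of a] by metis
    qed
  qed
  then obtain u where u: "u \<in> U" "u \<notin> W" "\<forall>\<gamma>\<in>G. \<gamma> u - u \<in> W" by blast
  have "(\<lambda>f. f \<circ> R a) \<in> G" for a
    unfolding G_def by (auto simp: fs.lin_def fun_plus_comp fscale_comp)
  then have "(u \<circ> R a) - u \<in> W" for a using bspec[OF u(3), of "\<lambda>f. f \<circ> R a"] by simp
  then show ?thesis using u by blast
qed

text \<open>Local finiteness of translations. Expanding f (m c (m x d)) by the comultiplication of
  \<open>f\<close>, and then that of its right factors, confines all two-sided translates to the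
  span of finitely many functions.\<close>

lemma translates_finite:
  assumes f: "f \<in> A"
  obtains V E where "fs.subspace V" "V \<subseteq> fs.span E" "finite E" "V \<subseteq> A" "tstable V" "f \<in> V"
    "\<And>U. fs.subspace U \<Longrightarrow> tstable U \<Longrightarrow> f \<in> U \<Longrightarrow> V \<subseteq> U"
proof -
  define T where "T = {f \<circ> m a \<circ> (\<lambda>x. m x b) | a b. True}"
  define V where "V = fs.span T"
  have TA: "T \<subseteq> A" using tstableD[OF tstable_A Tr_right tstableD[OF tstable_A Tr_left f]] by (auto simp: T_def)
  have VA: "V \<subseteq> A" unfolding V_def by (intro fs.span_minimal TA subalg_subspace A)
  obtain n a b where ab: "\<forall>j<(n::nat). a j \<in> A \<and> b j \<in> A" "\<forall>x y. f (m x y) = (\<Sum>j<n. a j x * b j y)"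
    using comult[OF f] by blast
  have "\<forall>j. \<exists>E. j < n \<longrightarrow> finite E \<and> (\<forall>c. b j \<circ> (\<lambda>x. m x c) \<in> fs.span E)"
  proof (intro allI)
    fix j
    show "\<exists>E. j < n \<longrightarrow> finite E \<and> (\<forall>c. b j \<circ> (\<lambda>x. m x c) \<in> fs.span E)"
    proof (cases "j < n")
      case True
      obtain l u v where uv: "\<forall>j<(l::nat). u j \<in> A \<and> v j \<in> A" "\<forall>x y. b j (m x y) = (\<Sum>j<l. u j x * v j y)"
        using comult[of "b j"] ab(1) True by metis
      have "b j \<circ> (\<lambda>x. m x c) = (\<Sum>i<l. fscale (v i c) (u i))" for c
        using uv(2) by (auto simp: mult.commute)
      moreover have "(\<Sum>i<l. fscale (v i c) (u i)) \<in> fs.span (u ` {..<l})" for c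
        by (intro fs.span_sum fs.span_scale fs.span_base) simp
      ultimately have "b j \<circ> (\<lambda>x. m x c) \<in> fs.span (u ` {..<l})" for c by metis
      then show ?thesis by blast
    qed simp
  qed
  from choice[OF this] obtain E where E: "\<And>j. j < n \<Longrightarrow> finite (E j)" "\<And>j c. j < n \<Longrightarrow> b j \<circ> (\<lambda>x. m x c) \<in> fs.span (E j)"
    by auto
  have "T \<subseteq> fs.span (\<Union>j<n. E j)"
  proof
    fix g assume "g \<in> T"
    then obtain c d where g: "g = f \<circ> m c \<circ> (\<lambda>x. m x d)" by (auto simp: T_def)
    have "g = (\<Sum>j<n. fscale (a j c) (b j \<circ> (\<lambda>x. m x d)))" unfolding g using ab(2) by (auto simp: fun_eq_iff)
    moreover have "b j \<circ> (\<lambda>x. m x d) \<in> fs.span (\<Union>j<n. E j)" if "j < n" for j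
      using E(2)[OF that, of d] fs.span_mono[of "E j" "\<Union>j<n. E j"] that by blast
    ultimately show "g \<in> fs.span (\<Union>j<n. E j)" by (auto intro!: fs.span_sum fs.span_scale)
  qed
  then have VE: "V \<subseteq> fs.span (\<Union>j<n. E j)" unfolding V_def by (intro fs.span_minimal) auto
  have "tstable V"
    unfolding tstable_def
  proof (intro ballI)
    fix \<sigma> g assume s: "\<sigma> \<in> Tr" and g: "g \<in> V"
    have "T \<subseteq> {h. h \<circ> \<sigma> \<in> V}"
    proof
      fix h assume "h \<in> T"
      then obtain c d where h: "h = f \<circ> m c \<circ> (\<lambda>x. m x d)" by (auto simp: T_def)
      have fc: "f \<circ> m c \<in> A" using tstableD[OF tstable_A Tr_left f] .
      consider b where "\<sigma> = (\<lambda>x. m x b)" | b where "\<sigma> = m b" using s by (auto simp: Tr_def)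
      then have "h \<circ> \<sigma> \<in> T"
      proof cases
        case 1
        have "h \<circ> \<sigma> = f \<circ> m c \<circ> (\<lambda>x. m x (m b d))"
          unfolding h 1 using assoc[OF fc] by (auto simp: fun_eq_iff)
        then show ?thesis by (auto simp: T_def)
      next
        case 2
        have "h \<circ> \<sigma> = f \<circ> m (m c b) \<circ> (\<lambda>x. m x d)"
        proof
          fix x
          have "f (m c (m (m b x) d)) = f (m c (m b (m x d)))" using assoc[OF fc] by simp
          then show "(h \<circ> \<sigma>) x = (f \<circ> m (m c b) \<circ> (\<lambda>x. m x d)) x"
            unfolding h 2 by (simp add: assoc[OF f])
        qed
        then show ?thesis by (auto simp: T_def)
      qed
      then show "h \<in> {h. h \<circ> \<sigma> \<in> V}" by (simp add: V_def fs.span_base)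
    qed
    moreover have "fs.subspace {h. h \<circ> \<sigma> \<in> V}"
      using fs.subspace_lin_vimage[of "\<lambda>h. h \<circ> \<sigma>" V]
      by (simp add: fs.lin_def fun_plus_comp fscale_comp V_def)
    ultimately have "V \<subseteq> {h. h \<circ> \<sigma> \<in> V}" unfolding V_def by (intro fs.span_minimal) auto
    then show "g \<circ> \<sigma> \<in> V" using g by auto
  qed
  moreover have "f \<in> V"
  proof -
    have "f \<circ> m e \<circ> (\<lambda>x. m x e) = f"
      using left_unit[OF f] right_unit[OF f] by (auto simp: fun_eq_iff)
    moreover have "f \<circ> m e \<circ> (\<lambda>x. m x e) \<in> T" unfolding T_def by blast
    ultimately have "f \<in> T" by simp
    then show ?thesis by (simp add: V_def fs.span_base)
  qed
  moreover have "V \<subseteq> U" if "fs.subspace U" "tstable U" "f \<in> U" for U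
    unfolding V_def using that tstableD Tr_left Tr_right
    by (intro fs.span_minimal) (auto simp: T_def)
  moreover have "fs.subspace V" "finite (\<Union>j<n. E j)" using E(1) by (auto simp: V_def)
  ultimately show thesis using that VE VA by blast
qed

text \<open>Unipotence is available for right and for left translations separately, so Kolchin's
  theorem is applied twice. The vectors that are right invariant modulo \<open>W\<close> form a
  space stable under left translations, since the two kinds commute, and the second application
  takes place there.\<close>

lemma invariant_exists:
  assumes W: "fs.subspace W" "tstable W" "W \<subseteq> A" and U: "fs.subspace U" "tstable U" "U \<subseteq> A" "\<not> U \<subseteq> W"
  shows "\<exists>f\<in>U. f \<notin> W \<and> (\<forall>\<sigma>\<in>Tr. (f \<circ> \<sigma>) - f \<in> W)"
proof -
  obtain f0 where f0: "f0 \<in> U" "f0 \<notin> W" using U(4) by blast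
  then have f0A: "f0 \<in> A" using U(3) by blast
  obtain V E where V: "fs.subspace V" "V \<subseteq> fs.span E" "finite E" "V \<subseteq> A" "tstable V" "f0 \<in> V" "V \<subseteq> U"
    using translates_finite[OF f0A] U(1,2) f0(1) by metis
  have st: "f \<circ> \<sigma> \<in> S" if "tstable S" "f \<in> S" "\<sigma> \<in> Tr" for f S \<sigma> using tstableD that by blast
  let ?R = "\<lambda>a x. m x a"
  define V1 where "V1 = {v \<in> V. \<forall>a. (v \<circ> ?R a) - v \<in> W}"
  have "\<exists>u\<in>V. u \<notin> W \<and> (\<forall>a. (u \<circ> ?R a) - u \<in> W)"
  proof (rule one_sided_invariant[where R = ?R, OF Tr_right _ unipotent_right W(1) _ W(3) V(1) _ V(2,3) _ V(4)])
    show "\<exists>c. \<forall>f\<in>A. f \<circ> ?R a \<circ> ?R b = f \<circ> ?R c" for a b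
      using assoc by (intro exI[of _ "m b a"]) (auto simp: fun_eq_iff)
  qed (use st W V f0 Tr_right in auto)
  then have V1W: "\<not> V1 \<subseteq> W" by (auto simp: V1_def)
  have "fs.subspace V1"
  proof -
    have "V1 = V \<inter> (\<Inter>a. {v. (v \<circ> ?R a) - v \<in> W})" by (auto simp: V1_def)
    moreover have "fs.subspace {v. (v \<circ> ?R a) - v \<in> W}" for a
      by (rule fs.subspace_lin_vimage[OF _ W(1)]) (auto simp: fs.lin_def fun_eq_iff algebra_simps)
    ultimately show ?thesis using V(1) fs.subspace_inter[of V] fs.subspace_Int[of UNIV "\<lambda>a. {v. (v \<circ> ?R a) - v \<in> W}"] by simp
  qed
  moreover have "v \<circ> m c \<in> V1" if v: "v \<in> V1" for c v
  proof -
    have vA: "v \<in> A" using v V(4) by (auto simp: V1_def)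
    have "(v \<circ> m c \<circ> ?R a) - (v \<circ> m c) = ((v \<circ> ?R a) - v) \<circ> m c" for a
      using assoc[OF vA] by (auto simp: fun_eq_iff)
    moreover have "((v \<circ> ?R a) - v) \<circ> m c \<in> W" for a using v st[OF W(2) _ Tr_left] by (auto simp: V1_def)
    ultimately show ?thesis using v st[OF V(5) _ Tr_left] by (auto simp: V1_def)
  qed
  moreover have V1A: "V1 \<subseteq> A" "V1 \<subseteq> fs.span E" using V by (auto simp: V1_def)
  ultimately have "\<exists>u\<in>V1. u \<notin> W \<and> (\<forall>a. (u \<circ> m a) - u \<in> W)"
  proof (intro one_sided_invariant[where R = m, OF Tr_left _ unipotent_left W(1) _ W(3) _ _ _ V(3) V1W])
    show "\<exists>c. \<forall>f\<in>A. f \<circ> m a \<circ> m b = f \<circ> m c" for a b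
    proof (intro exI[of _ "m a b"] ballI ext)
      fix f x assume "f \<in> A"
      from assoc[OF this, of a b x] show "(f \<circ> m a \<circ> m b) x = (f \<circ> m (m a b)) x" by simp
    qed
  qed (use st W Tr_left in auto)
  then obtain u where u: "u \<in> V1" "u \<notin> W" "\<forall>a. (u \<circ> m a) - u \<in> W" by blast
  have "(u \<circ> \<sigma>) - u \<in> W" if "\<sigma> \<in> Tr" for \<sigma> using that u by (auto simp: Tr_def V1_def)
  then show ?thesis using u V(7) by (intro bexI[of _ u]) (auto simp: V1_def)
qed

end

section \<open>Invariants modulo a translation stable subalgebra, and the shape of their
  relations\<close>

context unipotent_algebra
begin

abbreviation (input) R :: "'q \<Rightarrow> 'q \<Rightarrow> 'q" where "R a \<equiv> (\<lambda>x. m x a)"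

definition tsub :: "('q \<Rightarrow> 'k) set \<Rightarrow> bool" where
  "tsub S \<longleftrightarrow> subalg S \<and> tstable S \<and> S \<subseteq> A"

definition invs :: "('q \<Rightarrow> 'k) set \<Rightarrow> ('q \<Rightarrow> 'k) set" where
  "invs S = {f \<in> A. \<forall>\<sigma>\<in>Tr. (f \<circ> \<sigma>) - f \<in> S}"

lemma tsubD: assumes "tsub S" shows "subalg S" "tstable S" "S \<subseteq> A" "fs.subspace S"
  using assms subalg_subspace by (auto simp: tsub_def)

lemma invsD: "f \<in> invs S \<Longrightarrow> \<sigma> \<in> Tr \<Longrightarrow> (f \<circ> \<sigma>) - f \<in> S" and invs_A: "f \<in> invs S \<Longrightarrow> f \<in> A"
  by (auto simp: invs_def)

lemma invsI: "f \<in> A \<Longrightarrow> (\<And>\<sigma>. \<sigma> \<in> Tr \<Longrightarrow> (f \<circ> \<sigma>) - f \<in> S) \<Longrightarrow> f \<in> invs S"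
  by (auto simp: invs_def)

lemma invs_mono: "S \<subseteq> T \<Longrightarrow> invs S \<subseteq> invs T"
  by (auto simp: invs_def)

lemma invs_superset: assumes "tsub S" shows "S \<subseteq> invs S"
proof
  fix f assume f: "f \<in> S"
  show "f \<in> invs S"
  proof (rule invsI)
    show "f \<in> A" using f tsubD[OF assms] by blast
    show "(f \<circ> \<sigma>) - f \<in> S" if "\<sigma> \<in> Tr" for \<sigma>
      by (rule subalg_diff[OF tsubD(1)[OF assms] tstableD[OF tsubD(2)[OF assms] that f] f])
  qed
qed

lemma subspace_invs: assumes "fs.subspace S" shows "fs.subspace (invs S)"
proof (rule fs.subspaceI)
  show "0 \<in> invs S"
  proof (rule invsI)
    fix \<sigma> :: "'q \<Rightarrow> 'q"
    have "((0 :: 'q \<Rightarrow> 'k) \<circ> \<sigma>) - 0 = 0" by (auto simp: fun_eq_iff)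
    then show "((0 :: 'q \<Rightarrow> 'k) \<circ> \<sigma>) - 0 \<in> S" using fs.subspace_0[OF assms] by simp
  qed (rule subalg_0[OF A])
next
  fix f g assume fg: "f \<in> invs S" "g \<in> invs S"
  show "f + g \<in> invs S"
  proof (rule invsI)
    show "f + g \<in> A" using fg subalg_add[OF A] by (auto dest: invs_A)
    fix \<sigma> assume s: "\<sigma> \<in> Tr"
    have "((f + g) \<circ> \<sigma>) - (f + g) = ((f \<circ> \<sigma>) - f) + ((g \<circ> \<sigma>) - g)" by (auto simp: fun_eq_iff algebra_simps)
    then show "((f + g) \<circ> \<sigma>) - (f + g) \<in> S"
      using fs.subspace_add[OF assms invsD[OF fg(1) s] invsD[OF fg(2) s]] by (simp only:)
  qed
next
  fix c f assume f: "f \<in> invs S"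
  show "fscale c f \<in> invs S"
  proof (rule invsI)
    show "fscale c f \<in> A" using f subalg_scale[OF A] by (auto dest: invs_A)
    fix \<sigma> assume s: "\<sigma> \<in> Tr"
    have "(fscale c f \<circ> \<sigma>) - fscale c f = fscale c ((f \<circ> \<sigma>) - f)" by (auto simp: fun_eq_iff algebra_simps)
    then show "(fscale c f \<circ> \<sigma>) - fscale c f \<in> S"
      using fs.subspace_scale[OF assms invsD[OF f s]] by (simp only:)
  qed
qed

lemma right_invariant_const:
  assumes "f \<in> A" "\<And>a. f \<circ> R a = f"
  shows "\<exists>c. f = cst c"
proof (intro exI[of _ "f e"] ext)
  fix a
  have "f a = f (m e a)" using left_unit[OF assms(1)] by simp
  also have "\<dots> = (f \<circ> R a) e" by simp
  finally show "f a = cst (f e) a" by (simp add: assms(2))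
qed

lemma adj_tsub:
  assumes "tsub S" "y \<in> invs S" shows "tsub (adj S y)"
proof -
  note S = tsubD[OF assms(1)]
  have sub: "subalg (adj S y)" by (rule subalg_adj[OF S(1)])
  moreover have "adj S y \<subseteq> A" using adj_minimal[OF A S(3)] invs_A[OF assms(2)] by blast
  moreover have "tstable (adj S y)"
    unfolding tstable_def
  proof (intro ballI)
    fix \<sigma> f assume s: "\<sigma> \<in> Tr" and "f \<in> adj S y"
    then obtain p where p: "coeffs_in S p" "f = poly p y" by (auto simp: adj_def)
    have "y + ((y \<circ> \<sigma>) - y) \<in> adj S y"
      using invsD[OF assms(2) s] adj_base[OF S(1)] adj_self[OF S(1)] subalg_add[OF sub] by blast
    then have "y \<circ> \<sigma> \<in> adj S y" by simp
    moreover have "coeffs_in (adj S y) (map_poly (\<lambda>a. a \<circ> \<sigma>) p)"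
      using p(1) tstableD[OF S(2) s] adj_base[OF S(1)] by (auto simp: coeffs_in_def)
    ultimately show "f \<circ> \<sigma> \<in> adj S y" unfolding p(2) poly_comp by (intro poly_in[OF sub])
  qed
  ultimately show ?thesis by (simp add: tsub_def)
qed

text \<open>A nonzero stable space contains a nonzero function invariant under all translations, and
  such a function is constant. Applied to spaces of leading coefficients, this produces monic
  relations although the coefficients are functions.\<close>

lemma tstable_contains_constant:
  assumes "fs.subspace I" "tstable I" "I \<subseteq> A" "f \<in> I" "f \<noteq> 0"
  shows "1 \<in> I"
proof -
  have W: "fs.subspace {0 :: 'q \<Rightarrow> 'k}" "tstable {0}" "{0} \<subseteq> A"
    using subalg_0[OF A] by (auto simp: tstable_def)
  have "\<not> I \<subseteq> {0}" using assms(4,5) by auto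
  then obtain g where g: "g \<in> I" "g \<noteq> 0" "\<forall>\<sigma>\<in>Tr. (g \<circ> \<sigma>) - g = 0"
    using invariant_exists[OF W assms(1,2,3)] by auto
  have "g \<circ> R a = g" for a using g(3) Tr_right by auto
  then obtain c where c: "g = cst c" using right_invariant_const g(1) assms(3) by blast
  then have "c \<noteq> 0" using g(2) by auto
  then have "1 = fscale (inverse c) g" unfolding c by (auto simp: fun_eq_iff)
  then show ?thesis using fs.subspace_scale[OF assms(1) g(1)] by metis
qed

text \<open>The polynomial that represents the translate of p(y). As \<open>y\<close> changes by an
  element of \<open>S\<close>, the coefficients stay in \<open>S\<close>, the degree does not grow
  and the top coefficient is merely translated.\<close>

definition shift :: "('q \<Rightarrow> 'q) \<Rightarrow> ('q \<Rightarrow> 'k) \<Rightarrow> ('q \<Rightarrow> 'k) poly \<Rightarrow> ('q \<Rightarrow> 'k) poly" where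
  "shift \<sigma> y p = pcompose (map_poly (\<lambda>a. a \<circ> \<sigma>) p) [:(y \<circ> \<sigma>) - y, 1:]"

lemma poly_shift: "poly (shift \<sigma> y p) y = poly p y \<circ> \<sigma>"
  by (simp add: shift_def poly_pcompose poly_comp)

lemma coeff_shift:
  assumes "degree p \<le> n"
  shows "coeff (shift \<sigma> y p) j
    = (\<Sum>l\<le>n. of_nat (l choose j) * (coeff p l \<circ> \<sigma>) * ((y \<circ> \<sigma>) - y) ^ (l - j))"
proof -
  have "degree (map_poly (\<lambda>a. a \<circ> \<sigma>) p) \<le> n"
    by (rule degree_le) (use assms in \<open>auto simp: coeff_eq_0\<close>)
  then show ?thesis unfolding shift_def by (subst coeff_pcompose_shift) auto
qed

lemma degree_shift: "degree p \<le> n \<Longrightarrow> degree (shift \<sigma> y p) \<le> n"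
  by (rule degree_le) (auto simp: coeff_shift binomial_eq_0)

lemma coeff_shift_top:
  assumes "degree p \<le> n" shows "coeff (shift \<sigma> y p) n = coeff p n \<circ> \<sigma>"
proof -
  have "coeff (shift \<sigma> y p) n
    = (\<Sum>l\<in>{n}. of_nat (l choose n) * (coeff p l \<circ> \<sigma>) * ((y \<circ> \<sigma>) - y) ^ (l - n))"
    unfolding coeff_shift[OF assms] by (rule sum.mono_neutral_right) (auto simp: binomial_eq_0)
  then show ?thesis by simp
qed

lemma coeffs_in_shift:
  assumes "tsub S" "y \<in> invs S" "\<sigma> \<in> Tr" "coeffs_in S p"
  shows "coeffs_in S (shift \<sigma> y p)"
  unfolding shift_def
proof (rule coeffs_in_pcompose_shift)
  show "subalg S" by (rule tsubD[OF assms(1)])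
  show "coeffs_in S (map_poly (\<lambda>a. a \<circ> \<sigma>) p)"
    using assms(4) tstableD[OF tsubD(2)[OF assms(1)] assms(3)] by (auto simp: coeffs_in_def)
  show "(y \<circ> \<sigma>) - y \<in> S" by (rule invsD[OF assms(2,3)])
qed

text \<open>
  The leading coefficients of the relations of minimal degree form a translation stable space,
  which contains \<open>1\<close> by Kolchin's theorem.
\<close>

lemma monic_relation:
  assumes S: "tsub S" and y: "y \<in> invs S" and alg: "\<not> transc S y"
  shows "\<exists>p. coeffs_in S p \<and> lead_coeff p = 1 \<and> degree p > 0 \<and> poly p y = 0 \<and> free_below S y (degree p)"
proof -
  note S' = tsubD[OF S]
  define P where "P p \<longleftrightarrow> coeffs_in S p \<and> poly p y = 0 \<and> p \<noteq> 0" for p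
  obtain q where "P q" using alg by (auto simp: transc_def P_def)
  then obtain p0 where p0: "P p0" "\<And>p. P p \<Longrightarrow> degree p0 \<le> degree p"
    using ex_has_least_nat[of P q degree] by blast
  define n where "n = degree p0"
  have free: "free_below S y n"
    unfolding free_below_def using p0(2) by (force simp: P_def n_def)
  define I where "I = {a. \<exists>p. coeffs_in S p \<and> degree p \<le> n \<and> coeff p n = a \<and> poly p y = 0}"
  have "fs.subspace I"
  proof (rule fs.subspaceI)
    show "0 \<in> I" using coeffs_in_0[OF S'(1)] by (auto simp: I_def intro!: exI[of _ 0])
  next
    fix a b assume "a \<in> I" "b \<in> I"
    then obtain p q where "coeffs_in S p" "degree p \<le> n" "coeff p n = a" "poly p y = 0"
      "coeffs_in S q" "degree q \<le> n" "coeff q n = b" "poly q y = 0" by (auto simp: I_def)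
    then show "a + b \<in> I" unfolding I_def
      using coeffs_in_add[OF S'(1), of p q] degree_add_le[of p n q] by (auto intro!: exI[of _ "p + q"])
  next
    fix c a assume "a \<in> I"
    then obtain p where "coeffs_in S p" "degree p \<le> n" "coeff p n = a" "poly p y = 0" by (auto simp: I_def)
    then show "fscale c a \<in> I" unfolding I_def
      using coeffs_in_smult[OF S'(1) subalg_cst[OF S'(1), of c], of p] degree_smult_le[of "cst c" p]
      by (auto intro!: exI[of _ "Polynomial.smult (cst c) p"] simp: fscale_altdef)
  qed
  moreover have "tstable I"
    unfolding tstable_def
  proof (intro ballI)
    fix \<sigma> a assume s: "\<sigma> \<in> Tr" and "a \<in> I"
    then obtain p where p: "coeffs_in S p" "degree p \<le> n" "coeff p n = a" "poly p y = 0" by (auto simp: I_def)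
    have "poly (shift \<sigma> y p) y = 0" by (auto simp: poly_shift p(4) fun_eq_iff)
    then show "a \<circ> \<sigma> \<in> I" unfolding I_def
      using coeffs_in_shift[OF S y s p(1)] degree_shift[OF p(2)] coeff_shift_top[OF p(2)] p(3)
      by (auto intro!: exI[of _ "shift \<sigma> y p"])
  qed
  moreover have "I \<subseteq> A" using S'(3) by (auto simp: I_def coeffs_in_def)
  moreover have "lead_coeff p0 \<in> I" "lead_coeff p0 \<noteq> 0"
    using p0(1) by (auto simp: I_def P_def n_def)
  ultimately have "1 \<in> I" by (rule tstable_contains_constant)
  then obtain p where p: "coeffs_in S p" "degree p \<le> n" "coeff p n = 1" "poly p y = 0" by (auto simp: I_def)
  have deg: "degree p = n" using p(2,3) le_degree[of p n] by simp
  have "n > 0"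
  proof (rule ccontr)
    assume "\<not> n > 0"
    then have "degree p = 0" using deg by simp
    then obtain a where "p = [:a:]" by (rule degree_eq_zeroE)
    then show False using p(3,4) \<open>\<not> n > 0\<close> by simp
  qed
  then show ?thesis using p deg free by auto
qed

text \<open>Translating p(y) and comparing coefficients expresses the change of the j-th coefficient
  through the higher ones. Going down in \<open>j\<close>, the higher coefficients are already
  constant and the change is an additive polynomial D in the increment of \<open>y\<close>. Then
  D(y) plus the j-th coefficient is right invariant, hence constant, which is a relation of degree
  below \<open>n\<close> and must be trivial. The lemma serves both relations of least degree and
  transcendental \<open>y\<close>.\<close>

lemma influence:
  assumes S: "tsub S" and y: "y \<in> invs S" and free: "free_below S y n" and n: "n > 0"
    and p: "coeffs_in S p" "degree p \<le> n" "coeff p n = cst c"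
    and inv: "\<And>a. (poly p y \<circ> R a) - poly p y \<in> S"
    and l: "l > 0"
  shows "(\<exists>c. coeff p l = cst c) \<and> (coeff p l \<noteq> 0 \<longrightarrow> addexp TYPE('k) l)"
proof -
  note S' = tsubD[OF S]
  let ?r = "coeff p" and ?c = "\<lambda>a. (y \<circ> R a) - y"
  have E: "(\<Sum>l\<le>n. of_nat (l choose j) * (?r l \<circ> R a) * ?c a ^ (l - j)) = ?r j" if j: "j > 0" for a j
  proof -
    let ?d = "(poly p y \<circ> R a) - poly p y"
    \<comment> \<open>A relation for \<open>y\<close> whose degree is below \<open>n\<close>: the
      coefficients at \<open>n\<close> cancel because the top coefficient of \<open>p\<close> is
      constant.\<close>
    define B where "B = shift (R a) y p - p - [:?d:]"
    have "coeffs_in S B" unfolding B_def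
      by (intro coeffs_in_diff coeffs_in_const coeffs_in_shift S S' y Tr_right p inv)
    moreover have "poly B y = 0" by (simp add: B_def poly_shift)
    moreover have "degree B < n"
    proof -
      have "degree B \<le> n" unfolding B_def
        by (intro degree_diff_le degree_shift p) simp
      moreover have "coeff [:?d:] n = 0" using n by (cases n) auto
      then have "coeff B n = 0" by (simp add: B_def coeff_shift_top[OF p(2)] p(3))
      then have "degree B \<noteq> n" using n by (metis leading_coeff_0_iff degree_0 less_irrefl)
      ultimately show ?thesis by simp
    qed
    ultimately have "B = 0" using free by (auto simp: free_below_def)
    moreover have "shift (R a) y p = B + p + [:?d:]" by (simp add: B_def)
    ultimately have "coeff (shift (R a) y p) j = ?r j + coeff [:?d:] j" by simp
    moreover have "coeff [:?d:] j = 0" using j by (cases j) auto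
    ultimately show ?thesis using coeff_shift[OF p(2), of "R a" y j] by simp
  qed
  \<comment> \<open>The invariant of the downward induction: from index \<open>j\<close> on, the
    coefficients are constant, and those binomial coefficients vanish against them whose lower index
    is at least \<open>j\<close>. The target is \<open>Q 1\<close>, which says that only additive
    exponents occur.\<close>
  define Q where "Q j \<longleftrightarrow> (\<forall>l\<ge>j. \<exists>c. ?r l = cst c) \<and> (\<forall>j'\<ge>j. \<forall>l>j'. of_nat (l choose j') * ?r l = 0)" for j
  have "Q (n - k)" if "k < n" for k
    using that
  proof (induction k)
    case 0
    have "?r l = 0" if "l > n" for l using that p(2) by (simp add: coeff_eq_0)
    then have "\<exists>c. ?r l = cst c" if "l \<ge> n" for l
      using that p(3) cst_0 by (cases "l = n") (auto intro: exI[of _ 0] simp: cst_0)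
    then show ?case using \<open>\<And>l. l > n \<Longrightarrow> ?r l = 0\<close> by (auto simp: Q_def)
  next
    case (Suc k)
    define j where "j = n - Suc k"
    have j: "j > 0" "j < n" "n - k = Suc j" using Suc.prems by (auto simp: j_def)
    have Qj: "Q (Suc j)" using Suc j(3) by simp
    define \<rho> where "\<rho> l = ?r l e" for l
    have \<rho>: "?r l = cst (\<rho> l)" if l: "l > j" for l
    proof -
      obtain c where "?r l = cst c" using Qj l by (auto simp: Q_def Suc_le_eq)
      then show ?thesis by (simp add: \<rho>_def)
    qed
    have z: "of_nat (l choose j') * \<rho> l = 0" if "j' > j" "l > j'" for j' l
    proof -
      have "(of_nat (l choose j') * ?r l) e = 0" using Qj that by (auto simp: Q_def Suc_le_eq)
      then show ?thesis by (simp add: \<rho>_def)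
    qed
    define D where "D = (\<Sum>l\<in>{j<..n}. monom (of_nat (l choose j) * \<rho> l) (l - j))"
    have cD: "coeff D i = (if 0 < i \<and> i \<le> n - j then of_nat ((i + j) choose j) * \<rho> (i + j) else 0)" for i
    proof -
      have "coeff D i = (\<Sum>l\<in>{j<..n}. if l - j = i then of_nat (l choose j) * \<rho> l else 0)"
        by (simp add: D_def coeff_sum)
      also have "\<dots> = (\<Sum>l\<in>{j<..n}. if l = i + j \<and> 0 < i then of_nat (l choose j) * \<rho> l else 0)"
        by (intro sum.cong) auto
      also have "\<dots> = (if 0 < i \<and> i \<le> n - j then of_nat ((i + j) choose j) * \<rho> (i + j) else 0)"
        using j by (cases "0 < i") (auto simp: sum.delta)
      finally show ?thesis .
    qed
    have D: "additive_poly D"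
      unfolding additive_poly_def addexp_def
    proof (intro allI impI conjI)
      fix i assume "coeff D i \<noteq> 0"
      then have i: "0 < i" "i \<le> n - j" and nz: "of_nat ((i + j) choose j) * \<rho> (i + j) \<noteq> 0"
        by (auto simp: cD split: if_splits)
      show "0 < i" by fact
      fix i' assume i': "0 < i'" "i' < i"
      \<comment> \<open>This product identity carries the vanishing known for lower indices above
        \<open>j\<close> over to the binomial coefficients of the exponents of \<open>D\<close>,
        which makes \<open>D\<close> additive.\<close>
      have "((i + j) choose (j + i')) * ((j + i') choose j) = ((i + j) choose j) * (i choose i')"
        using choose_mult[of j "j + i'" "i + j"] i' by simp
      then have "of_nat ((i + j) choose (j + i')) * of_nat ((j + i') choose j) * \<rho> (i + j)
        = of_nat (i choose i') * (of_nat ((i + j) choose j) * \<rho> (i + j))"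
        by (metis (no_types, lifting) mult.assoc mult.commute of_nat_mult)
      moreover have "of_nat ((i + j) choose (j + i')) * \<rho> (i + j) = 0" using z i' by simp
      ultimately have "of_nat (i choose i') * (of_nat ((i + j) choose j) * \<rho> (i + j)) = 0"
        by (metis mult.assoc mult.commute mult_zero_right)
      then show "(of_nat (i choose i') :: 'k) = 0" using nz by simp
    qed
    have Ej: "(?r j \<circ> R a) + pev D (?c a) = ?r j" for a
    proof -
      have "pev D (?c a) = (\<Sum>l\<in>{j<..n}. of_nat (l choose j) * (?r l \<circ> R a) * ?c a ^ (l - j))"
        by (auto simp: fun_eq_iff D_def poly_sum poly_monom \<rho> intro!: sum.cong)
      then have "(?r j \<circ> R a) + pev D (?c a)
        = (\<Sum>l\<in>insert j {j<..n}. of_nat (l choose j) * (?r l \<circ> R a) * ?c a ^ (l - j))"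
        by simp
      also have "\<dots> = (\<Sum>l\<le>n. of_nat (l choose j) * (?r l \<circ> R a) * ?c a ^ (l - j))"
        using j by (intro sum.mono_neutral_left) (auto simp: binomial_eq_0)
      finally show ?thesis using E[OF j(1)] by simp
    qed
    let ?u = "pev D y + ?r j"
    have rA: "?r j \<in> S" using p(1) by (simp add: coeffs_in_def)
    have uA: "?u \<in> A" using rA S'(3) by (intro subalg_add[OF A] pev_in[OF A] invs_A[OF y]) auto
    have "?u \<circ> R a = ?u" for a
    proof -
      have "?u \<circ> R a = pev D (y + ?c a) + (?r j \<circ> R a)" by (auto simp: fun_eq_iff)
      also have "\<dots> = pev D y + ((?r j \<circ> R a) + pev D (?c a))" by (simp only: pev_additive[OF D] add_ac)
      finally show ?thesis by (simp only: Ej)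
    qed
    then obtain \<kappa> where \<kappa>: "?u = cst \<kappa>" using right_invariant_const[OF uA] by blast
    define G where "G = map_poly cst D + [:?r j - cst \<kappa>:]"
    have "coeffs_in S G" unfolding G_def
      using rA by (intro coeffs_in_add coeffs_in_map_poly_cst coeffs_in_const subalg_diff subalg_cst S')
    moreover have "poly G y = 0" using \<kappa> by (simp add: G_def pev_conv_poly[symmetric] algebra_simps)
    moreover have "degree D \<le> n - j" by (rule degree_le) (auto simp: cD)
    then have "degree G \<le> n - j" unfolding G_def by (intro degree_add_le) auto
    then have "degree G < n" using j by simp
    ultimately have G0: "G = 0" using free by (auto simp: free_below_def)
    have D0: "coeff D i = 0" if "i > 0" for i
    proof -
      have "coeff G i = cst (coeff D i)" using that by (cases i) (auto simp: G_def)
      then show ?thesis by (simp add: G0)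
    qed
    have "coeff G 0 = cst (coeff D 0) + (?r j - cst \<kappa>)" by (simp add: G_def)
    then have rj: "?r j = cst \<kappa>" by (simp add: G0 cD cst_0)
    have "of_nat (l choose j) * ?r l = 0" if "l > j" for l
    proof (cases "l \<le> n")
      case True
      define i where "i = l - j"
      have i: "l = i + j" "0 < i" "i \<le> n - j" using True that by (auto simp: i_def)
      then have "of_nat (l choose j) * \<rho> l = 0" using D0[OF i(2)] unfolding i(1) cD by simp
      then show ?thesis by (auto simp: fun_eq_iff \<rho>[OF that])
    next
      case False
      then show ?thesis using p(2) by (simp add: coeff_eq_0)
    qed
    moreover have "\<exists>c. ?r l = cst c" if "l \<ge> j" for l
      using that rj \<rho>[of l] by (cases "l = j") auto
    moreover have "of_nat (l choose j') * ?r l = 0" if "j' > j" "l > j'" for j' l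
      using Qj that by (simp add: Q_def Suc_le_eq)
    ultimately show ?case unfolding j_def[symmetric] Q_def
      using le_neq_implies_less by blast
  qed
  from this[of "n - 1"] have Q1: "Q 1" using n by simp
  moreover have "1 \<le> l" using l by simp
  ultimately obtain c where c: "?r l = cst c" unfolding Q_def by blast
  have "addexp TYPE('k) l" if nz: "?r l \<noteq> 0"
    unfolding addexp_def
  proof (intro conjI allI impI l)
    fix j assume j: "0 < j" "j < l"
    then have "of_nat (l choose j) * ?r l = 0" using Q1 by (auto simp: Q_def Suc_le_eq)
    then have "(of_nat (l choose j) * ?r l) e = 0" by simp
    then show "(of_nat (l choose j) :: 'k) = 0" using c nz by auto
  qed
  then show ?thesis using c by blast
qed

lemma additive_poly_of_coeffs:
  fixes p :: "('q \<Rightarrow> 'k) poly"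
  assumes "\<And>l. l > 0 \<Longrightarrow> (\<exists>c. coeff p l = cst c) \<and> (coeff p l \<noteq> 0 \<longrightarrow> addexp TYPE('k) l)"
  shows "\<exists>P. additive_poly P \<and> poly p y = coeff p 0 + pev P y \<and> (\<forall>l>0. coeff P l = coeff p l e)"
proof -
  define n where "n = degree p"
  define P where "P = (\<Sum>l\<in>{0<..n}. monom (coeff p l e) l)"
  have cP: "coeff P i = (if 0 < i \<and> i \<le> n then coeff p i e else 0)" for i
    by (auto simp: P_def coeff_sum)
  have cst: "coeff p l = cst (coeff p l e)" if "l > 0" for l using assms[OF that] by auto
  have "additive_poly P" unfolding additive_poly_def
  proof (intro allI impI)
    fix l assume "coeff P l \<noteq> 0"
    then have "l > 0" "coeff p l \<noteq> 0" by (auto simp: cP split: if_splits)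
    then show "addexp TYPE('k) l" using assms by blast
  qed
  moreover have "poly p y = coeff p 0 + pev P y"
  proof -
    have "poly p y = (\<Sum>l\<in>insert 0 {0<..n}. coeff p l * y ^ l)"
      unfolding poly_altdef n_def by (rule sum.cong) auto
    also have "\<dots> = coeff p 0 + (\<Sum>l\<in>{0<..n}. coeff p l * y ^ l)" by simp
    also have "(\<Sum>l\<in>{0<..n}. coeff p l * y ^ l) = pev P y"
    proof
      fix x
      have "coeff p l x = coeff p l e" if "l > 0" for l using fun_cong[OF cst[OF that], of x] by simp
      then show "(\<Sum>l\<in>{0<..n}. coeff p l * y ^ l) x = pev P y x"
        by (auto simp: P_def poly_sum poly_monom intro!: sum.cong)
    qed
    finally show ?thesis .
  qed
  moreover have "coeff P l = coeff p l e" if "l > 0" for l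
    using that by (auto simp: cP n_def coeff_eq_0)
  ultimately show ?thesis by blast
qed

lemma algebraic_additive:
  assumes S: "tsub S" and y: "y \<in> invs S" and alg: "\<not> transc S y"
  shows "\<exists>P. lead_coeff P = 1 \<and> degree P > 0 \<and> additive_poly P \<and> pev P y \<in> S \<and> free_below S y (degree P)"
proof -
  note S' = tsubD[OF S]
  obtain p where p: "coeffs_in S p" "lead_coeff p = 1" "degree p > 0" "poly p y = 0" "free_below S y (degree p)"
    using monic_relation[OF S y alg] by blast
  have inv: "(poly p y \<circ> R a) - poly p y \<in> S" for a
  proof -
    have "(poly p y \<circ> R a) - poly p y = 0" unfolding p(4) by (simp add: fun_eq_iff)
    then show ?thesis using subalg_0[OF S'(1)] by simp
  qed
  have c: "coeff p (degree p) = cst 1" using p(2) by (simp add: cst_1)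
  obtain P where P: "additive_poly P" "poly p y = coeff p 0 + pev P y" "\<forall>l>0. coeff P l = coeff p l e"
    using additive_poly_of_coeffs[OF influence[OF S y p(5,3,1) order_refl c inv]] by blast
  have deg: "degree P = degree p"
  proof (rule antisym)
    show "degree P \<le> degree p"
      by (rule degree_le) (use P(3) p(3) in \<open>auto simp: coeff_eq_0\<close>)
    show "degree p \<le> degree P" by (rule le_degree) (use P(3) p(2,3) in auto)
  qed
  moreover have "lead_coeff P = 1" using P(3) p(2,3) by (simp add: deg)
  moreover have "pev P y = - coeff p 0" using p(4) P(2) by (simp add: add_eq_0_iff2)
  then have "pev P y \<in> S" using p(1) subalg_uminus[OF S'(1)] by (simp add: coeffs_in_def)
  ultimately show ?thesis using p(3,5) P(1) by (intro exI[of _ P]) auto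
qed

lemma transc_additive_part:
  assumes S: "tsub S" and y: "y \<in> invs S" and tr: "transc S y" and p: "coeffs_in S p"
    and inv: "\<And>a. (poly p y \<circ> R a) - poly p y \<in> S"
  shows "\<exists>P. additive_poly P \<and> poly p y - pev P y \<in> S"
proof (cases "degree p = 0")
  case True
  then obtain a where "p = [:a:]" by (rule degree_eq_zeroE)
  then have "poly p y \<in> S" using p by (auto simp: coeffs_in_def coeff_pCons split: nat.splits)
  then show ?thesis by (intro exI[of _ 0]) auto
next
  case False
  note S' = tsubD[OF S]
  define n where "n = degree p"
  have n: "n > 0" using False by (simp add: n_def)
  \<comment> \<open>Transcendence makes the comparison of coefficients valid in the top degree too,
    so the top coefficient is right invariant and therefore constant, as \<open>influence\<close>
    demands.\<close>
  have "coeff p n \<circ> R a = coeff p n" for a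
  proof -
    let ?d = "(poly p y \<circ> R a) - poly p y"
    define B where "B = shift (R a) y p - p - [:?d:]"
    have "coeffs_in S B" unfolding B_def
      by (intro coeffs_in_diff coeffs_in_const coeffs_in_shift S S' y Tr_right p inv)
    moreover have "poly B y = 0" by (simp add: B_def poly_shift)
    ultimately have "B = 0" using tr by (auto simp: transc_def)
    moreover have "shift (R a) y p = B + p + [:?d:]" by (simp add: B_def)
    ultimately have "coeff (shift (R a) y p) n = coeff p n + coeff [:?d:] n" by simp
    moreover have "coeff [:?d:] n = 0" using n by (cases n) auto
    ultimately show ?thesis by (simp add: coeff_shift_top n_def)
  qed
  moreover have "coeff p n \<in> A" using p S'(3) by (auto simp: coeffs_in_def)
  ultimately obtain c where c: "coeff p n = cst c" using right_invariant_const by blast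
  obtain P where P: "additive_poly P" "poly p y = coeff p 0 + pev P y"
    using additive_poly_of_coeffs[OF influence[OF S y transc_free_below[OF tr] n p _ c inv]] by (auto simp: n_def)
  then show ?thesis using p by (intro exI[of _ P]) (auto simp: coeffs_in_def)
qed

end

section \<open>Independent lists of functions and additive relations between invariants\<close>

primrec adjs :: "('q \<Rightarrow> 'k::comm_ring_1) set \<Rightarrow> ('q \<Rightarrow> 'k) list \<Rightarrow> ('q \<Rightarrow> 'k) set" where
  "adjs S [] = S"
| "adjs S (f # fs) = adjs (adj S f) fs"

primrec indep :: "('q \<Rightarrow> 'k::comm_ring_1) set \<Rightarrow> ('q \<Rightarrow> 'k) list \<Rightarrow> bool" where
  "indep S [] = True"
| "indep S (f # fs) = (transc S f \<and> indep (adj S f) fs)"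

lemma adjs_append: "adjs S (fs @ gs) = adjs (adjs S fs) gs"
  by (induction fs arbitrary: S) auto

lemma indep_append: "indep S (fs @ gs) \<longleftrightarrow> indep S fs \<and> indep (adjs S fs) gs"
  by (induction fs arbitrary: S) auto

lemma subalg_adjs: "subalg S \<Longrightarrow> subalg (adjs S fs)"
  by (induction fs arbitrary: S) (auto simp: subalg_adj)

lemma adjs_superset: "subalg S \<Longrightarrow> S \<subseteq> adjs S fs"
  by (induction fs arbitrary: S) (use adj_superset subalg_adj in fastforce)+

lemma adjs_members: "subalg S \<Longrightarrow> set fs \<subseteq> adjs S fs"
proof (induction fs arbitrary: S)
  case (Cons f fs)
  then show ?case using adjs_superset[OF subalg_adj[OF Cons.prems], of f fs] adj_self[OF Cons.prems, of f] subalg_adj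
    by auto
qed simp

lemma adjs_minimal: "subalg T \<Longrightarrow> S \<subseteq> T \<Longrightarrow> set fs \<subseteq> T \<Longrightarrow> adjs S fs \<subseteq> T"
  by (induction fs arbitrary: S) (auto simp: adj_minimal)

definition no_additive_relation :: "('q \<Rightarrow> 'k::comm_ring_1) set \<Rightarrow> ('q \<Rightarrow> 'k) list \<Rightarrow> bool" where
  "no_additive_relation S fs \<longleftrightarrow> (\<forall>P. (\<forall>i<length fs. additive_poly (P i)) \<longrightarrow>
     (\<Sum>i<length fs. pev (P i) (fs ! i)) \<in> S \<longrightarrow> (\<forall>i<length fs. P i = 0))"

lemma no_additive_relationD:
  assumes "no_additive_relation S fs" "\<forall>i<length fs. additive_poly (P i)"
    "(\<Sum>i<length fs. pev (P i) (fs ! i)) \<in> S" "i < length fs"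
  shows "P i = 0"
  using assms unfolding no_additive_relation_def by blast

lemma additive_poly_plus:
  "additive_poly p \<Longrightarrow> additive_poly q \<Longrightarrow> additive_poly (p + q)"
  "additive_poly p \<Longrightarrow> additive_poly (- p)"
  unfolding additive_poly_def by (metis add_0 coeff_add) simp

lemma coeffs_in_iff:
  assumes "0 \<in> C" shows "coeffs_in C p \<longleftrightarrow> set (coeffs p) \<subseteq> C"
proof -
  have "coeffs_in C p \<longleftrightarrow> range (coeff p) \<subseteq> C" by (auto simp: coeffs_in_def)
  then show ?thesis using assms by (simp add: range_coeff)
qed

context unipotent_algebra
begin

primrec fchain :: "('q \<Rightarrow> 'k) set \<Rightarrow> ('q \<Rightarrow> 'k) list \<Rightarrow> bool" where
  "fchain S [] = True"
| "fchain S (f # fs) = (f \<in> invs S \<and> fchain (adj S f) fs)"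

lemma adjs_tsub: "tsub S \<Longrightarrow> fchain S fs \<Longrightarrow> tsub (adjs S fs)"
  by (induction fs arbitrary: S) (auto simp: adj_tsub)

lemma fchain_of_invs: "subalg S \<Longrightarrow> set fs \<subseteq> invs S \<Longrightarrow> fchain S fs"
proof (induction fs arbitrary: S)
  case (Cons f fs)
  have "set fs \<subseteq> invs (adj S f)" using Cons.prems invs_mono[OF adj_superset[OF Cons.prems(1)]] by fastforce
  then show ?case using Cons subalg_adj by auto
qed simp

lemma pev_invs:
  assumes "subalg S" "f \<in> invs S" "additive_poly P" shows "pev P f \<in> invs S"
proof (rule invsI)
  show "pev P f \<in> A" using pev_in[OF A invs_A[OF assms(2)]] .
  fix \<sigma> assume s: "\<sigma> \<in> Tr"
  have "(pev P f \<circ> \<sigma>) - pev P f = pev P ((f \<circ> \<sigma>) - f)"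
    by (auto simp: fun_eq_iff additive_poly_diff[OF assms(3)])
  then show "(pev P f \<circ> \<sigma>) - pev P f \<in> S" using pev_in[OF assms(1) invsD[OF assms(2) s]] by metis
qed

text \<open>The last function is transcendental over the ring of the others, so \<open>F\<close>
  equals an additive polynomial in it up to an element of that ring. The difference is still
  invariant modulo \<open>S\<close>, and the induction continues with the shorter list.\<close>

lemma additive_decomposition:
  assumes "tsub S" "set fs \<subseteq> invs S" "indep S fs" "F \<in> adjs S fs" "F \<in> invs S"
  shows "\<exists>P. (\<forall>i<length fs. additive_poly (P i)) \<and> F - (\<Sum>i<length fs. pev (P i) (fs ! i)) \<in> S"
  using assms
proof (induction fs arbitrary: F rule: rev_induct)
  case Nil
  then show ?case by simp
next
  case (snoc f fs)
  note S = tsubD[OF snoc.prems(1)]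
  have f: "f \<in> invs S" and fs: "set fs \<subseteq> invs S" using snoc.prems(2) by auto
  let ?R = "adjs S fs"
  have R: "tsub ?R" using adjs_tsub fchain_of_invs S(1) fs snoc.prems(1) by blast
  have SR: "S \<subseteq> ?R" by (rule adjs_superset[OF S(1)])
  have fR: "f \<in> invs ?R" using f invs_mono[OF SR] by blast
  have ind: "indep S fs" "transc ?R f" using snoc.prems(3) by (auto simp: indep_append)
  obtain p where p: "coeffs_in ?R p" "F = poly p f" using snoc.prems(4) by (auto simp: adjs_append adj_def)
  have "(poly p f \<circ> R a) - poly p f \<in> ?R" for a
    using invsD[OF snoc.prems(5) Tr_right] SR unfolding p(2) by blast
  then obtain P where P: "additive_poly P" "poly p f - pev P f \<in> ?R"
    using transc_additive_part[OF R fR ind(2) p(1)] by blast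
  have "F - pev P f \<in> invs S"
    using fs.subspace_diff[OF subspace_invs[OF S(4)] snoc.prems(5) pev_invs[OF S(1) f P(1)]] .
  then obtain P' where P': "\<forall>i<length fs. additive_poly (P' i)"
    "(F - pev P f) - (\<Sum>i<length fs. pev (P' i) (fs ! i)) \<in> S"
    using snoc.IH[OF snoc.prems(1) fs ind(1), of "F - pev P f"] P(2) p(2) by blast
  define P'' where "P'' i = (if i < length fs then P' i else P)" for i
  have "(\<Sum>i<length (fs @ [f]). pev (P'' i) ((fs @ [f]) ! i))
    = (\<Sum>i<length fs. pev (P' i) (fs ! i)) + pev P f"
    by (simp add: P''_def nth_append)
  then have "F - (\<Sum>i<length (fs @ [f]). pev (P'' i) ((fs @ [f]) ! i)) \<in> S"
    using P'(2) by (simp add: algebra_simps)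
  moreover have "\<forall>i<length (fs @ [f]). additive_poly (P'' i)" using P' P by (auto simp: P''_def)
  ultimately show ?case by blast
qed

text \<open>Dependence between invariants is always additive: if the last function is algebraic over
  the ring of the others, an additive polynomial maps it into that ring, and the value decomposes
  additively in turn.\<close>

lemma indep_if_no_additive_relation:
  assumes "tsub S" "set fs \<subseteq> invs S" "no_additive_relation S fs"
  shows "indep S fs"
  using assms
proof (induction fs rule: rev_induct)
  case Nil
  then show ?case by simp
next
  case (snoc f fs)
  note S = tsubD[OF snoc.prems(1)]
  have f: "f \<in> invs S" and fs: "set fs \<subseteq> invs S" using snoc.prems(2) by auto
  let ?R = "adjs S fs"
  have R: "tsub ?R" using adjs_tsub fchain_of_invs S(1) fs snoc.prems(1) by blast
  have SR: "S \<subseteq> ?R" by (rule adjs_superset[OF S(1)])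
  have fR: "f \<in> invs ?R" using f invs_mono[OF SR] by blast
  have nr: "no_additive_relation S fs"
    unfolding no_additive_relation_def
  proof (intro allI impI)
    fix P :: "nat \<Rightarrow> 'k poly" and i
    assume P: "\<forall>i<length fs. additive_poly (P i)" "(\<Sum>i<length fs. pev (P i) (fs ! i)) \<in> S" and i: "i < length fs"
    define P' where "P' i = (if i < length fs then P i else 0)" for i
    have "(\<Sum>i<length (fs @ [f]). pev (P' i) ((fs @ [f]) ! i)) = (\<Sum>i<length fs. pev (P i) (fs ! i))"
      by (simp add: P'_def nth_append)
    moreover have "\<forall>i<length (fs @ [f]). additive_poly (P' i)" using P by (auto simp: P'_def)
    ultimately have "P' i = 0"
      using no_additive_relationD[OF snoc.prems(3), of P' i] P(2) i by simp
    then show "P i = 0" using i by (simp add: P'_def)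
  qed
  then have ind: "indep S fs" using snoc by auto
  moreover have "transc ?R f"
  proof (rule ccontr)
    assume "\<not> transc ?R f"
    then obtain P where P: "degree P > 0" "additive_poly P" "pev P f \<in> ?R"
      using algebraic_additive[OF R fR] by blast
    obtain Q where Q: "\<forall>i<length fs. additive_poly (Q i)" "pev P f - (\<Sum>i<length fs. pev (Q i) (fs ! i)) \<in> S"
      using additive_decomposition[OF snoc.prems(1) fs ind P(3) pev_invs[OF S(1) f P(2)]] by blast
    define P' where "P' i = (if i < length fs then - Q i else P)" for i
    have "(\<Sum>i<length (fs @ [f]). pev (P' i) ((fs @ [f]) ! i)) = pev P f - (\<Sum>i<length fs. pev (Q i) (fs ! i))"
      by (auto simp: P'_def nth_append fun_eq_iff sum_negf)
    moreover have "\<forall>i<length (fs @ [f]). additive_poly (P' i)" using P Q by (auto simp: P'_def additive_poly_plus)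
    ultimately have "P' (length fs) = 0"
      using no_additive_relationD[OF snoc.prems(3), of P' "length fs"] Q(2) by simp
    then show False using P(1) by (simp add: P'_def)
  qed
  ultimately show ?case by (simp add: indep_append)
qed

subsection \<open>The ascending chain condition\<close>

definition fg :: "('q \<Rightarrow> 'k) set \<Rightarrow> bool" where
  "fg S \<longleftrightarrow> (\<exists>B. finite B \<and> S = algebra_gen B)"

lemma degree_reduce_monic:
  assumes C: "subalg C" and P: "coeffs_in C P" "lead_coeff P = 1" "degree P > 0" and p: "coeffs_in C p"
  shows "\<exists>q r. coeffs_in C r \<and> p = P * q + r \<and> degree r < degree P"
  using p
proof (induction "degree p" arbitrary: p rule: less_induct)
  case less
  show ?case
  proof (cases "degree p < degree P")
    case True
    then show ?thesis using less.prems by (intro exI[of _ 0] exI[of _ p]) auto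
  next
    case False
    define M where "M = monom (lead_coeff p) (degree p - degree P)"
    have M: "coeffs_in C M" unfolding M_def
      by (rule coeffs_in_monom[OF C]) (use less.prems in \<open>auto simp: coeffs_in_def\<close>)
    define p' where "p' = p - P * M"
    have p': "coeffs_in C p'" unfolding p'_def by (intro coeffs_in_diff coeffs_in_mult C less.prems M P)
    have cM: "coeff (P * M) (degree p) = lead_coeff p"
    proof -
      have "coeff (P * M) (degree p) = lead_coeff p * coeff P (degree p - (degree p - degree P))"
        unfolding M_def by (subst mult.commute) (simp add: coeff_monom_mult)
      then show ?thesis using False P(2) by simp
    qed
    have "degree (P * M) \<le> degree p"
      using degree_mult_le[of P M] degree_monom_le[of "lead_coeff p" "degree p - degree P"] False
      unfolding M_def by linarith
    then have le: "degree p' \<le> degree p" unfolding p'_def by (intro degree_diff_le) auto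
    have c0: "coeff p' (degree p) = 0" by (simp add: p'_def cM)
    show ?thesis
    proof (cases "degree p' = degree p")
      case True
      then have "p' = 0" using c0 by (metis leading_coeff_0_iff)
      then have "p = P * M + 0" by (simp add: p'_def)
      then show ?thesis using P(3) coeffs_in_0[OF C] by (metis degree_0)
    next
      case ne: False
      then have "degree p' < degree p" using le by simp
      then obtain q r where "coeffs_in C r" "p' = P * q + r" "degree r < degree P"
        using less.hyps[OF _ p'] by blast
      moreover from this have "p = P * (M + q) + r" by (simp add: p'_def algebra_simps)
      ultimately show ?thesis by blast
    qed
  qed
qed

text \<open>An Artin-Tate argument. Let \<open>C\<close> be generated by the coefficients that
  express the generators of S[y], together with those of a monic relation of least degree if there
  is one. Then C[y] = S[y], while uniqueness of remainders over \<open>S\<close> gives that C[y]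
  meets \<open>S\<close> only in \<open>C\<close>; so S = C.\<close>

lemma fg_descend:
  assumes S: "tsub S" and y: "y \<in> invs S" and fg: "fg (adj S y)"
  shows "fg S"
proof -
  note S' = tsubD[OF S]
  obtain E where E: "finite E" "adj S y = algebra_gen E" using fg by (auto simp: fg_def)
  have "\<forall>g\<in>E. \<exists>p. coeffs_in S p \<and> g = poly p y"
    using algebra_gen_superset[of E] unfolding E(2)[symmetric] by (auto simp: adj_def)
  then obtain p where p: "\<And>g. g \<in> E \<Longrightarrow> coeffs_in S (p g)" "\<And>g. g \<in> E \<Longrightarrow> g = poly (p g) y" by metis
  define B where "B = (\<Union>g\<in>E. set (coeffs (p g)))"
  \<comment> \<open>\<open>D\<close> forces C[y] to meet \<open>S\<close> in \<open>C\<close>: it is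
    empty for transcendental \<open>y\<close>, and otherwise consists of the coefficients of the
    monic relation, so that division takes place over \<open>C\<close>.\<close>
  have "\<exists>D. finite D \<and> D \<subseteq> S \<and> (\<forall>C. subalg C \<longrightarrow> C \<subseteq> S \<longrightarrow> D \<subseteq> C \<longrightarrow> adj C y \<inter> S \<subseteq> C)"
  proof (cases "transc S y")
    case True
    have "adj C y \<inter> S \<subseteq> C" if C: "subalg C" "C \<subseteq> S" for C
    proof
      fix s assume "s \<in> adj C y \<inter> S"
      then obtain q where q: "coeffs_in C q" "s = poly q y" "s \<in> S" by (auto simp: adj_def)
      have "q = [:s:]"
        by (rule transc_inj[OF S'(1) True coeffs_in_mono[OF q(1) C(2)] coeffs_in_const[OF S'(1) q(3)]])
          (use q(2) in simp)
      then have "coeff q 0 = s" by simp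
      then show "s \<in> C" using q(1) by (auto simp: coeffs_in_def)
    qed
    then show ?thesis by (intro exI[of _ "{}"]) auto
  next
    case False
    obtain P where P: "coeffs_in S P" "lead_coeff P = 1" "degree P > 0" "poly P y = 0" "free_below S y (degree P)"
      using monic_relation[OF S y False] by blast
    have "adj C y \<inter> S \<subseteq> C" if C: "subalg C" "C \<subseteq> S" "set (coeffs P) \<subseteq> C" for C
    proof
      fix s assume "s \<in> adj C y \<inter> S"
      then obtain q where q: "coeffs_in C q" "s = poly q y" "s \<in> S" by (auto simp: adj_def)
      have "coeffs_in C P" using C(3) subalg_0[OF C(1)] by (simp add: coeffs_in_iff)
      then obtain u r where r: "coeffs_in C r" "q = P * u + r" "degree r < degree P"
        using degree_reduce_monic[OF C(1) _ P(2,3) q(1)] by blast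
      have "poly r y = s" using q(2) r(2) P(4) by simp
      then have "poly (r - [:s:]) y = 0" by simp
      moreover have "coeffs_in S (r - [:s:])"
        by (intro coeffs_in_diff coeffs_in_const S' coeffs_in_mono[OF r(1) C(2)] q(3))
      moreover have "degree (r - [:s:]) < degree P" using r(3) P(3) by (intro degree_diff_less) auto
      ultimately have "r - [:s:] = 0" using P(5) unfolding free_below_def by blast
      then have "coeff r 0 = s" by (metis coeff_pCons_0 eq_iff_diff_eq_0)
      then show "s \<in> C" using r(1) by (auto simp: coeffs_in_def)
    qed
    moreover have "set (coeffs P) \<subseteq> S" using P(1) coeffs_in_iff[OF subalg_0[OF S'(1)]] by blast
    ultimately show ?thesis by (intro exI[of _ "set (coeffs P)"]) auto
  qed
  then obtain D where D: "finite D" "D \<subseteq> S"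
    "\<And>C. subalg C \<Longrightarrow> C \<subseteq> S \<Longrightarrow> D \<subseteq> C \<Longrightarrow> adj C y \<inter> S \<subseteq> C" by metis
  define C where "C = algebra_gen (B \<union> D)"
  have "finite (B \<union> D)" using E(1) D(1) by (auto simp: B_def)
  have C: "subalg C" unfolding C_def by (rule subalg_algebra_gen)
  have "B \<subseteq> S" using p(1) coeffs_in_iff[OF subalg_0[OF S'(1)]] unfolding B_def by blast
  then have CS: "C \<subseteq> S" unfolding C_def using D(2) by (intro algebra_gen_minimal S') auto
  have BC: "B \<union> D \<subseteq> C" unfolding C_def by (rule algebra_gen_superset)
  have "E \<subseteq> adj C y"
  proof
    fix g assume g: "g \<in> E"
    have "set (coeffs (p g)) \<subseteq> B" using g by (auto simp: B_def)
    then have "coeffs_in C (p g)" using BC subalg_0[OF C] by (auto simp: coeffs_in_iff)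
    then show "g \<in> adj C y" using p(2)[OF g] adjI by metis
  qed
  then have "adj S y \<subseteq> adj C y" unfolding E(2) by (intro algebra_gen_minimal subalg_adj C)
  then have "S \<subseteq> adj C y \<inter> S" using adj_superset[OF S'(1)] by blast
  then have "S = C" using D(3)[OF C CS] BC CS by blast
  then show ?thesis using \<open>finite (B \<union> D)\<close> by (auto simp: fg_def C_def)
qed

text \<open>Each invariant found in \<open>V\<close> outside \<open>S\<close> enlarges the
  intersection of \<open>V\<close> with the ring when it is adjoined, so \<open>V\<close> is
  absorbed after finitely many steps.\<close>

lemma fchain_exists:
  assumes "tsub S" "fs.subspace V" "tstable V" "V \<subseteq> A" "V \<subseteq> fs.span E" "finite E"
  shows "\<exists>ys. fchain S ys \<and> V \<subseteq> adjs S ys"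
  using assms(1)
proof (induction "fs.dim V - fs.dim (V \<inter> S)" arbitrary: S rule: less_induct)
  case less
  note S = tsubD[OF less.prems]
  show ?case
  proof (cases "V \<subseteq> S")
    case True
    then show ?thesis by (intro exI[of _ "[]"]) simp
  next
    case False
    then obtain f where f: "f \<in> V" "f \<notin> S" "\<forall>\<sigma>\<in>Tr. (f \<circ> \<sigma>) - f \<in> S"
      using invariant_exists[OF S(4,2,3) assms(2,3,4)] by blast
    have fi: "f \<in> invs S" using f assms(4) by (auto simp: invs_def)
    let ?S = "adj S f"
    have T: "tsub ?S" by (rule adj_tsub[OF less.prems fi])
    have "V \<inter> S \<subset> V \<inter> ?S" using f adj_self[OF S(1), of f] adj_superset[OF S(1), of f] by blast
    moreover have sub: "fs.subspace (V \<inter> S)" "fs.subspace (V \<inter> ?S)"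
      using fs.subspace_inter assms(2) S(4) tsubD(4)[OF T] by auto
    moreover have "V \<inter> ?S \<subseteq> fs.span E" using assms(5) by blast
    ultimately have "fs.dim (V \<inter> S) < fs.dim (V \<inter> ?S)" using fs.fd_dim_psubset assms(6) by blast
    moreover have "fs.dim (V \<inter> ?S) \<le> fs.dim V"
      by (rule fs.fd_dim_mono[OF sub(2) assms(2) _ assms(5,6)]) simp
    ultimately obtain ys where "fchain ?S ys \<and> V \<subseteq> adjs ?S ys"
      using less.hyps[OF _ T] by (meson diff_less_mono2 less_le_trans)
    then show ?thesis using fi by (intro exI[of _ "f # ys"]) simp
  qed
qed

lemma finite_stable_superspace:
  assumes "finite B" "B \<subseteq> A"
  shows "\<exists>V E. fs.subspace V \<and> tstable V \<and> V \<subseteq> A \<and> V \<subseteq> fs.span E \<and> finite E \<and> B \<subseteq> V"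
  using assms
proof (induction B)
  case empty
  show ?case
  proof (intro exI conjI)
    show "fs.subspace {0 :: 'q \<Rightarrow> 'k}" by (rule fs.subspace_single_0)
    show "tstable {0}" by (auto simp: tstable_def)
    show "{0} \<subseteq> A" using subalg_0[OF A] by simp
    show "{0} \<subseteq> fs.span {}" by (simp only: fs.span_empty)
  qed auto
next
  case (insert f B)
  have fA: "f \<in> A" and "B \<subseteq> A" using insert.prems by blast+
  then obtain V E where V: "fs.subspace V" "tstable V" "V \<subseteq> A" "V \<subseteq> fs.span E" "finite E" "B \<subseteq> V"
    using insert.IH by blast
  obtain W F where W: "fs.subspace W" "W \<subseteq> fs.span F" "finite F" "W \<subseteq> A" "tstable W" "f \<in> W"
    by (rule translates_finite[OF fA]) (rule that; assumption)
  let ?U = "{x + y | x y. x \<in> V \<and> y \<in> W}"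
  have "fs.subspace ?U" by (rule fs.subspace_sums[OF V(1) W(1)])
  moreover have "tstable ?U"
    unfolding tstable_def
  proof (intro ballI)
    fix \<sigma> g assume s: "\<sigma> \<in> Tr" and "g \<in> ?U"
    then obtain x y where "g = x + y" "x \<in> V" "y \<in> W" by blast
    then have "g \<circ> \<sigma> = (x \<circ> \<sigma>) + (y \<circ> \<sigma>)" "x \<circ> \<sigma> \<in> V" "y \<circ> \<sigma> \<in> W"
      using tstableD[OF V(2) s] tstableD[OF W(5) s] by (auto simp: fun_plus_comp)
    then show "g \<circ> \<sigma> \<in> ?U" by blast
  qed
  moreover have "?U \<subseteq> A" using V(3) W(4) subalg_add[OF A] by auto
  moreover have "?U \<subseteq> fs.span (E \<union> F)"
    using V(4) W(2) fs.span_mono[of E "E \<union> F"] fs.span_mono[of F "E \<union> F"] fs.span_add by blast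
  moreover have "insert f B \<subseteq> ?U"
  proof -
    have "f = 0 + f" by simp
    then have "f \<in> ?U" using fs.subspace_0[OF V(1)] W(6) by blast
    moreover have "b \<in> ?U" if "b \<in> B" for b
    proof -
      have "b = b + 0" by simp
      then show ?thesis using fs.subspace_0[OF W(1)] V(6) that by blast
    qed
    ultimately show ?thesis by blast
  qed
  moreover have "finite (E \<union> F)" using V(5) W(3) by simp
  ultimately show ?case by (intro exI conjI)
qed

text \<open>A finite dimensional stable space contains generators of \<open>A\<close>, so finitely
  many adjunctions of invariants lead from \<open>S\<close> to \<open>A\<close>. Finite generation
  of \<open>A\<close> then descends along this chain.\<close>

lemma tsub_fg:
  assumes "tsub S" shows "fg S"
proof -
  obtain B where B: "finite B" "A = algebra_gen B" using fin_gen by blast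
  have BA: "B \<subseteq> A" using algebra_gen_superset B(2) by blast
  obtain V E where V: "fs.subspace V" "tstable V" "V \<subseteq> A" "V \<subseteq> fs.span E" "finite E" "B \<subseteq> V"
    using finite_stable_superspace[OF B(1) BA] by blast
  obtain ys where ys: "fchain S ys" "V \<subseteq> adjs S ys" using fchain_exists[OF assms V(1-5)] by blast
  have T: "tsub (adjs S ys)" by (rule adjs_tsub[OF assms ys(1)])
  have "A \<subseteq> adjs S ys" unfolding B(2)
    by (rule algebra_gen_minimal[OF tsubD(1)[OF T]]) (use V(6) ys(2) in blast)
  then have "adjs S ys = A" using tsubD(3)[OF T] by blast
  then have "fg (adjs S ys)" using B by (auto simp: fg_def)
  then show ?thesis using assms ys(1)
  proof (induction ys arbitrary: S)
    case (Cons f fs)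
    then have "fg (adj S f)" using adj_tsub by auto
    then show ?case using fg_descend Cons.prems by auto
  qed simp
qed

text \<open>The ascending chain condition in the form needed for choices: the union of a chain is
  translation stable, hence finitely generated, hence equal to a member of the chain.\<close>

lemma tsub_maximal:
  assumes "\<F> \<noteq> {}" "\<And>S. S \<in> \<F> \<Longrightarrow> tsub S"
  shows "\<exists>M\<in>\<F>. \<forall>S\<in>\<F>. M \<subseteq> S \<longrightarrow> S = M"
proof (rule subset_Zorn_nonempty[OF assms(1)])
  fix \<C> assume ne: "\<C> \<noteq> {}" and ch: "subset.chain \<F> \<C>"
  have C: "\<C> \<subseteq> \<F>" "\<And>X Y. X \<in> \<C> \<Longrightarrow> Y \<in> \<C> \<Longrightarrow> X \<subseteq> Y \<or> Y \<subseteq> X"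
    using ch unfolding subset_chain_def by blast+
  have T: "tsub S" if "S \<in> \<C>" for S using assms(2) C(1) that by blast
  have two: "\<exists>Z\<in>\<C>. f \<in> Z \<and> g \<in> Z" if fg: "f \<in> \<Union>\<C>" "g \<in> \<Union>\<C>" for f g
  proof -
    obtain X Y where XY: "X \<in> \<C>" "f \<in> X" "Y \<in> \<C>" "g \<in> Y" using fg by blast
    then show ?thesis using C(2)[OF XY(1,3)] by blast
  qed
  have sub: "subalg (\<Union>\<C>)"
    unfolding subalg_def
  proof (intro conjI allI ballI)
    show "cst c \<in> \<Union>\<C>" for c using ne tsubD(1)[OF T] subalg_cst by blast
    fix f g assume "f \<in> \<Union>\<C>" "g \<in> \<Union>\<C>"
    then obtain Z where Z: "Z \<in> \<C>" "f \<in> Z" "g \<in> Z" using two by blast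
    then show "f + g \<in> \<Union>\<C>" "f * g \<in> \<Union>\<C>"
      using subalgD(2,3)[OF tsubD(1)[OF T[OF Z(1)]]] by blast+
  qed
  have "tsub (\<Union>\<C>)" unfolding tsub_def
  proof (intro conjI sub)
    show "tstable (\<Union>\<C>)" using tsubD(2)[OF T] unfolding tstable_def by blast
    show "\<Union>\<C> \<subseteq> A" using tsubD(3)[OF T] by blast
  qed
  from tsub_fg[OF this] obtain B where B: "finite B" "\<Union>\<C> = algebra_gen B" unfolding fg_def by blast
  have "B \<subseteq> \<Union>\<C>" using B(2) algebra_gen_superset by blast
  have "\<exists>Z\<in>\<C>. B' \<subseteq> Z" if "finite B'" "B' \<subseteq> \<Union>\<C>" for B'
    using that
  proof (induction B')
    case (insert b B')
    then obtain Z Y where ZY: "Z \<in> \<C>" "B' \<subseteq> Z" "Y \<in> \<C>" "b \<in> Y" by auto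
    then show ?case using C(2)[OF ZY(1,3)] by blast
  qed (use ne in blast)
  from this[OF B(1) \<open>B \<subseteq> \<Union>\<C>\<close>] obtain Z where Z: "Z \<in> \<C>" "B \<subseteq> Z" by blast
  have "\<Union>\<C> \<subseteq> Z" unfolding B(2) by (rule algebra_gen_minimal[OF tsubD(1)[OF T[OF Z(1)]] Z(2)])
  then have "\<Union>\<C> = Z" using Z(1) by blast
  then show "\<Union>\<C> \<in> \<F>" using Z(1) C(1) by blast
qed

end

section \<open>Artin-Schreier operators\<close>

lemma prime_char:
  assumes "CHAR('k::field) > 0" shows "prime CHAR('k)"
  using assms prime_CHAR_semidom[where 'a='k] by simp

text \<open>Phrased through a coefficient and a degree bound because rings of functions have zero
  divisors, so that the degree of a power may drop.\<close>

lemma coeff_power_top: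
  fixes q :: "'a::comm_ring_1 poly"
  assumes "degree q \<le> d"
  shows "coeff (q ^ n) (n * d) = coeff q d ^ n"
proof (induction n)
  case (Suc n)
  have dn: "degree (q ^ n) \<le> n * d"
    using degree_power_le[of q n] assms by (metis mult.commute mult_le_mono1 order_trans)
  have "coeff (q ^ Suc n) (Suc n * d) = (\<Sum>i\<le>Suc n * d. coeff q i * coeff (q ^ n) (Suc n * d - i))"
    by (simp add: coeff_mult)
  also have "\<dots> = (\<Sum>i\<in>{d}. coeff q i * coeff (q ^ n) (Suc n * d - i))"
  proof (rule sum.mono_neutral_right)
    show "\<forall>i\<in>{..Suc n * d} - {d}. coeff q i * coeff (q ^ n) (Suc n * d - i) = 0"
    proof
      fix i assume i: "i \<in> {..Suc n * d} - {d}"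
      show "coeff q i * coeff (q ^ n) (Suc n * d - i) = 0"
      proof (cases "i > d")
        case True
        then show ?thesis using assms by (simp add: coeff_eq_0)
      next
        case False
        then have "n * d < Suc n * d - i" using i by auto
        then show ?thesis using dn by (simp add: coeff_eq_0)
      qed
    qed
  qed auto
  finally show ?case using Suc by simp
qed simp

text \<open>The parameter unites the p-th power (\<epsilon> = 0) with the Artin-Schreier operator
  (\<epsilon> = 1). Other constants arise from the division of additive polynomials and are scaled
  to 1.\<close>

definition frob :: "'k::field \<Rightarrow> ('q \<Rightarrow> 'k) \<Rightarrow> 'q \<Rightarrow> 'k" where
  "frob \<epsilon> f = f ^ CHAR('k) - fscale \<epsilon> f"

lemma frob_apply: "frob \<epsilon> f x = f x ^ CHAR('k) - \<epsilon> * f x" for \<epsilon> :: "'k::field"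
  by (simp add: frob_def)

lemma frob_comp: "frob \<epsilon> f \<circ> \<sigma> = frob \<epsilon> (f \<circ> \<sigma>)"
  by (rule ext) (simp add: frob_apply)

context
  assumes pos: "CHAR('k::field) > 0"
begin

lemma power_char_add: "(x + y) ^ CHAR('k) = x ^ CHAR('k) + (y :: 'k) ^ CHAR('k)"
  by (rule freshmans_dream[OF prime_char[OF pos] refl])

lemma power_char_diff: "(x - y) ^ CHAR('k) = x ^ CHAR('k) - (y :: 'k) ^ CHAR('k)"
  using power_char_add[of "x - y" y] by simp

lemma power_char_power_add: "(x + y) ^ (CHAR('k) ^ i) = x ^ (CHAR('k) ^ i) + (y :: 'k) ^ (CHAR('k) ^ i)"
  by (rule freshmans_dream'[OF prime_char[OF pos] refl])

lemma frob_add: "frob \<epsilon> (f + g) = frob \<epsilon> f + frob \<epsilon> (g :: 'q \<Rightarrow> 'k)"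
  and frob_diff: "frob \<epsilon> (f - g) = frob \<epsilon> f - frob \<epsilon> (g :: 'q \<Rightarrow> 'k)"
  by (rule ext; simp add: frob_apply power_char_add power_char_diff algebra_simps)+

lemma poly_power_char_add: "(u + v) ^ CHAR('k) = u ^ CHAR('k) + (v :: 'k poly) ^ CHAR('k)"
  by (rule freshmans_dream) (use prime_char[OF pos] in simp_all)

end

lemma subalg_frob: "subalg S \<Longrightarrow> f \<in> S \<Longrightarrow> frob \<epsilon> f \<in> S"
  unfolding frob_def by (intro subalg_diff subalg_power subalg_scale)

lemma root_exists:
  assumes "n > 0" shows "\<exists>y. y ^ n = (x :: 'k::alg_closed_field)"
proof -
  have "degree (monom 1 n - [:x:]) = n"
  proof (rule antisym)
    show "degree (monom 1 n - [:x:]) \<le> n" by (intro degree_diff_le) (auto simp: degree_monom_le)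
    show "n \<le> degree (monom 1 n - [:x:])" using assms by (intro le_degree) (cases n, auto)
  qed
  then obtain y where "poly (monom 1 n - [:x:]) y = 0" using alg_closed_imp_poly_has_root assms by metis
  then show ?thesis by (auto simp: poly_monom)
qed

lemma infinite_UNIV_ac: "infinite (UNIV :: 'k::alg_closed_field set)"
proof
  assume fin: "finite (UNIV :: 'k set)"
  define p where "p = (\<Prod>a\<in>(UNIV :: 'k set). [:-a, 1:]) + 1"
  have "degree (\<Prod>a\<in>(UNIV :: 'k set). [:-a, 1:]) = card (UNIV :: 'k set)"
    by (subst degree_prod_eq_sum_degree) auto
  then have "degree p > 0"
    using fin by (simp add: p_def card_gt_0_iff degree_add_eq_left)
  then obtain x where "poly p x = 0" using alg_closed_imp_poly_has_root by blast
  moreover have "poly p x = 1" using fin by (auto simp: p_def poly_prod)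
  ultimately show False by simp
qed

lemma poly_eqI_ac: "(\<And>x. poly p x = poly q x) \<Longrightarrow> p = (q :: 'k::alg_closed_field poly)"
proof (rule ccontr)
  assume eq: "\<And>x. poly p x = poly q x" and "p \<noteq> q"
  then have "finite {x. poly (p - q) x = 0}" by (intro poly_roots_finite) simp
  moreover have "{x. poly (p - q) x = 0} = UNIV" using eq by simp
  ultimately show False using infinite_UNIV_ac by metis
qed

text \<open>Since coefficients have p-th roots, a monomial of exponent p l is congruent to a
  multiple of the monomial of exponent \<open>l\<close> modulo values of u^p - \<epsilon> u.
  Proceeding from the top removes all positive exponents divisible by p.\<close>

lemma artin_schreier_reduce:
  fixes F :: "'k::alg_closed_field poly"
  assumes pos: "CHAR('k) > 0" and "\<forall>i\<ge>n. coeff F i = 0"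
  shows "\<exists>u F1. F = F1 + (u ^ CHAR('k) - Polynomial.smult \<epsilon> u) \<and>
    (\<forall>i>0. CHAR('k) dvd i \<longrightarrow> coeff F1 i = 0)"
  using assms(2)
proof (induction n arbitrary: F)
  case 0
  then have "F = 0" by (intro poly_eqI) simp
  then show ?case using pos by (intro exI[of _ 0]) (simp add: power_0_left)
next
  case (Suc n)
  let ?p = "CHAR('k)"
  define c where "c = coeff F n"
  define F' where "F' = F - monom c n"
  have F': "\<forall>i\<ge>n. coeff F' i = 0"
  proof (intro allI impI)
    fix i assume "i \<ge> n"
    then show "coeff F' i = 0" using Suc.prems by (cases "i = n") (auto simp: F'_def c_def)
  qed
  show ?case
  proof (cases "n > 0 \<and> ?p dvd n")
    case True
    then obtain l where l: "n = ?p * l" by auto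
    have "0 < l" using l True by (cases l) auto
    then have "l < n" using n_less_m_mult_n[of l ?p] prime_gt_1_nat[OF prime_char[OF pos]] by (simp add: l)
    from root_exists[OF pos, of c] obtain d where d: "d ^ ?p = c" by (elim exE)
    define u0 where "u0 = monom d l"
    have u0: "u0 ^ ?p = monom c n" by (simp add: u0_def monom_power d l mult.commute)
    have "\<forall>i\<ge>n. coeff (F' + Polynomial.smult \<epsilon> u0) i = 0"
      using F' \<open>l < n\<close> by (auto simp: u0_def)
    then obtain u F1 where F1: "F' + Polynomial.smult \<epsilon> u0 = F1 + (u ^ ?p - Polynomial.smult \<epsilon> u)"
      "\<forall>i>0. ?p dvd i \<longrightarrow> coeff F1 i = 0" using Suc.IH by blast
    have "F = F' + Polynomial.smult \<epsilon> u0 + (u0 ^ ?p - Polynomial.smult \<epsilon> u0)"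
      by (simp add: F'_def u0)
    also have "\<dots> = F1 + ((u + u0) ^ ?p - Polynomial.smult \<epsilon> (u + u0))"
      unfolding F1(1) poly_power_char_add[OF pos] by (simp add: smult_add_right)
    finally show ?thesis using F1(2) by blast
  next
    case False
    obtain u F1 where F1: "F' = F1 + (u ^ ?p - Polynomial.smult \<epsilon> u)"
      "\<forall>i>0. ?p dvd i \<longrightarrow> coeff F1 i = 0" using Suc.IH[OF F'] by blast
    have "F = F' + monom c n" by (simp add: F'_def)
    then have "F = (F1 + monom c n) + (u ^ ?p - Polynomial.smult \<epsilon> u)" unfolding F1(1) by (simp only: add_ac)
    moreover have "\<forall>i>0. ?p dvd i \<longrightarrow> coeff (F1 + monom c n) i = 0" using F1(2) False by auto
    ultimately show ?thesis by blast
  qed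
qed

lemma degree_artin_schreier:
  fixes G :: "'k::field poly"
  assumes "CHAR('k) > 0" "degree G > 0"
  shows "coeff (G ^ CHAR('k) - Polynomial.smult \<epsilon> G) (CHAR('k) * degree G) \<noteq> 0"
proof -
  have "degree G < CHAR('k) * degree G" using assms(2) prime_gt_1_nat[OF prime_char[OF assms(1)]] by simp
  then have "coeff G (CHAR('k) * degree G) = 0" by (rule coeff_eq_0)
  then show ?thesis using coeff_power_top[of G "degree G" "CHAR('k)"] assms(2) by auto
qed

text \<open>
  Scaling the second variable by a constant \<open>l\<close> reduces the two-variable identity
  \<open>F(s + t) - F(s) - F(t) = C\<^sup>p - \<epsilon> C\<close> to one variable.
\<close>

lemma artin_schreier_linear:
  fixes F :: "'k::alg_closed_field poly"
  assumes pos: "CHAR('k) > 0"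
    and red: "\<forall>i>0. CHAR('k) dvd i \<longrightarrow> coeff F i = 0"
    and eq: "\<And>l. \<exists>G c. \<forall>t. poly G t ^ CHAR('k) - \<epsilon> * poly G t = poly F ((1 + l) * t) - poly F t - poly F (l * t) + c"
  shows "degree F \<le> 1"
proof (rule ccontr)
  let ?p = "CHAR('k)"
  assume "\<not> degree F \<le> 1"
  define n where "n = degree F"
  have n: "n > 1" using \<open>\<not> degree F \<le> 1\<close> by (simp add: n_def)
  have cn: "coeff F n \<noteq> 0" using n by (auto simp: n_def)
  then have pn: "\<not> ?p dvd n" using red n by auto
  have *: "(1 + l) ^ n - 1 - l ^ n = 0" for l :: 'k
  proof -
    obtain G c where G: "\<And>t. poly G t ^ ?p - \<epsilon> * poly G t = poly F ((1 + l) * t) - poly F t - poly F (l * t) + c"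
      using eq by blast
    define H where "H = pcompose F [:0, 1 + l:] - F - pcompose F [:0, l:] + [:c:]"
    have GH: "G ^ ?p - Polynomial.smult \<epsilon> G = H"
      by (rule poly_eqI_ac) (simp add: G H_def poly_pcompose mult.commute)
    have cH: "coeff H i = coeff F i * ((1 + l) ^ i - 1 - l ^ i)" if "i > 0" for i
      using that by (cases i) (auto simp: H_def coeff_pcompose_linear algebra_simps)
    \<comment> \<open>Otherwise the left side has a nonzero coefficient at a positive multiple of p,
      where \<open>F\<close> and therefore \<open>H\<close> has none.\<close>
    have "degree G = 0"
    proof (rule ccontr)
      assume "degree G \<noteq> 0"
      then have "coeff H (?p * degree G) \<noteq> 0" using degree_artin_schreier[OF pos, of G \<epsilon>] GH by simp
      then show False using cH[of "?p * degree G"] red pos \<open>degree G \<noteq> 0\<close> by auto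
    qed
    then obtain a where "G = [:a:]" by (rule degree_eq_zeroE)
    then have "coeff H n = 0" using GH n by (cases n) (auto simp: poly_const_pow)
    then show ?thesis using cH[of n] n cn by simp
  qed
  \<comment> \<open>Vanishing at every \<open>l\<close> makes this the zero polynomial; its linear
    coefficient is \<open>n\<close>, which is not divisible by p.\<close>
  have "[:1, 1:] ^ n - 1 - monom 1 n = (0 :: 'k poly)"
    by (rule poly_eqI_ac) (use * in \<open>simp add: poly_monom add.commute\<close>)
  then have "coeff ([:1, 1:] ^ n - 1 - monom 1 n) 1 = (0 :: 'k)" by simp
  then have "(of_nat n :: 'k) = 0" using n coeff_linear_poly_power[of 1 n "1 :: 'k" 1] by simp
  then show False using pn by (simp add: of_nat_eq_0_iff_char_dvd)
qed

section \<open>Characters of a polynomial extension\<close>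

context
  fixes S :: "('q \<Rightarrow> 'k::comm_ring_1) set" and h :: "'q \<Rightarrow> 'k"
  assumes S: "subalg S" and tr: "transc S h"
begin

definition rep :: "('q \<Rightarrow> 'k) \<Rightarrow> ('q \<Rightarrow> 'k) poly" where
  "rep g = (THE p. coeffs_in S p \<and> poly p h = g)"

lemma rep_poly: "coeffs_in S p \<Longrightarrow> rep (poly p h) = p"
  unfolding rep_def using transc_inj[OF S tr] by (intro the_equality) auto

lemma rep_in: assumes "g \<in> adj S h" shows "coeffs_in S (rep g)" and "poly (rep g) h = g"
  using assms rep_poly by (auto simp: adj_def)

text \<open>Evaluation at a formal point: the coefficients are taken at \<open>z\<close>, while
  \<open>h\<close> receives the independent value \<open>t\<close>. For t = h z this is evaluation
  at \<open>z\<close>; for other \<open>t\<close> the existence of a corresponding point is not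
  presupposed.\<close>

definition ev :: "'q \<Rightarrow> 'k \<Rightarrow> ('q \<Rightarrow> 'k) \<Rightarrow> 'k" where
  "ev z t g = poly (map_poly (\<lambda>a. a z) (rep g)) t"

lemma ev_poly: "coeffs_in S p \<Longrightarrow> ev z t (poly p h) = poly (map_poly (\<lambda>a. a z) p) t"
  by (simp add: ev_def rep_poly)

lemma map_poly_eval_add: "map_poly (\<lambda>a. a z) (p + q) = map_poly (\<lambda>a. a z) p + map_poly (\<lambda>a. a z) q"
  for p q :: "('q \<Rightarrow> 'k) poly"
  by (rule poly_eqI) (simp add: coeff_map_poly)

lemma map_poly_eval_mult: "map_poly (\<lambda>a. a z) (p * q) = map_poly (\<lambda>a. a z) p * map_poly (\<lambda>a. a z) q"
  for p q :: "('q \<Rightarrow> 'k) poly"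
  by (rule poly_eqI) (simp add: coeff_map_poly coeff_mult)

lemma ev_add: "f \<in> adj S h \<Longrightarrow> g \<in> adj S h \<Longrightarrow> ev z t (f + g) = ev z t f + ev z t g"
  and ev_mult: "f \<in> adj S h \<Longrightarrow> g \<in> adj S h \<Longrightarrow> ev z t (f * g) = ev z t f * ev z t g"
proof -
  assume "f \<in> adj S h" "g \<in> adj S h"
  then obtain p q where pq: "coeffs_in S p" "coeffs_in S q" "f = poly p h" "g = poly q h" by (auto simp: adj_def)
  show "ev z t (f + g) = ev z t f + ev z t g"
    using ev_poly[OF coeffs_in_add[OF S pq(1,2)]] pq by (simp add: ev_poly map_poly_eval_add)
  show "ev z t (f * g) = ev z t f * ev z t g"
    using ev_poly[OF coeffs_in_mult[OF S pq(1,2)]] pq by (simp add: ev_poly map_poly_eval_mult)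
qed

lemma ev_base: "g \<in> S \<Longrightarrow> ev z t g = g z"
  using ev_poly[OF coeffs_in_const[OF S], of g z t] by (simp add: map_poly_pCons)

lemma ev_cst: "ev z t (cst c) = c"
  by (simp add: ev_base subalg_cst[OF S])

lemma ev_self: "ev z t h = t"
proof -
  have "coeffs_in S [:0, 1:]" by (intro coeffs_in_pCons coeffs_in_0 subalg_0 subalg_1 S)
  from ev_poly[OF this, of z t] show ?thesis by (simp add: map_poly_pCons)
qed

lemma ev_diag: "g \<in> adj S h \<Longrightarrow> ev z (h z) g = g z"
  using rep_in(2) unfolding ev_def by (metis poly_fun_apply)

end


section \<open>The Artin-Schreier descent\<close>

text \<open>Membership in the tensor square of \<open>T\<close>, realised by functions of two
  variables.\<close>

definition tensor :: "('q \<Rightarrow> 'k::comm_ring_1) set \<Rightarrow> ('q \<Rightarrow> 'q \<Rightarrow> 'k) \<Rightarrow> bool" where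
  "tensor T C \<longleftrightarrow> (\<exists>(n::nat) a b. (\<forall>j<n. a j \<in> T \<and> b j \<in> T) \<and> (\<forall>x y. C x y = (\<Sum>j<n. a j x * b j y)))"

lemma tensor_add:
  assumes "tensor T C" "tensor T D" shows "tensor T (\<lambda>x y. C x y + D x y)"
proof -
  obtain n a b where 1: "\<forall>j<(n::nat). a j \<in> T \<and> b j \<in> T" "\<forall>x y. C x y = (\<Sum>j<n. a j x * b j y)"
    using assms(1) unfolding tensor_def by blast
  obtain n' a' b' where 2: "\<forall>j<(n'::nat). a' j \<in> T \<and> b' j \<in> T" "\<forall>x y. D x y = (\<Sum>j<n'. a' j x * b' j y)"
    using assms(2) unfolding tensor_def by blast
  define u where "u j = (if j < n then a j else a' (j - n))" for j
  define v where "v j = (if j < n then b j else b' (j - n))" for j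
  have "\<forall>j<n + n'. u j \<in> T \<and> v j \<in> T" using 1(1) 2(1) by (auto simp: u_def v_def)
  moreover have "(\<Sum>j<n + n'. u j x * v j y) = C x y + D x y" for x y
  proof -
    have "(\<Sum>j<n + n'. u j x * v j y) = (\<Sum>j<n. u j x * v j y) + (\<Sum>j\<in>{n..<n + n'}. u j x * v j y)"
      by (subst sum.union_disjoint[symmetric]) (auto intro: sum.cong)
    also have "(\<Sum>j\<in>{n..<n + n'}. u j x * v j y) = (\<Sum>j<n'. a' j x * b' j y)"
      by (rule sum.reindex_bij_witness[of _ "\<lambda>j. j + n" "\<lambda>j. j - n"]) (auto simp: u_def v_def)
    also have "(\<Sum>j<n. u j x * v j y) = (\<Sum>j<n. a j x * b j y)" by (simp add: u_def v_def)
    finally show ?thesis using 1(2) 2(2) by simp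
  qed
  ultimately show ?thesis unfolding tensor_def by (metis (no_types))
qed

lemma tensor_prod: "a \<in> T \<Longrightarrow> b \<in> T \<Longrightarrow> tensor T (\<lambda>x y. a x * b y)"
  unfolding tensor_def by (intro exI[of _ 1] exI[of _ "\<lambda>_. a"] exI[of _ "\<lambda>_. b"]) auto

text \<open>A linear projection onto \<open>T\<close> fixes the slices of \<open>C\<close>. Applied
  in one variable and then in the other, it moves the tensor factors into \<open>T\<close> without
  changing \<open>C\<close>.\<close>

lemma tensor_restrict:
  fixes C :: "'q \<Rightarrow> 'q \<Rightarrow> 'k::alg_closed_field"
  assumes C: "tensor UNIV C" and T: "fs.subspace T"
    and l: "\<And>y. (\<lambda>x. C x y) \<in> T" and r: "\<And>x. (\<lambda>y. C x y) \<in> T"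
  shows "tensor T C"
proof -
  obtain \<pi> where \<pi>: "fs.lin \<pi>" "\<And>v. \<pi> v \<in> T" "\<And>w. w \<in> T \<Longrightarrow> \<pi> w = w"
    by (rule fs.projection_exists[OF T]) (rule that)
  obtain n a b where ab: "\<forall>x y. C x y = (\<Sum>j<(n::nat). a j x * b j y)"
    using C unfolding tensor_def by blast
  have 1: "C x y = (\<Sum>j<n. \<pi> (a j) x * b j y)" for x y
  proof -
    have eq: "(\<lambda>x. C x y) = (\<Sum>j<n. fscale (b j y) (a j))" by (auto simp: ab fun_eq_iff mult.commute)
    have "(\<lambda>x. C x y) = \<pi> (\<Sum>j<n. fscale (b j y) (a j))"
      unfolding eq[symmetric] by (rule \<pi>(3)[OF l, symmetric])
    also have "\<dots> = (\<Sum>j<n. fscale (b j y) (\<pi> (a j)))"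
      by (simp only: fs.lin_sum[OF \<pi>(1)] fs.lin_scale[OF \<pi>(1)])
    finally have "(\<lambda>x. C x y) x = (\<Sum>j<n. fscale (b j y) (\<pi> (a j))) x" by (rule fun_cong)
    then show ?thesis by (simp add: mult.commute)
  qed
  have 2: "C x y = (\<Sum>j<n. \<pi> (a j) x * \<pi> (b j) y)" for x y
  proof -
    have eq: "(\<lambda>y. C x y) = (\<Sum>j<n. fscale (\<pi> (a j) x) (b j))" by (auto simp: 1 fun_eq_iff)
    have "(\<lambda>y. C x y) = \<pi> (\<Sum>j<n. fscale (\<pi> (a j) x) (b j))"
      unfolding eq[symmetric] by (rule \<pi>(3)[OF r, symmetric])
    also have "\<dots> = (\<Sum>j<n. fscale (\<pi> (a j) x) (\<pi> (b j)))"
      by (simp only: fs.lin_sum[OF \<pi>(1)] fs.lin_scale[OF \<pi>(1)])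
    finally have "(\<lambda>y. C x y) y = (\<Sum>j<n. fscale (\<pi> (a j) x) (\<pi> (b j))) y" by (rule fun_cong)
    then show ?thesis by simp
  qed
  show ?thesis unfolding tensor_def
    using \<pi>(2) 2 by (intro exI[of _ n] exI[of _ "\<lambda>j. \<pi> (a j)"] exI[of _ "\<lambda>j. \<pi> (b j)"]) simp
qed

section \<open>Functions of two variables evaluated at a pair of formal points\<close>

context
  fixes S :: "('q \<Rightarrow> 'k::comm_ring_1) set" and h :: "'q \<Rightarrow> 'k"
  assumes S: "subalg S" and tr: "transc S h"
begin

abbreviation "ev' \<equiv> ev S h"

text \<open>What \<open>Theta\<close> requires to make sense: after the first variable has been
  evaluated, the remaining function must lie in S[h] again.\<close>

definition nice :: "('q \<Rightarrow> 'q \<Rightarrow> 'k) \<Rightarrow> bool" where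
  "nice C \<longleftrightarrow> (\<forall>y. (\<lambda>x. C x y) \<in> adj S h) \<and> (\<forall>z t. (\<lambda>y. ev' z t (\<lambda>x. C x y)) \<in> adj S h)"

text \<open>The tensor product of two formal evaluations; on nice functions it respects sums and
  products.\<close>

definition Theta :: "'q \<Rightarrow> 'k \<Rightarrow> 'q \<Rightarrow> 'k \<Rightarrow> ('q \<Rightarrow> 'q \<Rightarrow> 'k) \<Rightarrow> 'k" where
  "Theta z t z' t' C = ev' z' t' (\<lambda>y. ev' z t (\<lambda>x. C x y))"

lemma Theta_add:
  assumes "nice C" "nice D"
  shows "nice (\<lambda>x y. C x y + D x y)"
    "Theta z t z' t' (\<lambda>x y. C x y + D x y) = Theta z t z' t' C + Theta z t z' t' D"
proof -
  have e: "ev' z t (\<lambda>x. C x y + D x y) = ev' z t (\<lambda>x. C x y) + ev' z t (\<lambda>x. D x y)" for z t y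
    using ev_add[OF S tr, of "\<lambda>x. C x y" "\<lambda>x. D x y" z t] assms by (simp add: nice_def plus_fun_def)
  have i: "(\<lambda>x. f x + g x) \<in> adj S h" if "f \<in> adj S h" "g \<in> adj S h" for f g
    using subalg_add[OF subalg_adj[OF S] that] by (simp add: plus_fun_def)
  show "nice (\<lambda>x y. C x y + D x y)" using assms i by (simp add: nice_def e)
  show "Theta z t z' t' (\<lambda>x y. C x y + D x y) = Theta z t z' t' C + Theta z t z' t' D"
    unfolding Theta_def e
    using ev_add[OF S tr, of "\<lambda>y. ev' z t (\<lambda>x. C x y)" "\<lambda>y. ev' z t (\<lambda>x. D x y)" z' t'] assms
    by (simp add: nice_def plus_fun_def)
qed

lemma Theta_mult:
  assumes "nice C" "nice D"
  shows "nice (\<lambda>x y. C x y * D x y)"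
    "Theta z t z' t' (\<lambda>x y. C x y * D x y) = Theta z t z' t' C * Theta z t z' t' D"
proof -
  have e: "ev' z t (\<lambda>x. C x y * D x y) = ev' z t (\<lambda>x. C x y) * ev' z t (\<lambda>x. D x y)" for z t y
    using ev_mult[OF S tr, of "\<lambda>x. C x y" "\<lambda>x. D x y" z t] assms by (simp add: nice_def times_fun_def)
  have i: "(\<lambda>x. f x * g x) \<in> adj S h" if "f \<in> adj S h" "g \<in> adj S h" for f g
    using subalg_mult[OF subalg_adj[OF S] that] by (simp add: times_fun_def)
  show "nice (\<lambda>x y. C x y * D x y)" using assms i by (simp add: nice_def e)
  show "Theta z t z' t' (\<lambda>x y. C x y * D x y) = Theta z t z' t' C * Theta z t z' t' D"
    unfolding Theta_def e
    using ev_mult[OF S tr, of "\<lambda>y. ev' z t (\<lambda>x. C x y)" "\<lambda>y. ev' z t (\<lambda>x. D x y)" z' t'] assms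
    by (simp add: nice_def times_fun_def)
qed

lemma Theta_fst:
  assumes "f \<in> adj S h" shows "nice (\<lambda>x y. f x)" "Theta z t z' t' (\<lambda>x y. f x) = ev' z t f"
proof -
  have c: "(\<lambda>y. c) \<in> adj S h" for c
    using adj_base[OF S subalg_cst[OF S], of c h] by (simp add: cst_def)
  show "nice (\<lambda>x y. f x)" using assms c by (simp add: nice_def)
  show "Theta z t z' t' (\<lambda>x y. f x) = ev' z t f"
    using ev_cst[OF S tr, of z' t' "ev' z t f"] by (simp add: Theta_def cst_def)
qed

lemma Theta_snd:
  assumes "f \<in> adj S h" shows "nice (\<lambda>x y. f y)" "Theta z t z' t' (\<lambda>x y. f y) = ev' z' t' f"
proof -
  have c: "(\<lambda>y. c) \<in> adj S h" for c
    using adj_base[OF S subalg_cst[OF S], of c h] by (simp add: cst_def)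
  have e: "ev' z t (\<lambda>x. c) = c" for z t c using ev_cst[OF S tr, of z t c] by (simp add: cst_def)
  show "nice (\<lambda>x y. f y)" using assms c by (simp add: nice_def e)
  show "Theta z t z' t' (\<lambda>x y. f y) = ev' z' t' f" by (simp add: Theta_def e)
qed

lemma Theta_sum_prod:
  assumes "\<And>j. j < n \<Longrightarrow> a j \<in> adj S h \<and> b j \<in> adj S h"
  shows "nice (\<lambda>x y. \<Sum>j<(n::nat). a j x * b j y)"
    and "Theta z t z' t' (\<lambda>x y. \<Sum>j<n. a j x * b j y) = (\<Sum>j<n. ev' z t (a j) * ev' z' t' (b j))"
proof -
  have "nice (\<lambda>x y. \<Sum>j<n. a j x * b j y) \<and>
    Theta z t z' t' (\<lambda>x y. \<Sum>j<n. a j x * b j y) = (\<Sum>j<n. ev' z t (a j) * ev' z' t' (b j))"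
    using assms
  proof (induction n)
    case 0
    have z: "(\<lambda>x. 0) \<in> adj S h" using subalg_0[OF subalg_adj[OF S, of h]] by (simp add: zero_fun_def)
    show ?case using Theta_fst[OF z] ev_cst[OF S tr, of z t 0] by (simp add: cst_def)
  next
    case (Suc n)
    have ab: "a n \<in> adj S h" "b n \<in> adj S h" using Suc.prems by auto
    have IH: "nice (\<lambda>x y. \<Sum>j<n. a j x * b j y)"
      "Theta z t z' t' (\<lambda>x y. \<Sum>j<n. a j x * b j y) = (\<Sum>j<n. ev' z t (a j) * ev' z' t' (b j))"
      using Suc by auto
    have p: "nice (\<lambda>x y. a n x * b n y)"
      "Theta z t z' t' (\<lambda>x y. a n x * b n y) = ev' z t (a n) * ev' z' t' (b n)"
      using Theta_mult[OF Theta_fst(1)[OF ab(1)] Theta_snd(1)[OF ab(2)]]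
      by (simp_all add: Theta_fst[OF ab(1)] Theta_snd[OF ab(2)])
    show ?case using Theta_add[OF IH(1) p(1)] IH(2) p(2) by simp
  qed
  then show "nice (\<lambda>x y. \<Sum>j<(n::nat). a j x * b j y)"
    "Theta z t z' t' (\<lambda>x y. \<Sum>j<n. a j x * b j y) = (\<Sum>j<n. ev' z t (a j) * ev' z' t' (b j))" by blast+
qed

lemma Theta_tensor_base:
  assumes "tensor S C" shows "nice C" "Theta z t z' t' C = C z z'"
proof -
  obtain n a b where ab: "\<forall>j<(n::nat). a j \<in> S \<and> b j \<in> S" "\<forall>x y. C x y = (\<Sum>j<n. a j x * b j y)"
    using assms unfolding tensor_def by blast
  have C: "C = (\<lambda>x y. \<Sum>j<n. a j x * b j y)" using ab(2) by (auto simp: fun_eq_iff)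
  have *: "a j \<in> adj S h \<and> b j \<in> adj S h" if "j < n" for j using ab(1) that adj_base[OF S] by blast
  show "nice C" unfolding C by (rule Theta_sum_prod[OF *])
  have "Theta z t z' t' C = (\<Sum>j<n. ev' z t (a j) * ev' z' t' (b j))" unfolding C by (rule Theta_sum_prod[OF *])
  also have "\<dots> = (\<Sum>j<n. a j z * b j z')" using ab(1) by (intro sum.cong) (simp_all add: ev_base[OF S tr])
  finally show "Theta z t z' t' C = C z z'" unfolding C .
qed

lemma nice_tensor: "tensor (adj S h) C \<Longrightarrow> nice C"
proof -
  assume "tensor (adj S h) C"
  then obtain n a b where ab: "\<forall>j<(n::nat). a j \<in> adj S h \<and> b j \<in> adj S h" "\<forall>x y. C x y = (\<Sum>j<n. a j x * b j y)"
    unfolding tensor_def by blast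
  have C: "C = (\<lambda>x y. \<Sum>j<n. a j x * b j y)" using ab(2) by (auto simp: fun_eq_iff)
  show "nice C" unfolding C using ab(1) by (intro Theta_sum_prod) auto
qed

lemma Theta_power:
  assumes "nice C"
  shows "nice (\<lambda>x y. C x y ^ n) \<and> Theta z t z' t' (\<lambda>x y. C x y ^ n) = Theta z t z' t' C ^ n"
proof (induction n)
  case 0
  have o: "(\<lambda>x. 1) \<in> adj S h" using subalg_1[OF subalg_adj[OF S, of h]] by (simp add: one_fun_def)
  show ?case using Theta_fst[OF o] ev_cst[OF S tr, of z t 1] by (simp add: cst_def)
next
  case (Suc n)
  then show ?case using Theta_mult[OF assms, of "\<lambda>x y. C x y ^ n"] by simp
qed

lemma Theta_scale:
  assumes "nice C"
  shows "nice (\<lambda>x y. c * C x y)" "Theta z t z' t' (\<lambda>x y. c * C x y) = c * Theta z t z' t' C"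
proof -
  have c: "(\<lambda>x. c) \<in> adj S h" using adj_base[OF S subalg_cst[OF S], of c h] by (simp add: cst_def)
  have e: "ev' z t (\<lambda>x. c) = c" for z t using ev_cst[OF S tr, of z t c] by (simp add: cst_def)
  show "nice (\<lambda>x y. c * C x y)" "Theta z t z' t' (\<lambda>x y. c * C x y) = c * Theta z t z' t' C"
    using Theta_mult[OF Theta_fst(1)[OF c] assms] Theta_fst(2)[OF c] by (simp_all add: e)
qed

lemma Theta_diff:
  assumes "nice C" "nice D"
  shows "nice (\<lambda>x y. C x y - D x y)"
    "Theta z t z' t' (\<lambda>x y. C x y - D x y) = Theta z t z' t' C - Theta z t z' t' D"
  using Theta_add[OF assms(1) Theta_scale(1)[OF assms(2), of "-1"]]
    Theta_scale(2)[OF assms(2), of _ _ _ _ "-1"] by simp_all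

end

section \<open>Coboundaries at formal points and the descent from S[h] to \<open>S\<close>\<close>

context unipotent_algebra
begin

lemma comult_tensor_UNIV: "g \<in> A \<Longrightarrow> tensor UNIV (\<lambda>x y. g (m x y))"
  using comult[of g] unfolding tensor_def by auto

lemma comult_tensor:
  assumes T: "tsub T" and g: "g \<in> T" shows "tensor T (\<lambda>x y. g (m x y))"
proof (rule tensor_restrict)
  note T' = tsubD[OF T]
  show "tensor UNIV (\<lambda>x y. g (m x y))" using comult_tensor_UNIV g T'(3) by blast
  show "fs.subspace T" by (rule T'(4))
  show "(\<lambda>x. g (m x y)) \<in> T" for y using tstableD[OF T'(2) Tr_right g, of y] by (simp add: comp_def)
  show "(\<lambda>y. g (m x y)) \<in> T" for x using tstableD[OF T'(2) Tr_left g, of x] by (simp add: comp_def)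
qed

text \<open>Invariance modulo \<open>T\<close> says that the slices of the coboundary lie in
  \<open>T\<close> up to constants, and the comultiplication provides the tensor expression over all
  functions; \<open>tensor_restrict\<close> combines the two.\<close>

lemma coboundary_tensor:
  assumes T: "tsub T" and f: "f \<in> invs T" shows "tensor T (\<lambda>x y. f (m x y) - f x - f y)"
proof (rule tensor_restrict)
  note T' = tsubD[OF T]
  show "fs.subspace T" by (rule T'(4))
  have "tensor UNIV (\<lambda>x y. (f (m x y) + (- f) x * 1 y) + (cst (-1)) x * f y)"
    by (intro tensor_add tensor_prod comult_tensor_UNIV invs_A[OF f]) auto
  then show "tensor UNIV (\<lambda>x y. f (m x y) - f x - f y)" by simp
  show "(\<lambda>x. f (m x y) - f x - f y) \<in> T" for y
  proof -
    have "((f \<circ> R y) - f) - cst (f y) \<in> T"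
      by (intro subalg_diff[OF T'(1)] subalg_cst[OF T'(1)] invsD[OF f Tr_right])
    moreover have "((f \<circ> R y) - f) - cst (f y) = (\<lambda>x. f (m x y) - f x - f y)" by (rule ext) simp
    ultimately show ?thesis by metis
  qed
  show "(\<lambda>y. f (m x y) - f x - f y) \<in> T" for x
  proof -
    have "((f \<circ> m x) - f) - cst (f x) \<in> T"
      by (intro subalg_diff[OF T'(1)] subalg_cst[OF T'(1)] invsD[OF f Tr_left])
    moreover have "((f \<circ> m x) - f) - cst (f x) = (\<lambda>y. f (m x y) - f x - f y)" by (rule ext) simp
    ultimately show ?thesis by metis
  qed
qed

context
  fixes S h assumes S: "tsub S" and h: "h \<in> invs S" and tr: "transc S h"
begin

lemmas S' = tsubD[OF S]

lemma tsub_adj_h: "tsub (adj S h)"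
  by (rule adj_tsub[OF S h])

abbreviation "e' \<equiv> ev S h"
abbreviation "\<Theta> \<equiv> Theta S h"

text \<open>The group law on formal points: (z, t) times (z', t') lies over \<open>m z z'\<close>
  and has the value t + t' plus the cocycle of \<open>h\<close>. Both sides are compatible with sums
  and products in \<open>g\<close>, so elements of \<open>S\<close> and \<open>h\<close> itself
  decide.\<close>

lemma Theta_comult:
  assumes "g \<in> adj S h"
  shows "\<Theta> z t z' t' (\<lambda>x y. g (m x y)) = e' (m z z') (t + t' + (h (m z z') - h z - h z')) g"
proof -
  have nice: "nice S h (\<lambda>x y. g (m x y))" if "g \<in> adj S h" for g
    by (rule nice_tensor[OF S'(1) tr comult_tensor[OF tsub_adj_h that]])
  let ?u = "t + t' + (h (m z z') - h z - h z')"
  have hT: "h \<in> adj S h" by (rule adj_self[OF S'(1)])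
  have base: "\<Theta> z t z' t' (\<lambda>x y. a (m x y)) = a (m z z')" if "a \<in> S" for a
    by (rule Theta_tensor_base(2)[OF S'(1) tr comult_tensor[OF S that]])
  have hh: "\<Theta> z t z' t' (\<lambda>x y. h (m x y)) = ?u"
  proof -
    have c: "tensor S (\<lambda>x y. h (m x y) - h x - h y)" by (rule coboundary_tensor[OF S h])
    have "\<Theta> z t z' t' (\<lambda>x y. h (m x y)) = \<Theta> z t z' t' (\<lambda>x y. (h x + h y) + (h (m x y) - h x - h y))"
      by simp
    also have "\<dots> = \<Theta> z t z' t' (\<lambda>x y. h x + h y) + (h (m z z') - h z - h z')"
      using Theta_add(2)[OF S'(1) tr Theta_add(1)[OF S'(1) tr Theta_fst(1)[OF S'(1) tr hT] Theta_snd(1)[OF S'(1) tr hT]]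
          Theta_tensor_base(1)[OF S'(1) tr c]] Theta_tensor_base(2)[OF S'(1) tr c] by simp
    also have "\<Theta> z t z' t' (\<lambda>x y. h x + h y) = t + t'"
      using Theta_add(2)[OF S'(1) tr Theta_fst(1)[OF S'(1) tr hT] Theta_snd(1)[OF S'(1) tr hT]]
        Theta_fst(2)[OF S'(1) tr hT] Theta_snd(2)[OF S'(1) tr hT] ev_self[OF S'(1) tr] by simp
    finally show ?thesis .
  qed
  have "coeffs_in S p \<Longrightarrow> \<Theta> z t z' t' (\<lambda>x y. poly p h (m x y)) = poly (map_poly (\<lambda>a. a (m z z')) p) ?u" for p
  proof (induction p)
    case 0
    show ?case using base[OF subalg_0[OF S'(1)]] by simp
  next
    case (pCons a p)
    have a: "a \<in> S" and p: "coeffs_in S p"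
      using pCons.prems unfolding coeffs_in_def by (metis coeff_pCons_0, metis coeff_pCons_Suc)
    have pT: "poly p h \<in> adj S h" by (rule adjI[OF p])
    have aT: "a \<in> adj S h" by (rule adj_base[OF S'(1) a])
    have n1: "nice S h (\<lambda>x y. h (m x y) * poly p h (m x y))"
      by (rule Theta_mult(1)[OF S'(1) tr nice[OF hT] nice[OF pT]])
    have "\<Theta> z t z' t' (\<lambda>x y. poly (pCons a p) h (m x y)) = \<Theta> z t z' t' (\<lambda>x y. a (m x y) + h (m x y) * poly p h (m x y))"
      by simp
    also have "\<dots> = a (m z z') + ?u * poly (map_poly (\<lambda>a. a (m z z')) p) ?u"
      unfolding Theta_add(2)[OF S'(1) tr nice[OF aT] n1] Theta_mult(2)[OF S'(1) tr nice[OF hT] nice[OF pT]]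
        base[OF a] hh pCons.IH[OF p] by (rule refl)
    also have "\<dots> = poly (map_poly (\<lambda>a. a (m z z')) (pCons a p)) ?u"
      by (simp add: map_poly_pCons)
    finally show ?case .
  qed
  then show ?thesis using assms ev_poly[OF S'(1) tr] by (auto simp: adj_def)
qed

text \<open>As \<open>f\<close> need not lie in S[h], it has no values at formal points, but its
  coboundary does. Applying the additive operator \<open>frob \<epsilon>\<close> to the coboundary
  leaves the coboundaries of \<open>w\<close> and \<open>r\<close>, and these are evaluated at the
  same pair of points.\<close>

lemma artin_schreier_identity:
  assumes pos: "CHAR('k) > 0" and f: "f \<in> invs (adj S h)" and w: "w \<in> invs S" and r: "r \<in> adj S h"
    and eq: "frob \<epsilon> f = w + r"
  obtains n a b where "\<And>j. j < (n::nat) \<Longrightarrow> a j \<in> adj S h \<and> b j \<in> adj S h"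
    "\<And>z t z' t'. (\<Sum>j<n. e' z t (a j) * e' z' t' (b j)) ^ CHAR('k) - \<epsilon> * (\<Sum>j<n. e' z t (a j) * e' z' t' (b j))
      = (w (m z z') - w z - w z') + e' (m z z') (t + t' + (h (m z z') - h z - h z')) r - e' z t r - e' z' t' r"
proof -
  let ?C = "\<lambda>x y. f (m x y) - f x - f y" and ?W = "\<lambda>x y. w (m x y) - w x - w y"
  have C: "tensor (adj S h) ?C" by (rule coboundary_tensor[OF tsub_adj_h f])
  have W: "tensor S ?W" by (rule coboundary_tensor[OF S w])
  obtain n a b where ab: "\<forall>j<(n::nat). a j \<in> adj S h \<and> b j \<in> adj S h" "\<forall>x y. ?C x y = (\<Sum>j<n. a j x * b j y)"
    using C unfolding tensor_def by blast
  have Cab: "?C = (\<lambda>x y. \<Sum>j<n. a j x * b j y)" using ab(2) by (intro ext) blast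
  have ab': "a j \<in> adj S h \<and> b j \<in> adj S h" if "j < n" for j using ab(1) that by blast
  have nC: "nice S h ?C" by (rule nice_tensor[OF S'(1) tr C])
  have nW: "nice S h ?W" by (rule Theta_tensor_base(1)[OF S'(1) tr W])
  have nr: "nice S h (\<lambda>x y. r (m x y))" by (rule nice_tensor[OF S'(1) tr comult_tensor[OF tsub_adj_h r]])
  note n1 = Theta_fst(1)[OF S'(1) tr r] and n2 = Theta_snd(1)[OF S'(1) tr r]
  have eqx: "f x ^ CHAR('k) - \<epsilon> * f x = w x + r x" for x
    using fun_cong[OF eq, of x] by (simp add: frob_apply)
  have id: "?C x y ^ CHAR('k) - \<epsilon> * ?C x y = ((?W x y + r (m x y)) - r x) - r y" for x y
    using eqx[of x] eqx[of y] eqx[of "m x y"] by (simp add: power_char_diff[OF pos] power_char_add[OF pos] algebra_simps)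
  show thesis
  proof (rule that[of n a b])
    show "a j \<in> adj S h \<and> b j \<in> adj S h" if "j < n" for j using ab' that .
    fix z t z' t'
    define c where "c = (\<Sum>j<n. e' z t (a j) * e' z' t' (b j))"
    have cC: "\<Theta> z t z' t' ?C = c"
      unfolding Cab c_def by (rule Theta_sum_prod(2)[OF S'(1) tr ab'])
    have "c ^ CHAR('k) - \<epsilon> * c = \<Theta> z t z' t' (\<lambda>x y. ?C x y ^ CHAR('k) - \<epsilon> * ?C x y)"
      using Theta_power[OF S'(1) tr nC, of "CHAR('k)" z t z' t'] Theta_scale[OF S'(1) tr nC]
        Theta_diff(2)[OF S'(1) tr, of "\<lambda>x y. ?C x y ^ CHAR('k)" "\<lambda>x y. \<epsilon> * ?C x y" z t z' t'] cC by simp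
    also have "\<dots> = \<Theta> z t z' t' (\<lambda>x y. ((?W x y + r (m x y)) - r x) - r y)"
      by (simp only: id)
    also have "\<dots> = ((\<Theta> z t z' t' ?W + \<Theta> z t z' t' (\<lambda>x y. r (m x y))) - e' z t r) - e' z' t' r"
      unfolding Theta_diff(2)[OF S'(1) tr Theta_diff(1)[OF S'(1) tr Theta_add(1)[OF S'(1) tr nW nr] n1] n2]
        Theta_diff(2)[OF S'(1) tr Theta_add(1)[OF S'(1) tr nW nr] n1] Theta_add(2)[OF S'(1) tr nW nr]
        Theta_fst(2)[OF S'(1) tr r] Theta_snd(2)[OF S'(1) tr r] by (rule refl)
    also have "\<Theta> z t z' t' ?W = w (m z z') - w z - w z'" by (rule Theta_tensor_base(2)[OF S'(1) tr W])
    also have "\<Theta> z t z' t' (\<lambda>x y. r (m x y)) = e' (m z z') (t + t' + (h (m z z') - h z - h z')) r"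
      by (rule Theta_comult[OF r])
    finally show "(\<Sum>j<n. e' z t (a j) * e' z' t' (b j)) ^ CHAR('k) - \<epsilon> * (\<Sum>j<n. e' z t (a j) * e' z' t' (b j))
      = (w (m z z') - w z - w z') + e' (m z z') (t + t' + (h (m z z') - h z - h z')) r - e' z t r - e' z' t' r"
      unfolding c_def .
  qed
qed

lemma ev_zero: "g \<in> adj S h \<Longrightarrow> (\<lambda>x. e' x 0 g) \<in> S"
proof -
  assume "g \<in> adj S h"
  then have "coeff (rep S h g) 0 \<in> S" using rep_in(1)[OF S'(1) tr] by (auto simp: coeffs_in_def)
  moreover have "(\<lambda>x. e' x 0 g) = coeff (rep S h g) 0"
    by (rule ext) (simp add: ev_def[OF S'(1) tr] poly_0_coeff_0 coeff_map_poly)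
  ultimately show ?thesis by simp
qed

text \<open>The restriction of \<open>g\<close> to the formal points over the identity, a polynomial
  in \<open>t\<close> with constant coefficients.\<close>

definition runit :: "('q \<Rightarrow> 'k) \<Rightarrow> 'k poly" where
  "runit g = map_poly (\<lambda>a. a e) (rep S h g)"

lemma ev_unit: "e' e t g = poly (runit g) t"
  by (simp add: runit_def ev_def[OF S'(1) tr])

lemma ev_right_unit:
  assumes "g \<in> adj S h" shows "e' (m x e) t g = e' x t g"
proof -
  have "coeff (rep S h g) i (m x e) = coeff (rep S h g) i x" for i
    using rep_in(1)[OF S'(1) tr assms] S'(3) right_unit by (auto simp: coeffs_in_def)
  then have "map_poly (\<lambda>a. a (m x e)) (rep S h g) = map_poly (\<lambda>a. a x) (rep S h g)"
    by (intro poly_eqI) (simp add: coeff_map_poly)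
  then show ?thesis by (simp add: ev_def[OF S'(1) tr])
qed

text \<open>The p-th power of a nonzero leading coefficient is a nonzero function, so
  \<open>frob \<epsilon>\<close> multiplies a positive degree in \<open>h\<close> by p and cannot
  land in \<open>S\<close>.\<close>

lemma frob_descends:
  assumes pos: "CHAR('k) > 0" and g: "g \<in> adj S h" and fg: "frob \<epsilon> g \<in> S"
  shows "g \<in> S"
proof -
  let ?p = "CHAR('k)"
  obtain q where q: "coeffs_in S q" "g = poly q h" using g by (auto simp: adj_def)
  define Q where "Q = q ^ ?p - Polynomial.smult (cst \<epsilon>) q"
  have "coeffs_in S (q ^ n)" for n
    by (induction n) (auto simp: coeffs_in_1[OF S'(1)] intro!: coeffs_in_mult[OF S'(1)] q)
  then have "coeffs_in S Q" unfolding Q_def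
    by (intro coeffs_in_diff coeffs_in_smult subalg_cst S' q) auto
  moreover have "poly Q h = poly [:frob \<epsilon> g:] h"
    by (simp add: Q_def q(2) poly_power frob_def fscale_altdef)
  ultimately have Q: "Q = [:frob \<epsilon> g:]" using transc_inj[OF S'(1) tr _ coeffs_in_const[OF S'(1) fg]] by blast
  have "degree q = 0"
  proof (rule ccontr)
    assume d: "degree q \<noteq> 0"
    then have lt: "degree q < ?p * degree q" using prime_gt_1_nat[OF prime_char[OF pos]] by simp
    then have "coeff q (?p * degree q) = 0" by (rule coeff_eq_0)
    then have "coeff Q (?p * degree q) = lead_coeff q ^ ?p"
      using coeff_power_top[of q "degree q" ?p] by (simp add: Q_def)
    moreover have "coeff Q (?p * degree q) = 0" unfolding Q using lt by (cases "?p * degree q") auto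
    ultimately have "lead_coeff q ^ ?p = 0" by simp
    then have "lead_coeff q x ^ ?p = 0" for x by (metis power_fun_apply zero_fun_apply)
    then have "lead_coeff q = 0" by (intro ext) simp
    then show False using d by auto
  qed
  then obtain a where "q = [:a:]" by (rule degree_eq_zeroE)
  then show ?thesis using q by (auto simp: coeffs_in_def coeff_pCons split: nat.splits)
qed

text \<open>A first evaluation of the identity gives \<open>s\<close>, which reduces
  \<open>r\<close> to an element of \<open>S\<close> plus a polynomial in \<open>h\<close> with
  constant coefficients. Artin-Schreier reduction removes its exponents divisible by p, and a second
  evaluation over the identity shows that the rest is linear. The image of the corrected function
  under \<open>frob \<epsilon>\<close> is then w + \<rho> h modulo \<open>S\<close>, which is
  invariant modulo \<open>S\<close>, and \<open>frob_descends\<close> transfers the invariance to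
  the function itself.\<close>

lemma artin_schreier_descent:
  assumes pos: "CHAR('k) > 0" and he: "h e = 0" and f: "f \<in> invs (adj S h)"
    and w: "w \<in> invs S" and eq: "frob \<epsilon> f - w \<in> adj S h"
  shows "\<exists>\<rho> s. s \<in> adj S h \<and> f - s \<in> invs S \<and> frob \<epsilon> (f - s) - (w + fscale \<rho> h) \<in> S"
proof -
  let ?tsub_adj_h = "adj S h" and ?p = "CHAR('k)"
  note sT = tsubD[OF tsub_adj_h]
  have hT: "h \<in> ?tsub_adj_h" by (rule adj_self[OF S'(1)])
  have hme: "h (m x e) - h x - h e = 0" for x using right_unit[OF invs_A[OF h]] he by simp
  define r where "r = frob \<epsilon> f - w"
  have r: "r \<in> ?tsub_adj_h" and fr: "frob \<epsilon> f = w + r" using eq by (auto simp: r_def)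
  obtain n a b where ab: "\<And>j. j < (n::nat) \<Longrightarrow> a j \<in> ?tsub_adj_h \<and> b j \<in> ?tsub_adj_h"
    and id: "\<And>z t z' t'. (\<Sum>j<n. e' z t (a j) * e' z' t' (b j)) ^ ?p - \<epsilon> * (\<Sum>j<n. e' z t (a j) * e' z' t' (b j))
      = (w (m z z') - w z - w z') + e' (m z z') (t + t' + (h (m z z') - h z - h z')) r - e' z t r - e' z' t' r"
    by (rule artin_schreier_identity[OF pos f w r fr]) (rule that; assumption)
  \<comment> \<open>The tensor at the formal points (x, 0) and (e, h x). Their product is (x, h x),
    where evaluation is honest evaluation at \<open>x\<close>; the other terms involve only (x, 0),
    which gives elements of \<open>S\<close>, and (e, h x), which gives polynomials in
    \<open>h\<close>.\<close>
  define s where "s = (\<Sum>j<n. (\<lambda>x. e' x 0 (a j)) * pev (runit (b j)) h)"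
  have s: "s \<in> ?tsub_adj_h" unfolding s_def
  proof (rule subalg_sum[OF sT(1)])
    fix j assume "j \<in> {..<n}"
    then have "a j \<in> ?tsub_adj_h" using ab by simp
    then show "(\<lambda>x. e' x 0 (a j)) * pev (runit (b j)) h \<in> ?tsub_adj_h"
      by (rule subalg_mult[OF sT(1) adj_base[OF S'(1) ev_zero] pev_in[OF sT(1) hT]])
  qed
  define r0 where "r0 = (\<lambda>x. e' x 0 r) + cst (w e)"
  have r0: "r0 \<in> S" unfolding r0_def by (intro subalg_add[OF S'(1)] ev_zero r subalg_cst[OF S'(1)])
  define F where "F = runit r"
  have "frob \<epsilon> s = r - r0 - pev F h"
  proof
    fix x
    have "s x = (\<Sum>j<n. e' x 0 (a j) * e' e (h x) (b j))" by (simp add: s_def ev_unit)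
    then have "frob \<epsilon> s x = (w (m x e) - w x - w e) + e' (m x e) (0 + h x + (h (m x e) - h x - h e)) r - e' x 0 r - e' e (h x) r"
      unfolding frob_apply using id[of x 0 e "h x"] by simp
    also have "\<dots> = r x - e' x 0 r - e' e (h x) r - w e"
      using right_unit[OF invs_A[OF w]] by (simp only: hme ev_right_unit[OF r] add_0 add_0_right ev_diag[OF S'(1) tr r]) simp
    finally show "frob \<epsilon> s x = (r - r0 - pev F h) x" by (simp add: r0_def F_def ev_unit)
  qed
  then have fs1: "frob \<epsilon> (f - s) = w + r0 + pev F h"
    unfolding frob_diff[OF pos] fr by simp
  obtain u F1 where F1: "F = F1 + (u ^ ?p - Polynomial.smult \<epsilon> u)" "\<forall>i>0. ?p dvd i \<longrightarrow> coeff F1 i = 0"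
    using artin_schreier_reduce[OF pos, of "Suc (degree F)" F \<epsilon>] by (auto simp: coeff_eq_0)
  define s2 where "s2 = s + pev u h"
  have s2: "s2 \<in> ?tsub_adj_h" unfolding s2_def by (intro subalg_add[OF sT(1)] s pev_in[OF sT(1)] hT)
  have "frob \<epsilon> (pev u h) = pev F h - pev F1 h"
    by (rule ext) (simp add: frob_apply F1(1))
  then have fs2: "frob \<epsilon> (f - s2) = w + (r0 + pev F1 h)"
    unfolding s2_def diff_diff_eq[symmetric] frob_diff[OF pos, of _ "f - s"] fs1 by simp
  have f2: "f - s2 \<in> invs ?tsub_adj_h"
    using fs.subspace_diff[OF subspace_invs[OF sT(4)] f] invs_superset[OF tsub_adj_h] s2 by blast
  define r2 where "r2 = r0 + pev F1 h"
  have r2: "r2 \<in> ?tsub_adj_h" unfolding r2_def by (intro subalg_add[OF sT(1)] adj_base[OF S'(1)] r0 pev_in[OF sT(1)] hT)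
  obtain n2 a2 b2 where ab2: "\<And>j. j < (n2::nat) \<Longrightarrow> a2 j \<in> ?tsub_adj_h \<and> b2 j \<in> ?tsub_adj_h"
    and id2: "\<And>z t z' t'. (\<Sum>j<n2. e' z t (a2 j) * e' z' t' (b2 j)) ^ ?p - \<epsilon> * (\<Sum>j<n2. e' z t (a2 j) * e' z' t' (b2 j))
      = (w (m z z') - w z - w z') + e' (m z z') (t + t' + (h (m z z') - h z - h z')) r2 - e' z t r2 - e' z' t' r2"
    by (rule artin_schreier_identity[OF pos f2 w r2 fs2[folded r2_def]]) (rule that; assumption)
  have er2: "e' e t r2 = r0 e + poly F1 t" for t
  proof -
    have ci: "coeffs_in S ([:r0:] + map_poly cst F1)"
      by (intro coeffs_in_add coeffs_in_const coeffs_in_map_poly_cst S' r0)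
    have r2p: "r2 = poly ([:r0:] + map_poly cst F1) h" by (simp add: r2_def pev_conv_poly)
    have "e' e t r2 = poly (map_poly (\<lambda>a. a e) ([:r0:] + map_poly cst F1)) t"
      unfolding r2p by (rule ev_poly[OF S'(1) tr ci])
    also have "map_poly (\<lambda>a. a e) ([:r0:] + map_poly cst F1) = [:r0 e:] + F1"
      by (rule poly_eqI) (simp add: coeff_map_poly coeff_pCons split: nat.splits)
    finally show ?thesis by simp
  qed
  have "degree F1 \<le> 1"
  proof (rule artin_schreier_linear[OF pos F1(2), of \<epsilon>])
    fix l :: 'k
    \<comment> \<open>The tensor at the formal points (e, t) and (e, l t), where \<open>r2\<close>
      becomes \<open>F1\<close> up to a constant.\<close>
    define G where "G = (\<Sum>j<n2. runit (a2 j) * pcompose (runit (b2 j)) [:0, l:])"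
    have "poly G t ^ ?p - \<epsilon> * poly G t = poly F1 ((1 + l) * t) - poly F1 t - poly F1 (l * t) + (- w e - r0 e)" for t
    proof -
      have "poly G t = (\<Sum>j<n2. e' e t (a2 j) * e' e (l * t) (b2 j))"
        by (simp add: G_def poly_sum poly_pcompose ev_unit mult.commute)
      then have "poly G t ^ ?p - \<epsilon> * poly G t
        = (w (m e e) - w e - w e) + e' (m e e) (t + l * t + (h (m e e) - h e - h e)) r2 - e' e t r2 - e' e (l * t) r2"
        using id2[of e t e "l * t"] by simp
      also have "\<dots> = - w e + e' e (t + l * t) r2 - e' e t r2 - e' e (l * t) r2"
        using right_unit[OF invs_A[OF w]] by (simp only: hme ev_right_unit[OF r2] add_0 add_0_right) simp
      finally show ?thesis unfolding er2 by (simp add: algebra_simps)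
    qed
    then show "\<exists>G c. \<forall>t. poly G t ^ ?p - \<epsilon> * poly G t = poly F1 ((1 + l) * t) - poly F1 t - poly F1 (l * t) + c"
      by blast
  qed
  define \<rho> where "\<rho> = coeff F1 1"
  have "poly F1 t = coeff F1 0 + \<rho> * t" for t
  proof -
    have "F1 = [:coeff F1 0, \<rho>:]"
      by (rule poly_eqI) (use \<open>degree F1 \<le> 1\<close> in \<open>auto simp: \<rho>_def coeff_pCons coeff_eq_0 split: nat.splits\<close>)
    then show ?thesis by (metis mult.commute mult_zero_left poly_0 poly_pCons add_0_right)
  qed
  then have pF1: "pev F1 h = cst (coeff F1 0) + fscale \<rho> h" by (intro ext) simp
  have final: "frob \<epsilon> (f - s2) - (w + fscale \<rho> h) \<in> S"
  proof -
    have "frob \<epsilon> (f - s2) - (w + fscale \<rho> h) = r0 + cst (coeff F1 0)" unfolding fs2 pF1 by simp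
    then show ?thesis using r0 subalg_add[OF S'(1)] subalg_cst[OF S'(1)] by metis
  qed
  have "f - s2 \<in> invs S"
  proof (rule invsI)
    show "f - s2 \<in> A" using invs_A[OF f2] .
    fix \<sigma> assume s: "\<sigma> \<in> Tr"
    define v where "v = frob \<epsilon> (f - s2) - (w + fscale \<rho> h)"
    have v: "v \<in> S" using final by (simp only: v_def)
    have wh: "w + fscale \<rho> h \<in> invs S"
      by (intro fs.subspace_add fs.subspace_scale subspace_invs S' w h)
    have "frob \<epsilon> ((f - s2 \<circ> \<sigma>) - (f - s2)) = (frob \<epsilon> (f - s2) \<circ> \<sigma>) - frob \<epsilon> (f - s2)"
      unfolding frob_diff[OF pos, of _ "f - s2 \<circ> \<sigma>"] frob_comp by (rule refl)
    also have "frob \<epsilon> (f - s2) = v + (w + fscale \<rho> h)" by (simp only: v_def diff_add_cancel)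
    also have "((v + (w + fscale \<rho> h)) \<circ> \<sigma>) - (v + (w + fscale \<rho> h))
      = ((v \<circ> \<sigma>) - v) + (((w + fscale \<rho> h) \<circ> \<sigma>) - (w + fscale \<rho> h))"
      by (rule ext) simp
    also have "\<dots> \<in> S"
      by (intro subalg_add[OF S'(1)] subalg_diff[OF S'(1)] tstableD[OF S'(2) s] v invsD[OF wh s])
    finally show "(f - s2 \<circ> \<sigma>) - (f - s2) \<in> S"
      by (rule frob_descends[OF pos invsD[OF f2 s]])
  qed
  then show ?thesis using s2 final by blast
qed

end

end

section \<open>Division of additive polynomials under composition\<close>

lemma additive_poly_monom: "addexp TYPE('k) l \<Longrightarrow> additive_poly (monom (c :: 'k::comm_ring_1) l)"
  by (auto simp: additive_poly_def)

lemma additive_poly_linear: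
  assumes "additive_poly (P :: 'k::comm_ring_1 poly)" "\<forall>i>1. coeff P i = 0"
  shows "P = monom (coeff P 1) 1"
proof (rule poly_eqI)
  fix i
  show "coeff P i = coeff (monom (coeff P 1) 1) i"
    using assms(2) additive_poly_sum_monom[OF assms(1)] by (cases "i = 0"; cases "i = 1") auto
qed

text \<open>Right division by X^p - c X in the ring of additive polynomials with composition as
  product. The remainder is additive of degree at most 1, hence of the form d X.\<close>

lemma additive_poly_division:
  fixes P :: "'k::field poly"
  assumes pos: "CHAR('k) > 0" and "additive_poly P" "\<forall>i > CHAR('k) ^ Suc a. coeff P i = 0"
  shows "\<exists>P2 d. additive_poly P2 \<and> (\<forall>i > CHAR('k) ^ a. coeff P2 i = 0) \<and>
    coeff P2 (CHAR('k) ^ a) = coeff P (CHAR('k) ^ Suc a) \<and> (c = 0 \<longrightarrow> d = coeff P 1) \<and>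
    (\<forall>x. poly P x = poly P2 (x ^ CHAR('k) - c * x) + d * x)"
  using assms(2,3)
proof (induction a arbitrary: P)
  case (0 P)
  let ?p = "CHAR('k)"
  have p: "?p > 1" by (rule prime_gt_1_nat[OF prime_char[OF pos]])
  define t where "t = coeff P ?p"
  define P' where "P' = P + monom (- t) ?p"
  have P': "additive_poly P'" unfolding P'_def
    using 0(1) additive_poly_monom[OF addexp_prime_power[OF refl pos, of 1]] by (simp add: additive_poly_plus)
  have "\<forall>i>1. coeff P' i = 0"
  proof (intro allI impI)
    fix i :: nat assume i: "i > 1"
    show "coeff P' i = 0"
    proof (rule ccontr)
      assume nz: "coeff P' i \<noteq> 0"
      then obtain j where j: "i = ?p ^ j" using P' addexp_prime_char[OF _ refl pos] unfolding additive_poly_def by blast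
      have "i \<noteq> ?p" using nz by (auto simp: P'_def t_def)
      then have "j \<noteq> 1" "j \<noteq> 0" using j i by (metis power_one_right, metis power_0 less_irrefl)
      then have "i > ?p" using j power_strict_increasing[of 1 j ?p] p by simp
      then show False using nz 0(2) by (auto simp: P'_def)
    qed
  qed
  from additive_poly_linear[OF P' this] have lin: "P' = monom (coeff P 1) 1"
    using p by (simp add: P'_def)
  have "P = P' + monom t ?p" by (simp add: P'_def flip: minus_monom)
  then have eq: "P = monom (coeff P 1) 1 + monom t ?p" using lin by metis
  have "poly P x = coeff P 1 * x + t * x ^ ?p" for x
    using arg_cong[OF eq, of "\<lambda>q. poly q x"] by (simp add: poly_monom)
  then have "poly P x = poly (monom t 1) (x ^ ?p - c * x) + (coeff P 1 + t * c) * x" for x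
    by (simp add: poly_monom algebra_simps)
  then show ?case
    by (intro exI[of _ "monom t 1"] exI[of _ "coeff P 1 + t * c"])
      (auto simp: t_def intro!: additive_poly_monom addexp_1 simp flip: One_nat_def)
next
  case (Suc a P)
  let ?p = "CHAR('k)"
  have p: "?p > 1" by (rule prime_gt_1_nat[OF prime_char[OF pos]])
  define n where "n = ?p ^ Suc a"
  have n: "n > 1" using p unfolding n_def by (intro one_less_power) auto
  define t where "t = coeff P (?p * n)"
  \<comment> \<open>This subtracts t (X^p - c X)^n, which has just two terms because
    \<open>n\<close> is a power of p.\<close>
  define P' where "P' = P + (monom (- t) (?p * n) + monom (t * c ^ n) n)"
  have "addexp TYPE('k) (?p * n)" "addexp TYPE('k) n"
    using addexp_prime_power[OF refl pos, of "Suc (Suc a)"] addexp_prime_power[OF refl pos, of "Suc a"]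
    by (simp_all add: n_def)
  then have P': "additive_poly P'" unfolding P'_def
    by (intro additive_poly_plus Suc.prems additive_poly_monom)
  have "\<forall>i>n. coeff P' i = 0"
  proof (intro allI impI)
    fix i :: nat assume i: "i > n"
    show "coeff P' i = 0"
    proof (rule ccontr)
      assume nz: "coeff P' i \<noteq> 0"
      then obtain j where j: "i = ?p ^ j" using P' addexp_prime_char[OF _ refl pos] unfolding additive_poly_def by blast
      have ne: "i \<noteq> ?p * n" using nz i by (auto simp: P'_def t_def)
      have "j > Suc a" using i j p power_increasing[of j "Suc a" ?p] unfolding n_def by (cases "j \<le> Suc a") auto
      moreover have "j \<noteq> Suc (Suc a)" using ne j by (auto simp: n_def)
      ultimately have "j > Suc (Suc a)" by simp
      then have "i > ?p ^ Suc (Suc a)" using j power_strict_increasing[of "Suc (Suc a)" j ?p] p by simp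
      then show False using nz Suc.prems(2) i by (auto simp: P'_def n_def)
    qed
  qed
  from Suc.IH[OF P' this[unfolded n_def]] obtain P2 d where P2: "additive_poly P2" "\<forall>i > ?p ^ a. coeff P2 i = 0"
    "c = 0 \<longrightarrow> d = coeff P' 1" "\<forall>x. poly P' x = poly P2 (x ^ ?p - c * x) + d * x" by blast
  have small: "?p ^ a < n" using p by (simp add: n_def)
  have 1: "coeff P' 1 = coeff P 1" if "c = 0" using n p that by (simp add: P'_def)
  have key: "(x ^ ?p - c * x) ^ n = x ^ (?p * n) - c ^ n * x ^ n" for x
    using power_char_power_add[OF pos, of "x ^ ?p - c * x" "c * x" "Suc a"]
    by (simp add: n_def[symmetric] power_mult power_mult_distrib del: power_Suc)
  have eq: "poly P x = poly (P2 + monom t n) (x ^ ?p - c * x) + d * x" for x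
  proof -
    have "poly P x = poly P' x + t * x ^ (?p * n) - t * c ^ n * x ^ n" by (simp add: P'_def poly_monom)
    then show ?thesis using P2(4) by (simp add: poly_monom key algebra_simps)
  qed
  show ?case
  proof (intro exI conjI allI impI)
    show "additive_poly (P2 + monom t n)"
      using P2(1) \<open>addexp TYPE('k) n\<close> by (intro additive_poly_plus additive_poly_monom)
    show "coeff (P2 + monom t n) i = 0" if i: "?p ^ Suc a < i" for i
    proof -
      have "n < i" using i by (simp only: n_def)
      then show ?thesis using P2(2) small by simp
    qed
    show "coeff (P2 + monom t n) (?p ^ Suc a) = coeff P (?p ^ Suc (Suc a))"
      using P2(2) small by (simp add: n_def t_def)
    show "d = coeff P 1" if "c = 0" using P2(3) 1 that by simp
    show "poly P x = poly (P2 + monom t n) (x ^ ?p - c * x) + d * x" for x by (rule eq)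
  qed
qed

text \<open>Scaling by \<open>\<mu>\<close> normalises a nonzero constant \<open>c\<close> to
  1.\<close>

lemma frob_fscale:
  fixes \<mu> :: "'k::field"
  assumes "CHAR('k) > 0" "\<mu> ^ (CHAR('k) - 1) * c = 1"
  shows "frob 1 (fscale \<mu> f) = fscale (\<mu> ^ CHAR('k)) (frob c f)"
proof
  fix x
  have "\<mu> ^ CHAR('k) = \<mu> * \<mu> ^ (CHAR('k) - 1)" using assms(1) by (simp add: power_eq_if)
  then have "\<mu> ^ CHAR('k) * (c * f x) = \<mu> * (\<mu> ^ (CHAR('k) - 1) * c) * f x" by (simp only: mult_ac)
  then have "\<mu> ^ CHAR('k) * (c * f x) = \<mu> * f x" by (simp only: assms(2) mult_1_right)
  then show "frob 1 (fscale \<mu> f) x = fscale (\<mu> ^ CHAR('k)) (frob c f) x"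
    by (simp only: frob_apply power_mult_distrib fscale_apply right_diff_distrib mult_1_left mult_1)
qed

section \<open>Transcendence of invariants after adjoining a list\<close>

context unipotent_algebra
begin

text \<open>The functions are removed from the last to the first. Each removal adds a multiple of
  the removed function to \<open>w\<close>, and the sum stays invariant modulo \<open>S\<close>;
  this is why the descent carries the parameter \<open>w\<close>.\<close>

lemma artin_schreier_descent_list:
  assumes pos: "CHAR('k) > 0" and S: "tsub S"
    and "set fs \<subseteq> invs S" "indep S fs" "\<forall>f\<in>set fs. f e = 0" "y \<in> invs (adjs S fs)" "w \<in> invs S"
      "frob \<epsilon> y - w \<in> adjs S fs"
  shows "\<exists>c s. s \<in> adjs S fs \<and> y - s \<in> invs S \<and>
    frob \<epsilon> (y - s) - w - (\<Sum>i<length fs. fscale (c i) (fs ! i)) \<in> S"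
  using assms(3-)
proof (induction fs arbitrary: y w rule: rev_induct)
  case Nil
  then show ?case using subalg_0[OF tsubD(1)[OF S]] by (intro exI[of _ "\<lambda>_. 0"] exI[of _ 0])
      (simp only: adjs.simps diff_0_right list.size lessThan_0 sum.empty simp_thms)
next
  case (snoc f fs)
  note S' = tsubD[OF S]
  let ?R = "adjs S fs"
  have fs: "set fs \<subseteq> invs S" "f \<in> invs S" using snoc.prems(1) by auto
  have R: "tsub ?R" using adjs_tsub fchain_of_invs S'(1) fs S by blast
  note R' = tsubD[OF R]
  have SR: "S \<subseteq> ?R" by (rule adjs_superset[OF S'(1)])
  have ind: "indep S fs" "transc ?R f" using snoc.prems(2) by (auto simp: indep_append)
  have fR: "f \<in> invs ?R" and wR: "w \<in> invs ?R" using fs snoc.prems(5) invs_mono[OF SR] by blast+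
  have e0: "f e = 0" "\<forall>f\<in>set fs. f e = 0" using snoc.prems(3) by auto
  have y: "y \<in> invs (adj ?R f)" "frob \<epsilon> y - w \<in> adj ?R f" using snoc.prems(4,6) by (simp_all only: adjs_append adjs.simps)
  obtain \<rho> s where s: "s \<in> adj ?R f" "y - s \<in> invs ?R" "frob \<epsilon> (y - s) - (w + fscale \<rho> f) \<in> ?R"
    using artin_schreier_descent[OF R fR ind(2) pos e0(1) y(1) wR y(2)] by blast
  have w': "w + fscale \<rho> f \<in> invs S"
    using subspace_invs[OF S'(4)] fs.subspace_add fs.subspace_scale snoc.prems(5) fs(2) by blast
  obtain c s' where c: "s' \<in> ?R" "y - s - s' \<in> invs S"
    "frob \<epsilon> (y - s - s') - (w + fscale \<rho> f) - (\<Sum>i<length fs. fscale (c i) (fs ! i)) \<in> S"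
    using snoc.IH[OF fs(1) ind(1) e0(2) s(2) w' s(3)] by blast
  define c' where "c' i = (if i < length fs then c i else \<rho>)" for i
  have "(\<Sum>i<length (fs @ [f]). fscale (c' i) ((fs @ [f]) ! i))
    = (\<Sum>i<length fs. fscale (c i) (fs ! i)) + fscale \<rho> f"
    by (simp add: c'_def nth_append)
  then have eq: "frob \<epsilon> (y - s - s') - w - (\<Sum>i<length (fs @ [f]). fscale (c' i) ((fs @ [f]) ! i))
    = frob \<epsilon> (y - s - s') - (w + fscale \<rho> f) - (\<Sum>i<length fs. fscale (c i) (fs ! i))"
    by (simp only: diff_diff_eq[symmetric] diff_right_commute add_diff_eq)
      (simp only: algebra_simps)
  have "s + s' \<in> adjs S (fs @ [f])"
    using subalg_add[OF subalg_adj[OF R'(1)] s(1) adj_base[OF R'(1) c(1)]] by (simp only: adjs_append adjs.simps)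
  moreover have "y - (s + s') = y - s - s'" by (simp only: diff_diff_eq)
  ultimately show ?case using c(2,3) eq by (intro exI[of _ c'] exI[of _ "s + s'"]) (simp only: simp_thms)
qed

definition Tcond :: "('q \<Rightarrow> 'k) set \<Rightarrow> bool" where
  "Tcond S \<longleftrightarrow> (\<forall>y\<in>invs S - S. transc S y)"

lemma not_transc_pev:
  assumes S: "subalg S" and "additive_poly P" "P \<noteq> 0" "pev P y \<in> S"
  shows "\<not> transc S y"
proof
  assume tr: "transc S y"
  let ?q = "map_poly cst P - [:pev P y:]"
  have "coeffs_in S ?q" by (intro coeffs_in_diff coeffs_in_map_poly_cst coeffs_in_const assms)
  moreover have "poly ?q y = 0" by (simp add: pev_conv_poly)
  ultimately have "?q = 0" using tr unfolding transc_def by blast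
  have "coeff P i = 0" if "i > 0" for i
  proof -
    have "coeff ?q i = cst (coeff P i)" using that by (cases i) auto
    then show ?thesis using \<open>?q = 0\<close> by simp
  qed
  moreover have "coeff P 0 = 0" by (rule additive_poly_sum_monom[OF assms(2)])
  ultimately have "P = 0" by (intro poly_eqI) (metis coeff_0 gr0I)
  then show False using assms(3) by simp
qed

text \<open>A function algebraic over the constants takes its values among the finitely many roots
  of one polynomial, so connectedness makes it constant.\<close>

lemma Tcond_constants: "Tcond (range cst)"
  unfolding Tcond_def
proof (intro ballI, rule ccontr)
  fix y assume y: "y \<in> invs (range cst) - range cst" and alg: "\<not> transc (range cst) y"
  obtain p where p: "coeffs_in (range cst) p" "poly p y = 0" "p \<noteq> 0" using alg by (auto simp: transc_def)
  define q where "q = map_poly (\<lambda>a. a e) p"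
  have cq: "coeff p i = cst (coeff q i)" for i
  proof -
    obtain c where "coeff p i = cst c" using p(1) by (auto simp: coeffs_in_def)
    then show ?thesis by (simp add: q_def coeff_map_poly)
  qed
  have "map_poly cst q = p" by (rule poly_eqI) (simp add: cq)
  then have "pev q y = 0" "q \<noteq> 0" using p by (auto simp: pev_conv_poly)
  then have "range y \<subseteq> {z. poly q z = 0}" by (auto dest: fun_cong)
  then have "finite (range y)" using poly_roots_finite[OF \<open>q \<noteq> 0\<close>] finite_subset by blast
  moreover have "y \<in> A" using y invs_A by blast
  ultimately obtain c where "y = cst c" using conn by blast
  then show False using y by blast
qed

text \<open>No invariant modulo \<open>S\<close> has its p-th power or its Artin-Schreier image
  congruent to a nontrivial combination of the list. These two operators are the only ones to
  exclude, since scaling reduces every other constant to 1.\<close>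

definition saturated :: "('q \<Rightarrow> 'k) set \<Rightarrow> ('q \<Rightarrow> 'k) list \<Rightarrow> bool" where
  "saturated S fs \<longleftrightarrow> (CHAR('k) > 0 \<longrightarrow> (\<forall>\<epsilon>\<in>{0,1}. \<forall>c. \<forall>y\<in>invs S.
     frob \<epsilon> y - (\<Sum>i<length fs. fscale (c i) (fs ! i)) \<in> S \<longrightarrow> (\<forall>i<length fs. c i = 0)))"

definition frob_poly :: "'k \<Rightarrow> 'k poly" where "frob_poly c = monom 1 CHAR('k) - monom c 1"

lemma additive_frob_poly:
  assumes "CHAR('k) > 0" shows "additive_poly (frob_poly c)"
proof -
  have "frob_poly c = monom 1 CHAR('k) + (- monom c 1)" by (simp add: frob_poly_def)
  then show ?thesis
    using additive_poly_monom[OF addexp_prime_power[OF refl assms, of 1]] additive_poly_monom[OF addexp_1]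
    by (metis additive_poly_plus power_one_right)
qed

lemma frob_poly_nonzero: assumes "CHAR('k) > 0" shows "frob_poly c \<noteq> 0"
proof -
  have "coeff (frob_poly c) CHAR('k) = 1"
    using prime_gt_1_nat[OF prime_char[OF assms]] by (auto simp: frob_poly_def)
  then show ?thesis by auto
qed

lemma pev_frob_poly: "pev (frob_poly c) y = frob c y"
  by (rule ext) (simp add: frob_poly_def frob_apply poly_monom)

text \<open>Among all algebraic invariants outside the larger ring and their additive polynomials,
  take a pair with \<open>P\<close> of least degree. \<open>P\<close> factors through some X^p - c
  X, and minimality puts \<open>frob c y\<close> into the ring. After scaling \<open>c\<close> to 0
  or 1, the descent replaces \<open>y\<close> by an invariant modulo \<open>S\<close>; saturation
  makes it algebraic over \<open>S\<close>, so it lies in \<open>S\<close>.\<close>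

lemma Tcond_adjs:
  assumes S: "tsub S" and T: "Tcond S" and fs: "set fs \<subseteq> invs S" "indep S fs" "\<forall>f\<in>set fs. f e = 0"
    and sat: "saturated S fs"
  shows "Tcond (adjs S fs)"
proof (rule ccontr)
  note S' = tsubD[OF S]
  let ?R = "adjs S fs" and ?p = "CHAR('k)"
  have R: "tsub ?R" using adjs_tsub fchain_of_invs S'(1) fs S by blast
  note R' = tsubD[OF R]
  have SR: "S \<subseteq> ?R" by (rule adjs_superset[OF S'(1)])
  define rel where "rel y P \<longleftrightarrow> y \<in> invs ?R \<and> y \<notin> ?R \<and> lead_coeff P = 1 \<and> degree P > 0 \<and> additive_poly P \<and> pev P y \<in> ?R"
    for y P
  assume "\<not> Tcond ?R"
  then obtain y0 where y0: "y0 \<in> invs ?R" "y0 \<notin> ?R" "\<not> transc ?R y0" by (auto simp: Tcond_def)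
  from algebraic_additive[OF R y0(1,3)] y0 obtain P0 where "rel y0 P0" by (auto simp: rel_def)
  then have "\<exists>n y P. rel y P \<and> degree P = n" by blast
  then obtain n where n: "\<exists>y P. rel y P \<and> degree P = n" "\<And>l. l < n \<Longrightarrow> \<not> (\<exists>y P. rel y P \<and> degree P = l)"
    using exists_least_iff[of "\<lambda>n. \<exists>y P. rel y P \<and> degree P = n"] by blast
  then obtain y P where yP: "rel y P" and min: "\<And>y' P'. rel y' P' \<Longrightarrow> degree P \<le> degree P'"
    by (metis linorder_not_less)
  have y: "y \<in> invs ?R" "y \<notin> ?R" and P: "lead_coeff P = 1" "degree P > 0" "additive_poly P" "pev P y \<in> ?R"
    using yP by (auto simp: rel_def)
  have add: "addexp TYPE('k) (degree P)" using P(1,3) unfolding additive_poly_def by auto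
  have d1: "degree P \<noteq> 1"
  proof
    assume d: "degree P = 1"
    then have "\<forall>i>1. coeff P i = 0" by (auto simp: coeff_eq_0)
    from additive_poly_linear[OF P(3) this] have "P = monom 1 1" using P(1) d by simp
    then have "pev P y = y" by (auto simp: poly_monom)
    then show False using P(4) y(2) by simp
  qed
  have pos: "?p > 0" using addexp_char_0[OF add] d1 by auto
  have p: "?p > 1" by (rule prime_gt_1_nat[OF prime_char[OF pos]])
  obtain j where j: "degree P = ?p ^ j" using addexp_prime_char[OF add refl pos] by blast
  then obtain a where a: "degree P = ?p ^ Suc a" using d1 by (cases j) auto
  obtain c where c: "frob c y \<in> ?R"
  proof -
    have dP: "\<forall>i > ?p ^ Suc a. coeff P i = 0" using a by (auto simp: coeff_eq_0)
    obtain c P2 where P2: "additive_poly P2" "\<forall>i > ?p ^ a. coeff P2 i = 0"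
      "coeff P2 (?p ^ a) = coeff P (?p ^ Suc a)" "\<forall>x. poly P x = poly P2 (x ^ ?p - c * x)"
    proof (cases "coeff P 1 = 0")
      case True
      obtain P2 d where "additive_poly P2" "\<forall>i > ?p ^ a. coeff P2 i = 0"
        "coeff P2 (?p ^ a) = coeff P (?p ^ Suc a)" "(0 :: 'k) = 0 \<longrightarrow> d = coeff P 1" "\<forall>x. poly P x = poly P2 (x ^ ?p - 0 * x) + d * x"
        using additive_poly_division[OF pos P(3) dP, of 0] by blast
      then show thesis using True that[of P2 0] by simp
    next
      case False
      obtain Q where Q: "P = pCons 0 Q" using additive_poly_sum_monom[OF P(3)] by (metis coeff_pCons_0 pCons_cases)
      have "degree Q > 0" using Q d1 P(2) by (cases "Q = 0") auto
      then obtain z where z: "poly Q z = 0" using alg_closed_imp_poly_has_root by blast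
      have "z \<noteq> 0" using z False Q by (auto simp: poly_0_coeff_0)
      \<comment> \<open>With this \<open>c\<close> the root \<open>z\<close> of \<open>P\<close> is
        also a root of X^p - c X, so the remainder d X vanishes at a nonzero point and d =
        0.\<close>
      define c where "c = z ^ (?p - 1)"
      have zc: "z ^ ?p - c * z = 0" using pos unfolding c_def by (metis Suc_diff_1 power_Suc2 cancel_comm_monoid_add_class.diff_cancel)
      obtain P2 d where P2: "additive_poly P2" "\<forall>i > ?p ^ a. coeff P2 i = 0"
        "coeff P2 (?p ^ a) = coeff P (?p ^ Suc a)" "\<forall>x. poly P x = poly P2 (x ^ ?p - c * x) + d * x"
        using additive_poly_division[OF pos P(3) dP, of c] by blast
      have "poly P z = 0" using Q z by simp
      then have "d * z = 0" using P2(4)[rule_format, of z] zc additive_poly_at_0[OF P2(1)] by simp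
      then show thesis using that[of P2 c] P2 \<open>z \<noteq> 0\<close> by simp
    qed
    have dP2: "degree P2 = ?p ^ a"
    proof (rule antisym)
      show "degree P2 \<le> ?p ^ a" using P2(2) by (intro degree_le) auto
      show "?p ^ a \<le> degree P2" using P2(3) P(1) a by (intro le_degree) auto
    qed
    have fy: "pev P2 (frob c y) = pev P y" by (rule ext) (simp add: frob_apply P2(4))
    have "frob c y \<in> ?R"
    proof (rule ccontr)
      assume "frob c y \<notin> ?R"
      moreover have "frob c y \<in> invs ?R"
        using pev_invs[OF R'(1) y(1) additive_frob_poly[OF pos]] by (simp only: pev_frob_poly)
      ultimately have "rel (frob c y) P2"
        unfolding rel_def using P2(1,3) dP2 P(1,4) a fy pos by simp
      then show False using min a dP2 p by fastforce
    qed
    then show thesis using that by blast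
  qed
  obtain \<epsilon> z where z: "\<epsilon> \<in> {0, 1 :: 'k}" "z \<in> invs ?R" "z \<notin> ?R" "frob \<epsilon> z \<in> ?R"
  proof (cases "c = 0")
    case True
    then show thesis using that[of 0 y] y c by simp
  next
    case False
    from root_exists[of "?p - 1" "1 / c"] p obtain \<mu> where "\<mu> ^ (?p - 1) = 1 / c" by auto
    then have \<mu>: "\<mu> ^ (?p - 1) * c = 1" using False by simp
    have m0: "\<mu> \<noteq> 0" using \<mu> p by (auto simp: power_0_left)
    have "fscale (1 / \<mu>) (fscale \<mu> y) = y" using m0 by (auto simp: fun_eq_iff)
    then have "fscale \<mu> y \<notin> ?R" using y(2) subalg_scale[OF R'(1), of "fscale \<mu> y" "1 / \<mu>"] by (metis (full_types))
    moreover have "frob 1 (fscale \<mu> y) \<in> ?R" unfolding frob_fscale[OF pos \<mu>] by (rule subalg_scale[OF R'(1) c])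
    moreover have "fscale \<mu> y \<in> invs ?R" by (rule fs.subspace_scale[OF subspace_invs[OF R'(4)] y(1)])
    ultimately show thesis using that[of 1 "fscale \<mu> y"] by blast
  qed
  have 0: "0 \<in> invs S" by (rule fs.subspace_0[OF subspace_invs[OF S'(4)]])
  obtain d s where s: "s \<in> ?R" "z - s \<in> invs S" "frob \<epsilon> (z - s) - 0 - (\<Sum>i<length fs. fscale (d i) (fs ! i)) \<in> S"
    using artin_schreier_descent_list[OF pos S fs z(2) 0, of \<epsilon>] z(4) by auto
  have "\<forall>i<length fs. d i = 0" using sat s(2,3) z(1) pos unfolding saturated_def diff_0_right by blast
  then have "(\<Sum>i<length fs. fscale (d i) (fs ! i)) = 0" by (intro sum.neutral) (auto simp: fun_eq_iff)
  then have "pev (frob_poly \<epsilon>) (z - s) \<in> S" using s(3) by (simp add: pev_frob_poly)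
  then have "\<not> transc S (z - s)" using not_transc_pev[OF S'(1) additive_frob_poly[OF pos] frob_poly_nonzero[OF pos]] by blast
  then have "z - s \<in> S" using T s(2) unfolding Tcond_def by blast
  then have "z - s \<in> ?R" using SR by blast
  from subalg_add[OF R'(1) this s(1)] have "z \<in> ?R" by simp
  then show False using z(3) by simp
qed

end

section \<open>Linear independence and bases modulo a subspace\<close>

context ac_vector_space
begin

definition indep_mod :: "'b set \<Rightarrow> 'b set \<Rightarrow> bool" where
  "indep_mod W B \<longleftrightarrow> finite B \<and> (\<forall>c. (\<Sum>b\<in>B. c b *s b) \<in> W \<longrightarrow> (\<forall>b\<in>B. c b = 0))"

lemma indep_mod_card:
  assumes W: "subspace W" and B: "indep_mod W B" and E: "finite E" "\<And>x. x \<in> B \<Longrightarrow> \<exists>v\<in>span E. x - v \<in> W"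
  shows "card B \<le> card E"
proof (rule ccontr)
  assume "\<not> card B \<le> card E"
  then have lt: "Suc (card E) \<le> card B" by simp
  obtain h where h: "bij_betw h {0..<card B} B" using B ex_bij_betw_nat_finite unfolding indep_mod_def by blast
  have hB: "h i \<in> B" if "i \<le> card E" for i using that lt h by (auto simp: bij_betw_def)
  obtain v where v: "\<And>x. x \<in> B \<Longrightarrow> v x \<in> span E \<and> x - v x \<in> W" using E(2) by metis
  obtain c where c: "\<exists>i\<le>card E. c i \<noteq> 0" "(\<Sum>i\<le>card E. c i *s v (h i)) = 0"
    using family_dependent[OF E(1), of "\<lambda>i. v (h i)"] v hB by blast
  define d where "d b = (let i = inv_into {0..<card B} h b in if i \<le> card E then c i else 0)" for b
  have dh: "d (h i) = (if i \<le> card E then c i else 0)" if "i < card B" for i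
    using that h by (simp add: d_def bij_betw_def)
  have "(\<Sum>b\<in>B. d b *s b) = (\<Sum>i\<in>{0..<card B}. d (h i) *s h i)"
    by (rule sum.reindex_bij_betw[OF h, symmetric])
  also have "\<dots> = (\<Sum>i\<in>{..card E}. c i *s h i)"
    using lt by (intro sum.mono_neutral_cong_right) (auto simp: dh)
  also have "\<dots> = (\<Sum>i\<le>card E. c i *s (h i - v (h i)))"
    using c(2) by (simp add: scale_right_diff_distrib sum_subtractf)
  also have "\<dots> \<in> W" using v hB by (intro subspace_sum[OF W] subspace_scale[OF W]) auto
  finally have "\<forall>b\<in>B. d b = 0" using B by (auto simp: indep_mod_def)
  moreover obtain i where "i \<le> card E" "c i \<noteq> 0" using c(1) by blast
  ultimately show False using dh[of i] hB[of i] lt by auto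
qed

text \<open>The basis is taken inside \<open>X\<close>, so that its members keep the properties of
  \<open>X\<close>, such as vanishing at the identity or being translates of one function.\<close>

lemma basis_mod_exists:
  assumes W: "subspace W" and E: "finite E" "\<forall>x\<in>X. \<exists>v\<in>span E. x - v \<in> W"
  shows "\<exists>B\<subseteq>X. indep_mod W B \<and> (\<forall>x\<in>X. \<exists>c. x - (\<Sum>b\<in>B. c b *s b) \<in> W)"
proof -
  define P where "P B \<longleftrightarrow> B \<subseteq> X \<and> indep_mod W B" for B
  have "P {}" by (simp add: P_def indep_mod_def)
  moreover have "\<forall>B. P B \<longrightarrow> card B < Suc (card E)"
  proof (intro allI impI)
    fix B assume B: "P B"
    have "card B \<le> card E" by (rule indep_mod_card[OF W _ E(1)]) (use B E(2) in \<open>auto simp: P_def\<close>)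
    then show "card B < Suc (card E)" by simp
  qed
  ultimately have "\<exists>B. P B \<and> (\<forall>C. P C \<longrightarrow> card C \<le> card B)" by (rule Lattices_Big.ex_has_greatest_nat)
  then obtain B where B: "P B" "\<And>C. P C \<Longrightarrow> card C \<le> card B" by blast
  have fin: "finite B" and ind: "\<And>c. (\<Sum>b\<in>B. c b *s b) \<in> W \<Longrightarrow> \<forall>b\<in>B. c b = 0"
    using B(1) unfolding P_def indep_mod_def by blast+
  show ?thesis
  proof (intro exI[of _ B] conjI ballI)
    show "B \<subseteq> X" "indep_mod W B" using B(1) by (auto simp: P_def)
    fix x assume x: "x \<in> X"
    show "\<exists>c. x - (\<Sum>b\<in>B. c b *s b) \<in> W"
    proof (cases "x \<in> B")
      case True
      have "(\<Sum>b\<in>B. (if b = x then 1 else 0) *s b) = (\<Sum>b\<in>{x}. 1 *s b)"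
        using True fin by (intro sum.mono_neutral_cong_right) auto
      then have "x - (\<Sum>b\<in>B. (if b = x then 1 else 0) *s b) = 0" by simp
      then show ?thesis using subspace_0[OF W] by (intro exI[of _ "\<lambda>b. if b = x then 1 else 0"]) simp
    next
      case False
      have "card (insert x B) = Suc (card B)" using False fin by simp
      then have "\<not> P (insert x B)" using B(2)[of "insert x B"] by auto
      then have "\<not> indep_mod W (insert x B)" using B(1) x by (auto simp: P_def)
      then obtain c where c: "(\<Sum>b\<in>insert x B. c b *s b) \<in> W" "\<exists>b\<in>insert x B. c b \<noteq> 0"
        using fin by (auto simp: indep_mod_def)
      have c': "c x *s x + (\<Sum>b\<in>B. c b *s b) \<in> W" using c(1) fin False by simp
      have cx: "c x \<noteq> 0"
      proof
        assume "c x = 0"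
        then have "(\<Sum>b\<in>B. c b *s b) \<in> W" using c' by simp
        from ind[OF this] show False using c(2) \<open>c x = 0\<close> by auto
      qed
      have "inverse (c x) *s (c x *s x + (\<Sum>b\<in>B. c b *s b)) \<in> W" by (rule subspace_scale[OF W c'])
      moreover have "inverse (c x) *s (c x *s x + (\<Sum>b\<in>B. c b *s b)) = x - (\<Sum>b\<in>B. (- (inverse (c x) * c b)) *s b)"
        using cx by (simp add: scale_right_distrib scale_sum_right sum_negf)
      ultimately show ?thesis by (intro exI[of _ "\<lambda>b. - (inverse (c x) * c b)"]) simp
    qed
  qed
qed

text \<open>The coordinate at \<open>b\<close> modulo \<open>W\<close>, extended to the whole space.
  The extension matters because the tensor factors in the expansion of the action lie outside the
  span of \<open>B\<close> and \<open>W\<close> in general.\<close>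

lemma dual_functional:
  assumes W: "subspace W" and B: "indep_mod W B" and b: "b \<in> B"
  obtains \<phi> :: "'b \<Rightarrow> 'a" where "\<And>x y. \<phi> (x + y) = \<phi> x + \<phi> y" "\<And>c x. \<phi> (c *s x) = c * \<phi> x"
    "\<And>w. w \<in> W \<Longrightarrow> \<phi> w = 0" "\<And>b'. b' \<in> B \<Longrightarrow> \<phi> b' = (if b' = b then 1 else 0)"
proof -
  have fin: "finite B" using B by (simp add: indep_mod_def)
  define W' where "W' = span (W \<union> (B - {b}))"
  have bW: "b \<notin> W'"
  proof
    assume "b \<in> W'"
    then have "b \<in> {x + y |x y. x \<in> span W \<and> y \<in> span (B - {b})}" unfolding W'_def span_Un .
    moreover have "span W = W" using W span_eq_iff by blast
    ultimately obtain x y where xy: "b = x + y" "x \<in> W" "y \<in> span (B - {b})" by blast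
    obtain u where u: "y = (\<Sum>v\<in>B - {b}. u v *s v)" using xy(3) fin by (auto simp: span_finite)
    define c where "c v = (if v = b then 1 else - u v)" for v
    have "(\<Sum>v\<in>B. c v *s v) = b + (\<Sum>v\<in>B - {b}. c v *s v)"
      using sum.remove[OF fin b, of "\<lambda>v. c v *s v"] by (simp add: c_def)
    also have "(\<Sum>v\<in>B - {b}. c v *s v) = - y"
      unfolding u sum_negf[symmetric] by (rule sum.cong) (auto simp: c_def)
    also have "b + - y = x" using xy(1) by simp
    finally have "\<forall>v\<in>B. c v = 0" using B xy(2) unfolding indep_mod_def by blast
    then have "c b = 0" using b by blast
    then show False by (simp add: c_def)
  qed
  obtain \<pi> where \<pi>: "lin \<pi>" "\<And>v. \<pi> v \<in> W'" "\<And>w. w \<in> W' \<Longrightarrow> \<pi> w = w"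
    by (rule projection_exists[OF subspace_span[of "W \<union> (B - {b})", folded W'_def]]) (rule that; assumption)
  define c where "c = b - \<pi> b"
  have "c \<noteq> 0" using bW \<pi>(2)[of b] by (auto simp: c_def)
  then have "independent {c}" by (simp add: dependent_single)
  obtain C where C: "{c} \<subseteq> C" "independent C" "UNIV \<subseteq> span C"
    by (rule maximal_independent_subset_extend[OF subset_UNIV \<open>independent {c}\<close>]) (rule that; assumption)
  have sp: "v \<in> span C" for v using C(3) by blast
  define \<phi> where "\<phi> v = representation C (v - \<pi> v) c" for v
  have add: "\<phi> (x + y) = \<phi> x + \<phi> y" for x y
  proof -
    have eq: "x + y - \<pi> (x + y) = (x - \<pi> x) + (y - \<pi> y)" by (simp add: lin_add[OF \<pi>(1)])
    show ?thesis unfolding \<phi>_def eq by (simp only: representation_add[OF C(2) sp sp])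
  qed
  have scale: "\<phi> (a *s x) = a * \<phi> x" for a x
  proof -
    have eq: "a *s x - \<pi> (a *s x) = a *s (x - \<pi> x)" by (simp add: lin_scale[OF \<pi>(1)] scale_right_diff_distrib)
    show ?thesis unfolding \<phi>_def eq by (simp only: representation_scale[OF C(2) sp])
  qed
  have zero: "\<phi> w = 0" if "w \<in> W'" for w using \<pi>(3)[OF that] by (simp add: \<phi>_def representation_zero)
  show thesis
  proof (rule that)
    show "\<phi> (x + y) = \<phi> x + \<phi> y" for x y by (rule add)
    show "\<phi> (a *s x) = a * \<phi> x" for a x by (rule scale)
    show "\<phi> w = 0" if "w \<in> W" for w using that by (intro zero) (auto simp: W'_def intro: span_base)
    fix b' assume b': "b' \<in> B"
    show "\<phi> b' = (if b' = b then 1 else 0)"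
    proof (cases "b' = b")
      case True
      have "\<phi> b = 1" unfolding \<phi>_def c_def[symmetric] using C(1) by (simp add: representation_basis[OF C(2)])
      then show ?thesis using True by simp
    next
      case False
      then have "b' \<in> W'" using b' by (auto simp: W'_def intro: span_base)
      then show ?thesis using zero False by simp
    qed
  qed
qed

lemma sum_functional:
  assumes "\<And>x y. \<phi> (x + y) = \<phi> x + \<phi> y" "\<And>c x. \<phi> (c *s x) = c * \<phi> x"
  shows "\<phi> (\<Sum>i\<in>I. c i *s f i) = (\<Sum>i\<in>I. c i * (\<phi> (f i) :: 'a))"
proof -
  have "\<phi> 0 = 0" using assms(2)[of 0 0] by simp
  then show ?thesis by (induction I rule: infinite_finite_induct) (auto simp: assms)
qed

end

section \<open>Actions of a connected group\<close>

text \<open>\<open>K\<close> stands for the coordinate ring of the acting group; it enters through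
  its linear structure and through connectedness in the form \<open>K_conn\<close>. The composite in
  \<open>act_comp\<close> is merely some element of \<open>\<Gamma>\<close>, which leaves room for
  the reversed order of a right action.\<close>

locale unipotent_G_algebra = unipotent_algebra m e A
  for m :: "'q \<Rightarrow> 'q \<Rightarrow> 'q" and e :: 'q and A :: "('q \<Rightarrow> 'k::alg_closed_field) set" +
  fixes \<Gamma> :: "'g set" and \<alpha> :: "'g \<Rightarrow> 'q \<Rightarrow> 'q" and K :: "('g \<Rightarrow> 'k) set"
  assumes act_A: "g \<in> \<Gamma> \<Longrightarrow> f \<in> A \<Longrightarrow> f \<circ> \<alpha> g \<in> A"
    and act_mult: "g \<in> \<Gamma> \<Longrightarrow> f \<in> A \<Longrightarrow> f (\<alpha> g (m x y)) = f (m (\<alpha> g x) (\<alpha> g y))"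
    and act_comp: "g \<in> \<Gamma> \<Longrightarrow> h \<in> \<Gamma> \<Longrightarrow> \<exists>l\<in>\<Gamma>. \<forall>f\<in>A. f \<circ> \<alpha> g \<circ> \<alpha> h = f \<circ> \<alpha> l"
    and act_one: "\<exists>u\<in>\<Gamma>. \<forall>f\<in>A. f \<circ> \<alpha> u = f"
    and act_rational: "f \<in> A \<Longrightarrow> \<exists>(n::nat) a b. (\<forall>j<n. a j \<in> K \<and> b j \<in> A) \<and>
      (\<forall>g\<in>\<Gamma>. \<forall>x. f (\<alpha> g x) = (\<Sum>j<n. a j g * b j x))"
    and K: "fs.subspace K"
    and K_conn: "\<beta> \<in> K \<Longrightarrow> finite (\<beta> ` \<Gamma>) \<Longrightarrow> \<exists>c. \<forall>g\<in>\<Gamma>. \<beta> g = c"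
begin

definition gstable :: "('q \<Rightarrow> 'k) set \<Rightarrow> bool" where
  "gstable U \<longleftrightarrow> (\<forall>g\<in>\<Gamma>. \<forall>f\<in>U. f \<circ> \<alpha> g \<in> U)"

lemma gstableD: "gstable U \<Longrightarrow> g \<in> \<Gamma> \<Longrightarrow> f \<in> U \<Longrightarrow> f \<circ> \<alpha> g \<in> U"
  by (simp add: gstable_def)

lemma gstable_consts: "gstable (range cst)"
  by (auto simp: gstable_def)

lemma gstable_invs: assumes S: "tsub S" and "gstable S" shows "gstable (invs S)"
  unfolding gstable_def
proof (intro ballI invsI)
  fix g f assume g: "g \<in> \<Gamma>" and f: "f \<in> invs S"
  show "f \<circ> \<alpha> g \<in> A" by (rule act_A[OF g invs_A[OF f]])
  fix \<sigma> assume "\<sigma> \<in> Tr"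
  then consider a where "\<sigma> = R a" | a where "\<sigma> = m a" by (auto simp: Tr_def)
  then show "((f \<circ> \<alpha> g) \<circ> \<sigma>) - (f \<circ> \<alpha> g) \<in> S"
  proof cases
    case 1
    have "((f \<circ> \<alpha> g) \<circ> \<sigma>) - (f \<circ> \<alpha> g) = ((f \<circ> R (\<alpha> g a)) - f) \<circ> \<alpha> g"
      by (rule ext) (simp add: 1 act_mult[OF g invs_A[OF f]])
    then show ?thesis using gstableD[OF assms(2) g invsD[OF f Tr_right]] by metis
  next
    case 2
    have "((f \<circ> \<alpha> g) \<circ> \<sigma>) - (f \<circ> \<alpha> g) = ((f \<circ> m (\<alpha> g a)) - f) \<circ> \<alpha> g"
      by (rule ext) (simp add: 2 act_mult[OF g invs_A[OF f]])
    then show ?thesis using gstableD[OF assms(2) g invsD[OF f Tr_left]] by metis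
  qed
qed

lemma gstable_span: assumes "gstable X" shows "gstable (fs.span X)"
  unfolding gstable_def
proof (intro ballI)
  fix g f assume g: "g \<in> \<Gamma>" and f: "f \<in> fs.span X"
  have "fs.subspace {f. f \<circ> \<alpha> g \<in> fs.span X}"
    by (rule fs.subspace_lin_vimage) (auto simp: fs.lin_def fun_plus_comp fscale_comp fs.subspace_span)
  moreover have "X \<subseteq> {f. f \<circ> \<alpha> g \<in> fs.span X}" using gstableD[OF assms g] fs.span_base by blast
  ultimately show "f \<circ> \<alpha> g \<in> fs.span X" using fs.span_minimal f by blast
qed

lemma gstable_algebra_gen: assumes "gstable X" shows "gstable (algebra_gen X)"
  unfolding gstable_def
proof (intro ballI)
  fix g f assume g: "g \<in> \<Gamma>" and f: "f \<in> algebra_gen X"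
  have "subalg {f. f \<circ> \<alpha> g \<in> algebra_gen X}"
    using subalg_algebra_gen[of X] by (auto simp: subalg_def fun_plus_comp fun_times_comp)
  moreover have "X \<subseteq> {f. f \<circ> \<alpha> g \<in> algebra_gen X}" using gstableD[OF assms g] algebra_gen_superset by blast
  ultimately show "f \<circ> \<alpha> g \<in> algebra_gen X" using algebra_gen_minimal f by blast
qed

definition fdmod :: "('q \<Rightarrow> 'k) set \<Rightarrow> ('q \<Rightarrow> 'k) set \<Rightarrow> bool" where
  "fdmod S M \<longleftrightarrow> (\<exists>E. finite E \<and> (\<forall>u\<in>M. \<exists>v\<in>fs.span E. u - v \<in> S))"

definition irr :: "('q \<Rightarrow> 'k) set \<Rightarrow> ('q \<Rightarrow> 'k) set \<Rightarrow> bool" where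
  "irr S M \<longleftrightarrow> fs.subspace M \<and> S \<subset> M \<and> M \<subseteq> invs S \<and> gstable M \<and> fdmod S M \<and>
     (\<forall>N. fs.subspace N \<longrightarrow> gstable N \<longrightarrow> S \<subset> N \<longrightarrow> N \<subseteq> M \<longrightarrow> N = M)"

definition translates :: "('q \<Rightarrow> 'k) \<Rightarrow> ('q \<Rightarrow> 'k) set" where
  "translates f = (\<lambda>g. f \<circ> \<alpha> g) ` \<Gamma>"

lemma gstable_translates: "f \<in> A \<Longrightarrow> gstable (translates f)"
  unfolding gstable_def translates_def using act_comp by blast

lemma translates_self: "f \<in> A \<Longrightarrow> f \<in> translates f"
  unfolding translates_def using act_one by (metis image_eqI)

lemma translates_fd: assumes "f \<in> A" obtains E where "finite E" "translates f \<subseteq> fs.span E"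
proof -
  obtain n a b where ab: "\<forall>g\<in>\<Gamma>. \<forall>x. f (\<alpha> g x) = (\<Sum>j<(n::nat). a j g * b j x)"
    using act_rational[OF assms] by blast
  have "f \<circ> \<alpha> g = (\<Sum>j<n. fscale (a j g) (b j))" if "g \<in> \<Gamma>" for g
    using ab that by (auto simp: fun_eq_iff)
  moreover have "(\<Sum>j<n. fscale (a j g) (b j)) \<in> fs.span (b ` {..<n})" for g
    by (intro fs.span_sum fs.span_scale fs.span_base) simp
  ultimately have "translates f \<subseteq> fs.span (b ` {..<n})" unfolding translates_def by auto
  then show thesis using that[of "b ` {..<n}"] by blast
qed

text \<open>The second conclusion keeps \<open>M\<close> inside every stable space above
  \<open>S\<close> that contains \<open>y\<close>. It passes a property of \<open>y\<close> that
  defines such a space on to elements of \<open>M\<close> outside \<open>S\<close>.\<close>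

lemma irr_exists:
  assumes S: "tsub S" "gstable S" and y: "y \<in> invs S" "y \<notin> S"
  obtains M where "irr S M" "\<And>N. fs.subspace N \<Longrightarrow> gstable N \<Longrightarrow> S \<subseteq> N \<Longrightarrow> y \<in> N \<Longrightarrow> M \<subseteq> N"
proof -
  note S' = tsubD[OF S(1)]
  define U where "U = fs.span (S \<union> translates y)"
  have yA: "y \<in> A" by (rule invs_A[OF y(1)])
  obtain E where E: "finite E" "translates y \<subseteq> fs.span E" by (rule translates_fd[OF yA])
  have sU: "fs.subspace U" unfolding U_def by (rule fs.subspace_span)
  have SU: "S \<subseteq> U" and yU: "y \<in> U" using fs.span_superset translates_self[OF yA] unfolding U_def by blast+
  have gU: "gstable U" unfolding U_def
    by (rule gstable_span) (use S(2) gstable_translates[OF yA] in \<open>auto simp: gstable_def\<close>)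
  have UN: "U \<subseteq> N" if N: "fs.subspace N" "gstable N" "S \<subseteq> N" "y \<in> N" for N
  proof -
    have "translates y \<subseteq> N" using gstableD[OF N(2) _ N(4)] by (auto simp: translates_def)
    then show ?thesis unfolding U_def using fs.span_minimal[OF _ N(1)] N(3) by blast
  qed
  have Uinv: "U \<subseteq> invs S"
    by (rule UN[OF subspace_invs[OF S'(4)] gstable_invs[OF S] invs_superset[OF S(1)] y(1)])
  have UV: "\<exists>v\<in>fs.span (translates y). u - v \<in> S" if u: "u \<in> U" for u
  proof -
    have "u \<in> {s + v |s v. s \<in> fs.span S \<and> v \<in> fs.span (translates y)}"
      using u unfolding U_def fs.span_Un .
    then obtain s v where "u = s + v" "s \<in> fs.span S" "v \<in> fs.span (translates y)" by blast
    moreover have "fs.span S = S" using S'(4) fs.span_eq_iff by blast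
    ultimately show ?thesis by (intro bexI[of _ v]) auto
  qed
  have VE: "fs.span (translates y) \<subseteq> fs.span E" using fs.span_minimal[OF E(2) fs.subspace_span] .
  define H :: "(('q \<Rightarrow> 'k) \<Rightarrow> 'q \<Rightarrow> 'k) set" where "H = (\<lambda>g f. f \<circ> \<alpha> g) ` \<Gamma>"
  have gH: "gstable N" if "\<And>\<gamma> v. \<gamma> \<in> H \<Longrightarrow> v \<in> N \<Longrightarrow> \<gamma> v \<in> N" for N
    using that by (force simp: gstable_def H_def)
  have Hg: "\<gamma> v \<in> N" if "gstable N" "\<gamma> \<in> H" "v \<in> N" for N \<gamma> v
    using that by (auto simp: gstable_def H_def)
  have SsU: "S \<subset> U" using SU yU y(2) by blast
  show thesis
  proof (rule fs.minimal_stable_subspace[OF S'(4) sU SsU fs.subspace_span VE E(1), of H])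
    fix u assume "u \<in> U" then show "\<exists>v\<in>fs.span (translates y). u - v \<in> S" by (rule UV)
  next
    fix \<gamma> v assume "\<gamma> \<in> H" "v \<in> U" then show "\<gamma> v \<in> U" by (rule Hg[OF gU])
  next
    fix M assume M: "fs.subspace M" "S \<subset> M" "M \<subseteq> U" "\<And>\<gamma> v. \<gamma> \<in> H \<Longrightarrow> v \<in> M \<Longrightarrow> \<gamma> v \<in> M"
    and min: "\<And>N. fs.subspace N \<Longrightarrow> (\<And>\<gamma> v. \<gamma> \<in> H \<Longrightarrow> v \<in> N \<Longrightarrow> \<gamma> v \<in> N) \<Longrightarrow> S \<subset> N \<Longrightarrow> N \<subseteq> M \<Longrightarrow> N = M"
  have "irr S M"
    unfolding irr_def fdmod_def
  proof (intro conjI allI impI)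
    show "fs.subspace M" "S \<subset> M" by fact+
    show "M \<subseteq> invs S" using M(3) Uinv by blast
    show "gstable M"
    proof (rule gH)
      fix \<gamma> v assume "\<gamma> \<in> H" "v \<in> M" then show "\<gamma> v \<in> M" by (rule M(4))
    qed
    show "\<exists>E. finite E \<and> (\<forall>u\<in>M. \<exists>v\<in>fs.span E. u - v \<in> S)"
    proof (intro exI[of _ E] conjI ballI E(1))
      fix u assume "u \<in> M"
      then have "u \<in> U" using M(3) by blast
      from UV[OF this] show "\<exists>v\<in>fs.span E. u - v \<in> S" using VE by blast
    qed
    show "N = M" if N: "fs.subspace N" "gstable N" "S \<subset> N" "N \<subseteq> M" for N
    proof (rule min[OF N(1) _ N(3,4)])
      fix \<gamma> v assume "\<gamma> \<in> H" "v \<in> N" then show "\<gamma> v \<in> N" by (rule Hg[OF N(2)])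
    qed
  qed
  moreover have "M \<subseteq> N" if "fs.subspace N" "gstable N" "S \<subseteq> N" "y \<in> N" for N
    using UN[OF that] M(3) by blast
  ultimately show thesis by (rule that)
  qed
qed

end

section \<open>Powers of functions and additive polynomials in characteristic p\<close>

lemma fscale_power: "(fscale c f) ^ n = fscale (c ^ n) (f ^ n)" for c :: "'k::comm_ring_1"
  by (rule ext) (simp add: power_mult_distrib)

context
  assumes pos: "CHAR('k::field) > 0"
begin

lemma fun_power_add: "(f + g) ^ (CHAR('k) ^ i) = f ^ (CHAR('k) ^ i) + (g :: 'q \<Rightarrow> 'k) ^ (CHAR('k) ^ i)"
  by (rule ext) (simp add: power_char_power_add[OF pos])

lemma fun_power_sum: "(sum f I) ^ (CHAR('k) ^ i) = (\<Sum>j\<in>I. (f j :: 'q \<Rightarrow> 'k) ^ (CHAR('k) ^ i))"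
proof (induction I rule: infinite_finite_induct)
  case (insert x F)
  show ?case unfolding sum.insert[OF insert.hyps(1,2)] fun_power_add insert.IH by (rule refl)
qed (auto simp: fun_eq_iff pos)

lemma poly_power_sum: "(sum f I) ^ CHAR('k) = (\<Sum>j\<in>I. (f j :: 'k poly) ^ CHAR('k))"
proof (induction I rule: infinite_finite_induct)
  case (insert x F)
  show ?case unfolding sum.insert[OF insert.hyps(1,2)] poly_power_char_add[OF pos] insert.IH by (rule refl)
qed (auto simp: power_0_left pos)

lemma additive_poly_sum: "(\<And>i. i \<in> I \<Longrightarrow> additive_poly (f i :: 'k poly)) \<Longrightarrow> additive_poly (sum f I)"
  by (induction I rule: infinite_finite_induct) (auto simp: additive_poly_plus)

lemma additive_poly_frobenius:
  assumes "additive_poly (P :: 'k poly)" shows "additive_poly (P ^ CHAR('k))"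
proof -
  have "P ^ CHAR('k) = (\<Sum>i\<le>degree P. monom (coeff P i) i) ^ CHAR('k)"
    by (simp only: poly_as_sum_of_monoms)
  also have "\<dots> = (\<Sum>i\<le>degree P. monom (coeff P i ^ CHAR('k)) (i * CHAR('k)))"
    by (simp add: poly_power_sum monom_power mult.commute)
  finally have eq: "P ^ CHAR('k) = \<dots>" .
  show ?thesis unfolding eq
  proof (rule additive_poly_sum)
    fix i
    show "additive_poly (monom (coeff P i ^ CHAR('k)) (i * CHAR('k)))"
    proof (cases "coeff P i = 0")
      case True
      then show ?thesis using pos by (simp add: power_0_left)
    next
      case False
      then obtain j where "i = CHAR('k) ^ j"
        using assms addexp_prime_char[OF _ refl pos] unfolding additive_poly_def by blast
      then have "i * CHAR('k) = CHAR('k) ^ Suc j" by (simp add: mult.commute)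
      then show ?thesis using additive_poly_monom[OF addexp_prime_power[OF refl pos, of "Suc j"]] by metis
    qed
  qed
qed

lemma additive_poly_expand:
  assumes "additive_poly (P :: 'k poly)" "\<forall>i > CHAR('k) ^ L. coeff P i = 0"
  shows "pev P y = (\<Sum>l\<le>L. fscale (coeff P (CHAR('k) ^ l)) (y ^ (CHAR('k) ^ l)))"
proof -
  let ?p = "CHAR('k)"
  have p: "?p > 1" by (rule prime_gt_1_nat[OF prime_char[OF pos]])
  have "P = (\<Sum>l\<le>L. monom (coeff P (?p ^ l)) (?p ^ l))"
  proof (rule poly_eqI)
    fix i
    have c: "coeff (\<Sum>l\<le>L. monom (coeff P (?p ^ l)) (?p ^ l)) i = (\<Sum>l\<le>L. if ?p ^ l = i then coeff P i else 0)"
      unfolding coeff_sum by (intro sum.cong) auto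
    show "coeff P i = coeff (\<Sum>l\<le>L. monom (coeff P (?p ^ l)) (?p ^ l)) i"
    proof (cases "coeff P i = 0")
      case True
      then show ?thesis unfolding c by (simp add: sum.neutral)
    next
      case False
      then obtain j where j: "i = ?p ^ j"
        using assms(1) addexp_prime_char[OF _ refl pos] unfolding additive_poly_def by blast
      have "\<not> i > ?p ^ L" using False assms(2) by blast
      then have "j \<le> L" using p unfolding j by simp
      have "(\<Sum>l\<le>L. if ?p ^ l = i then coeff P i else 0) = (\<Sum>l\<in>{j}. coeff P i)"
        using \<open>j \<le> L\<close> p by (intro sum.mono_neutral_cong_right) (auto simp: j)
      then show ?thesis unfolding c by simp
    qed
  qed
  then have "poly P x = (\<Sum>l\<le>L. coeff P (?p ^ l) * x ^ (?p ^ l))" for x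
    by (metis (no_types, lifting) poly_monom poly_sum sum.cong)
  then show ?thesis by (intro ext) simp
qed

end

lemma sum_set_conv_nth: "distinct ws \<Longrightarrow> (\<Sum>b\<in>set ws. F b) = (\<Sum>i<length ws. F (ws ! i))"
  by (rule sum.reindex_bij_betw[symmetric]) (simp add: bij_betw_nth)

lemma indep_mod_nth:
  assumes "fs.indep_mod S (set ws)" "distinct ws" "(\<Sum>i<length ws. fscale (c i) (ws ! i)) \<in> S" "i < length ws"
  shows "c i = 0"
proof -
  define d where "d b = c (inv_into {..<length ws} ((!) ws) b)" for b
  have inj: "inj_on ((!) ws) {..<length ws}" using assms(2) by (simp add: inj_on_nth)
  have d: "d (ws ! i) = c i" if "i < length ws" for i
    unfolding d_def using inv_into_f_f[OF inj, of i] that by simp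
  have "(\<Sum>b\<in>set ws. fscale (d b) b) = (\<Sum>i<length ws. fscale (d (ws ! i)) (ws ! i))"
    by (rule sum_set_conv_nth[OF assms(2)])
  also have "\<dots> = (\<Sum>i<length ws. fscale (c i) (ws ! i))" by (intro sum.cong) (auto simp: d)
  finally have "(\<Sum>b\<in>set ws. fscale (d b) b) \<in> S" using assms(3) by simp
  then have "\<forall>b\<in>set ws. d b = 0" using assms(1) unfolding fs.indep_mod_def by blast
  then show ?thesis using d[OF assms(4)] assms(4) by auto
qed

context unipotent_G_algebra
begin

text \<open>Applying the functional dual to \<open>b\<close> to the expansion of f \<circ> \<alpha>
  g given by \<open>act_rational\<close> writes the coefficient as a linear combination of members
  of \<open>K\<close>.\<close>

lemma coefficients_in_K:
  assumes W: "fs.subspace W" and B: "fs.indep_mod W B" "b \<in> B" and f: "f \<in> A"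
    and rep: "\<And>g. g \<in> \<Gamma> \<Longrightarrow> (f \<circ> \<alpha> g) - (\<Sum>b\<in>B. fscale (\<beta> g b) b) \<in> W"
  shows "\<exists>\<kappa>\<in>K. \<forall>g\<in>\<Gamma>. \<kappa> g = \<beta> g b"
proof -
  have fin: "finite B" using B(1) by (simp add: fs.indep_mod_def)
  obtain \<phi> :: "('q \<Rightarrow> 'k) \<Rightarrow> 'k" where \<phi>: "\<And>x y. \<phi> (x + y) = \<phi> x + \<phi> y" "\<And>c x. \<phi> (fscale c x) = c * \<phi> x"
    "\<And>w. w \<in> W \<Longrightarrow> \<phi> w = 0" "\<And>b'. b' \<in> B \<Longrightarrow> \<phi> b' = (if b' = b then 1 else 0)"
    by (rule fs.dual_functional[OF W B]) (rule that; assumption)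
  note sum = fs.sum_functional[of \<phi>, OF \<phi>(1,2)]
  obtain n a c where ac: "\<forall>j<(n::nat). a j \<in> K" "\<forall>g\<in>\<Gamma>. \<forall>x. f (\<alpha> g x) = (\<Sum>j<n. a j g * c j x)"
    using act_rational[OF f] by blast
  define \<kappa> where "\<kappa> = (\<Sum>j<n. fscale (\<phi> (c j)) (a j))"
  have "\<kappa> \<in> K" unfolding \<kappa>_def using ac(1) by (intro fs.subspace_sum[OF K] fs.subspace_scale[OF K]) auto
  moreover have "\<kappa> g = \<beta> g b" if g: "g \<in> \<Gamma>" for g
  proof -
    have "f \<circ> \<alpha> g = (\<Sum>j<n. fscale (a j g) (c j))" using ac(2) g by (auto simp: fun_eq_iff)
    then have "\<kappa> g = \<phi> (f \<circ> \<alpha> g)" by (simp add: sum \<kappa>_def mult.commute)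
    also have "\<dots> = \<phi> (\<Sum>b\<in>B. fscale (\<beta> g b) b)"
      using \<phi>(3)[OF rep[OF g]] \<phi>(1)[of "(f \<circ> \<alpha> g) - (\<Sum>b\<in>B. fscale (\<beta> g b) b)" "\<Sum>b\<in>B. fscale (\<beta> g b) b"]
      by (simp only: diff_add_cancel add_0)
    also have "\<dots> = (\<Sum>b'\<in>B. \<beta> g b' * \<phi> b')" by (rule sum)
    also have "\<dots> = (\<Sum>b'\<in>{b}. \<beta> g b')"
      using fin B(2) by (intro sum.mono_neutral_cong_right) (auto simp: \<phi>(4))
    finally show ?thesis by simp
  qed
  ultimately show ?thesis by blast
qed

text \<open>Vanishing at the identity is arranged by subtracting constants, which lie in
  \<open>S\<close>. It centres the basis functions, so that they become homomorphisms on the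
  subgroup cut out by \<open>S\<close>.\<close>

definition basis_list :: "('q \<Rightarrow> 'k) set \<Rightarrow> ('q \<Rightarrow> 'k) set \<Rightarrow> ('q \<Rightarrow> 'k) list \<Rightarrow> bool" where
  "basis_list S M ws \<longleftrightarrow> distinct ws \<and> set ws \<subseteq> M \<and> (\<forall>w\<in>set ws. w e = 0) \<and> fs.indep_mod S (set ws) \<and>
     (\<forall>u\<in>M. \<exists>c. u - (\<Sum>b\<in>set ws. fscale (c b) b) \<in> S)"

lemma basis_list_exists:
  assumes S: "tsub S" and M: "fs.subspace M" "S \<subseteq> M" "fdmod S M"
  shows "\<exists>ws. basis_list S M ws"
proof -
  note S' = tsubD[OF S]
  define X where "X = {f \<in> M. f e = 0}"
  obtain E where E: "finite E" "\<And>u. u \<in> M \<Longrightarrow> \<exists>v\<in>fs.span E. u - v \<in> S" using M(3) unfolding fdmod_def by blast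
  have EX: "\<forall>u\<in>X. \<exists>v\<in>fs.span E. u - v \<in> S" using E(2) by (simp add: X_def)
  obtain B where B: "B \<subseteq> X" "fs.indep_mod S B" "\<forall>x\<in>X. \<exists>c. x - (\<Sum>b\<in>B. fscale (c b) b) \<in> S"
    using fs.basis_mod_exists[OF S'(4) E(1) EX] by (elim exE conjE) (rule that)
  have "finite B" using B(2) unfolding fs.indep_mod_def by (rule conjunct1)
  then obtain ws where ws: "set ws = B" "distinct ws" using finite_distinct_list by blast
  have "\<exists>c. u - (\<Sum>b\<in>B. fscale (c b) b) \<in> S" if u: "u \<in> M" for u
  proof -
    have cS: "cst (u e) \<in> S" by (rule subalg_cst[OF S'(1)])
    have "u - cst (u e) \<in> M" using fs.subspace_diff[OF M(1) u] cS M(2) by blast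
    then have "u - cst (u e) \<in> X" by (simp add: X_def)
    then obtain c where "u - cst (u e) - (\<Sum>b\<in>B. fscale (c b) b) \<in> S" using B(3) by blast
    from subalg_add[OF S'(1) this cS]
    have "(u - cst (u e) - (\<Sum>b\<in>B. fscale (c b) b)) + cst (u e) \<in> S" .
    moreover have "(u - cst (u e) - (\<Sum>b\<in>B. fscale (c b) b)) + cst (u e) = u - (\<Sum>b\<in>B. fscale (c b) b)"
      by (rule ext) simp
    ultimately have "u - (\<Sum>b\<in>B. fscale (c b) b) \<in> S" by (simp only:)
    then show ?thesis by blast
  qed
  moreover have "set ws \<subseteq> M" "\<forall>w\<in>set ws. w e = 0" using B(1) by (auto simp: X_def ws)
  ultimately have "basis_list S M ws" using ws B(2) unfolding basis_list_def by simp
  then show ?thesis by blast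
qed

text \<open>One layer of the filtration in coordinates: the list consists of the linear coordinates
  of a factor, and the functions \<open>\<rho>\<close> form a row of the matrix by which the group
  acts on them.\<close>

definition block :: "('q \<Rightarrow> 'k) set \<Rightarrow> ('q \<Rightarrow> 'k) list \<Rightarrow> bool" where
  "block S ws \<longleftrightarrow> set ws \<subseteq> invs S \<and> (\<forall>w\<in>set ws. w e = 0) \<and> indep S ws \<and>
    (\<forall>i<length ws. \<exists>\<rho>. (\<forall>j<length ws. \<rho> j \<in> K) \<and>
      (\<forall>g\<in>\<Gamma>. (ws ! i \<circ> \<alpha> g) - (\<Sum>j<length ws. fscale (\<rho> j g) (ws ! j)) \<in> S))"

section \<open>Bases of irreducible extensions\<close>

context
  fixes S M ws
  assumes S: "tsub S" and gS: "gstable S" and TS: "Tcond S" and M: "irr S M" and ws: "basis_list S M ws"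
begin

lemmas S' = tsubD[OF S]

lemma irr_M: "fs.subspace M" "S \<subset> M" "S \<subseteq> M" "M \<subseteq> invs S" "gstable M"
  "\<And>N. fs.subspace N \<Longrightarrow> gstable N \<Longrightarrow> S \<subset> N \<Longrightarrow> N \<subseteq> M \<Longrightarrow> N = M"
  using M unfolding irr_def by blast+

lemma basis_ws: "distinct ws" "set ws \<subseteq> M" "set ws \<subseteq> invs S" "\<And>w. w \<in> set ws \<Longrightarrow> w e = 0" "fs.indep_mod S (set ws)"
  "\<And>u. u \<in> M \<Longrightarrow> \<exists>c. u - (\<Sum>b\<in>set ws. fscale (c b) b) \<in> S"
  using ws irr_M(4) unfolding basis_list_def by blast+

lemma basis_nth: "u \<in> M \<Longrightarrow> \<exists>c. u - (\<Sum>i<length ws. fscale (c i) (ws ! i)) \<in> S"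
proof -
  assume "u \<in> M"
  then obtain c where "u - (\<Sum>b\<in>set ws. fscale (c b) b) \<in> S" using basis_ws(6) by blast
  then show ?thesis
    unfolding sum_set_conv_nth[OF basis_ws(1), of "\<lambda>b. fscale (c b) b"] by (rule exI[of _ "\<lambda>i. c (ws ! i)"])
qed

lemma combination_in_M: "(\<Sum>i<length ws. fscale (c i) (ws ! i)) \<in> M"
  using basis_ws(2) by (intro fs.subspace_sum[OF irr_M(1)] fs.subspace_scale[OF irr_M(1)]) auto

lemma algebraic_in_S:
  assumes "f \<in> invs S" "additive_poly P" "P \<noteq> 0" "pev P f \<in> S" shows "f \<in> S"
  using not_transc_pev[OF S'(1) assms(2-4)] TS assms(1) unfolding Tcond_def by blast

lemma frob_in_S:
  assumes "CHAR('k) > 0" "f \<in> invs S" "frob \<epsilon> f \<in> S" shows "f \<in> S"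
  using algebraic_in_S[OF assms(2) additive_frob_poly[OF assms(1)] frob_poly_nonzero[OF assms(1)]] assms(3)
  by (simp only: pev_frob_poly)

text \<open>In characteristic 0 additive polynomials are linear. In characteristic p let p^L be the
  highest exponent of a relation, and let \<open>F\<close> be spanned by \<open>S\<close> and the
  lower p-power powers of \<open>M\<close>. The relation puts the p^L-th power of an element of
  \<open>M\<close> outside \<open>S\<close> into \<open>F\<close>, and irreducibility extends this
  to all of \<open>M\<close>. So \<open>F\<close> is closed under p-th powers, and as it is finite
  dimensional modulo \<open>S\<close>, a single element of \<open>M\<close> outside \<open>S\<close>
  satisfies an additive relation, against \<open>Tcond S\<close>.\<close>

lemma no_additive_relation_basis: "no_additive_relation S ws"
proof (cases "CHAR('k) = 0")
  case True
  show ?thesis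
    unfolding no_additive_relation_def
  proof (intro allI impI)
    fix P i assume P: "\<forall>i<length ws. additive_poly (P i)" "(\<Sum>i<length ws. pev (P i) (ws ! i)) \<in> S"
      and i: "i < length ws"
    have lin: "P i = monom (coeff (P i) 1) 1" if "i < length ws" for i
    proof (rule additive_poly_linear)
      show "additive_poly (P i)" using P that by blast
      then show "\<forall>j>1. coeff (P i) j = 0" using addexp_char_0[OF _ True] unfolding additive_poly_def by blast
    qed
    have "pev (P i) (ws ! i) = fscale (coeff (P i) 1) (ws ! i)" if "i < length ws" for i
      by (subst lin[OF that]) (rule ext, simp add: poly_monom)
    then have "(\<Sum>i<length ws. fscale (coeff (P i) 1) (ws ! i)) \<in> S" using P(2) by simp
    from indep_mod_nth[OF basis_ws(5,1) this i] show "P i = 0" using lin[OF i] by simp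
  qed
next
  case False
  then have pos: "CHAR('k) > 0" by simp
  let ?p = "CHAR('k)"
  have p: "?p > 1" by (rule prime_gt_1_nat[OF prime_char[OF pos]])
  show ?thesis
    unfolding no_additive_relation_def
  proof (intro allI impI, rule ccontr)
    fix P i0 assume P: "\<forall>i<length ws. additive_poly (P i)" "(\<Sum>i<length ws. pev (P i) (ws ! i)) \<in> S"
      and i0: "i0 < length ws" "P i0 \<noteq> 0"
    define T where "T = {i. i < length ws \<and> P i \<noteq> 0}"
    define d where "d = Max (degree ` P ` T)"
    have T: "finite (degree ` P ` T)" "degree ` P ` T \<noteq> {}" using i0 by (auto simp: T_def)
    have "d \<in> degree ` P ` T" unfolding d_def by (rule Max_in[OF T])
    then obtain i1 where i1: "i1 < length ws" "P i1 \<noteq> 0" "degree (P i1) = d" by (auto simp: T_def)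
    have dle: "degree (P i) \<le> d" if "i < length ws" for i
      using that Max_ge[OF T(1)] unfolding d_def T_def by (cases "P i = 0") auto
    obtain L where L: "d = ?p ^ L"
      using i1 P(1) addexp_prime_char[OF _ refl pos] unfolding additive_poly_def by (metis leading_coeff_0_iff)
    define c where "c i l = coeff (P i) (?p ^ l)" for i l
    have ex: "pev (P i) (ws ! i) = (\<Sum>l\<le>L. fscale (c i l) ((ws ! i) ^ (?p ^ l)))" if "i < length ws" for i
      unfolding c_def using dle[OF that] P(1) that
      by (intro additive_poly_expand[OF pos]) (auto simp: L intro!: coeff_eq_0)
    define F where "F = fs.span (S \<union> {f ^ (?p ^ l) | f l. f \<in> M \<and> l < L})"
    have sF: "fs.subspace F" unfolding F_def by (rule fs.subspace_span)
    have SF: "S \<subseteq> F" unfolding F_def using fs.span_superset by blast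
    have MF: "f ^ (?p ^ l) \<in> F" if "f \<in> M" "l < L" for f l
      unfolding F_def using that by (intro fs.span_base) blast
    have gF: "gstable F" unfolding F_def
    proof (rule gstable_span, unfold gstable_def, intro ballI)
      fix g f assume g: "g \<in> \<Gamma>" and "f \<in> S \<union> {f ^ (?p ^ l) | f l. f \<in> M \<and> l < L}"
      then consider "f \<in> S" | h l where "f = h ^ (?p ^ l)" "h \<in> M" "l < L" by blast
      then show "f \<circ> \<alpha> g \<in> S \<union> {f ^ (?p ^ l) | f l. f \<in> M \<and> l < L}"
      proof cases
        case 1
        then show ?thesis using gstableD[OF gS g] by blast
      next
        case 2
        then have "f \<circ> \<alpha> g = (h \<circ> \<alpha> g) ^ (?p ^ l)" "h \<circ> \<alpha> g \<in> M"
          using gstableD[OF irr_M(5) g] by (auto simp: fun_power_comp)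
        then show ?thesis using 2(3) by blast
      qed
    qed
    define N where "N = {f \<in> M. f ^ (?p ^ L) \<in> F}"
    have "N = M"
    proof (rule irr_M(6))
      show "fs.subspace N"
      proof (rule fs.subspaceI)
        have "(0 :: 'q \<Rightarrow> 'k) ^ (?p ^ L) = 0" using pos by (simp add: power_0_left)
        then show "0 \<in> N" using fs.subspace_0[OF irr_M(1)] fs.subspace_0[OF sF] by (simp add: N_def)
        show "f + g \<in> N" if "f \<in> N" "g \<in> N" for f g
          using that fs.subspace_add[OF irr_M(1)] fs.subspace_add[OF sF] by (simp add: N_def fun_power_add[OF pos])
        show "fscale a f \<in> N" if "f \<in> N" for a f
          using that fs.subspace_scale[OF irr_M(1)] fs.subspace_scale[OF sF] by (simp add: N_def fscale_power)
      qed
      show "gstable N" unfolding gstable_def N_def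
        using gstableD[OF irr_M(5)] gstableD[OF gF] by (auto simp: fun_power_comp[symmetric])
      show "N \<subseteq> M" by (auto simp: N_def)
      have "S \<subseteq> N" using irr_M(3) SF subalg_power[OF S'(1)] by (auto simp: N_def)
      \<comment> \<open>Taking roots of the coefficients at exponent p^L gathers the top part of the
        relation into the power of one element of \<open>M\<close>. That element lies outside
        \<open>S\<close> since the coefficients are not all zero.\<close>
      have "\<forall>i. \<exists>d. d ^ (?p ^ L) = c i L" by (intro allI root_exists) (use pos in simp)
      from choice[OF this] obtain d where d: "\<And>i. d i ^ (?p ^ L) = c i L" by blast
      let ?f = "\<Sum>i<length ws. fscale (d i) (ws ! i)"
      have "?f ^ (?p ^ L) = (\<Sum>i<length ws. fscale (c i L) ((ws ! i) ^ (?p ^ L)))"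
        unfolding fun_power_sum[OF pos] by (simp add: fscale_power d)
      also have "\<dots> = (\<Sum>i<length ws. pev (P i) (ws ! i) - (\<Sum>l<L. fscale (c i l) ((ws ! i) ^ (?p ^ l))))"
        by (intro sum.cong refl) (simp add: ex lessThan_Suc_atMost[symmetric])
      also have "\<dots> = (\<Sum>i<length ws. pev (P i) (ws ! i)) - (\<Sum>i<length ws. \<Sum>l<L. fscale (c i l) ((ws ! i) ^ (?p ^ l)))"
        by (rule sum_subtractf)
      also have "\<dots> \<in> F"
        using basis_ws(2) by (intro fs.subspace_diff[OF sF] set_mp[OF SF P(2)] fs.subspace_sum[OF sF] fs.subspace_scale[OF sF] MF)
          (auto simp: subset_iff)
      finally have "?f \<in> N" using combination_in_M by (simp add: N_def)
      moreover have "?f \<notin> S"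
      proof
        assume "?f \<in> S"
        from indep_mod_nth[OF basis_ws(5,1) this i1(1)] have "d i1 = 0" .
        then have "c i1 L = 0" using d[of i1] pos by (simp add: power_0_left)
        then show False unfolding c_def using i1(2,3) L by (metis leading_coeff_0_iff)
      qed
      ultimately show "S \<subset> N" using \<open>S \<subseteq> N\<close> by blast
    qed
    then have powL: "f ^ (?p ^ L) \<in> F" if "f \<in> M" for f using that by (auto simp: N_def)
    have Fp: "f ^ ?p \<in> F" if "f \<in> F" for f
    proof -
      have "fs.subspace {f. f ^ ?p \<in> F}"
      proof (rule fs.subspaceI)
        have "(0 :: 'q \<Rightarrow> 'k) ^ ?p = 0" using pos by (simp add: power_0_left)
        then show "0 \<in> {f. f ^ ?p \<in> F}" using fs.subspace_0[OF sF] by simp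
        show "f + g \<in> {f. f ^ ?p \<in> F}" if "f \<in> {f. f ^ ?p \<in> F}" "g \<in> {f. f ^ ?p \<in> F}" for f g
          using that fs.subspace_add[OF sF] fun_power_add[OF pos, of f g 1] by simp
        show "fscale a f \<in> {f. f ^ ?p \<in> F}" if "f \<in> {f. f ^ ?p \<in> F}" for a f
          using that fs.subspace_scale[OF sF] by (simp add: fscale_power)
      qed
      moreover have "S \<union> {f ^ (?p ^ l) | f l. f \<in> M \<and> l < L} \<subseteq> {f. f ^ ?p \<in> F}"
      proof
        fix f assume "f \<in> S \<union> {f ^ (?p ^ l) | f l. f \<in> M \<and> l < L}"
        then consider "f \<in> S" | h l where "f = h ^ (?p ^ l)" "h \<in> M" "l < L" by blast
        then show "f \<in> {f. f ^ ?p \<in> F}"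
        proof cases
          case 1
          then show ?thesis using SF subalg_power[OF S'(1)] by blast
        next
          case 2
          then have f: "f ^ ?p = h ^ (?p ^ Suc l)" by (simp add: power_mult[symmetric] mult.commute)
          show ?thesis
          proof (cases "Suc l = L")
            case True
            then show ?thesis using powL[OF 2(2)] f by simp
          next
            case False
            then have "Suc l < L" using 2(3) by simp
            from MF[OF 2(2) this] show ?thesis using f by simp
          qed
        qed
      qed
      ultimately have "F \<subseteq> {f. f ^ ?p \<in> F}" unfolding F_def by (rule fs.span_minimal[rotated])
      then show ?thesis using that by blast
    qed
    have pow: "f ^ (?p ^ (L + n)) \<in> F" if "f \<in> M" for f n
    proof (induction n)
      case 0
      show ?case unfolding add_0_right by (rule powL[OF that])
    next
      case (Suc n)
      have eq: "f ^ (?p ^ (L + Suc n)) = (f ^ (?p ^ (L + n))) ^ ?p"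
        by (simp only: power_mult[symmetric] add_Suc_right power_Suc2)
      show ?case unfolding eq by (rule Fp[OF Suc])
    qed
    define E where "E = (\<lambda>(b, l). b ^ (?p ^ l)) ` (set ws \<times> {..<L})"
    have finE: "finite E" by (simp add: E_def)
    have "F \<subseteq> fs.span (S \<union> E)"
      unfolding F_def
    proof (rule fs.span_minimal[OF _ fs.subspace_span])
      have "f ^ (?p ^ l) \<in> fs.span (S \<union> E)" if f: "f \<in> M" and l: "l < L" for f l
      proof -
        obtain c where c: "f - (\<Sum>b\<in>set ws. fscale (c b) b) \<in> S" using basis_ws(6)[OF f] by blast
        have "f ^ (?p ^ l) = ((f - (\<Sum>b\<in>set ws. fscale (c b) b)) + (\<Sum>b\<in>set ws. fscale (c b) b)) ^ (?p ^ l)"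
          by (simp only: diff_add_cancel)
        also have "\<dots> = (f - (\<Sum>b\<in>set ws. fscale (c b) b)) ^ (?p ^ l) + (\<Sum>b\<in>set ws. fscale (c b ^ (?p ^ l)) (b ^ (?p ^ l)))"
          by (simp only: fun_power_add[OF pos] fun_power_sum[OF pos] fscale_power)
        also have "\<dots> \<in> fs.span (S \<union> E)"
        proof (intro fs.span_add fs.span_sum fs.span_scale fs.span_base)
          show "(f - (\<Sum>b\<in>set ws. fscale (c b) b)) ^ (?p ^ l) \<in> S \<union> E" using subalg_power[OF S'(1) c] by blast
          show "b ^ (?p ^ l) \<in> S \<union> E" if "b \<in> set ws" for b using that l by (auto simp: E_def)
        qed
        finally show ?thesis .
      qed
      moreover have "S \<subseteq> fs.span (S \<union> E)" using fs.span_superset by blast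
      ultimately show "S \<union> {f ^ (?p ^ l) | f l. f \<in> M \<and> l < L} \<subseteq> fs.span (S \<union> E)" by blast
    qed
    then have FE: "\<exists>v\<in>fs.span E. f - v \<in> S" if "f \<in> F" for f
    proof -
      have "f \<in> {s + v |s v. s \<in> fs.span S \<and> v \<in> fs.span E}"
        using that \<open>F \<subseteq> fs.span (S \<union> E)\<close> unfolding fs.span_Un by blast
      then obtain s v where "f = s + v" "s \<in> fs.span S" "v \<in> fs.span E" by blast
      moreover have "fs.span S = S" using S'(4) fs.span_eq_iff by blast
      ultimately show ?thesis by (intro bexI[of _ v]) auto
    qed
    obtain f where f: "f \<in> M" "f \<notin> S" using irr_M(2) by blast
    have "\<forall>n. \<exists>v. v \<in> fs.span E \<and> f ^ (?p ^ (L + n)) - v \<in> S" using FE pow[OF f(1)] by blast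
    from choice[OF this] obtain v where v: "\<And>n. v n \<in> fs.span E" "\<And>n. f ^ (?p ^ (L + n)) - v n \<in> S" by blast
    obtain a where a: "\<exists>n\<le>card E. a n \<noteq> 0" "(\<Sum>n\<le>card E. fscale (a n) (v n)) = 0"
      by (rule fs.family_dependent[OF finE v(1)]) (rule that; assumption)
    define Q where "Q = (\<Sum>n\<le>card E. monom (a n) (?p ^ (L + n)))"
    have "additive_poly Q" unfolding Q_def
      by (intro additive_poly_sum additive_poly_monom addexp_prime_power pos refl)
    moreover have "Q \<noteq> 0"
    proof -
      obtain n where n: "n \<le> card E" "a n \<noteq> 0" using a(1) by blast
      have "coeff Q (?p ^ (L + n)) = (\<Sum>j\<le>card E. if j = n then a j else 0)"
        unfolding Q_def coeff_sum using p by (intro sum.cong) auto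
      then have "coeff Q (?p ^ (L + n)) = a n" using n by simp
      then show ?thesis using n by auto
    qed
    moreover have "pev Q f \<in> S"
    proof -
      have "pev Q f = (\<Sum>n\<le>card E. fscale (a n) (f ^ (?p ^ (L + n))))"
        by (rule ext) (simp add: Q_def poly_sum poly_monom)
      also have "\<dots> = (\<Sum>n\<le>card E. fscale (a n) (f ^ (?p ^ (L + n)) - v n))"
        using a(2) by (simp only: fs.scale_right_diff_distrib sum_subtractf diff_0_right)
      also have "\<dots> \<in> S" by (intro subalg_sum[OF S'(1)] subalg_scale[OF S'(1)] v(2))
      finally show ?thesis .
    qed
    ultimately have "f \<in> S" using algebraic_in_S f(1) irr_M(4) by blast
    then show False using f(2) by blast
  qed
qed

lemma indep_basis: "indep S ws"
  by (rule indep_if_no_additive_relation[OF S basis_ws(3) no_additive_relation_basis])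

lemma adjs_basis: "adjs S ws = algebra_gen M"
proof
  show "adjs S ws \<subseteq> algebra_gen M"
    using irr_M(3) basis_ws(2) algebra_gen_superset[of M] by (intro adjs_minimal subalg_algebra_gen) blast+
  have sub: "subalg (adjs S ws)" by (rule subalg_adjs[OF S'(1)])
  have "M \<subseteq> adjs S ws"
  proof
    fix u assume "u \<in> M"
    then obtain c where c: "u - (\<Sum>b\<in>set ws. fscale (c b) b) \<in> S" using basis_ws(6) by blast
    have "(u - (\<Sum>b\<in>set ws. fscale (c b) b)) + (\<Sum>b\<in>set ws. fscale (c b) b) \<in> adjs S ws"
      using c adjs_superset[OF S'(1)] adjs_members[OF S'(1)]
      by (intro subalg_add[OF sub] subalg_sum[OF sub] subalg_scale[OF sub]) blast+
    then show "u \<in> adjs S ws" by (simp only: diff_add_cancel)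
  qed
  then show "algebra_gen M \<subseteq> adjs S ws" by (rule algebra_gen_minimal[OF sub])
qed

text \<open>The image of \<open>g\<close> lies in \<open>M\<close> but not in \<open>S\<close>, so
  irreducibility puts \<open>M\<close> into S[M1], and maximality makes the two rings equal. Then
  \<open>g\<close> is a sum of additive polynomials P_i in the basis of \<open>M\<close>, while its
  image is a linear combination of the basis. Without additive relations this can be compared in
  each variable, and P^p - \<epsilon> P is a multiple of X only for P = 0.\<close>

lemma frob_basis_impossible:
  assumes pos: "CHAR('k) > 0" and max: "\<forall>M'. irr S M' \<longrightarrow> algebra_gen M \<subseteq> algebra_gen M' \<longrightarrow> algebra_gen M' = algebra_gen M"
    and M1: "irr S M1" and g: "g \<in> M1" "g \<notin> S" "frob \<epsilon> g \<in> M"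
  shows False
proof -
  let ?p = "CHAR('k)"
  have p: "?p > 1" by (rule prime_gt_1_nat[OF prime_char[OF pos]])
  have M1': "S \<subseteq> M1" "M1 \<subseteq> invs S" "gstable M1" using M1 unfolding irr_def by blast+
  have gi: "g \<in> invs S" using g(1) M1'(2) by blast
  have fS: "frob \<epsilon> g \<notin> S" using frob_in_S[OF pos gi] g(2) by blast
  have sub: "subalg (algebra_gen M1)" by (rule subalg_algebra_gen)
  have M1g: "M1 \<subseteq> algebra_gen M1" by (rule algebra_gen_superset)
  have fg: "frob \<epsilon> g \<in> algebra_gen M1" using M1g g(1) by (intro subalg_frob[OF sub]) blast
  have "M \<inter> algebra_gen M1 = M"
  proof (rule irr_M(6))
    show "fs.subspace (M \<inter> algebra_gen M1)" by (rule fs.subspace_inter[OF irr_M(1) subalg_subspace[OF sub]])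
    show "gstable (M \<inter> algebra_gen M1)"
      using gstableD[OF irr_M(5)] gstableD[OF gstable_algebra_gen[OF M1'(3)]] by (simp add: gstable_def)
    show "S \<subset> M \<inter> algebra_gen M1" using fS fg g(3) irr_M(3) M1'(1) M1g by blast
  qed blast
  then have "algebra_gen M \<subseteq> algebra_gen M1" by (intro algebra_gen_minimal[OF sub]) blast
  from max[rule_format, OF M1 this] have "g \<in> adjs S ws" using adjs_basis M1g g(1) by blast
  then obtain P where P: "\<forall>i<length ws. additive_poly (P i)" "g - (\<Sum>i<length ws. pev (P i) (ws ! i)) \<in> S"
    using additive_decomposition[OF S basis_ws(3) indep_basis _ gi] by blast
  obtain c where c: "frob \<epsilon> g - (\<Sum>i<length ws. fscale (c i) (ws ! i)) \<in> S" using basis_nth[OF g(3)] by blast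
  define Q where "Q i = P i ^ ?p + (- Polynomial.smult \<epsilon> (P i)) + monom (- c i) 1" for i
  have aQ: "\<forall>i<length ws. additive_poly (Q i)"
    using P(1) unfolding Q_def
    by (intro allI impI additive_poly_plus additive_poly_smult additive_poly_frobenius pos additive_poly_monom addexp_1) auto
  have fsum: "frob \<epsilon> (\<Sum>i<n. pev (P i) (ws ! i)) = (\<Sum>i<n. frob \<epsilon> (pev (P i) (ws ! i)))" for n
  proof (induction n)
    case 0
    then show ?case using pos by (auto simp: fun_eq_iff frob_apply)
  next
    case (Suc n)
    then show ?case unfolding sum.lessThan_Suc frob_add[OF pos] by (simp only:)
  qed
  have "(\<Sum>i<length ws. pev (Q i) (ws ! i)) = (\<Sum>i<length ws. frob \<epsilon> (pev (P i) (ws ! i))) - (\<Sum>i<length ws. fscale (c i) (ws ! i))"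
    unfolding sum_subtractf[symmetric]
    by (intro sum.cong refl ext) (simp add: Q_def frob_apply poly_power poly_monom)
  also have "\<dots> = (frob \<epsilon> g - (\<Sum>i<length ws. fscale (c i) (ws ! i))) - frob \<epsilon> (g - (\<Sum>i<length ws. pev (P i) (ws ! i)))"
    unfolding frob_diff[OF pos] fsum by (rule ext) simp
  also have "\<dots> \<in> S" by (intro subalg_diff[OF S'(1)] subalg_frob[OF S'(1)] P(2) c)
  finally have Q0: "Q i = 0" if "i < length ws" for i
    using no_additive_relationD[OF no_additive_relation_basis aQ] that by blast
  have "P i = 0" if i: "i < length ws" for i
  proof (cases "degree (P i) = 0")
    case True
    then obtain a where "P i = [:a:]" by (rule degree_eq_zeroE)
    then show ?thesis using additive_poly_sum_monom[of "P i"] P(1) i by auto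
  next
    case False
    have "P i ^ ?p - Polynomial.smult \<epsilon> (P i) = monom (c i) 1"
      using Q0[OF i] unfolding Q_def by (simp add: minus_monom[symmetric] eq_neg_iff_add_eq_0 flip: minus_monom)
    moreover have "?p * degree (P i) \<noteq> 1" using p by simp
    ultimately have "coeff (P i ^ ?p - Polynomial.smult \<epsilon> (P i)) (?p * degree (P i)) = 0" by simp
    then show ?thesis using degree_artin_schreier[OF pos, of "P i" \<epsilon>] False by simp
  qed
  then have "(\<Sum>i<length ws. pev (P i) (ws ! i)) = 0" by (intro sum.neutral) auto
  then show False using P(2) g(2) by simp
qed

text \<open>The p-th power is additive and semilinear, so the invariants whose p-th power lies in
  \<open>M\<close> form a stable subspace. It contains an irreducible extension of \<open>S\<close>
  as soon as it exceeds \<open>S\<close>.\<close>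

lemma frob_0_descends:
  assumes pos: "CHAR('k) > 0" and max: "\<forall>M'. irr S M' \<longrightarrow> algebra_gen M \<subseteq> algebra_gen M' \<longrightarrow> algebra_gen M' = algebra_gen M"
    and y: "y \<in> invs S" "y ^ CHAR('k) \<in> M"
  shows "y \<in> S"
proof (rule ccontr)
  let ?p = "CHAR('k)"
  assume yS: "y \<notin> S"
  obtain M1 where M1: "irr S M1" "\<And>N. fs.subspace N \<Longrightarrow> gstable N \<Longrightarrow> S \<subseteq> N \<Longrightarrow> y \<in> N \<Longrightarrow> M1 \<subseteq> N"
    by (rule irr_exists[OF S gS y(1) yS]) (rule that; assumption)
  define N where "N = {g \<in> invs S. g ^ ?p \<in> M}"
  note iS = subspace_invs[OF S'(4)]
  have "M1 \<subseteq> N"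
  proof (rule M1(2))
    show "fs.subspace N"
    proof (rule fs.subspaceI)
      have "(0 :: 'q \<Rightarrow> 'k) ^ ?p = 0" using pos by (simp add: power_0_left)
      then show "0 \<in> N" using fs.subspace_0[OF iS] fs.subspace_0[OF irr_M(1)] by (simp add: N_def)
      show "f + g \<in> N" if "f \<in> N" "g \<in> N" for f g
        using that fs.subspace_add[OF iS] fs.subspace_add[OF irr_M(1)] fun_power_add[OF pos, of f g 1] by (simp add: N_def)
      show "fscale a f \<in> N" if "f \<in> N" for a f
        using that fs.subspace_scale[OF iS] fs.subspace_scale[OF irr_M(1)] by (simp add: N_def fscale_power)
    qed
    show "gstable N" unfolding gstable_def N_def
      using gstableD[OF gstable_invs[OF S gS]] gstableD[OF irr_M(5)] by (auto simp: fun_power_comp[symmetric])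
    show "S \<subseteq> N" using invs_superset[OF S] subalg_power[OF S'(1)] irr_M(3) by (auto simp: N_def)
    show "y \<in> N" using y by (simp add: N_def)
  qed
  moreover obtain g where g: "g \<in> M1" "g \<notin> S" using M1(1) unfolding irr_def by blast
  moreover have "frob 0 g = g ^ ?p" by (rule ext) (simp add: frob_apply)
  ultimately have "frob 0 g \<in> M" unfolding N_def by auto
  from frob_basis_impossible[OF pos max M1(1) g this] show False by blast
qed

text \<open>The condition on \<open>a\<close> is not preserved by scaling, so the subspace argument
  for p-th powers fails. Instead, the coefficients of the translates of \<open>a\<close> in a basis
  modulo \<open>M\<close> are shown to satisfy \<beta>^p = \<beta>, with an error in
  \<open>S\<close> rather than just in \<open>M\<close>. They are regular functions of
  \<open>g\<close> with finitely many values, hence constant, so \<open>a\<close> is fixed modulo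
  \<open>S\<close>. Then S + k a is stable and yields an irreducible extension containing
  \<open>a\<close>.\<close>

lemma frob_1_descends:
  assumes pos: "CHAR('k) > 0" and max: "\<forall>M'. irr S M' \<longrightarrow> algebra_gen M \<subseteq> algebra_gen M' \<longrightarrow> algebra_gen M' = algebra_gen M"
    and a: "a \<in> invs S" "frob 1 a \<in> M"
  shows "a \<in> S"
proof (rule ccontr)
  let ?p = "CHAR('k)"
  have p: "?p > 1" by (rule prime_gt_1_nat[OF prime_char[OF pos]])
  assume aS: "a \<notin> S"
  note iS = subspace_invs[OF S'(4)]
  have aA: "a \<in> A" by (rule invs_A[OF a(1)])
  obtain E where E: "finite E" "translates a \<subseteq> fs.span E" by (rule translates_fd[OF aA])
  have "\<forall>x\<in>translates a. \<exists>v\<in>fs.span E. x - v \<in> M"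
  proof
    fix x assume "x \<in> translates a"
    then have "x \<in> fs.span E" "x - x \<in> M" using E(2) fs.subspace_0[OF irr_M(1)] by auto
    then show "\<exists>v\<in>fs.span E. x - v \<in> M" by blast
  qed
  from fs.basis_mod_exists[OF irr_M(1) E(1) this]
  obtain B where B: "B \<subseteq> translates a" "fs.indep_mod M B"
    "\<forall>x\<in>translates a. \<exists>c. x - (\<Sum>b\<in>B. fscale (c b) b) \<in> M" by (elim exE conjE) (rule that)
  have fin: "finite B" using B(2) unfolding fs.indep_mod_def by (rule conjunct1)
  have "\<forall>g. \<exists>c. g \<in> \<Gamma> \<longrightarrow> (a \<circ> \<alpha> g) - (\<Sum>b\<in>B. fscale (c b) b) \<in> M"
    using B(3) unfolding translates_def by blast
  from choice[OF this] obtain \<beta> where \<beta>: "\<And>g. g \<in> \<Gamma> \<Longrightarrow> (a \<circ> \<alpha> g) - (\<Sum>b\<in>B. fscale (\<beta> g b) b) \<in> M" by blast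
  have tB: "b \<in> invs S \<and> frob 1 b \<in> M" if bt: "b \<in> translates a" for b
  proof -
    obtain g where g: "g \<in> \<Gamma>" "b = a \<circ> \<alpha> g" using bt by (auto simp: translates_def)
    then show ?thesis using gstableD[OF gstable_invs[OF S gS] g(1) a(1)] gstableD[OF irr_M(5) g(1) a(2)]
      unfolding frob_comp by blast
  qed
  have key: "(\<forall>b\<in>B. \<beta> g b ^ ?p = \<beta> g b) \<and> (a \<circ> \<alpha> g) - (\<Sum>b\<in>B. fscale (\<beta> g b) b) \<in> S" if g: "g \<in> \<Gamma>" for g
  proof -
    have "\<forall>b. \<exists>r. r ^ ?p = \<beta> g b" by (intro allI root_exists) (rule pos)
    from choice[OF this] obtain r where r: "\<And>b. r b ^ ?p = \<beta> g b" by blast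
    \<comment> \<open>As r^p = \<beta>, the p-th power of \<open>\<delta>\<close> is \<beta>^p -
      \<beta>. This makes (v + n)^p a combination of \<open>n\<close> and Artin-Schreier images of
      translates of \<open>a\<close>, all in \<open>M\<close>, so that the case of p-th powers
      applies to v + n.\<close>
    define \<delta> where "\<delta> b = \<beta> g b - r b" for b
    define n where "n = (a \<circ> \<alpha> g) - (\<Sum>b\<in>B. fscale (\<beta> g b) b)"
    define v where "v = (\<Sum>b\<in>B. fscale (\<delta> b) b)"
    have nM: "n \<in> M" unfolding n_def by (rule \<beta>[OF g])
    have ag: "frob 1 (a \<circ> \<alpha> g) \<in> M" using tB g by (auto simp: translates_def)
    have vi: "v + n \<in> invs S"
      unfolding v_def using B(1) tB nM irr_M(4)
      by (intro fs.subspace_add[OF iS] fs.subspace_sum[OF iS] fs.subspace_scale[OF iS]) auto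
    have "(v + n) ^ ?p = frob 1 (a \<circ> \<alpha> g) + n - (\<Sum>b\<in>B. fscale (\<beta> g b) (frob 1 b))"
    proof
      fix x
      have \<delta>: "\<delta> b ^ ?p = \<beta> g b ^ ?p - \<beta> g b" for b by (simp add: \<delta>_def power_char_diff[OF pos] r)
      have ax: "a (\<alpha> g x) = n x + (\<Sum>b\<in>B. \<beta> g b * b x)" by (simp add: n_def)
      have sp: "(\<Sum>b\<in>B. c b * b x) ^ ?p = (\<Sum>b\<in>B. c b ^ ?p * b x ^ ?p)" for c
        using fun_power_sum[OF pos, of "\<lambda>b (_ :: unit). c b * b x" B 1]
        by (auto dest: fun_cong[of _ _ "()"] simp: power_mult_distrib)
      have "((v + n) ^ ?p) x = (\<Sum>b\<in>B. \<delta> b ^ ?p * b x ^ ?p) + n x ^ ?p"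
        by (simp add: v_def power_char_add[OF pos] sp)
      also have "(\<Sum>b\<in>B. \<delta> b ^ ?p * b x ^ ?p) = (\<Sum>b\<in>B. \<beta> g b ^ ?p * b x ^ ?p) - (\<Sum>b\<in>B. \<beta> g b * b x ^ ?p)"
        by (simp add: \<delta> left_diff_distrib sum_subtractf)
      also have "(\<Sum>b\<in>B. \<beta> g b ^ ?p * b x ^ ?p) = a (\<alpha> g x) ^ ?p - n x ^ ?p"
        by (simp add: ax power_char_add[OF pos] sp)
      also have "(\<Sum>b\<in>B. \<beta> g b * b x ^ ?p) = (\<Sum>b\<in>B. \<beta> g b * (b x ^ ?p - b x)) + (\<Sum>b\<in>B. \<beta> g b * b x)"
        by (simp add: right_diff_distrib sum_subtractf)
      also have "(\<Sum>b\<in>B. \<beta> g b * b x) = a (\<alpha> g x) - n x" by (simp add: ax)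
      finally show "((v + n) ^ ?p) x = (frob 1 (a \<circ> \<alpha> g) + n - (\<Sum>b\<in>B. fscale (\<beta> g b) (frob 1 b))) x"
        by (simp add: frob_apply)
    qed
    also have "\<dots> \<in> M"
      using B(1) tB by (intro fs.subspace_diff[OF irr_M(1)] fs.subspace_add[OF irr_M(1)] fs.subspace_sum[OF irr_M(1)]
        fs.subspace_scale[OF irr_M(1)] ag nM) auto
    finally have vnS: "v + n \<in> S" by (rule frob_0_descends[OF pos max vi, rotated])
    have "v + n - n \<in> M" by (rule fs.subspace_diff[OF irr_M(1) set_mp[OF irr_M(3) vnS] nM])
    then have "v \<in> M" by simp
    then have \<delta>0: "\<forall>b\<in>B. \<delta> b = 0" using B(2) unfolding v_def fs.indep_mod_def by blast
    then have "v = 0" unfolding v_def by (intro sum.neutral) (auto simp: fun_eq_iff)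
    then have "n \<in> S" using vnS by simp
    moreover have "\<beta> g b ^ ?p = \<beta> g b" if "b \<in> B" for b using \<delta>0 r[of b] that by (simp add: \<delta>_def)
    ultimately show ?thesis unfolding n_def by blast
  qed
  have const: "\<exists>c. \<forall>g\<in>\<Gamma>. \<beta> g b = c" if b: "b \<in> B" for b
  proof -
    obtain \<kappa> where \<kappa>: "\<kappa> \<in> K" "\<forall>g\<in>\<Gamma>. \<kappa> g = \<beta> g b"
      using coefficients_in_K[OF irr_M(1) B(2) b aA, of \<beta>] \<beta> by blast
    have "frob_poly 1 \<noteq> 0" by (rule frob_poly_nonzero[OF pos])
    then have "finite {z. poly (frob_poly 1) z = 0}" by (rule poly_roots_finite)
    moreover have "\<kappa> ` \<Gamma> \<subseteq> {z. poly (frob_poly 1) z = 0}"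
      using \<kappa>(2) key b by (auto simp: frob_poly_def poly_monom)
    ultimately have "finite (\<kappa> ` \<Gamma>)" by (rule rev_finite_subset)
    from K_conn[OF \<kappa>(1) this] show ?thesis using \<kappa>(2) by auto
  qed
  have trans: "(a \<circ> \<alpha> g) - a \<in> S" if g: "g \<in> \<Gamma>" for g
  proof -
    obtain u where u: "u \<in> \<Gamma>" "a \<circ> \<alpha> u = a" using act_one aA by blast
    have "(\<Sum>b\<in>B. fscale (\<beta> g b) b) = (\<Sum>b\<in>B. fscale (\<beta> u b) b)"
      using const g u(1) by (intro sum.cong refl) metis
    moreover have "((a \<circ> \<alpha> g) - (\<Sum>b\<in>B. fscale (\<beta> g b) b)) - ((a \<circ> \<alpha> u) - (\<Sum>b\<in>B. fscale (\<beta> u b) b)) \<in> S"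
      by (rule subalg_diff[OF S'(1) conjunct2[OF key[OF g]] conjunct2[OF key[OF u(1)]]])
    ultimately show ?thesis using u(2) by simp
  qed
  define N :: "('q \<Rightarrow> 'k) set" where "N = {f. \<exists>c. f - fscale c a \<in> S}"
  have NI: "f \<in> N" if "f - fscale c a \<in> S" for f c using that unfolding N_def by blast
  obtain M1 where M1: "irr S M1" "\<And>N. fs.subspace N \<Longrightarrow> gstable N \<Longrightarrow> S \<subseteq> N \<Longrightarrow> a \<in> N \<Longrightarrow> M1 \<subseteq> N"
    by (rule irr_exists[OF S gS a(1) aS]) (rule that; assumption)
  have "M1 \<subseteq> N"
  proof (rule M1(2))
    show "fs.subspace N"
    proof (rule fs.subspaceI)
      have "(0 :: 'q \<Rightarrow> 'k) - fscale 0 a = 0" by (rule ext) simp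
      then show "0 \<in> N" by (intro NI[of _ 0]) (simp only: subalg_0[OF S'(1)])
      fix f g assume "f \<in> N" "g \<in> N"
      then obtain c d where "f - fscale c a \<in> S" "g - fscale d a \<in> S" unfolding N_def by blast
      from subalg_add[OF S'(1) this] have "f + g - fscale (c + d) a \<in> S"
        by (simp add: fs.scale_left_distrib algebra_simps)
      then show "f + g \<in> N" unfolding N_def by blast
    next
      fix c f assume "f \<in> N"
      then obtain d where "f - fscale d a \<in> S" unfolding N_def by blast
      from subalg_scale[OF S'(1) this, of c] have "fscale c f - fscale (c * d) a \<in> S"
        by (simp only: fs.scale_right_diff_distrib fs.scale_scale)
      then show "fscale c f \<in> N" unfolding N_def by blast
    qed
    show "gstable N" unfolding gstable_def
    proof (intro ballI)
      fix g f assume g: "g \<in> \<Gamma>" and "f \<in> N"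
      then obtain d where d: "f - fscale d a \<in> S" unfolding N_def by blast
      have "(f \<circ> \<alpha> g) - fscale d a = ((f - fscale d a) \<circ> \<alpha> g) + fscale d ((a \<circ> \<alpha> g) - a)"
        by (rule ext) (simp add: algebra_simps)
      also have "\<dots> \<in> S" by (intro subalg_add[OF S'(1)] subalg_scale[OF S'(1)] trans g gstableD[OF gS g d])
      finally show "f \<circ> \<alpha> g \<in> N" unfolding N_def by blast
    qed
    show "S \<subseteq> N"
    proof
      fix s assume s: "s \<in> S"
      have "s - fscale 0 a = s" by (rule ext) simp
      then show "s \<in> N" by (intro NI[of _ 0]) (simp only: s)
    qed
    have "a - fscale 1 a = 0" by (rule ext) simp
    then show "a \<in> N" by (intro NI[of _ 1]) (simp only: subalg_0[OF S'(1)])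
  qed
  moreover have M1': "fs.subspace M1" "S \<subset> M1" using M1(1) unfolding irr_def by blast+
  then obtain f where f: "f \<in> M1" "f \<notin> S" by blast
  ultimately obtain c where c: "f - fscale c a \<in> S" unfolding N_def by blast
  have "c \<noteq> 0"
  proof
    assume "c = 0"
    then have "f - fscale c a = f" by (intro ext) simp
    then show False using c f(2) by (simp only: simp_thms)
  qed
  have "f - (f - fscale c a) \<in> M1" using fs.subspace_diff[OF M1'(1) f(1)] c M1'(2) by blast
  then have "fscale (1 / c) (f - (f - fscale c a)) \<in> M1" by (rule fs.subspace_scale[OF M1'(1)])
  moreover have "fscale (1 / c) (f - (f - fscale c a)) = a" using \<open>c \<noteq> 0\<close> by (intro ext) simp
  ultimately have "a \<in> M1" by simp
  from frob_basis_impossible[OF pos max M1(1) this aS a(2)] show False by blast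
qed

lemma saturated_basis:
  assumes max: "\<forall>M'. irr S M' \<longrightarrow> algebra_gen M \<subseteq> algebra_gen M' \<longrightarrow> algebra_gen M' = algebra_gen M"
  shows "saturated S ws"
  unfolding saturated_def
proof (intro impI ballI allI)
  fix \<epsilon> :: 'k and c y i
  assume pos: "CHAR('k) > 0" and \<epsilon>: "\<epsilon> \<in> {0, 1}" and y: "y \<in> invs S"
    and r: "frob \<epsilon> y - (\<Sum>i<length ws. fscale (c i) (ws ! i)) \<in> S" and i: "i < length ws"
  have "(frob \<epsilon> y - (\<Sum>i<length ws. fscale (c i) (ws ! i))) + (\<Sum>i<length ws. fscale (c i) (ws ! i)) \<in> M"
    using fs.subspace_add[OF irr_M(1) _ combination_in_M] r irr_M(3) by blast
  then have fM: "frob \<epsilon> y \<in> M" by (simp only: diff_add_cancel)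
  have "y \<in> S"
  proof (cases "\<epsilon> = 0")
    case True
    have "frob 0 y = y ^ CHAR('k)" by (rule ext) (simp add: frob_apply)
    then show ?thesis using frob_0_descends[OF pos max y] fM True by simp
  next
    case False
    then show ?thesis using frob_1_descends[OF pos max y] fM \<epsilon> by simp
  qed
  then have "frob \<epsilon> y \<in> S" by (rule subalg_frob[OF S'(1)])
  from subalg_diff[OF S'(1) this r] have "(\<Sum>i<length ws. fscale (c i) (ws ! i)) \<in> S" by (simp only: diff_diff_eq2 add_diff_cancel_left')
  from indep_mod_nth[OF basis_ws(5,1) this i] show "c i = 0" .
qed

lemma block_basis: "block S ws"
  unfolding block_def
proof (intro conjI allI impI ballI)
  fix i assume i: "i < length ws"
  then have w: "ws ! i \<in> M" using basis_ws(2) by auto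
  have wA: "ws ! i \<in> A" using w irr_M(4) invs_A by blast
  have "\<forall>g. \<exists>c. g \<in> \<Gamma> \<longrightarrow> (ws ! i \<circ> \<alpha> g) - (\<Sum>b\<in>set ws. fscale (c b) b) \<in> S"
    using basis_ws(6)[OF gstableD[OF irr_M(5) _ w]] by blast
  from choice[OF this] obtain \<beta> where \<beta>: "\<And>g. g \<in> \<Gamma> \<Longrightarrow> (ws ! i \<circ> \<alpha> g) - (\<Sum>b\<in>set ws. fscale (\<beta> g b) b) \<in> S" by blast
  have "\<forall>b. \<exists>\<kappa>. b \<in> set ws \<longrightarrow> \<kappa> \<in> K \<and> (\<forall>g\<in>\<Gamma>. \<kappa> g = \<beta> g b)"
    using coefficients_in_K[OF S'(4) basis_ws(5) _ wA, of _ \<beta>] \<beta> by blast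
  from choice[OF this] obtain \<kappa> where \<kappa>: "\<And>b. b \<in> set ws \<Longrightarrow> \<kappa> b \<in> K \<and> (\<forall>g\<in>\<Gamma>. \<kappa> b g = \<beta> g b)" by blast
  show "\<exists>\<rho>. (\<forall>j<length ws. \<rho> j \<in> K) \<and>
      (\<forall>g\<in>\<Gamma>. (ws ! i \<circ> \<alpha> g) - (\<Sum>j<length ws. fscale (\<rho> j g) (ws ! j)) \<in> S)"
  proof (intro exI[of _ "\<lambda>j. \<kappa> (ws ! j)"] conjI allI impI ballI)
    show "\<kappa> (ws ! j) \<in> K" if "j < length ws" for j using \<kappa> that by simp
    fix g assume g: "g \<in> \<Gamma>"
    have "(\<Sum>b\<in>set ws. fscale (\<beta> g b) b) = (\<Sum>b\<in>set ws. fscale (\<kappa> b g) b)" using \<kappa> g by (intro sum.cong refl) simp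
    also have "\<dots> = (\<Sum>j<length ws. fscale (\<kappa> (ws ! j) g) (ws ! j))" by (rule sum_set_conv_nth[OF basis_ws(1)])
    finally show "(ws ! i \<circ> \<alpha> g) - (\<Sum>j<length ws. fscale (\<kappa> (ws ! j) g) (ws ! j)) \<in> S" using \<beta>[OF g] by (simp only:)
  qed
qed (use basis_ws(3,4) indep_basis in blast)+

end

end

section \<open>Blocks and towers\<close>

context unipotent_G_algebra
begin

definition good :: "('q \<Rightarrow> 'k) set \<Rightarrow> bool" where
  "good S \<longleftrightarrow> tsub S \<and> gstable S \<and> Tcond S"

lemma good_constants: "good (range cst)"
proof -
  have "subalg (range cst :: ('q \<Rightarrow> 'k) set)"
    unfolding subalg_def
  proof (intro conjI allI ballI)
    fix f g :: "'q \<Rightarrow> 'k" assume "f \<in> range cst" "g \<in> range cst"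
    then obtain c d where "f = cst c" "g = cst d" by blast
    then have "f + g = cst (c + d)" "f * g = cst (c * d)" by auto
    then show "f + g \<in> range cst" "f * g \<in> range cst" by blast+
  qed blast
  moreover have "tstable (range cst)" by (auto simp: tstable_def)
  moreover have "range cst \<subseteq> A" using subalg_cst[OF A] by blast
  ultimately show ?thesis unfolding good_def tsub_def using gstable_consts Tcond_constants by blast
qed

lemma block_exists:
  assumes "good S" "S \<noteq> A"
  shows "\<exists>ws. block S ws \<and> good (adjs S ws) \<and> S \<subset> adjs S ws"
proof -
  have S: "tsub S" and gS: "gstable S" and TS: "Tcond S" using assms(1) unfolding good_def by blast+
  note S' = tsubD[OF S]
  obtain f where f: "f \<in> A" "f \<notin> S" using assms(2) S'(3) by blast
  obtain V E where V: "fs.subspace V" "V \<subseteq> fs.span E" "finite E" "V \<subseteq> A" "tstable V" "f \<in> V"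
    by (rule translates_finite[OF f(1)]) (rule that; assumption)
  have "\<not> V \<subseteq> S" using V(6) f(2) by blast
  then obtain y where y: "y \<in> V" "y \<notin> S" "\<forall>\<sigma>\<in>Tr. (y \<circ> \<sigma>) - y \<in> S"
    using invariant_exists[OF S'(4,2,3) V(1,5,4)] by blast
  have "y \<in> invs S" using y(1,3) V(4) unfolding invs_def by blast
  obtain M0 where M0: "irr S M0" by (rule irr_exists[OF S gS \<open>y \<in> invs S\<close> y(2)])
  \<comment> \<open>Maximality is taken among the generated rings, not among the spaces: an
    irreducible space may lie inside the ring generated by another one, as x^p lies in k[x].\<close>
  define \<F> where "\<F> = {algebra_gen M | M. irr S M}"
  have gen: "\<exists>ws. basis_list S M ws" if M: "irr S M" for M
  proof -
    have "fs.subspace M" "S \<subseteq> M" "fdmod S M" using M unfolding irr_def by blast+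
    then show ?thesis by (rule basis_list_exists[OF S])
  qed
  have tsub_gen: "tsub (algebra_gen M)" if M: "irr S M" for M
  proof -
    obtain ws where ws: "basis_list S M ws" using gen[OF M] by blast
    have "set ws \<subseteq> invs S" by (rule basis_ws(3)[OF S gS TS M ws])
    then have "tsub (adjs S ws)" using adjs_tsub[OF S] fchain_of_invs[OF S'(1)] by blast
    then show ?thesis using adjs_basis[OF S gS TS M ws] by simp
  qed
  have "\<F> \<noteq> {}" using M0 unfolding \<F>_def by blast
  moreover have "tsub T" if "T \<in> \<F>" for T using that tsub_gen unfolding \<F>_def by blast
  ultimately obtain T where T: "T \<in> \<F>" "\<forall>T'\<in>\<F>. T \<subseteq> T' \<longrightarrow> T' = T" using tsub_maximal[of \<F>] by blast
  then obtain M where M: "irr S M" "T = algebra_gen M" unfolding \<F>_def by blast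
  have max: "\<forall>M'. irr S M' \<longrightarrow> algebra_gen M \<subseteq> algebra_gen M' \<longrightarrow> algebra_gen M' = algebra_gen M"
    using T(2) M(2) unfolding \<F>_def by blast
  obtain ws where ws: "basis_list S M ws" using gen[OF M(1)] by blast
  note c = S gS TS M(1) ws
  have eq: "adjs S ws = algebra_gen M" by (rule adjs_basis[OF c])
  have "Tcond (adjs S ws)"
  proof (rule Tcond_adjs[OF S TS basis_ws(3)[OF c] indep_basis[OF c] _ saturated_basis[OF c max]])
    show "\<forall>w\<in>set ws. w e = 0" using basis_ws(4)[OF c] by blast
  qed
  moreover have "gstable (adjs S ws)" unfolding eq by (rule gstable_algebra_gen[OF irr_M(5)[OF c]])
  moreover have "tsub (adjs S ws)" unfolding eq by (rule tsub_gen[OF M(1)])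
  moreover have "S \<subset> adjs S ws" unfolding eq using algebra_gen_superset[of M] irr_M(2)[OF c] by blast
  ultimately show ?thesis using block_basis[OF c] unfolding good_def by blast
qed

primrec tower :: "('q \<Rightarrow> 'k) set \<Rightarrow> ('q \<Rightarrow> 'k) list list \<Rightarrow> bool" where
  "tower S [] = True"
| "tower S (ws # bs) = (block S ws \<and> tower (adjs S ws) bs)"

lemma tower_append: "tower S (bs @ cs) \<longleftrightarrow> tower S bs \<and> tower (adjs S (concat bs)) cs"
  by (induction bs arbitrary: S) (auto simp: adjs_append)

lemma tower_exists: "\<exists>bs. tower (range cst) bs \<and> adjs (range cst) (concat bs) = A"
proof -
  let ?k = "range cst :: ('q \<Rightarrow> 'k) set"
  define \<F> where "\<F> = {adjs ?k (concat bs) | bs. tower ?k bs \<and> good (adjs ?k (concat bs))}"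
  have "adjs ?k (concat []) \<in> \<F>"
    unfolding \<F>_def using good_constants by (intro CollectI exI[of _ "[]"]) simp
  then have "\<F> \<noteq> {}" by blast
  moreover have "tsub T" if "T \<in> \<F>" for T using that unfolding \<F>_def good_def by blast
  ultimately obtain T where T: "T \<in> \<F>" "\<forall>T'\<in>\<F>. T \<subseteq> T' \<longrightarrow> T' = T" using tsub_maximal[of \<F>] by blast
  then obtain bs where bs: "tower ?k bs" "good (adjs ?k (concat bs))" "T = adjs ?k (concat bs)" unfolding \<F>_def by blast
  have "T = A"
  proof (rule ccontr)
    assume "T \<noteq> A"
    then obtain ws where ws: "block T ws" "good (adjs T ws)" "T \<subset> adjs T ws"
      using block_exists bs(2,3) by blast
    have "adjs T ws = adjs ?k (concat (bs @ [ws]))" by (simp add: bs(3) adjs_append)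
    moreover have "tower ?k (bs @ [ws])" using bs ws(1) by (simp add: tower_append)
    ultimately have "adjs T ws \<in> \<F>" unfolding \<F>_def using ws(2)
      by (intro CollectI exI[of _ "bs @ [ws]"] conjI) (simp_all only:)
    then show False using T(2) ws(3) by blast
  qed
  then show ?thesis using bs by blast
qed

end

section \<open>The coordinate ring of a unipotent \<open>G\<close>-group\<close>

lemma reg_affine_space: "f \<in> reg (affine_space d) \<longleftrightarrow> (\<exists>p\<in>poly_fun d. \<forall>v\<in>carrier_vec d. f v = p v)"
  by (simp add: affine_space_def)

lemma reg_subvariety_affine_space:
  assumes Z: "Z \<subseteq> carrier_vec d"
  shows "f \<in> reg (subvariety (affine_space d) Z) \<longleftrightarrow> (\<exists>p\<in>poly_fun d. \<forall>v\<in>Z. f v = p v)"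
proof
  assume "f \<in> reg (subvariety (affine_space d) Z)"
  then obtain g where g: "g \<in> reg (affine_space d)" "\<forall>v\<in>Z. f v = g v" by (auto simp: subvariety_def)
  then obtain p where "p \<in> poly_fun d" "\<forall>v\<in>carrier_vec d. g v = p v" unfolding reg_affine_space by blast
  then show "\<exists>p\<in>poly_fun d. \<forall>v\<in>Z. f v = p v" using g(2) Z by (intro bexI[of _ p]) auto
next
  assume "\<exists>p\<in>poly_fun d. \<forall>v\<in>Z. f v = p v"
  then obtain p where p: "p \<in> poly_fun d" "\<forall>v\<in>Z. f v = p v" by blast
  have "p \<in> reg (affine_space d)" unfolding reg_affine_space using p(1) by blast
  then show "f \<in> reg (subvariety (affine_space d) Z)" using p(2) by (auto simp: subvariety_def)
qed

lemma affine_variety_add: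
  fixes V :: "('a, 'k::field) variety"
  assumes V: "affine_variety V" and f: "f \<in> reg V" and g: "g \<in> reg V"
  shows "(\<lambda>x. f x + g x) \<in> reg V"
proof (rule affine_varietyE[OF V])
  fix d and Z :: "'k vec set" and \<iota> :: "'a \<Rightarrow> 'k vec"
  let ?W = "subvariety (affine_space d) Z" and ?j = "inv_into (points V) \<iota>"
  assume Z: "Z \<subseteq> carrier_vec d" and b: "bij_betw \<iota> (points V) Z"
    and pull: "\<And>f. f \<in> reg ?W \<Longrightarrow> f \<circ> \<iota> \<in> reg V"
    and push: "\<And>f. f \<in> reg V \<Longrightarrow> f \<circ> ?j \<in> reg ?W"
  note ex = reg_subvariety_affine_space[OF Z, THEN iffD1]
  obtain p q where pq: "p \<in> poly_fun d" "\<forall>x\<in>Z. (f \<circ> ?j) x = p x" "q \<in> poly_fun d" "\<forall>x\<in>Z. (g \<circ> ?j) x = q x"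
    using ex[OF push[OF f]] ex[OF push[OF g]] by blast
  have "(\<lambda>v. p v + q v) \<in> reg ?W"
    unfolding reg_subvariety_affine_space[OF Z] by (rule bexI[OF _ poly_fun.add[OF pq(1,3)]]) simp
  note pv = pull[OF this]
  have eq: "f x + g x = ((\<lambda>v. p v + q v) \<circ> \<iota>) x" if "x \<in> points V" for x
  proof -
    have "\<iota> x \<in> Z" "?j (\<iota> x) = x" using b that by (auto simp: bij_betw_def)
    then show ?thesis using pq by (metis comp_apply)
  qed
  show ?thesis by (rule affine_variety_cong[OF V pv]) (use eq in blast)
qed

text \<open>A fibre is closed, and its complement is closed too, being the zero set of the product
  over the finitely many other values.\<close>

lemma connected_finite_range:
  fixes V :: "('a, 'k::field) variety"
  assumes V: "affine_variety V" and conn: "connected_space (zariski V)"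
    and f: "f \<in> reg V" and fin: "finite (f ` points V)"
  shows "\<exists>c. \<forall>x\<in>points V. f x = c"
proof (cases "points V = {}")
  case False
  then obtain x0 where x0: "x0 \<in> points V" by blast
  define c where "c = f x0"
  have diff: "(\<lambda>x. f x - d) \<in> reg V" for d
    using affine_variety_add[OF V f affine_variety_const[OF V, of "- d"]] by simp
  have prod: "finite D \<Longrightarrow> (\<lambda>x. \<Prod>d\<in>D. f x - d) \<in> reg V" for D
  proof (induction D rule: finite_induct)
    case empty
    then show ?case using affine_variety_const[OF V, of 1] by simp
  next
    case (insert d D)
    then show ?case using affine_variety_mult[OF V diff insert.IH] by simp
  qed
  define T where "T = {x \<in> points V. f x = c}"
  have "T = zero_set V {\<lambda>x. f x - c}" by (auto simp: T_def zero_set_def)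
  then have closed: "closedin (zariski V) T" unfolding closedin_zariski[OF V] using diff by blast
  have "points V - T = zero_set V {\<lambda>x. \<Prod>d\<in>f ` points V - {c}. f x - d}"
    using fin by (auto simp: T_def zero_set_def)
  moreover have "{\<lambda>x. \<Prod>d\<in>f ` points V - {c}. f x - d} \<subseteq> reg V" using prod fin by simp
  moreover have "T \<subseteq> points V" by (auto simp: T_def)
  ultimately have "openin (zariski V) T" unfolding openin_zariski[OF V] by blast
  then have "T = {} \<or> T = topspace (zariski V)" using closed conn unfolding connected_space_clopen_in by blast
  moreover have "x0 \<in> T" using x0 by (simp add: T_def c_def)
  ultimately have "T = points V" using topspace_zariski[OF V] by blast
  then show ?thesis unfolding T_def by blast
qed auto

section \<open>The group and its normalised ring of functions\<close>

locale unipotent_G_group =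
  fixes G :: "('g, 'k::alg_closed_field) alg_group" and Q :: "('q, 'k) alg_group"
    and act :: "'q \<Rightarrow> 'g \<Rightarrow> 'q"
  assumes algebraic_G: "algebraic_group G" and connected_G: "connected_alg_group G"
    and G_group: "algebraic_G_group G Q act"
    and connected_Q: "connected_alg_group Q" and unipotent_Q: "unipotent_alg_group Q"
begin

lemma algebraic_Q: "algebraic_group Q"
  using G_group by (simp add: algebraic_G_group_def)

lemma group_Q: "group Q" and group_G: "group G"
  and affine_Q: "affine_variety (variety_of Q)" and affine_G: "affine_variety (variety_of G)"
  using algebraic_Q algebraic_G by (auto simp: algebraic_group_def)

interpretation Q: group Q by (rule group_Q)
interpretation G: group G by (rule group_G)

lemma variety_of_simps [simp]: "points (variety_of H) = carrier H" "reg (variety_of H) = coord_ring H"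
  by (simp_all add: variety_of_def)

lemma coord_ring_cong: "f \<in> coord_ring Q \<Longrightarrow> (\<And>x. x \<in> carrier Q \<Longrightarrow> g x = f x) \<Longrightarrow> g \<in> coord_ring Q"
  using affine_variety_cong[OF affine_Q, of f g] by simp

definition ret :: "'q \<Rightarrow> 'q" where "ret x = (if x \<in> carrier Q then x else \<one>\<^bsub>Q\<^esub>)"

text \<open>
  Functions on \<open>Q\<close> are normalised to take the value at \<open>1\<close> outside the carrier; this makes the
  coordinate ring a ring of total functions on which the extended multiplication acts.
\<close>

definition kQ :: "('q \<Rightarrow> 'k) set" where
  "kQ = {f \<in> coord_ring Q. \<forall>x. f x = f (ret x)}"

definition mlt :: "'q \<Rightarrow> 'q \<Rightarrow> 'q" where "mlt x y = ret x \<otimes>\<^bsub>Q\<^esub> ret y"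

definition alpha :: "'g \<Rightarrow> 'q \<Rightarrow> 'q" where "alpha g x = act (ret x) g"

lemma ret_in [simp]: "ret x \<in> carrier Q" and ret_id: "x \<in> carrier Q \<Longrightarrow> ret x = x"
  by (auto simp: ret_def)

lemma mlt_in [simp]: "mlt x y \<in> carrier Q"
  by (simp add: mlt_def)

lemma kQ_ret: "f \<in> kQ \<Longrightarrow> f (ret x) = f x"
  unfolding kQ_def by (metis (mono_tags) mem_Collect_eq)

lemma kQ_coord: "f \<in> kQ \<Longrightarrow> f \<in> coord_ring Q"
  by (simp add: kQ_def)

lemma norm_kQ: "f \<in> coord_ring Q \<Longrightarrow> f \<circ> ret \<in> kQ"
  unfolding kQ_def using coord_ring_cong[of f "f \<circ> ret"] by (simp add: ret_id)

lemma subalg_kQ: "subalg kQ"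
  unfolding subalg_def
proof (intro conjI allI ballI)
  show "cst c \<in> kQ" for c using affine_variety_const[OF affine_Q, of c] by (simp add: kQ_def cst_def)
  fix f g assume fg: "f \<in> kQ" "g \<in> kQ"
  have "(\<lambda>x. f x + g x) \<in> coord_ring Q" "(\<lambda>x. f x * g x) \<in> coord_ring Q"
    using affine_variety_add[OF affine_Q, of f g] affine_variety_mult[OF affine_Q, of f g] fg kQ_coord by auto
  moreover have "f + g = (\<lambda>x. f x + g x)" "f * g = (\<lambda>x. f x * g x)" by auto
  ultimately show "f + g \<in> kQ" "f * g \<in> kQ" using kQ_ret[OF fg(1)] kQ_ret[OF fg(2)] by (auto simp: kQ_def)
qed

lemma act_in: "x \<in> carrier Q \<Longrightarrow> g \<in> carrier G \<Longrightarrow> act x g \<in> carrier Q"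
  and act_one': "x \<in> carrier Q \<Longrightarrow> act x \<one>\<^bsub>G\<^esub> = x"
  and act_mult': "x \<in> carrier Q \<Longrightarrow> g \<in> carrier G \<Longrightarrow> h \<in> carrier G \<Longrightarrow> act x (g \<otimes>\<^bsub>G\<^esub> h) = act (act x g) h"
  using G_group by (auto simp: algebraic_G_group_def right_action_def)

lemma act_hom: "g \<in> carrier G \<Longrightarrow> x \<in> carrier Q \<Longrightarrow> y \<in> carrier Q \<Longrightarrow> act (x \<otimes>\<^bsub>Q\<^esub> y) g = act x g \<otimes>\<^bsub>Q\<^esub> act y g"
  using G_group by (auto simp: algebraic_G_group_def iso_def hom_def)

lemma act_e: "g \<in> carrier G \<Longrightarrow> act \<one>\<^bsub>Q\<^esub> g = \<one>\<^bsub>Q\<^esub>"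
  using act_hom[of g "\<one>\<^bsub>Q\<^esub>" "\<one>\<^bsub>Q\<^esub>"] act_in[of "\<one>\<^bsub>Q\<^esub>" g] Q.r_cancel_one' by simp

lemma comult_kQ:
  assumes f: "f \<in> kQ"
  shows "\<exists>(n::nat) a b. (\<forall>j<n. a j \<in> kQ \<and> b j \<in> kQ) \<and> (\<forall>x y. f (mlt x y) = (\<Sum>j<n. a j x * b j y))"
proof -
  have "f \<circ> (\<lambda>(x, y). x \<otimes>\<^bsub>Q\<^esub> y) \<in> reg (product_variety (variety_of Q) (variety_of Q))"
    using algebraic_Q kQ_coord[OF f] by (simp add: algebraic_group_def regular_map_def)
  then obtain n a b where ab: "\<forall>i<(n::nat). a i \<in> coord_ring Q \<and> b i \<in> coord_ring Q"
    "\<forall>x\<in>carrier Q. \<forall>y\<in>carrier Q. f (x \<otimes>\<^bsub>Q\<^esub> y) = (\<Sum>i<n. a i x * b i y)"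
    by (auto simp: product_variety_def)
  then show ?thesis using norm_kQ
    by (intro exI[of _ n] exI[of _ "\<lambda>i. a i \<circ> ret"] exI[of _ "\<lambda>i. b i \<circ> ret"]) (simp add: mlt_def)
qed

lemma act_rational_kQ:
  assumes f: "f \<in> kQ"
  shows "\<exists>(n::nat) a b. (\<forall>j<n. a j \<in> coord_ring G \<and> b j \<in> kQ) \<and>
    (\<forall>g\<in>carrier G. \<forall>x. f (alpha g x) = (\<Sum>j<n. a j g * b j x))"
proof -
  have "f \<circ> (\<lambda>(g, q). act q g) \<in> reg (product_variety (variety_of G) (variety_of Q))"
    using G_group kQ_coord[OF f] by (simp add: algebraic_G_group_def regular_map_def)
  then obtain n a b where ab: "\<forall>i<(n::nat). a i \<in> coord_ring G \<and> b i \<in> coord_ring Q"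
    "\<forall>g\<in>carrier G. \<forall>y\<in>carrier Q. f (act y g) = (\<Sum>i<n. a i g * b i y)"
    by (auto simp: product_variety_def)
  then show ?thesis using norm_kQ
    by (intro exI[of _ n] exI[of _ a] exI[of _ "\<lambda>i. b i \<circ> ret"]) (simp add: alpha_def)
qed

lemma kQ_scale: "f \<in> kQ \<Longrightarrow> fscale c f \<in> kQ"
  by (rule subalg_scale[OF subalg_kQ])

lemma alpha_kQ: assumes g: "g \<in> carrier G" and f: "f \<in> kQ" shows "f \<circ> alpha g \<in> kQ"
proof -
  obtain n a b where ab: "\<forall>j<(n::nat). a j \<in> coord_ring G \<and> b j \<in> kQ"
    "\<forall>g\<in>carrier G. \<forall>x. f (alpha g x) = (\<Sum>j<n. a j g * b j x)" using act_rational_kQ[OF f] by blast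
  have "f \<circ> alpha g = (\<Sum>j<n. fscale (a j g) (b j))" using ab(2) g by (auto simp: fun_eq_iff)
  moreover have "(\<Sum>j<n. fscale (a j g) (b j)) \<in> kQ"
    using ab(1) by (intro subalg_sum[OF subalg_kQ] kQ_scale) auto
  ultimately show ?thesis by simp
qed

lemma unipotent_translation:
  assumes f: "f \<in> kQ" and a: "a \<in> carrier Q"
  shows "\<exists>n. \<forall>y\<in>carrier Q. ((\<lambda>h y. h (y \<otimes>\<^bsub>Q\<^esub> a) - h y) ^^ n) f y = 0"
  using unipotent_Q a kQ_coord[OF f] unfolding unipotent_alg_group_def unipotent_element_def by blast

lemma ret_mlt: "ret (mlt x y) = ret x \<otimes>\<^bsub>Q\<^esub> ret y"
  using ret_id[OF mlt_in] by (simp add: mlt_def)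

lemma right_translation_power:
  assumes f: "f \<in> kQ"
  shows "((\<lambda>h. (h \<circ> (\<lambda>x. mlt x a)) - h) ^^ n) f y = ((\<lambda>h y. h (y \<otimes>\<^bsub>Q\<^esub> ret a) - h y) ^^ n) f (ret y)"
    (is "(?L ^^ n) f y = (?D ^^ n) f (ret y)")
proof (induction n arbitrary: y)
  case 0
  show ?case using kQ_ret[OF f] by simp
next
  case (Suc n)
  have 1: "(?L ^^ Suc n) f y = (?L ^^ n) f (mlt y a) - (?L ^^ n) f y" by simp
  have 2: "(?D ^^ Suc n) f (ret y) = (?D ^^ n) f (ret y \<otimes>\<^bsub>Q\<^esub> ret a) - (?D ^^ n) f (ret y)" by simp
  show ?case unfolding 1 2 Suc.IH ret_mlt by (rule refl)
qed

text \<open>Unipotence of an element is defined by right translation. Inversion turns left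
  translation by \<open>a\<close> into right translation by the inverse of \<open>a\<close>, applied
  to the function composed with inversion.\<close>

lemma left_translation_power:
  assumes f: "f \<in> kQ"
  shows "((\<lambda>h. (h \<circ> mlt a) - h) ^^ n) f y
    = ((\<lambda>h y. h (y \<otimes>\<^bsub>Q\<^esub> inv\<^bsub>Q\<^esub> (ret a)) - h y) ^^ n) (f \<circ> m_inv Q \<circ> ret) (inv\<^bsub>Q\<^esub> (ret y))"
    (is "(?L ^^ n) f y = (?D ^^ n) ?f (inv\<^bsub>Q\<^esub> (ret y))")
proof (induction n arbitrary: y)
  case 0
  show ?case using kQ_ret[OF f] by (simp add: ret_id)
next
  case (Suc n)
  have 1: "(?L ^^ Suc n) f y = (?L ^^ n) f (mlt a y) - (?L ^^ n) f y" by simp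
  have 2: "(?D ^^ Suc n) ?f x = (?D ^^ n) ?f (x \<otimes>\<^bsub>Q\<^esub> inv\<^bsub>Q\<^esub> (ret a)) - (?D ^^ n) ?f x" for x by simp
  have 3: "inv\<^bsub>Q\<^esub> (ret (mlt a y)) = inv\<^bsub>Q\<^esub> (ret y) \<otimes>\<^bsub>Q\<^esub> inv\<^bsub>Q\<^esub> (ret a)"
    by (simp add: ret_mlt Q.inv_mult_group)
  show ?case unfolding 1 2 Suc.IH 3 by (rule refl)
qed

lemma inverse_kQ: assumes "f \<in> kQ" shows "f \<circ> m_inv Q \<circ> ret \<in> kQ"
proof -
  have "f \<circ> m_inv Q \<in> coord_ring Q"
    using algebraic_Q kQ_coord[OF assms] by (simp add: algebraic_group_def regular_map_def)
  then show ?thesis by (rule norm_kQ)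
qed

text \<open>A closed embedding of \<open>Q\<close> in affine space gives generators of \<open>kQ\<close>; every character of \<open>kQ\<close>
  is the evaluation at a point because it maps the generators to a point of the embedded variety.\<close>

lemma kQ_coordinates:
  obtains d and \<iota> :: "'q \<Rightarrow> 'k vec" where "\<And>i. i < d \<Longrightarrow> (\<lambda>x. \<iota> (ret x) $ i) \<in> kQ"
    "\<And>f. f \<in> kQ \<Longrightarrow> \<exists>p\<in>poly_fun d. \<forall>x. f x = p (\<iota> (ret x))"
    "inj_on \<iota> (carrier Q)" "\<iota> ` carrier Q \<subseteq> carrier_vec d"
    "\<And>v. v \<in> carrier_vec d \<Longrightarrow> (\<And>p. p \<in> poly_fun d \<Longrightarrow> (\<forall>x. p (\<iota> (ret x)) = 0) \<Longrightarrow> p v = 0) \<Longrightarrow>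
      \<exists>x\<in>carrier Q. \<iota> x = v"
proof -
  obtain d Z \<iota> where Zc: "closedin (zariski (affine_space d :: ('k vec, 'k) variety)) Z"
    and i: "variety_iso (variety_of Q) (subvariety (affine_space d) Z) \<iota>"
    using affine_Q unfolding affine_variety_def by blast
  have p: "points (subvariety (affine_space d) Z) = Z" by (simp add: subvariety_def)
  have Z: "Z \<subseteq> carrier_vec d"
    using closedin_subset[OF Zc] by (simp add: topspace_zariski_affine_space)
  have b: "bij_betw \<iota> (carrier Q) Z" using i unfolding variety_iso_def p by simp
  have pull: "f \<circ> \<iota> \<in> coord_ring Q" if "f \<in> reg (subvariety (affine_space d) Z)" for f
    using i that unfolding variety_iso_def regular_map_def by simp
  have push: "f \<circ> inv_into (carrier Q) \<iota> \<in> reg (subvariety (affine_space d) Z)" if "f \<in> coord_ring Q" for f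
    using i that unfolding variety_iso_def regular_map_def by simp
  note rs = reg_subvariety_affine_space[OF Z]
  show thesis
  proof (rule that[of d \<iota>])
    fix i assume l: "i < d"
    have "(\<lambda>v. v $ i) \<in> reg (subvariety (affine_space d) Z)" unfolding rs by (rule bexI[OF _ poly_fun.coord[OF l]]) simp
    from norm_kQ[OF pull[OF this]] show "(\<lambda>x. \<iota> (ret x) $ i) \<in> kQ" by (simp add: comp_def)
  next
    fix f assume f: "f \<in> kQ"
    obtain p where p: "p \<in> poly_fun d" "\<forall>v\<in>Z. (f \<circ> inv_into (carrier Q) \<iota>) v = p v"
      using push[OF kQ_coord[OF f]] unfolding rs by blast
    have "f x = p (\<iota> (ret x))" for x
    proof -
      have "\<iota> (ret x) \<in> Z" "inv_into (carrier Q) \<iota> (\<iota> (ret x)) = ret x"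
        using b by (auto simp: bij_betw_def)
      then show ?thesis using p(2) kQ_ret[OF f, of x] by (metis comp_apply)
    qed
    then show "\<exists>p\<in>poly_fun d. \<forall>x. f x = p (\<iota> (ret x))" using p(1) by blast
  next
    show "inj_on \<iota> (carrier Q)" "\<iota> ` carrier Q \<subseteq> carrier_vec d" using b Z by (auto simp: bij_betw_def)
  next
    fix v :: "'k vec" assume v: "v \<in> carrier_vec d"
      and van: "\<And>p. p \<in> poly_fun d \<Longrightarrow> (\<forall>x. p (\<iota> (ret x)) = 0) \<Longrightarrow> p v = 0"
    obtain S where S: "S \<subseteq> reg (affine_space d)" "Z = zero_set (affine_space d) S"
      using Zc unfolding closedin_zariski[OF affine_variety_affine_space] by blast
    have "f v = 0" if f: "f \<in> S" for f
    proof -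
      obtain p where p: "p \<in> poly_fun d" "\<forall>v\<in>carrier_vec d. f v = p v" using S(1) f reg_affine_space by blast
      have "p (\<iota> (ret x)) = 0" for x
      proof -
        have "\<iota> (ret x) \<in> Z" using b by (auto simp: bij_betw_def)
        then have "f (\<iota> (ret x)) = 0" using S(2) f by (auto simp: zero_set_def)
        then show ?thesis using p(2) Z \<open>\<iota> (ret x) \<in> Z\<close> by auto
      qed
      then show ?thesis using van[OF p(1)] p(2) v by simp
    qed
    then have "v \<in> Z" using v S(2) by (auto simp: zero_set_def affine_space_def)
    then show "\<exists>x\<in>carrier Q. \<iota> x = v" using b by (auto simp: bij_betw_def)
  qed
qed

lemma fin_gen_kQ: "\<exists>B. finite B \<and> kQ = algebra_gen B"
proof -
  obtain d \<iota> where i: "\<And>i. i < d \<Longrightarrow> (\<lambda>x. \<iota> (ret x) $ i) \<in> kQ"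
    "\<And>f. f \<in> kQ \<Longrightarrow> \<exists>p\<in>poly_fun d. \<forall>x. f x = p (\<iota> (ret x))"
    by (rule kQ_coordinates) (rule that; assumption)
  define B where "B = (\<lambda>i x. \<iota> (ret x) $ i) ` {..<d}"
  have sub: "subalg (algebra_gen B)" by (rule subalg_algebra_gen)
  have poly: "(\<lambda>x. p (\<iota> (ret x))) \<in> algebra_gen B" if "p \<in> poly_fun d" for p
    using that
  proof induction
    case (const c)
    then show ?case using subalg_cst[OF sub, of c] by (simp add: cst_def)
  next
    case (coord i)
    then show ?case using algebra_gen_superset[of B] by (auto simp: B_def)
  next
    case (add p q)
    then show ?case using subalg_add[OF sub add.IH] by (simp add: plus_fun_def)
  next
    case (mult p q)
    then show ?case using subalg_mult[OF sub mult.IH] by (simp add: times_fun_def)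
  qed
  have "kQ \<subseteq> algebra_gen B"
  proof
    fix f assume "f \<in> kQ"
    then obtain p where p: "p \<in> poly_fun d" "\<forall>x. f x = p (\<iota> (ret x))" using i(2) by blast
    then have "f = (\<lambda>x. p (\<iota> (ret x)))" by auto
    then show "f \<in> algebra_gen B" using poly[OF p(1)] by simp
  qed
  moreover have "algebra_gen B \<subseteq> kQ"
    by (rule algebra_gen_minimal[OF subalg_kQ]) (use i(1) in \<open>auto simp: B_def\<close>)
  ultimately show ?thesis by (intro exI[of _ B]) (auto simp: B_def)
qed

sublocale unipotent_G_algebra mlt "\<one>\<^bsub>Q\<^esub>" kQ "carrier G" alpha "coord_ring G"
proof unfold_locales
  show "subalg kQ" by (rule subalg_kQ)
  show "f (mlt (mlt x y) z) = f (mlt x (mlt y z))" for f x y z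
    unfolding mlt_def[of "mlt x y"] mlt_def[of x "mlt y z"] ret_mlt by (simp add: Q.m_assoc)
  show "f (mlt x \<one>\<^bsub>Q\<^esub>) = f x" if "f \<in> kQ" for f x using kQ_ret[OF that] by (simp add: mlt_def ret_id)
  show "f (mlt \<one>\<^bsub>Q\<^esub> x) = f x" if "f \<in> kQ" for f x using kQ_ret[OF that] by (simp add: mlt_def ret_id)
  show "\<exists>(n::nat) a b. (\<forall>j<n. a j \<in> kQ \<and> b j \<in> kQ) \<and> (\<forall>x y. f (mlt x y) = (\<Sum>j<n. a j x * b j y))"
    if "f \<in> kQ" for f by (rule comult_kQ[OF that])
  show "\<exists>n. ((\<lambda>h. (h \<circ> (\<lambda>x. mlt x a)) - h) ^^ n) f = 0" if f: "f \<in> kQ" for f a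
  proof -
    obtain n where "\<forall>y\<in>carrier Q. ((\<lambda>h y. h (y \<otimes>\<^bsub>Q\<^esub> ret a) - h y) ^^ n) f y = 0"
      using unipotent_translation[OF f ret_in] by blast
    then have "((\<lambda>h. (h \<circ> (\<lambda>x. mlt x a)) - h) ^^ n) f y = 0" for y
      unfolding right_translation_power[OF f] by simp
    then show ?thesis by (intro exI[of _ n] ext) (simp only: zero_fun_apply)
  qed
  show "\<exists>n. ((\<lambda>h. (h \<circ> mlt a) - h) ^^ n) f = 0" if f: "f \<in> kQ" for f a
  proof -
    obtain n where "\<forall>y\<in>carrier Q. ((\<lambda>h y. h (y \<otimes>\<^bsub>Q\<^esub> inv\<^bsub>Q\<^esub> (ret a)) - h y) ^^ n) (f \<circ> m_inv Q \<circ> ret) y = 0"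
      using unipotent_translation[OF inverse_kQ[OF f], of "inv\<^bsub>Q\<^esub> (ret a)"] by auto
    then have "((\<lambda>h. (h \<circ> mlt a) - h) ^^ n) f y = 0" for y
      unfolding left_translation_power[OF f] by simp
    then show ?thesis by (intro exI[of _ n] ext) (simp only: zero_fun_apply)
  qed
  show "\<exists>B. finite B \<and> kQ = algebra_gen B" by (rule fin_gen_kQ)
  show "\<exists>c. f = cst c" if f: "f \<in> kQ" "finite (range f)" for f
  proof -
    have "finite (f ` points (variety_of Q))" using f(2) by (rule finite_subset[rotated]) auto
    then obtain c where "\<forall>x\<in>carrier Q. f x = c"
      using connected_finite_range[OF affine_Q, of f] connected_Q kQ_coord[OF f(1)]
      by (auto simp: connected_alg_group_def)
    then have "f x = c" for x using kQ_ret[OF f(1), of x] by simp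
    then show ?thesis by (intro exI[of _ c] ext) simp
  qed
  fix g assume g: "g \<in> carrier G"
  show "f \<circ> alpha g \<in> kQ" if "f \<in> kQ" for f by (rule alpha_kQ[OF g that])
  show "f (alpha g (mlt x y)) = f (mlt (alpha g x) (alpha g y))" for f x y
    using g by (simp add: mlt_def alpha_def act_hom ret_id act_in)
  \<comment> \<open>A right action reverses the order of composition, hence the witness is the
    product of \<open>h\<close> and \<open>g\<close> in this order.\<close>
  show "\<exists>l\<in>carrier G. \<forall>f\<in>kQ. f \<circ> alpha g \<circ> alpha h = f \<circ> alpha l" if h: "h \<in> carrier G" for h
    using g h by (intro bexI[of _ "h \<otimes>\<^bsub>G\<^esub> g"] ballI ext) (simp_all add: alpha_def act_mult' ret_id act_in)
next
  show "\<exists>u\<in>carrier G. \<forall>f\<in>kQ. f \<circ> alpha u = f"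
    by (intro bexI[of _ "\<one>\<^bsub>G\<^esub>"] ballI ext) (simp_all add: alpha_def act_one' kQ_ret)
  show "\<exists>(n::nat) a b. (\<forall>j<n. a j \<in> coord_ring G \<and> b j \<in> kQ) \<and>
      (\<forall>g\<in>carrier G. \<forall>x. f (alpha g x) = (\<Sum>j<n. a j g * b j x))" if "f \<in> kQ" for f
    by (rule act_rational_kQ[OF that])
  show "fs.subspace (coord_ring G)"
  proof (rule fs.subspaceI)
    show "0 \<in> coord_ring G" using affine_variety_const[OF affine_G, of 0] by (simp add: zero_fun_def)
    show "a + b \<in> coord_ring G" if "a \<in> coord_ring G" "b \<in> coord_ring G" for a b
      using affine_variety_add[OF affine_G, of a b] that by (simp add: plus_fun_def)
    show "fscale c a \<in> coord_ring G" if "a \<in> coord_ring G" for c a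
      using affine_variety_mult[OF affine_G affine_variety_const[OF affine_G, of c], of a] that by (simp add: fscale_def)
  qed
  show "\<exists>c. \<forall>g\<in>carrier G. \<beta> g = c" if "\<beta> \<in> coord_ring G" "finite (\<beta> ` carrier G)" for \<beta>
    using connected_finite_range[OF affine_G, of \<beta>] connected_G that by (simp add: connected_alg_group_def)
qed

end

section \<open>Coordinates adapted to a tower\<close>

lemma subalg_poly_fun: "subalg (poly_fun d)"
  unfolding subalg_def cst_def plus_fun_def times_fun_def by (auto intro: poly_fun.intros)

lemma poly_fun_subst:
  assumes T: "subalg T" and "P \<in> poly_fun n" and u: "\<And>l. l < n \<Longrightarrow> u l \<in> T"
  shows "(\<lambda>x. P (vec n (\<lambda>l. u l x))) \<in> T"
  using assms(2)
proof induction
  case (const c)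
  then show ?case using subalg_cst[OF T, of c] by (simp add: cst_def)
next
  case (coord i)
  then show ?case using u[OF coord] by simp
next
  case (add p q)
  then show ?case using subalg_add[OF T add.IH] by (simp add: plus_fun_def)
next
  case (mult p q)
  then show ?case using subalg_mult[OF T mult.IH] by (simp add: times_fun_def)
qed

definition character :: "('q \<Rightarrow> 'k::comm_ring_1) set \<Rightarrow> (('q \<Rightarrow> 'k) \<Rightarrow> 'k) \<Rightarrow> bool" where
  "character S \<chi> \<longleftrightarrow> (\<forall>c. \<chi> (cst c) = c) \<and> (\<forall>f\<in>S. \<forall>g\<in>S. \<chi> (f + g) = \<chi> f + \<chi> g \<and> \<chi> (f * g) = \<chi> f * \<chi> g)"

text \<open>An element of S[h] is represented by only one polynomial over \<open>S\<close>, so the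
  value at \<open>h\<close> can be prescribed freely.\<close>

lemma character_extend:
  assumes S: "subalg S" and tr: "transc S h" and \<chi>: "character S \<chi>"
  shows "\<exists>\<chi>'. character (adj S h) \<chi>' \<and> \<chi>' h = t \<and> (\<forall>a\<in>S. \<chi>' a = \<chi> a)"
proof -
  have c: "\<chi> (cst c) = c" for c using \<chi> by (simp add: character_def)
  have add: "\<chi> (f + g) = \<chi> f + \<chi> g" and mult: "\<chi> (f * g) = \<chi> f * \<chi> g" if "f \<in> S" "g \<in> S" for f g
    using \<chi> that by (auto simp: character_def)
  have 0: "\<chi> 0 = 0" using c[of 0] by (simp add: cst_0)
  have sum: "\<chi> (sum f I) = (\<Sum>i\<in>I. \<chi> (f i))" if "\<And>i. i \<in> I \<Longrightarrow> f i \<in> S" for f and I :: "nat set"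
    using that
  proof (induction I rule: infinite_finite_induct)
    case (insert x F)
    have IH: "\<chi> (sum f F) = (\<Sum>i\<in>F. \<chi> (f i))" by (rule insert.IH) (rule insert.prems, simp)
    have fx: "f x \<in> S" by (rule insert.prems) simp
    have sF: "sum f F \<in> S" by (rule subalg_sum[OF S]) (rule insert.prems, simp)
    show ?case unfolding sum.insert[OF insert.hyps(1,2)] by (simp only: add[OF fx sF] IH)
  qed (auto simp: 0)
  let ?m = "map_poly \<chi>"
  have cm: "coeff (?m p) i = \<chi> (coeff p i)" for p i by (rule coeff_map_poly[where f = \<chi>, OF 0])
  have madd: "?m (p + q) = ?m p + ?m q" if "coeffs_in S p" "coeffs_in S q" for p q
    using that by (intro poly_eqI) (simp add: cm add coeffs_in_def)
  have mmult: "?m (p * q) = ?m p * ?m q" if "coeffs_in S p" "coeffs_in S q" for p q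
  proof (rule poly_eqI)
    fix i
    have "\<chi> (\<Sum>j\<le>i. coeff p j * coeff q (i - j)) = (\<Sum>j\<le>i. \<chi> (coeff p j * coeff q (i - j)))"
      using that by (intro sum) (auto simp: coeffs_in_def intro: subalg_mult[OF S])
    then show "coeff (?m (p * q)) i = coeff (?m p * ?m q) i"
      using that by (simp add: cm coeff_mult mult coeffs_in_def)
  qed
  define \<chi>' where "\<chi>' g = poly (?m (rep S h g)) t" for g
  have base: "\<chi>' a = \<chi> a" if "a \<in> S" for a
  proof -
    have "rep S h (poly [:a:] h) = [:a:]" by (rule rep_poly[OF S tr coeffs_in_const[OF S that]])
    then show ?thesis by (simp add: \<chi>'_def map_poly_pCons[where f = \<chi>] 0)
  qed
  have "\<chi>' h = t"
  proof -
    have "coeffs_in S [:0, 1:]" by (intro coeffs_in_pCons coeffs_in_0 subalg_0 subalg_1 S)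
    from rep_poly[OF S tr this] have "rep S h h = [:0, 1:]" by simp
    moreover have "\<chi> 1 = 1" using c[of 1] by (simp add: cst_1)
    ultimately show ?thesis by (simp add: \<chi>'_def map_poly_pCons[where f = \<chi>] 0)
  qed
  moreover have "character (adj S h) \<chi>'"
    unfolding character_def
  proof (intro conjI allI ballI)
    show "\<chi>' (cst a) = a" for a using base[OF subalg_cst[OF S]] c by simp
    fix f g assume "f \<in> adj S h" "g \<in> adj S h"
    then obtain p q where pq: "coeffs_in S p" "coeffs_in S q" "f = poly p h" "g = poly q h" by (auto simp: adj_def)
    have r: "rep S h (poly u h) = u" if "coeffs_in S u" for u by (rule rep_poly[OF S tr that])
    have "\<chi>' (poly (p + q) h) = \<chi>' f + \<chi>' g" "\<chi>' (poly (p * q) h) = \<chi>' f * \<chi>' g"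
      unfolding \<chi>'_def pq(3,4) r[OF pq(1)] r[OF pq(2)] r[OF coeffs_in_add[OF S pq(1,2)]] r[OF coeffs_in_mult[OF S pq(1,2)]]
        madd[OF pq(1,2)] mmult[OF pq(1,2)] by simp_all
    then show "\<chi>' (f + g) = \<chi>' f + \<chi>' g" "\<chi>' (f * g) = \<chi>' f * \<chi>' g" by (simp_all only: pq(3,4) poly_add poly_mult)
  qed
  ultimately show ?thesis using base by blast
qed

lemma character_exists:
  assumes "subalg S" "indep S fs" "character S \<chi>"
  shows "\<exists>\<chi>'. character (adjs S fs) \<chi>' \<and> (\<forall>i<length fs. \<chi>' (fs ! i) = t i) \<and> (\<forall>a\<in>S. \<chi>' a = \<chi> a)"
  using assms
proof (induction fs arbitrary: S \<chi> t)
  case Nil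
  then show ?case by auto
next
  case (Cons f fs)
  have tr: "transc S f" and ind: "indep (adj S f) fs" using Cons.prems by auto
  obtain \<chi>1 where \<chi>1: "character (adj S f) \<chi>1" "\<chi>1 f = t 0" "\<forall>a\<in>S. \<chi>1 a = \<chi> a"
    using character_extend[OF Cons.prems(1) tr Cons.prems(3)] by blast
  obtain \<chi>2 where \<chi>2: "character (adjs (adj S f) fs) \<chi>2" "\<forall>i<length fs. \<chi>2 (fs ! i) = t (Suc i)"
    "\<forall>a\<in>adj S f. \<chi>2 a = \<chi>1 a"
    using Cons.IH[OF subalg_adj[OF Cons.prems(1)] ind \<chi>1(1), of "\<lambda>i. t (Suc i)"] by blast
  have "\<chi>2 f = t 0" using \<chi>2(3) \<chi>1(2) adj_self[OF Cons.prems(1)] by metis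
  moreover have "\<forall>a\<in>S. \<chi>2 a = \<chi> a" using \<chi>2(3) \<chi>1(3) adj_base[OF Cons.prems(1)] by metis
  ultimately show ?case using \<chi>2(1,2) by (intro exI[of _ \<chi>2]) (auto simp: nth_Cons split: nat.splits)
qed

context unipotent_G_algebra
begin

lemma block_tsub: "tsub S \<Longrightarrow> block S ws \<Longrightarrow> tsub (adjs S ws)"
  using adjs_tsub fchain_of_invs tsubD(1) unfolding block_def by blast

lemma block_gstable:
  assumes S: "tsub S" and gS: "gstable S" and b: "block S ws"
  shows "gstable (adjs S ws)"
  unfolding gstable_def
proof (intro ballI)
  fix g f assume g: "g \<in> \<Gamma>" and f: "f \<in> adjs S ws"
  note S' = tsubD[OF S]
  have sub: "subalg (adjs S ws)" by (rule subalg_adjs[OF S'(1)])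
  have SR: "S \<subseteq> adjs S ws" by (rule adjs_superset[OF S'(1)])
  have mem: "set ws \<subseteq> adjs S ws" by (rule adjs_members[OF S'(1)])
  have "subalg {f. f \<circ> \<alpha> g \<in> adjs S ws}"
    using sub by (auto simp: subalg_def fun_plus_comp fun_times_comp)
  moreover have "S \<subseteq> {f. f \<circ> \<alpha> g \<in> adjs S ws}" using gstableD[OF gS g] SR by blast
  moreover have "set ws \<subseteq> {f. f \<circ> \<alpha> g \<in> adjs S ws}"
  proof
    fix w assume "w \<in> set ws"
    then obtain i where i: "i < length ws" "w = ws ! i" by (auto simp: in_set_conv_nth)
    then obtain \<rho> where "\<forall>g\<in>\<Gamma>. (ws ! i \<circ> \<alpha> g) - (\<Sum>j<length ws. fscale (\<rho> j g) (ws ! j)) \<in> S"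
      using b unfolding block_def by blast
    then have r: "(w \<circ> \<alpha> g) - (\<Sum>j<length ws. fscale (\<rho> j g) (ws ! j)) \<in> adjs S ws" using g SR i by blast
    have "(\<Sum>j<length ws. fscale (\<rho> j g) (ws ! j)) \<in> adjs S ws"
      using mem by (intro subalg_sum[OF sub] subalg_scale[OF sub]) auto
    from subalg_add[OF sub r this] have "w \<circ> \<alpha> g \<in> adjs S ws" by (simp only: diff_add_cancel)
    then show "w \<in> {f. f \<circ> \<alpha> g \<in> adjs S ws}" by simp
  qed
  ultimately have "adjs S ws \<subseteq> {f. f \<circ> \<alpha> g \<in> adjs S ws}" by (rule adjs_minimal)
  then show "f \<circ> \<alpha> g \<in> adjs S ws" using f by blast
qed

lemma tower_indep: "tower S bs \<Longrightarrow> indep S (concat bs)"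
  by (induction bs arbitrary: S) (auto simp: indep_append block_def)

lemma tower_nth: "tower S bs \<Longrightarrow> i < length bs \<Longrightarrow> block (adjs S (concat (take i bs))) (bs ! i)"
proof (induction bs arbitrary: S i)
  case (Cons ws bs)
  then show ?case by (cases i) (auto simp: adjs_append)
qed simp

end

context unipotent_G_group
begin

interpretation Q: group Q by (rule group_Q)
interpretation G: group G by (rule group_G)

lemma poly_kQ:
  assumes "\<And>i. i < d \<Longrightarrow> (\<lambda>x. \<iota> (ret x) $ i) \<in> kQ" "\<And>x. \<iota> (ret x) \<in> carrier_vec d" "p \<in> poly_fun d"
  shows "(\<lambda>x. p (\<iota> (ret x))) \<in> kQ"
proof -
  have "vec d (\<lambda>l. \<iota> (ret x) $ l) = \<iota> (ret x)" for x using assms(2)[of x] by (intro eq_vecI) auto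
  then show ?thesis using poly_fun_subst[OF subalg_kQ assms(3), of "\<lambda>l x. \<iota> (ret x) $ l"] assms(1) by simp
qed

lemma character_point:
  assumes \<chi>: "character kQ \<chi>"
  shows "\<exists>x\<in>carrier Q. \<forall>f\<in>kQ. \<chi> f = f x"
proof -
  obtain d and \<iota> :: "'q \<Rightarrow> 'k vec" where i: "\<And>i. i < d \<Longrightarrow> (\<lambda>x. \<iota> (ret x) $ i) \<in> kQ"
    "\<And>f. f \<in> kQ \<Longrightarrow> \<exists>p\<in>poly_fun d. \<forall>x. f x = p (\<iota> (ret x))"
    "inj_on \<iota> (carrier Q)" "\<iota> ` carrier Q \<subseteq> carrier_vec d"
    and pt: "\<And>v. v \<in> carrier_vec d \<Longrightarrow> (\<And>p. p \<in> poly_fun d \<Longrightarrow> (\<forall>x. p (\<iota> (ret x)) = 0) \<Longrightarrow> p v = 0) \<Longrightarrow>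
      \<exists>x\<in>carrier Q. \<iota> x = v"
  proof (rule kQ_coordinates)
    fix d and \<iota> :: "'q \<Rightarrow> 'k vec"
    assume "\<And>i. i < d \<Longrightarrow> (\<lambda>x. \<iota> (ret x) $ i) \<in> kQ" "\<And>f. f \<in> kQ \<Longrightarrow> \<exists>p\<in>poly_fun d. \<forall>x. f x = p (\<iota> (ret x))"
      "inj_on \<iota> (carrier Q)" "\<iota> ` carrier Q \<subseteq> carrier_vec d"
      "\<And>v. v \<in> carrier_vec d \<Longrightarrow> (\<And>p. p \<in> poly_fun d \<Longrightarrow> (\<forall>x. p (\<iota> (ret x)) = 0) \<Longrightarrow> p v = 0) \<Longrightarrow>
      \<exists>x\<in>carrier Q. \<iota> x = v"
    then show thesis by (rule that)
  qed
  have pk: "(\<lambda>x. p (\<iota> (ret x))) \<in> kQ" if "p \<in> poly_fun d" for p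
    using i(4) by (intro poly_kQ[OF i(1) _ that]) auto
  define v where "v = vec d (\<lambda>i. \<chi> (\<lambda>x. \<iota> (ret x) $ i))"
  have pv: "\<chi> (\<lambda>x. p (\<iota> (ret x))) = p v" if "p \<in> poly_fun d" for p
    using that
  proof induction
    case (const c)
    have "\<chi> (cst c) = c" using \<chi> by (simp add: character_def)
    then show ?case by (simp add: cst_def)
  next
    case (coord i)
    then show ?case by (simp add: v_def)
  next
    case (add p q)
    have "\<chi> ((\<lambda>x. p (\<iota> (ret x))) + (\<lambda>x. q (\<iota> (ret x)))) = p v + q v"
      using \<chi> pk[OF add.hyps(1)] pk[OF add.hyps(2)] add.IH unfolding character_def by metis
    then show ?case by (simp add: plus_fun_def)
  next
    case (mult p q)
    have "\<chi> ((\<lambda>x. p (\<iota> (ret x))) * (\<lambda>x. q (\<iota> (ret x)))) = p v * q v"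
      using \<chi> pk[OF mult.hyps(1)] pk[OF mult.hyps(2)] mult.IH unfolding character_def by metis
    then show ?case by (simp add: times_fun_def)
  qed
  have "p v = 0" if "p \<in> poly_fun d" "\<forall>x. p (\<iota> (ret x)) = 0" for p
  proof -
    have "(\<lambda>x. p (\<iota> (ret x))) = cst 0" using that(2) by auto
    then show ?thesis using pv[OF that(1)] \<chi> by (simp add: character_def)
  qed
  then obtain x where x: "x \<in> carrier Q" "\<iota> x = v" using pt[of v] by (auto simp: v_def)
  have "\<chi> f = f x" if f: "f \<in> kQ" for f
  proof -
    obtain p where p: "p \<in> poly_fun d" "\<forall>x. f x = p (\<iota> (ret x))" using i(2)[OF f] by blast
    then have "f = (\<lambda>x. p (\<iota> (ret x)))" by auto
    then have "\<chi> f = p v" using pv[OF p(1)] by simp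
    then show ?thesis using p(2) x by (simp add: ret_id)
  qed
  then show ?thesis using x(1) by blast
qed

lemma kQ_separates:
  assumes "x \<in> carrier Q" "y \<in> carrier Q" "\<And>f. f \<in> kQ \<Longrightarrow> f x = f y" shows "x = y"
proof (rule kQ_coordinates)
  fix d and \<iota> :: "'q \<Rightarrow> 'k vec"
  assume i: "\<And>i. i < d \<Longrightarrow> (\<lambda>x. \<iota> (ret x) $ i) \<in> kQ" "inj_on \<iota> (carrier Q)" "\<iota> ` carrier Q \<subseteq> carrier_vec d"
  have "\<iota> x = \<iota> y"
  proof (rule eq_vecI)
    have d: "\<iota> x \<in> carrier_vec d" "\<iota> y \<in> carrier_vec d" using i(3) assms by auto
    then show "dim_vec (\<iota> x) = dim_vec (\<iota> y)" by auto
    fix l assume "l < dim_vec (\<iota> y)"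
    then have "l < d" using d by auto
    from assms(3)[OF i(1)[OF this]] show "\<iota> x $ l = \<iota> y $ l" using assms(1,2) by (simp add: ret_id)
  qed
  then show "x = y" using i(2) assms by (auto dest: inj_onD)
qed

end

section \<open>Coordinates given by a tower identify the group with affine space\<close>

locale tower_coordinates = unipotent_G_group G Q act
  for G :: "('g, 'k::alg_closed_field) alg_group" and Q :: "('q, 'k) alg_group" and act +
  fixes bs :: "('q \<Rightarrow> 'k) list list"
  assumes tower: "tower (range cst) bs" and full: "adjs (range cst) (concat bs) = kQ"
begin

text \<open>The ring of functions generated by the first \<open>i\<close> blocks; it plays the role
  of the coordinate ring of the quotient by the i-th subgroup.\<close>

definition level :: "nat \<Rightarrow> ('q \<Rightarrow> 'k) set" where "level i = adjs (range cst) (concat (take i bs))"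

definition offset :: "nat \<Rightarrow> nat" where "offset i = length (concat (take i bs))"

abbreviation "cs \<equiv> concat bs"
abbreviation "n \<equiv> length (concat bs)"

definition crd :: "'q \<Rightarrow> 'k vec" where "crd x = vec n (\<lambda>l. (cs ! l) x)"

lemma level_Suc: "i < length bs \<Longrightarrow> level (Suc i) = adjs (level i) (bs ! i)"
  by (simp add: level_def take_Suc_conv_app_nth adjs_append)

lemma level_0: "level 0 = range cst" and level_full: "level (length bs) = kQ"
  by (simp_all add: level_def full)

lemma block_level: "i < length bs \<Longrightarrow> block (level i) (bs ! i)"
  unfolding level_def by (rule tower_nth[OF tower])

lemma level_good: "i \<le> length bs \<Longrightarrow> tsub (level i) \<and> gstable (level i)"
proof (induction i)
  case 0
  show ?case using good_constants unfolding level_0 good_def by blast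
next
  case (Suc i)
  then show ?case using block_tsub block_gstable block_level[of i] level_Suc[of i] by simp
qed

lemma take_offset: "take (offset i) cs = concat (take i bs)"
proof -
  have "cs = concat (take i bs) @ concat (drop i bs)" by (metis append_take_drop_id concat_append)
  then show ?thesis unfolding offset_def by (metis append_eq_conv_conj)
qed

lemma offset_le: "offset i \<le> n"
  using arg_cong[OF take_offset[of i], of length] unfolding offset_def by simp

lemma nth_block:
  assumes "i < length bs" "j < length (bs ! i)"
  shows "cs ! (offset i + j) = bs ! i ! j" "offset i + j < offset (Suc i)"
proof -
  have "concat (take (Suc i) bs) = concat (take i bs) @ bs ! i" using assms by (simp add: take_Suc_conv_app_nth)
  then have eq: "take (offset (Suc i)) cs = concat (take i bs) @ bs ! i" by (simp add: take_offset)
  have o: "offset (Suc i) = offset i + length (bs ! i)" using assms by (simp add: offset_def take_Suc_conv_app_nth)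
  show "offset i + j < offset (Suc i)" using o assms by simp
  then have "cs ! (offset i + j) = take (offset (Suc i)) cs ! (offset i + j)" by simp
  then show "cs ! (offset i + j) = bs ! i ! j" unfolding eq by (simp add: nth_append offset_def)
qed

lemma offset_Suc: "i < length bs \<Longrightarrow> offset (Suc i) = offset i + length (bs ! i)"
  by (simp add: offset_def take_Suc_conv_app_nth)

lemma nth_level: "l < offset i \<Longrightarrow> cs ! l \<in> level i"
proof -
  assume l: "l < offset i"
  then have eq: "concat (take i bs) ! l = cs ! l" unfolding take_offset[symmetric] by simp
  have "l < length (concat (take i bs))" using l by (simp only: offset_def)
  from nth_mem[OF this] have "cs ! l \<in> set (concat (take i bs))" unfolding eq .
  moreover have "subalg (range cst :: ('q \<Rightarrow> 'k) set)" using tsubD(1) level_good[of 0] level_0 by simp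
  ultimately show ?thesis unfolding level_def using adjs_members by blast
qed

lemma level_induct:
  assumes "subalg T" "\<And>l. l < offset i \<Longrightarrow> cs ! l \<in> T" shows "level i \<subseteq> T"
  unfolding level_def
proof (rule adjs_minimal[OF assms(1)])
  show "range cst \<subseteq> T" using subalg_cst[OF assms(1)] by blast
  show "set (concat (take i bs)) \<subseteq> T"
  proof
    fix w assume "w \<in> set (concat (take i bs))"
    then have "\<exists>l<length (concat (take i bs)). concat (take i bs) ! l = w" unfolding in_set_conv_nth .
    then obtain l where l: "l < length (concat (take i bs))" "concat (take i bs) ! l = w" by (elim exE conjE)
    have lo: "l < offset i" using l(1) by (simp only: offset_def)
    have "w = cs ! l" using l(2) lo unfolding take_offset[symmetric] by simp
    then show "w \<in> T" using assms(2)[OF lo] by simp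
  qed
qed

lemma cs_kQ: "l < n \<Longrightarrow> cs ! l \<in> kQ"
  using nth_level[of l "length bs"] unfolding level_full by (simp add: offset_def)

lemma cs_unit: "l < n \<Longrightarrow> (cs ! l) \<one>\<^bsub>Q\<^esub> = 0"
proof -
  assume "l < n"
  then have "cs ! l \<in> set cs" by (rule nth_mem)
  then obtain ws where ws: "ws \<in> set bs" "cs ! l \<in> set ws" by auto
  then obtain i where "i < length bs" "ws = bs ! i" by (auto simp: in_set_conv_nth)
  then show ?thesis using block_level[of i] ws unfolding block_def by blast
qed

lemma crd_carrier [simp]: "crd x \<in> carrier_vec n"
  by (simp add: crd_def)

lemma poly_crd: "f \<in> kQ \<Longrightarrow> \<exists>P\<in>poly_fun n. \<forall>x. f x = P (crd x)"
proof -
  assume f: "f \<in> kQ"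
  define T where "T = {f. \<exists>P\<in>poly_fun n. \<forall>x. f x = P (crd x)}"
  have "subalg T" unfolding subalg_def
  proof (intro conjI allI ballI)
    show "cst c \<in> T" for c unfolding T_def by (intro CollectI bexI[OF _ poly_fun.const[of c]]) simp
    fix f g assume "f \<in> T" "g \<in> T"
    then obtain P R where PR: "P \<in> poly_fun n" "\<forall>x. f x = P (crd x)" "R \<in> poly_fun n" "\<forall>x. g x = R (crd x)"
      unfolding T_def by blast
    show "f + g \<in> T" unfolding T_def
      by (intro CollectI bexI[OF _ poly_fun.add[OF PR(1,3)]]) (simp add: PR(2,4))
    show "f * g \<in> T" unfolding T_def
      by (intro CollectI bexI[OF _ poly_fun.mult[OF PR(1,3)]]) (simp add: PR(2,4))
  qed
  moreover have "cs ! l \<in> T" if "l < offset (length bs)" for l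
    unfolding T_def using that
    by (intro CollectI bexI[OF _ poly_fun.coord[of l]]) (simp_all add: crd_def offset_def)
  ultimately have "level (length bs) \<subseteq> T" by (rule level_induct)
  then show ?thesis using f unfolding level_full T_def by blast
qed

lemma crd_inj: assumes "x \<in> carrier Q" "y \<in> carrier Q" "crd x = crd y" shows "x = y"
proof (rule kQ_separates[OF assms(1,2)])
  fix f assume "f \<in> kQ"
  then obtain P where "\<forall>x. f x = P (crd x)" using poly_crd by blast
  then show "f x = f y" using assms(3) by simp
qed

text \<open>Independence of the coordinates allows a character of \<open>kQ\<close> with any
  prescribed values on them, and every character is evaluation at a point of
  \<open>Q\<close>.\<close>

lemma crd_surj: assumes "t \<in> carrier_vec n" shows "\<exists>x\<in>carrier Q. crd x = t"
proof -
  have c: "subalg (range cst :: ('q \<Rightarrow> 'k) set)" using tsubD(1) level_good[of 0] level_0 by simp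
  have "character (range cst) (\<lambda>f :: 'q \<Rightarrow> 'k. f \<one>\<^bsub>Q\<^esub>)" by (simp add: character_def)
  from character_exists[OF c tower_indep[OF tower] this, of "\<lambda>l. t $ l"]
  obtain \<chi> where \<chi>: "character kQ \<chi>" "\<forall>i<n. \<chi> (cs ! i) = t $ i" unfolding full by blast
  obtain x where x: "x \<in> carrier Q" "\<forall>f\<in>kQ. \<chi> f = f x" using character_point[OF \<chi>(1)] by blast
  have "crd x = t"
  proof (rule eq_vecI)
    show "dim_vec (crd x) = dim_vec t" using assms by (simp add: crd_def)
    fix l assume "l < dim_vec t"
    then have "l < n" using assms by simp
    then have "(cs ! l) x = t $ l" using \<chi>(2) bspec[OF x(2) cs_kQ] by metis
    then show "crd x $ l = t $ l" using \<open>l < n\<close> by (simp add: crd_def)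
  qed
  then show ?thesis using x(1) by blast
qed

definition pt :: "'k vec \<Rightarrow> 'q" where "pt t = (SOME x. x \<in> carrier Q \<and> crd x = t)"

lemma pt: assumes "t \<in> carrier_vec n" shows "pt t \<in> carrier Q" "crd (pt t) = t"
proof -
  have "\<exists>x. x \<in> carrier Q \<and> crd x = t" using crd_surj[OF assms] by blast
  from someI_ex[OF this] show "pt t \<in> carrier Q" "crd (pt t) = t" by (simp_all add: pt_def)
qed

lemma pt_nth: "t \<in> carrier_vec n \<Longrightarrow> l < n \<Longrightarrow> (cs ! l) (pt t) = t $ l"
  using pt(2)[of t] by (metis crd_def index_vec)

end

section \<open>The filtration\<close>

lemma product_variety_regI:
  assumes "finite I" "\<And>i. i \<in> I \<Longrightarrow> f i \<in> reg V \<and> g i \<in> reg W"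
    "\<And>x y. x \<in> points V \<Longrightarrow> y \<in> points W \<Longrightarrow> h (x, y) = (\<Sum>i\<in>I. f i x * g i y)"
  shows "h \<in> reg (product_variety V W)"
proof -
  obtain b where b: "bij_betw b {0..<card I} I" using ex_bij_betw_nat_finite[OF assms(1)] by blast
  have bI: "b i \<in> I" if "i < card I" for i using b that by (auto simp: bij_betw_def)
  have "h (x, y) = (\<Sum>i<card I. f (b i) x * g (b i) y)" if "x \<in> points V" "y \<in> points W" for x y
    unfolding assms(3)[OF that] using sum.reindex_bij_betw[OF b, of "\<lambda>i. f i x * g i y"] by (simp add: lessThan_atLeast0)
  then show ?thesis unfolding product_variety_def using assms(2)[OF bI]
    by (auto intro!: exI[of _ "card I"] exI[of _ "\<lambda>i. f (b i)"] exI[of _ "\<lambda>i. g (b i)"])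
qed

lemma product_variety_regD:
  "h \<in> reg (product_variety V W) \<Longrightarrow> \<exists>(n::nat) f g. (\<forall>i<n. f i \<in> reg V \<and> g i \<in> reg W) \<and>
    (\<forall>x\<in>points V. \<forall>y\<in>points W. h (x, y) = (\<Sum>i<n. f i x * g i y))"
  by (simp add: product_variety_def)

lemma subalg_product_variety:
  assumes V: "affine_variety V" and W: "affine_variety W"
  shows "subalg (reg (product_variety V W))"
  unfolding subalg_def
proof (intro conjI allI ballI)
  show "cst c \<in> reg (product_variety V W)" for c
    using affine_variety_const[OF V, of c] affine_variety_const[OF W, of 1]
    by (intro product_variety_regI[of "{()}" "\<lambda>_ _. c" _ "\<lambda>_ _. 1"]) auto
  fix h k assume "h \<in> reg (product_variety V W)" "k \<in> reg (product_variety V W)"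
  from product_variety_regD[OF this(1)] product_variety_regD[OF this(2)]
  obtain n n' :: nat and f g f' g' where
    "\<forall>i<n. f i \<in> reg V \<and> g i \<in> reg W" "\<forall>x\<in>points V. \<forall>y\<in>points W. h (x, y) = (\<Sum>i<n. f i x * g i y)"
    "\<forall>i<n'. f' i \<in> reg V \<and> g' i \<in> reg W" "\<forall>x\<in>points V. \<forall>y\<in>points W. k (x, y) = (\<Sum>i<n'. f' i x * g' i y)"
    by (elim exE conjE) (rule that)
  then have h: "\<And>i. i < n \<Longrightarrow> f i \<in> reg V \<and> g i \<in> reg W"
      "\<And>x y. x \<in> points V \<Longrightarrow> y \<in> points W \<Longrightarrow> h (x, y) = (\<Sum>i<n. f i x * g i y)" and
    k: "\<And>i. i < n' \<Longrightarrow> f' i \<in> reg V \<and> g' i \<in> reg W"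
      "\<And>x y. x \<in> points V \<Longrightarrow> y \<in> points W \<Longrightarrow> k (x, y) = (\<Sum>i<n'. f' i x * g' i y)"
    by blast+
  show "h + k \<in> reg (product_variety V W)"
  proof (rule product_variety_regI)
    show "finite ({..<n} <+> {..<n'})" by simp
    show "case_sum f f' i \<in> reg V \<and> case_sum g g' i \<in> reg W" if "i \<in> {..<n} <+> {..<n'}" for i
      using that h(1) k(1) by auto
    show "(h + k) (x, y) = (\<Sum>i\<in>{..<n} <+> {..<n'}. case_sum f f' i x * case_sum g g' i y)"
      if "x \<in> points V" "y \<in> points W" for x y
      using h(2)[OF that] k(2)[OF that] by (simp add: sum.Plus)
  qed
  show "h * k \<in> reg (product_variety V W)"
  proof (rule product_variety_regI)
    show "finite ({..<n} \<times> {..<n'})" by simp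
    show "(\<lambda>x. f (fst i) x * f' (snd i) x) \<in> reg V \<and> (\<lambda>x. g (fst i) x * g' (snd i) x) \<in> reg W"
      if "i \<in> {..<n} \<times> {..<n'}" for i
      using that h(1) k(1) by (auto intro!: affine_variety_mult V W)
    show "(h * k) (x, y) = (\<Sum>i\<in>{..<n} \<times> {..<n'}. (f (fst i) x * f' (snd i) x) * (g (fst i) y * g' (snd i) y))"
      if "x \<in> points V" "y \<in> points W" for x y
      unfolding times_fun_apply h(2)[OF that] k(2)[OF that] sum_product sum.cartesian_product
      by (intro sum.cong) (auto simp: mult_ac)
  qed
qed

context tower_coordinates
begin

interpretation Q: group Q by (rule group_Q)
interpretation G: group G by (rule group_G)

definition N :: "nat \<Rightarrow> 'q set" where "N i = {x \<in> carrier Q. \<forall>f\<in>level i. f x = f \<one>\<^bsub>Q\<^esub>}"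

lemma N_carrier: "N i \<subseteq> carrier Q"
  by (auto simp: N_def)

lemma N_eq: "x \<in> N i \<Longrightarrow> f \<in> level i \<Longrightarrow> f x = f \<one>\<^bsub>Q\<^esub>"
  unfolding N_def by blast

lemma agree_iff: "(\<forall>f\<in>level i. f x = f y) \<longleftrightarrow> (\<forall>l<offset i. (cs ! l) x = (cs ! l) y)"
proof
  assume "\<forall>l<offset i. (cs ! l) x = (cs ! l) y"
  moreover have "subalg {f :: 'q \<Rightarrow> 'k. f x = f y}" by (auto simp: subalg_def)
  ultimately have "level i \<subseteq> {f. f x = f y}" by (intro level_induct) auto
  then show "\<forall>f\<in>level i. f x = f y" by blast
qed (use nth_level in blast)

lemma N_iff: "x \<in> N i \<longleftrightarrow> x \<in> carrier Q \<and> (\<forall>l<offset i. (cs ! l) x = 0)"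
  using cs_unit offset_le[of i] unfolding N_def agree_iff by (auto simp: less_le_trans)

text \<open>Translation stability makes agreement on \<open>level i\<close> a congruence for the
  multiplication. From this follow the subgroup property, normality and the description of
  cosets.\<close>

lemma agree_mult:
  assumes i: "i \<le> length bs" and c: "x \<in> carrier Q" "y \<in> carrier Q" "a \<in> carrier Q"
    and eq: "\<And>f. f \<in> level i \<Longrightarrow> f x = f y" and f: "f \<in> level i"
  shows "f (x \<otimes>\<^bsub>Q\<^esub> a) = f (y \<otimes>\<^bsub>Q\<^esub> a)" "f (a \<otimes>\<^bsub>Q\<^esub> x) = f (a \<otimes>\<^bsub>Q\<^esub> y)"
proof -
  have st: "tstable (level i)" using level_good[OF i] tsubD(2) by blast
  show "f (x \<otimes>\<^bsub>Q\<^esub> a) = f (y \<otimes>\<^bsub>Q\<^esub> a)" "f (a \<otimes>\<^bsub>Q\<^esub> x) = f (a \<otimes>\<^bsub>Q\<^esub> y)"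
    using eq[OF tstableD[OF st Tr_right f, of a]] eq[OF tstableD[OF st Tr_left f, of a]] c
    by (simp_all add: mlt_def ret_id)
qed

lemma N_mult:
  assumes i: "i \<le> length bs" and "x \<in> N i" "a \<in> carrier Q" "f \<in> level i"
  shows "f (x \<otimes>\<^bsub>Q\<^esub> a) = f a" "f (a \<otimes>\<^bsub>Q\<^esub> x) = f a"
  using agree_mult[OF i, of x "\<one>\<^bsub>Q\<^esub>" a f] assms by (auto simp: N_def)

lemma subgroup_N: assumes i: "i \<le> length bs" shows "subgroup (N i) Q"
proof
  show "N i \<subseteq> carrier Q" by (rule N_carrier)
  show "\<one>\<^bsub>Q\<^esub> \<in> N i" by (simp add: N_def)
  show "x \<otimes>\<^bsub>Q\<^esub> y \<in> N i" if xy: "x \<in> N i" "y \<in> N i" for x y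
  proof -
    have c: "x \<in> carrier Q" "y \<in> carrier Q" using xy N_carrier by blast+
    have "f (x \<otimes>\<^bsub>Q\<^esub> y) = f \<one>\<^bsub>Q\<^esub>" if f: "f \<in> level i" for f
      using N_mult(1)[OF i xy(1) c(2) f] xy(2) f by (simp add: N_def)
    then show ?thesis using c by (simp add: N_def)
  qed
  show "inv\<^bsub>Q\<^esub> x \<in> N i" if "x \<in> N i" for x
  proof -
    have x: "x \<in> carrier Q" using that N_carrier by blast
    have "f (inv\<^bsub>Q\<^esub> x) = f \<one>\<^bsub>Q\<^esub>" if f: "f \<in> level i" for f
      using N_mult(2)[OF i \<open>x \<in> N i\<close> Q.inv_closed[OF x] f] x by simp
    then show ?thesis using x by (simp add: N_def)
  qed
qed

lemma normal_N: assumes i: "i \<le> length bs" shows "N i \<lhd> Q"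
  unfolding Q.normal_inv_iff
proof (intro conjI ballI subgroup_N i)
  fix a x assume a: "a \<in> carrier Q" and x: "x \<in> N i"
  have xc: "x \<in> carrier Q" using x N_carrier by blast
  have "f (a \<otimes>\<^bsub>Q\<^esub> x \<otimes>\<^bsub>Q\<^esub> inv\<^bsub>Q\<^esub> a) = f \<one>\<^bsub>Q\<^esub>" if f: "f \<in> level i" for f
  proof -
    have "f (a \<otimes>\<^bsub>Q\<^esub> (x \<otimes>\<^bsub>Q\<^esub> inv\<^bsub>Q\<^esub> a)) = f (a \<otimes>\<^bsub>Q\<^esub> inv\<^bsub>Q\<^esub> a)"
      using N_mult(1)[OF i x Q.inv_closed[OF a]] a xc
      by (intro agree_mult(2)[OF i _ _ a _ f]) auto
    then show ?thesis using a xc by (simp add: Q.m_assoc)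
  qed
  then show "a \<otimes>\<^bsub>Q\<^esub> x \<otimes>\<^bsub>Q\<^esub> inv\<^bsub>Q\<^esub> a \<in> N i" using a xc by (simp add: N_def)
qed

lemma closed_N: assumes i: "i \<le> length bs" shows "closed_subgroup (N i) Q"
  unfolding closed_subgroup_def
proof (intro conjI subgroup_N i)
  have "N i = zero_set (variety_of Q) ((!) cs ` {..<offset i})"
    using N_iff[of _ i] by (auto simp: zero_set_def)
  moreover have "(!) cs ` {..<offset i} \<subseteq> reg (variety_of Q)"
    using cs_kQ offset_le[of i] kQ_coord by (auto simp: less_le_trans)
  ultimately show "closedin (zariski (variety_of Q)) (N i)" unfolding closedin_zariski[OF affine_Q] by blast
qed

text \<open>The functions of \<open>level i\<close> are constant on the cosets of \<open>N i\<close>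
  and separate them, so coordinates of a coset can be read off any representative.\<close>

lemma coset_eq_iff:
  assumes i: "i \<le> length bs" and x: "x \<in> carrier Q" and y: "y \<in> carrier Q"
  shows "N i #>\<^bsub>Q\<^esub> x = N i #>\<^bsub>Q\<^esub> y \<longleftrightarrow> (\<forall>f\<in>level i. f x = f y)"
proof
  assume eq: "N i #>\<^bsub>Q\<^esub> x = N i #>\<^bsub>Q\<^esub> y"
  have "x \<in> N i #>\<^bsub>Q\<^esub> y" using Q.rcos_self[OF x subgroup_N[OF i]] unfolding eq .
  then obtain h where "h \<in> N i" "x = h \<otimes>\<^bsub>Q\<^esub> y" unfolding r_coset_def by blast
  then show "\<forall>f\<in>level i. f x = f y" using N_mult(1)[OF i _ y] by blast
next
  assume eq: "\<forall>f\<in>level i. f x = f y"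
  have "f (y \<otimes>\<^bsub>Q\<^esub> inv\<^bsub>Q\<^esub> x) = f \<one>\<^bsub>Q\<^esub>" if "f \<in> level i" for f
    using agree_mult(1)[OF i x y Q.inv_closed[OF x] _ that] eq x by simp
  then have "y \<otimes>\<^bsub>Q\<^esub> inv\<^bsub>Q\<^esub> x \<in> N i" using x y by (simp add: N_def)
  moreover have "y = (y \<otimes>\<^bsub>Q\<^esub> inv\<^bsub>Q\<^esub> x) \<otimes>\<^bsub>Q\<^esub> x" using x y by (simp add: Q.m_assoc)
  ultimately have "y \<in> N i #>\<^bsub>Q\<^esub> x" unfolding r_coset_def by blast
  then show "N i #>\<^bsub>Q\<^esub> x = N i #>\<^bsub>Q\<^esub> y" using Q.repr_independence x subgroup_N[OF i] by blast
qed

lemma coset_agree: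
  assumes i: "i \<le> length bs" and x: "x \<in> carrier Q" and y: "y \<in> N i #>\<^bsub>Q\<^esub> x" and f: "f \<in> level i"
  shows "f y = f x" "y \<in> carrier Q"
proof -
  obtain h where h: "h \<in> N i" "y = h \<otimes>\<^bsub>Q\<^esub> x" using y by (auto simp: r_coset_def)
  then show "f y = f x" "y \<in> carrier Q" using N_mult(1)[OF i h(1) x f] x N_carrier by auto
qed

lemma some_coset:
  assumes i: "i \<le> length bs" and x: "x \<in> carrier Q" and f: "f \<in> level i"
  shows "f (SOME y. y \<in> N i #>\<^bsub>Q\<^esub> x) = f x"
  by (rule coset_agree(1)[OF i x _ f]) (rule someI[of _ x], rule Q.rcos_self[OF x subgroup_N[OF i]])

lemma act_N: assumes i: "i \<le> length bs" and x: "x \<in> N i" and g: "g \<in> carrier G" shows "act x g \<in> N i"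
proof -
  have xc: "x \<in> carrier Q" using x N_carrier by blast
  have "f (act x g) = f \<one>\<^bsub>Q\<^esub>" if f: "f \<in> level i" for f
  proof -
    have "f \<circ> alpha g \<in> level i" using level_good[OF i] gstableD[OF _ g f] by blast
    from N_eq[OF x this] have "(f \<circ> alpha g) x = (f \<circ> alpha g) \<one>\<^bsub>Q\<^esub>" .
    then show ?thesis using xc g by (simp add: alpha_def ret_id act_e)
  qed
  then show ?thesis using act_in[OF xc g] by (simp add: N_def)
qed

lemma N_0: "N 0 = carrier Q"
  by (auto simp: N_def level_0)

lemma N_full: "N (length bs) = {\<one>\<^bsub>Q\<^esub>}"
proof -
  have o: "offset (length bs) = n" by (simp add: offset_def)
  have "x = \<one>\<^bsub>Q\<^esub>" if "x \<in> N (length bs)" for x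
  proof (rule crd_inj)
    show "x \<in> carrier Q" using that N_carrier by blast
    show "crd x = crd \<one>\<^bsub>Q\<^esub>" using that cs_unit unfolding N_iff o crd_def by auto
  qed simp
  then show ?thesis by (auto simp: N_def)
qed

lemma N_Suc: "j < length bs \<Longrightarrow> N (Suc j) \<subseteq> N j"
  using N_iff[of _ "Suc j"] N_iff[of _ j] offset_Suc[of j] by auto

section \<open>The factor belonging to one block\<close>

context
  fixes j assumes j: "j < length bs"
begin

abbreviation (input) "w \<equiv> bs ! j"
abbreviation (input) "d \<equiv> length (bs ! j)"

definition blk :: "'q \<Rightarrow> 'k vec" where "blk x = vec d (\<lambda>i. (w ! i) x)"

lemma j_le: "j \<le> length bs" "Suc j \<le> length bs"
  using j by auto

lemma w_invs: "i < d \<Longrightarrow> w ! i \<in> invs (level j)"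
  using block_level[OF j] unfolding block_def by auto

lemma w_unit: "i < d \<Longrightarrow> (w ! i) \<one>\<^bsub>Q\<^esub> = 0"
  using block_level[OF j] unfolding block_def by auto

lemma w_level: "i < d \<Longrightarrow> w ! i \<in> level (Suc j)"
  using nth_level[of "offset j + i" "Suc j"] nth_block[OF j, of i] by simp

text \<open>By invariance, a translate of a block function minus the function itself belongs to
  \<open>level j\<close> and takes at \<open>x\<close> the value it has at the identity. The result
  is the same for left and right translations, which is the source of centrality.\<close>

lemma w_mult:
  assumes i: "i < d" and x: "x \<in> N j" and a: "a \<in> carrier Q"
  shows "(w ! i) (a \<otimes>\<^bsub>Q\<^esub> x) = (w ! i) a + (w ! i) x" "(w ! i) (x \<otimes>\<^bsub>Q\<^esub> a) = (w ! i) a + (w ! i) x"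
proof -
  have xc: "x \<in> carrier Q" using x N_carrier by blast
  have "(w ! i \<circ> mlt a) - w ! i \<in> level j" "(w ! i \<circ> (\<lambda>x. mlt x a)) - w ! i \<in> level j"
    by (intro invsD[OF w_invs[OF i]] Tr_left Tr_right)+
  then have "((w ! i \<circ> mlt a) - w ! i) x = ((w ! i \<circ> mlt a) - w ! i) \<one>\<^bsub>Q\<^esub>"
    "((w ! i \<circ> (\<lambda>x. mlt x a)) - w ! i) x = ((w ! i \<circ> (\<lambda>x. mlt x a)) - w ! i) \<one>\<^bsub>Q\<^esub>"
    using x unfolding N_def by blast+
  then show "(w ! i) (a \<otimes>\<^bsub>Q\<^esub> x) = (w ! i) a + (w ! i) x" "(w ! i) (x \<otimes>\<^bsub>Q\<^esub> a) = (w ! i) a + (w ! i) x"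
    using a xc by (simp_all add: mlt_def ret_id w_unit[OF i] algebra_simps)
qed

lemma blk_carrier [simp]: "blk x \<in> carrier_vec d"
  by (simp add: blk_def)

lemma blk_mult: "x \<in> N j \<Longrightarrow> y \<in> N j \<Longrightarrow> blk (x \<otimes>\<^bsub>Q\<^esub> y) = blk x + blk y"
  using w_mult(1)[of _ y x] N_carrier[of j] by (intro eq_vecI) (auto simp: blk_def)

lemma agree_Suc:
  assumes "\<And>f. f \<in> level j \<Longrightarrow> f x = f y" "blk x = blk y" "f \<in> level (Suc j)"
  shows "f x = f y"
proof -
  have "(cs ! l) x = (cs ! l) y" if l: "l < offset (Suc j)" for l
  proof (cases "l < offset j")
    case True
    then show ?thesis using assms(1) nth_level by blast
  next
    case False
    define i where "i = l - offset j"
    have i: "i < d" "l = offset j + i" using False l offset_Suc[OF j] by (auto simp: i_def)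
    have "blk x $ i = blk y $ i" using assms(2) by simp
    then show ?thesis using i nth_block(1)[OF j i(1)] by (simp add: blk_def)
  qed
  then show ?thesis using agree_iff assms(3) by blast
qed

lemma coset_Suc_eq:
  assumes "x \<in> carrier Q" "y \<in> carrier Q" "\<And>f. f \<in> level j \<Longrightarrow> f x = f y" "blk x = blk y"
  shows "N (Suc j) #>\<^bsub>Q\<^esub> x = N (Suc j) #>\<^bsub>Q\<^esub> y"
  unfolding coset_eq_iff[OF j_le(2) assms(1,2)] using agree_Suc[OF assms(3,4)] by blast

lemma coset_commute:
  assumes x: "x \<in> N j" and a: "a \<in> carrier Q"
  shows "N (Suc j) #>\<^bsub>Q\<^esub> (x \<otimes>\<^bsub>Q\<^esub> a) = N (Suc j) #>\<^bsub>Q\<^esub> (a \<otimes>\<^bsub>Q\<^esub> x)"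
proof (rule coset_Suc_eq)
  have xc: "x \<in> carrier Q" using x N_carrier by blast
  then show "x \<otimes>\<^bsub>Q\<^esub> a \<in> carrier Q" "a \<otimes>\<^bsub>Q\<^esub> x \<in> carrier Q" using a by auto
  show "f (x \<otimes>\<^bsub>Q\<^esub> a) = f (a \<otimes>\<^bsub>Q\<^esub> x)" if "f \<in> level j" for f
    using N_mult[OF j_le(1) x a that] by simp
  show "blk (x \<otimes>\<^bsub>Q\<^esub> a) = blk (a \<otimes>\<^bsub>Q\<^esub> x)" using w_mult[OF _ x a] by (auto simp: blk_def)
qed

text \<open>The earlier coordinates must vanish for the point to lie in \<open>N j\<close>; setting
  the later ones to 0 selects one representative of a coset of \<open>N (Suc j)\<close>.\<close>

definition lift :: "'k vec \<Rightarrow> 'k vec" where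
  "lift v = vec n (\<lambda>l. if offset j \<le> l \<and> l < offset (Suc j) then v $ (l - offset j) else 0)"

lemma pt_lift: assumes v: "v \<in> carrier_vec d" shows "pt (lift v) \<in> N j" "blk (pt (lift v)) = v"
proof -
  have l: "lift v \<in> carrier_vec n" by (simp add: lift_def)
  note on = offset_le[of j] offset_le[of "Suc j"]
  show "pt (lift v) \<in> N j"
    unfolding N_iff using pt(1)[OF l] pt_nth[OF l] on by (auto simp: lift_def)
  show "blk (pt (lift v)) = v"
  proof (rule eq_vecI)
    show "dim_vec (blk (pt (lift v))) = dim_vec v" using v by (simp add: blk_def)
    fix i assume "i < dim_vec v"
    then have i: "i < d" using v by simp
    have o: "offset j + i < offset (Suc j)" by (rule nth_block(2)[OF j i])
    have "(w ! i) (pt (lift v)) = lift v $ (offset j + i)"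
      using pt_nth[OF l, of "offset j + i"] nth_block(1)[OF j i] o on by simp
    then show "blk (pt (lift v)) $ i = v $ i" using i o on by (simp add: blk_def lift_def)
  qed
qed

definition fac :: "('q set, 'k) alg_group" where
  "fac = quotient_alg_group (sub_alg_group Q (N j)) (N (Suc j))"

lemma coset_sub: "N (Suc j) #>\<^bsub>sub_alg_group Q (N j)\<^esub> x = N (Suc j) #>\<^bsub>Q\<^esub> x"
  by (simp add: r_coset_def sub_alg_group_def)

lemma carrier_fac: "carrier fac = (\<lambda>x. N (Suc j) #>\<^bsub>Q\<^esub> x) ` N j"
  unfolding fac_def quotient_alg_group_def partial_object.simps carrier_FactGroup coset_sub
  by (simp add: sub_alg_group_def)

lemma mult_fac: "C \<otimes>\<^bsub>fac\<^esub> D = C <#>\<^bsub>Q\<^esub> D"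
  by (simp add: fac_def quotient_alg_group_def set_mult_def sub_alg_group_def)

lemma coord_ring_fac: "coord_ring fac = {f. \<exists>g\<in>coord_ring Q. \<forall>x\<in>N j. f (N (Suc j) #>\<^bsub>Q\<^esub> x) = g x}"
  unfolding fac_def quotient_alg_group_def alg_group.simps coset_sub
  by (simp add: sub_alg_group_def subvariety_def)

text \<open>Any representative will do, since the block functions belong to
  \<open>level (Suc j)\<close> and are constant on cosets of \<open>N (Suc j)\<close>.\<close>

definition \<phi> :: "'q set \<Rightarrow> 'k vec" where "\<phi> C = blk (SOME x. x \<in> C)"

lemma \<phi>_coset: "x \<in> N j \<Longrightarrow> \<phi> (N (Suc j) #>\<^bsub>Q\<^esub> x) = blk x"
  using some_coset[OF j_le(2) _ w_level] N_carrier unfolding \<phi>_def blk_def by (intro eq_vecI) auto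

lemma bij_\<phi>: "bij_betw \<phi> (carrier fac) (carrier_vec d)"
  unfolding bij_betw_def
proof
  show "inj_on \<phi> (carrier fac)"
  proof (rule inj_onI)
    fix C D assume "C \<in> carrier fac" "D \<in> carrier fac" and eq: "\<phi> C = \<phi> D"
    then obtain x y where xy: "x \<in> N j" "C = N (Suc j) #>\<^bsub>Q\<^esub> x" "y \<in> N j" "D = N (Suc j) #>\<^bsub>Q\<^esub> y"
      unfolding carrier_fac by blast
    show "C = D" unfolding xy(2,4)
    proof (rule coset_Suc_eq)
      show "x \<in> carrier Q" "y \<in> carrier Q" using xy N_carrier by blast+
      show "f x = f y" if "f \<in> level j" for f using N_eq[OF xy(1) that] N_eq[OF xy(3) that] by simp
      show "blk x = blk y" using eq xy by (simp add: \<phi>_coset)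
    qed
  qed
  show "\<phi> ` carrier fac = carrier_vec d"
  proof
    show "\<phi> ` carrier fac \<subseteq> carrier_vec d" by (auto simp: \<phi>_def)
    show "carrier_vec d \<subseteq> \<phi> ` carrier fac"
    proof
      fix v :: "'k vec" assume v: "v \<in> carrier_vec d"
      have "\<phi> (N (Suc j) #>\<^bsub>Q\<^esub> pt (lift v)) = v" using \<phi>_coset[OF pt_lift(1)[OF v]] pt_lift(2)[OF v] by simp
      then show "v \<in> \<phi> ` carrier fac" unfolding carrier_fac using pt_lift(1)[OF v] by (metis image_eqI)
    qed
  qed
qed

lemma inv_\<phi>: "v \<in> carrier_vec d \<Longrightarrow> inv_into (carrier fac) \<phi> v = N (Suc j) #>\<^bsub>Q\<^esub> pt (lift v)"
proof (rule inv_into_f_eq)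
  assume v: "v \<in> carrier_vec d"
  show "inj_on \<phi> (carrier fac)" using bij_\<phi> by (simp add: bij_betw_def)
  show "N (Suc j) #>\<^bsub>Q\<^esub> pt (lift v) \<in> carrier fac" unfolding carrier_fac using pt_lift(1)[OF v] by blast
  show "\<phi> (N (Suc j) #>\<^bsub>Q\<^esub> pt (lift v)) = v" using \<phi>_coset[OF pt_lift(1)[OF v]] pt_lift(2)[OF v] by simp
qed

lemma iso_\<phi>: "alg_group_iso fac (vector_alg_group d) \<phi>"
  unfolding alg_group_iso_def variety_iso_def
proof (intro conjI)
  have v: "points (variety_of (vector_alg_group d)) = (carrier_vec d :: 'k vec set)"
    "reg (variety_of (vector_alg_group d)) = reg (affine_space d :: ('k vec, 'k) variety)"
    "carrier (vector_alg_group d) = (carrier_vec d :: 'k vec set)"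
    "coord_ring (vector_alg_group d) = reg (affine_space d :: ('k vec, 'k) variety)"
    by (simp_all add: vector_alg_group_def)
  have "\<phi> (C \<otimes>\<^bsub>fac\<^esub> D) = \<phi> C \<otimes>\<^bsub>vector_alg_group d\<^esub> \<phi> D" if "C \<in> carrier fac" "D \<in> carrier fac" for C D
  proof -
    obtain x y where xy: "x \<in> N j" "C = N (Suc j) #>\<^bsub>Q\<^esub> x" "y \<in> N j" "D = N (Suc j) #>\<^bsub>Q\<^esub> y"
      using \<open>C \<in> carrier fac\<close> \<open>D \<in> carrier fac\<close> unfolding carrier_fac by blast
    have "C <#>\<^bsub>Q\<^esub> D = N (Suc j) #>\<^bsub>Q\<^esub> (x \<otimes>\<^bsub>Q\<^esub> y)"
      unfolding xy(2,4) using normal.rcos_sum[OF normal_N[OF j_le(2)]] xy N_carrier by blast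
    moreover have "x \<otimes>\<^bsub>Q\<^esub> y \<in> N j" using subgroup.m_closed[OF subgroup_N[OF j_le(1)]] xy by blast
    ultimately show ?thesis
      using xy unfolding mult_fac by (simp add: \<phi>_coset blk_mult vector_alg_group_def)
  qed
  then show "\<phi> \<in> iso fac (vector_alg_group d)"
    using bij_\<phi> unfolding iso_def hom_def v by (auto simp: bij_betw_def)
  show "bij_betw \<phi> (points (variety_of fac)) (points (variety_of (vector_alg_group d)))"
    using bij_\<phi> unfolding v by simp
  show "regular_map (variety_of fac) (variety_of (vector_alg_group d)) \<phi>"
    unfolding regular_map_def v
  proof (intro conjI ballI)
    show "\<phi> \<in> points (variety_of fac) \<rightarrow> carrier_vec d" by (auto simp: \<phi>_def)
    fix f :: "'k vec \<Rightarrow> 'k" assume "f \<in> reg (affine_space d)"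
    then obtain p where p: "p \<in> poly_fun d" "\<forall>v\<in>carrier_vec d. f v = p v" unfolding reg_affine_space by blast
    have "(\<lambda>x. p (blk x)) \<in> kQ" unfolding blk_def
      using w_invs invs_A by (intro poly_fun_subst[OF subalg_kQ p(1)]) blast
    then have "(\<lambda>x. p (blk x)) \<in> coord_ring Q" by (rule kQ_coord)
    moreover have "\<forall>x\<in>N j. (f \<circ> \<phi>) (N (Suc j) #>\<^bsub>Q\<^esub> x) = p (blk x)" using p(2) by (simp add: \<phi>_coset)
    ultimately show "f \<circ> \<phi> \<in> reg (variety_of fac)"
      unfolding variety_of_simps coord_ring_fac by (intro CollectI bexI[of _ "\<lambda>x. p (blk x)"])
  qed
  show "regular_map (variety_of (vector_alg_group d)) (variety_of fac) (inv_into (points (variety_of fac)) \<phi>)"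
    unfolding regular_map_def v variety_of_simps
  proof (intro conjI ballI)
    show "inv_into (carrier fac) \<phi> \<in> carrier_vec d \<rightarrow> carrier fac"
    proof
      fix v :: "'k vec" assume v: "v \<in> carrier_vec d"
      show "inv_into (carrier fac) \<phi> v \<in> carrier fac"
        unfolding inv_\<phi>[OF v] unfolding carrier_fac using pt_lift(1)[OF v] by blast
    qed
    fix f assume "f \<in> coord_ring fac"
    then have "\<exists>g\<in>coord_ring Q. \<forall>x\<in>N j. f (N (Suc j) #>\<^bsub>Q\<^esub> x) = g x" unfolding coord_ring_fac by (rule CollectD)
    then obtain g where g: "g \<in> coord_ring Q" "\<forall>x\<in>N j. f (N (Suc j) #>\<^bsub>Q\<^esub> x) = g x" by blast
    obtain P where P: "P \<in> poly_fun n" "\<forall>x. (g \<circ> ret) x = P (crd x)" using poly_crd[OF norm_kQ[OF g(1)]] by blast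
    \<comment> \<open>In the coordinates of \<open>Q\<close> the inverse of \<open>\<phi>\<close> is
      induced by \<open>lift\<close>, whose entries are coordinates or zero, so substitution into
      \<open>P\<close> gives a polynomial.\<close>
    have "(\<lambda>v. P (lift v)) \<in> poly_fun d" unfolding lift_def
    proof (rule poly_fun_subst[OF subalg_poly_fun P(1)])
      show "(\<lambda>v. if offset j \<le> l \<and> l < offset (Suc j) then v $ (l - offset j) else 0) \<in> poly_fun d" for l
        using offset_Suc[OF j] by (cases "offset j \<le> l \<and> l < offset (Suc j)") (auto intro: poly_fun.intros)
    qed
    moreover have "(f \<circ> inv_into (carrier fac) \<phi>) v = P (lift v)" if v: "v \<in> carrier_vec d" for v
    proof -
      have l: "lift v \<in> carrier_vec n" by (simp add: lift_def)
      have "(f \<circ> inv_into (carrier fac) \<phi>) v = g (pt (lift v))" using g(2) pt_lift(1)[OF v] by (simp add: inv_\<phi>[OF v])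
      also have "\<dots> = (g \<circ> ret) (pt (lift v))" using pt(1)[OF l] by (simp add: ret_id)
      also have "\<dots> = P (lift v)" using P(2) pt(2)[OF l] by simp
      finally show ?thesis .
    qed
    ultimately show "f \<circ> inv_into (carrier fac) \<phi> \<in> reg (affine_space d)"
      unfolding reg_affine_space by (intro bexI[of _ "\<lambda>v. P (lift v)"] ballI)
  qed
qed

lemma module_fac: "has_rational_module_structure G fac (coset_action act)"
proof -
  have "\<forall>i. \<exists>\<rho>. i < d \<longrightarrow> (\<forall>l<d. \<rho> l \<in> coord_ring G) \<and>
    (\<forall>g\<in>carrier G. (w ! i \<circ> alpha g) - (\<Sum>l<d. fscale (\<rho> l g) (w ! l)) \<in> level j)"
    using block_level[OF j] unfolding block_def by blast
  from choice[OF this] obtain \<rho> where \<rho>: "\<And>i l. i < d \<Longrightarrow> l < d \<Longrightarrow> \<rho> i l \<in> coord_ring G"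
    "\<And>i g. i < d \<Longrightarrow> g \<in> carrier G \<Longrightarrow> (w ! i \<circ> alpha g) - (\<Sum>l<d. fscale (\<rho> i l g) (w ! l)) \<in> level j" by blast
  define r where "r v g = vec d (\<lambda>i. \<Sum>l<d. \<rho> i l g * v $ l)" for v and g
  have blk_act: "blk (act x g) = r (blk x) g" if x: "x \<in> N j" and g: "g \<in> carrier G" for x g
  proof (rule eq_vecI)
    have xc: "x \<in> carrier Q" using x N_carrier by blast
    fix i assume "i < dim_vec (r (blk x) g)"
    then have i: "i < d" by (simp add: r_def)
    let ?f = "(w ! i \<circ> alpha g) - (\<Sum>l<d. fscale (\<rho> i l g) (w ! l))"
    \<comment> \<open>The remainder lies in \<open>level j\<close>, so on \<open>N j\<close> it
      equals its value at the identity, which is 0: there the action is exactly linear, not just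
      linear modulo \<open>level j\<close>.\<close>
    have "?f x = ?f \<one>\<^bsub>Q\<^esub>" using \<rho>(2)[OF i g] x unfolding N_def by blast
    moreover have "?f \<one>\<^bsub>Q\<^esub> = 0" using g i by (simp add: alpha_def ret_id act_e w_unit)
    ultimately have "(w ! i) (act x g) = (\<Sum>l<d. \<rho> i l g * (w ! l) x)" using xc by (simp add: alpha_def ret_id)
    then show "blk (act x g) $ i = r (blk x) g $ i" using i by (simp add: blk_def r_def)
  qed (simp add: blk_def r_def)
  \<comment> \<open>Every vector is the block coordinate vector of a point of \<open>N j\<close>, so
    the laws of a right action pass from \<open>act\<close> to \<open>r\<close>.\<close>
  have surj: "\<exists>x\<in>N j. v = blk x" if "v \<in> carrier_vec d" for v using pt_lift[OF that] by metis
  have "right_action G (carrier_vec d) r"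
    unfolding right_action_def
  proof (intro conjI ballI)
    show "r v g \<in> carrier_vec d" for v g by (simp add: r_def)
    show "r v \<one>\<^bsub>G\<^esub> = v" if v: "v \<in> carrier_vec d" for v
    proof -
      obtain x where x: "x \<in> N j" "v = blk x" using surj[OF v] by blast
      have "x \<in> carrier Q" using x N_carrier by blast
      then show ?thesis using blk_act[OF x(1), of "\<one>\<^bsub>G\<^esub>"] x(2) by (simp add: act_one')
    qed
    show "r v (g \<otimes>\<^bsub>G\<^esub> h) = r (r v g) h" if v: "v \<in> carrier_vec d" and g: "g \<in> carrier G" and h: "h \<in> carrier G" for v g h
    proof -
      obtain x where x: "x \<in> N j" "v = blk x" using surj[OF v] by blast
      have xc: "x \<in> carrier Q" using x N_carrier by blast
      show ?thesis unfolding x(2) blk_act[OF x(1) g, symmetric] blk_act[OF act_N[OF j_le(1) x(1) g] h, symmetric]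
        blk_act[OF x(1) G.m_closed[OF g h], symmetric] act_mult'[OF xc g h] by (rule refl)
    qed
  qed
  moreover have "r (a \<cdot>\<^sub>v v + u) g = a \<cdot>\<^sub>v r v g + r u g" if "v \<in> carrier_vec d" "u \<in> carrier_vec d" for a v u g
    using that by (intro eq_vecI) (auto simp: r_def sum.distrib sum_distrib_left algebra_simps)
  moreover have "regular_map (product_variety (variety_of G) (affine_space d)) (affine_space d) (\<lambda>(g, v). r v g)"
    unfolding regular_map_def
  proof (intro conjI ballI)
    show "(\<lambda>(g, v). r v g) \<in> points (product_variety (variety_of G) (affine_space d)) \<rightarrow> points (affine_space d)"
      by (auto simp: r_def affine_space_def)
    fix f :: "'k vec \<Rightarrow> 'k" assume "f \<in> reg (affine_space d)"
    then obtain p where p: "p \<in> poly_fun d" "\<forall>v\<in>carrier_vec d. f v = p v" unfolding reg_affine_space by blast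
    have "(\<lambda>z. p (vec d (\<lambda>i. \<Sum>l<d. \<rho> i l (fst z) * snd z $ l))) \<in> reg (product_variety (variety_of G) (affine_space d))"
    proof (rule poly_fun_subst[OF subalg_product_variety[OF affine_G affine_variety_affine_space] p(1)])
      fix i assume i: "i < d"
      show "(\<lambda>z. \<Sum>l<d. \<rho> i l (fst z) * snd z $ l) \<in> reg (product_variety (variety_of G) (affine_space d))"
      proof (rule product_variety_regI)
        show "\<rho> i l \<in> reg (variety_of G) \<and> (\<lambda>v. v $ l) \<in> reg (affine_space d)" if "l \<in> {..<d}" for l
          using \<rho>(1)[OF i] that poly_fun.coord[of l d] unfolding reg_affine_space by auto
      qed auto
    qed
    moreover have "(\<lambda>z. p (vec d (\<lambda>i. \<Sum>l<d. \<rho> i l (fst z) * snd z $ l))) = f \<circ> (\<lambda>(g, v). r v g)"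
      using p(2) by (auto simp: r_def fun_eq_iff)
    ultimately show "f \<circ> (\<lambda>(g, v). r v g) \<in> reg (product_variety (variety_of G) (affine_space d))" by simp
  qed
  ultimately have "rational_module G d r" unfolding rational_module_def by blast
  moreover have "\<phi> (coset_action act C g) = r (\<phi> C) g" if C: "C \<in> carrier fac" and g: "g \<in> carrier G" for C g
  proof -
    obtain x where x: "x \<in> N j" "C = N (Suc j) #>\<^bsub>Q\<^esub> x" using C unfolding carrier_fac by blast
    have xc: "x \<in> carrier Q" using x N_carrier by blast
    have "x \<in> C" unfolding x(2) by (rule Q.rcos_self[OF xc subgroup_N[OF j_le(2)]])
    then have "act x g \<in> coset_action act C g" by (simp add: coset_action_def)
    then have "(SOME y. y \<in> coset_action act C g) \<in> coset_action act C g" by (rule someI)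
    then obtain h where h: "h \<in> N (Suc j)" "(SOME y. y \<in> coset_action act C g) = act (h \<otimes>\<^bsub>Q\<^esub> x) g"
      unfolding coset_action_def x(2) r_coset_def by blast
    have hc: "h \<in> carrier Q" using h N_carrier by blast
    have "act (h \<otimes>\<^bsub>Q\<^esub> x) g = act h g \<otimes>\<^bsub>Q\<^esub> act x g" by (rule act_hom[OF g hc xc])
    then have "blk (act (h \<otimes>\<^bsub>Q\<^esub> x) g) = blk (act x g)"
      using N_mult(1)[OF j_le(2) act_N[OF j_le(2) h(1) g] act_in[OF xc g] w_level] by (auto simp: blk_def)
    then have "\<phi> (coset_action act C g) = blk (act x g)" unfolding \<phi>_def h(2) .
    then show ?thesis unfolding blk_act[OF x(1) g] x(2) \<phi>_coset[OF x(1)] .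
  qed
  ultimately show ?thesis unfolding has_rational_module_structure_def using iso_\<phi> by blast
qed

lemma central_fac: "carrier fac \<subseteq> center_of (Q Mod N (Suc j))"
proof
  fix C assume "C \<in> carrier fac"
  then obtain x where x: "x \<in> N j" "C = N (Suc j) #>\<^bsub>Q\<^esub> x" unfolding carrier_fac by blast
  have xc: "x \<in> carrier Q" using x N_carrier by blast
  show "C \<in> center_of (Q Mod N (Suc j))"
    unfolding center_of_def
  proof (intro CollectI conjI ballI)
    show "C \<in> carrier (Q Mod N (Suc j))" unfolding carrier_FactGroup x(2) using xc by blast
    fix D assume "D \<in> carrier (Q Mod N (Suc j))"
    then obtain a where a: "a \<in> carrier Q" "D = N (Suc j) #>\<^bsub>Q\<^esub> a" unfolding carrier_FactGroup by blast
    note s = normal.rcos_sum[OF normal_N[OF j_le(2)]]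
    show "C \<otimes>\<^bsub>Q Mod N (Suc j)\<^esub> D = D \<otimes>\<^bsub>Q Mod N (Suc j)\<^esub> C"
      unfolding mult_FactGroup a(2) x(2) s[OF xc a(1)] s[OF a(1) xc] by (rule coset_commute[OF x(1) a(1)])
  qed
qed

end

lemma section_N:
  assumes i: "i \<le> length bs"
  shows "\<exists>\<sigma>. regular_map (variety_of (quotient_alg_group Q (N i))) (variety_of Q) \<sigma> \<and>
    (\<forall>C\<in>carrier (Q Mod N i). N i #>\<^bsub>Q\<^esub> \<sigma> C = C)"
proof -
  define tr where "tr x = vec n (\<lambda>l. if l < offset i then (cs ! l) x else 0)" for x
  define \<sigma> where "\<sigma> C = pt (tr (SOME x. x \<in> C))" for C
  have tr: "tr x \<in> carrier_vec n" for x by (simp add: tr_def)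
  have \<sigma>: "\<sigma> (N i #>\<^bsub>Q\<^esub> x) = pt (tr x)" if "x \<in> carrier Q" for x
    unfolding \<sigma>_def tr_def using some_coset[OF i that nth_level] by (intro arg_cong[of _ _ pt] eq_vecI) auto
  show ?thesis
  proof (intro exI[of _ \<sigma>] conjI ballI)
    show "regular_map (variety_of (quotient_alg_group Q (N i))) (variety_of Q) \<sigma>"
      unfolding regular_map_def variety_of_simps
    proof (intro conjI ballI)
      show "\<sigma> \<in> carrier (quotient_alg_group Q (N i)) \<rightarrow> carrier Q" using pt(1)[OF tr] by (auto simp: \<sigma>_def)
      fix f assume f: "f \<in> coord_ring Q"
      obtain P where P: "P \<in> poly_fun n" "\<forall>x. (f \<circ> ret) x = P (crd x)" using poly_crd[OF norm_kQ[OF f]] by blast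
      have "(\<lambda>x. P (tr x)) \<in> kQ" unfolding tr_def
      proof (rule poly_fun_subst[OF subalg_kQ P(1)])
        fix l assume l: "l < n"
        show "(\<lambda>x. if l < offset i then (cs ! l) x else 0) \<in> kQ"
          using cs_kQ[OF l] subalg_cst[OF subalg_kQ, of 0] by (cases "l < offset i") (auto simp: cst_def)
      qed
      then have "(\<lambda>x. P (tr x)) \<in> coord_ring Q" by (rule kQ_coord)
      moreover have "(f \<circ> \<sigma>) (N i #>\<^bsub>Q\<^esub> x) = P (tr x)" if "x \<in> carrier Q" for x
      proof -
        have "f (pt (tr x)) = (f \<circ> ret) (pt (tr x))" using pt(1)[OF tr] by (simp add: ret_id)
        then show ?thesis using P(2) pt(2)[OF tr] by (simp add: \<sigma>[OF that])
      qed
      ultimately have "(\<lambda>x. (f \<circ> \<sigma>) (N i #>\<^bsub>Q\<^esub> x)) \<in> coord_ring Q" by (rule coord_ring_cong)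
      then show "f \<circ> \<sigma> \<in> coord_ring (quotient_alg_group Q (N i))" by (simp add: quotient_alg_group_def)
    qed
    fix C assume "C \<in> carrier (Q Mod N i)"
    then obtain x where x: "x \<in> carrier Q" "C = N i #>\<^bsub>Q\<^esub> x" unfolding carrier_FactGroup by blast
    have "(cs ! l) (pt (tr x)) = (cs ! l) x" if "l < offset i" for l
      using pt_nth[OF tr, of l x] that offset_le[of i] by (simp add: tr_def)
    then have "\<forall>f\<in>level i. f (pt (tr x)) = f x" unfolding agree_iff by blast
    then show "N i #>\<^bsub>Q\<^esub> \<sigma> C = C" unfolding x(2) \<sigma>[OF x(1)] coset_eq_iff[OF i pt(1)[OF tr] x(1)] .
  qed
qed

lemma filtration_exists:
  "\<exists>n F. central_filtration Q n F \<and> filtration_by_G_modules G Q act n F \<and> sectioned_filtration Q n F"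
proof -
  \<comment> \<open>Filtrations are indexed from 1, levels from 0.\<close>
  define F where "F i = N (i - 1)" for i
  have factor: "filtration_factor Q F i = fac (i - 1)" if "i \<in> {1..length bs}" for i
  proof -
    have "Suc (i - 1) = i" "i - 1 < length bs" using that by auto
    then show ?thesis unfolding filtration_factor_def F_def by (simp add: fac_def)
  qed
  have fil: "filtration Q (length bs) F"
    unfolding filtration_def
  proof (intro conjI ballI)
    fix i assume "i \<in> {1..length bs + 1}"
    then have "i - 1 \<le> length bs" by auto
    then show "closed_subgroup (F i) Q" "F i \<lhd> Q" unfolding F_def by (rule closed_N, rule normal_N)
  next
    fix i assume "i \<in> {1..length bs}"
    then have "Suc (i - 1) = i" "i - 1 < length bs" by auto
    then show "F (i + 1) \<subseteq> F i" using N_Suc[of "i - 1"] by (simp add: F_def)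
  qed (simp_all add: F_def N_0 N_full)
  have "central_filtration Q (length bs) F"
    unfolding central_filtration_def
  proof (intro conjI ballI fil)
    fix i assume i: "i \<in> {1..length bs}"
    have "F (i + 1) = N (Suc (i - 1))" using i by (simp add: F_def)
    then show "carrier (filtration_factor Q F i) \<subseteq> center_of (Q Mod F (i + 1))"
      unfolding factor[OF i] by (simp only:) (rule central_fac, use i in auto)
  qed
  moreover have "filtration_by_G_modules G Q act (length bs) F"
    unfolding filtration_by_G_modules_def filtration_by_G_groups_def
  proof (intro conjI ballI fil)
    fix i q g assume i: "i \<in> {1..length bs + 1}" and q: "q \<in> F i" and g: "g \<in> carrier G"
    have "i - 1 \<le> length bs" using i by auto
    then show "act q g \<in> F i" using act_N q g unfolding F_def by blast
  next
    fix i assume i: "i \<in> {1..length bs}"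
    show "has_rational_module_structure G (filtration_factor Q F i) (coset_action act)"
      unfolding factor[OF i] by (rule module_fac) (use i in auto)
  qed
  moreover have "sectioned_filtration Q (length bs) F"
    unfolding sectioned_filtration_def
  proof (intro conjI ballI fil)
    fix i assume "i \<in> {1..length bs + 1}"
    then have "i - 1 \<le> length bs" by auto
    from section_N[OF this] show "\<exists>\<sigma>. regular_map (variety_of (quotient_alg_group Q (F i))) (variety_of Q) \<sigma> \<and>
        (\<forall>C\<in>carrier (Q Mod F i). F i #>\<^bsub>Q\<^esub> \<sigma> C = C)" unfolding F_def .
  qed
  ultimately show ?thesis by blast
qed

end

theorem theorem3p3p5:
  fixes G :: "('g, 'k::alg_closed_field) alg_group"
    and Q :: "('q, 'k) alg_group"
    and act :: "'q \<Rightarrow> 'g \<Rightarrow> 'q"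
  assumes "algebraic_group G" and "connected_alg_group G"
    and "algebraic_G_group G Q act"
    and "connected_alg_group Q" and "unipotent_alg_group Q"
  shows "\<exists>n F. central_filtration Q n F \<and> filtration_by_G_modules G Q act n F \<and>
           sectioned_filtration Q n F"
proof -
  interpret unipotent_G_group G Q act using assms by unfold_locales
  obtain bs where bs: "tower (range cst) bs" "adjs (range cst) (concat bs) = kQ" using tower_exists by blast
  interpret tower_coordinates G Q act bs using bs by unfold_locales
  show ?thesis by (rule filtration_exists)
qed

end
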